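(* Let $\mathcal{D}=(G,\chi,g,0)$ be a group datum of nilpotent type with $n\ge 2$ the order of $\chi(g)$, let $H=H_{\mathcal D}$, and let $R_{st}(H)=\mathbb{C}\otimes_{\mathbb Z}r_{st}(H)$ be the complexified stable Green ring. With the algebra morphism $\varepsilon:R_{st}(H)\to\mathbb{C}$, the basis $\mathbf{B}=\{b_{(i,j)}\mid (i,j)\in I\}$ and the involution $*$ of the index set $I$ defined in the context, the quadruple $(R_{st}(H),\varepsilon,\mathbf{B},* )$ is a group-like algebra.
   Context: $\mathbb{K}$ is an algebraically closed field of characteristic zero; modules are finite dimensional left modules; $\otimes=\otimes_{\mathbb K}$ for modules. Group datum: $G$ is a finite group, $g$ an element of the center of $G$, $\chi:G\to\mathbb{K}^\times$ a linear character, $q=\chi(g)$ has order $n\ge 2$. $H=H_{\mathcal D}$ is the $\mathbb K$-algebra generated by $y$ and the elements $h\in G$, containing $\mathbb{K}G$ as a subalgebra, with relations $y^n=0$ and $yh=\chi(h)hy$ for $h\in G$; it has basis $\{y^ih\mid h\in G,\ 0\le i\le n-1\}$. It is a Hopf algebra with $\Delta(y)=y\otimes g+1\otimes y$, $\varepsilon(y)=0$, $S(y)=-yg^{-1}$, and $\Delta(h)=h\otimes h$, $\varepsilon(h)=1$, $S(h)=h^{-1}$ for $h\in G$. $V_1,\dots,V_m$ is a complete set of non-isomorphic simple $\mathbb{K}G$-modules, with $V_1$ the trivial module; each is regarded as a simple $H$-module with $y$ acting by $0$. $V_{\chi^{-1}}$ is the one-dimensional module with character $\chi^{-1}$; $a=[V_{\chi^{-1}}]$.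 $\tau$ is the permutation of $\{1,\dots,m\}$ with $V_{\chi^{-1}}\otimes V_i\cong V_{\tau(i)}$, and $i^*$ is the index with $(V_i)^*\cong V_{i^*}$. For $1\le i\le m$, $1\le j\le n$, $M(i,j)=V_i\oplus xV_i\oplus\cdots\oplus x^{j-1}V_i$ (formal copies of $V_i$), with $h(x^kv)=\chi^{-k}(h)\,x^k(hv)$ for $h\in G$, and $y(x^kv)=x^{k+1}v$ if $0\le k\le j-2$, $y(x^{j-1}v)=0$. These form a complete set of non-isomorphic indecomposable $H$-modules; $M(i,j)$ is projective iff $j=n$. The Green ring $r(H)$ is the free abelian group on isomorphism classes of finite dimensional $H$-modules modulo $[M\oplus N]=[M]+[N]$, with product $[M][N]=[M\otimes N]$; $M[i,j]=[M(i,j)]$. The stable Green ring $r_{st}(H)$ (the Green ring of the stable category of finite dimensional $H$-modules) is identified with $r(H)/\mathcal P$, $\mathcal P$ the ideal generated by classes of indecomposable projective modules, and $\overline{M[i,j]}$ denotes the image of $M[i,j]$. It is isomorphic to $r(\mathbb{K}G)[z]/(F_n(a,z))$, with $\overline{M[i,j]}$ corresponding to $\overline{[V_i]F_j(a,z)}$, where $F_1(y,z)=1$, $F_2(y,z)=z$, $F_i(y,z)=zF_{i-1}(y,z)-yF_{i-2}(y,z)$ for $i\ge 3$. $\varepsilon:R_{st}(H)\to\mathbb{C}$ is the algebra morphism with $\varepsilon(\overline{[V_i]})=\dim V_i$ and $\varepsilon(\overline z)=2\cos\frac{\pi}{n}$; thus $\varepsilon(\overline{M[i,j]})=\dim(V_i)F_j(1,2\cos\frac{\pi}{n})$.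 Set $I=\{(i,j)\mid 1\le i\le m,\ 1\le j\le n-1\}$, $b_{(i,j)}=\varepsilon(\overline{M[i,j]})\,\overline{M[i,j]}$, so $b_{(1,1)}=1$ (the distinguished index $0\in I$ is $(1,1)$), and $(i,j)^*=(\tau^{1-j}(i^* ),j)$. Definition: let $A$ be a finite dimensional algebra over a field $F$ with unit $1$, $\varepsilon:A\to F$ an algebra morphism, $\mathbf{B}=\{b_i\}_{i\in I}$ an $F$-basis of $A$ with $0\in I$ and $b_0=1$, and $*$ an involution of $I$. Write $b_ib_j=\sum_{k\in I}p_{ij}^kb_k$. $(A,\varepsilon,\mathbf{B},* )$ is a group-like algebra if (G1) $\varepsilon(b_i)=\varepsilon(b_{i^*})\ne0$ for all $i$; (G2) $p_{ij}^k=p_{j^*i^*}^{k^*}$ for all $i,j,k$; (G3) $p_{ij}^0=\delta_{i,j^*}\varepsilon(b_i)$ for all $i,j$. *)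

theory Defs
  imports
    "HOL-Algebra.QuotRing"
    "HOL-Algebra.Generated_Groups"
    "HOL-Library.Poly_Mapping"
    "Jordan_Normal_Form.VS_Connect"
    Complex_Main
begin

section \<open>Monoid algebras, free algebras and quotients\<close>

definition monoid_algebra ::
  "('m, 'z) monoid_scheme \<Rightarrow> ('k::comm_ring_1, 'm \<Rightarrow>\<^sub>0 'k) module" where
  "monoid_algebra M =
    \<lparr>carrier = {p. Poly_Mapping.keys p \<subseteq> carrier M},
     mult = (\<lambda>p q. \<Sum>a\<in>Poly_Mapping.keys p. \<Sum>b\<in>Poly_Mapping.keys q.
        Poly_Mapping.single (a \<otimes>\<^bsub>M\<^esub> b) (Poly_Mapping.lookup p a * Poly_Mapping.lookup q b)),
     one = Poly_Mapping.single \<one>\<^bsub>M\<^esub> 1,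
     zero = 0,
     add = (+),
     smult = (\<lambda>c p. Poly_Mapping.map ((*) c) p)\<rparr>"

definition free_algebra :: "'s set \<Rightarrow> ('k::comm_ring_1, 's list \<Rightarrow>\<^sub>0 'k) module" where
  "free_algebra S = monoid_algebra \<lparr>carrier = lists S, mult = (@), one = []\<rparr>"

definition quot_algebra :: "('k, 'a) module \<Rightarrow> 'a set \<Rightarrow> ('k, 'a set) module" where
  "quot_algebra A J =
    \<lparr>carrier = carrier (A Quot J), mult = mult (A Quot J), one = one (A Quot J),
     zero = zero (A Quot J), add = add (A Quot J),
     smult = (\<lambda>c X. \<Union>x\<in>X. J +>\<^bsub>A\<^esub> (c \<odot>\<^bsub>A\<^esub> x))\<rparr>"

section \<open>Finite dimensional modules over an algebra\<close>

text \<open>A module of dimension \<open>d\<close> is given on the space of column vectors \<open>K\<^sup>d\<close> by an algebra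
  homomorphism into the \<open>d\<close> by \<open>d\<close> matrices.  Its values outside the carrier of the algebra are
  irrelevant, and all notions below ignore them.\<close>

type_synonym ('k, 'a) fdmod = "nat \<times> ('a \<Rightarrow> 'k mat)"

abbreviation mdim :: "('k, 'a) fdmod \<Rightarrow> nat" where "mdim \<equiv> fst"
abbreviation act :: "('k, 'a) fdmod \<Rightarrow> 'a \<Rightarrow> 'k mat" where "act \<equiv> snd"

definition alg_module :: "('k::field, 'a) module \<Rightarrow> ('k, 'a) fdmod \<Rightarrow> bool" where
  "alg_module A M \<longleftrightarrow>
     act M \<in> Ring.ring_hom A (ring_mat TYPE('k) (mdim M) ()) \<and>
     (\<forall>c. \<forall>x\<in>carrier A. act M (c \<odot>\<^bsub>A\<^esub> x) = c \<cdot>\<^sub>m act M x)"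

definition intertwiners ::
  "('k::field, 'a) module \<Rightarrow> ('k, 'a) fdmod \<Rightarrow> ('k, 'a) fdmod \<Rightarrow> 'k mat set" where
  "intertwiners A M N =
     {P \<in> carrier_mat (mdim N) (mdim M). \<forall>x\<in>carrier A. P * act M x = act N x * P}"

definition iso_mod ::
  "('k::field, 'a) module \<Rightarrow> ('k, 'a) fdmod \<Rightarrow> ('k, 'a) fdmod \<Rightarrow> bool" where
  "iso_mod A M N \<longleftrightarrow> (\<exists>P\<in>intertwiners A M N. invertible_mat P)"

definition iso_class ::
  "('k::field, 'a) module \<Rightarrow> ('k, 'a) fdmod \<Rightarrow> ('k, 'a) fdmod set" where
  "iso_class A M = {N. alg_module A N \<and> iso_mod A M N}"

definition dsum_mod :: "('k::field, 'a) fdmod \<Rightarrow> ('k, 'a) fdmod \<Rightarrow> ('k, 'a) fdmod" where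
  "dsum_mod M N = (mdim M + mdim N,
     \<lambda>x. four_block_mat (act M x) (0\<^sub>m (mdim M) (mdim N)) (0\<^sub>m (mdim N) (mdim M)) (act N x))"

definition simple_mod :: "('k::field, 'a) module \<Rightarrow> ('k, 'a) fdmod \<Rightarrow> bool" where
  "simple_mod A M \<longleftrightarrow> alg_module A M \<and> mdim M \<noteq> 0 \<and>
     (\<forall>W. subspace class_ring W (module_vec TYPE('k) (mdim M)) \<longrightarrow>
          (\<forall>x\<in>carrier A. \<forall>w\<in>W. act M x *\<^sub>v w \<in> W) \<longrightarrow>
          W = {0\<^sub>v (mdim M)} \<or> W = carrier_vec (mdim M))"

definition indecomposable_mod :: "('k::field, 'a) module \<Rightarrow> ('k, 'a) fdmod \<Rightarrow> bool" where
  "indecomposable_mod A M \<longleftrightarrow> alg_module A M \<and> mdim M \<noteq> 0 \<and>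
     (\<forall>N L. alg_module A N \<longrightarrow> alg_module A L \<longrightarrow> iso_mod A M (dsum_mod N L) \<longrightarrow>
        mdim N = 0 \<or> mdim L = 0)"

text \<open>Projectivity is the lifting property with respect to epimorphisms of finite dimensional
  modules; over a finite dimensional algebra this is projectivity among all modules.\<close>

definition projective_mod :: "('k::field, 'a) module \<Rightarrow> ('k, 'a) fdmod \<Rightarrow> bool" where
  "projective_mod A P \<longleftrightarrow> alg_module A P \<and>
     (\<forall>M N. \<forall>f\<in>intertwiners A M N. \<forall>h\<in>intertwiners A P N.
        alg_module A M \<longrightarrow> alg_module A N \<longrightarrow>
        (\<lambda>v. f *\<^sub>v v) ` carrier_vec (mdim M) = carrier_vec (mdim N) \<longrightarrow>
        (\<exists>k\<in>intertwiners A P M. f * k = h))"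

definition complete_simples ::
  "('k::field, 'a) module \<Rightarrow> nat \<Rightarrow> (nat \<Rightarrow> ('k, 'a) fdmod) \<Rightarrow> bool" where
  "complete_simples A m V \<longleftrightarrow>
     (\<forall>i\<in>{1..m}. simple_mod A (V i)) \<and>
     (\<forall>i\<in>{1..m}. \<forall>j\<in>{1..m}. iso_mod A (V i) (V j) \<longrightarrow> i = j) \<and>
     (\<forall>M. simple_mod A M \<longrightarrow> (\<exists>i\<in>{1..m}. iso_mod A M (V i)))"

text \<open>The module structure on \<open>K\<^sup>d\<close> for which the elements \<open>\<iota> s\<close>, \<open>s \<in> S\<close>, act by the matrices
  \<open>f s\<close>.  It is only used where these elements generate \<open>A\<close> as an algebra, so that the action is
  determined on the carrier of \<open>A\<close>.\<close>

definition gen_module ::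
  "('k::field, 'a) module \<Rightarrow> ('s \<Rightarrow> 'a) \<Rightarrow> 's set \<Rightarrow> nat \<Rightarrow> ('s \<Rightarrow> 'k mat) \<Rightarrow> ('k, 'a) fdmod" where
  "gen_module A \<iota> S d f =
     (d, SOME \<rho>. alg_module A (d, \<rho>) \<and> (\<forall>s\<in>S. \<rho> (\<iota> s) = f s))"

definition kron :: "'k::semiring_0 mat \<Rightarrow> 'k mat \<Rightarrow> 'k mat" where
  "kron A B = mat (dim_row A * dim_row B) (dim_col A * dim_col B)
     (\<lambda>(r, c). A $$ (r div dim_row B, c div dim_col B) * B $$ (r mod dim_row B, c mod dim_col B))"

section \<open>Group data and modules over the group algebra\<close>

text \<open>Group data of nilpotent type: the parameter \<open>\<mu>\<close> of the general notion is \<open>0\<close>.\<close>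

locale group_datum = group G
  for G :: "('g, 'z) monoid_scheme" (structure)
    and \<chi> :: "'g \<Rightarrow> 'k::field" and g :: 'g and n :: nat +
  assumes finite_carrier: "finite (carrier G)"
    and g_closed: "g \<in> carrier G"
    and g_central: "h \<in> carrier G \<Longrightarrow> g \<otimes> h = h \<otimes> g"
    and chi_nonzero: "h \<in> carrier G \<Longrightarrow> \<chi> h \<noteq> 0"
    and chi_mult: "h \<in> carrier G \<Longrightarrow> h' \<in> carrier G \<Longrightarrow> \<chi> (h \<otimes> h') = \<chi> h * \<chi> h'"
    and n_ge_2: "n \<ge> 2"
    and q_power: "\<chi> g ^ n = 1"
    and q_order: "0 < k \<Longrightarrow> k < n \<Longrightarrow> \<chi> g ^ k \<noteq> 1"

definition kg_elt :: "'g \<Rightarrow> ('g \<Rightarrow>\<^sub>0 'k::field)" where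
  "kg_elt h = Poly_Mapping.single h 1"

abbreviation group_algebra :: "('g, 'z) monoid_scheme \<Rightarrow> ('k::field, 'g \<Rightarrow>\<^sub>0 'k) module" where
  "group_algebra \<equiv> monoid_algebra"

definition kg_module ::
  "('g, 'z) monoid_scheme \<Rightarrow> nat \<Rightarrow> ('g \<Rightarrow> 'k::field mat) \<Rightarrow> ('k, 'g \<Rightarrow>\<^sub>0 'k) fdmod" where
  "kg_module G d f = gen_module (group_algebra G) kg_elt (carrier G) d f"

definition kg_char ::
  "('g, 'z) monoid_scheme \<Rightarrow> ('g \<Rightarrow> 'k::field) \<Rightarrow> ('k, 'g \<Rightarrow>\<^sub>0 'k) fdmod" where
  "kg_char G \<psi> = kg_module G 1 (\<lambda>h. \<psi> h \<cdot>\<^sub>m 1\<^sub>m 1)"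

definition kg_tensor ::
  "('g, 'z) monoid_scheme \<Rightarrow> ('k::field, 'g \<Rightarrow>\<^sub>0 'k) fdmod \<Rightarrow> ('k, 'g \<Rightarrow>\<^sub>0 'k) fdmod
     \<Rightarrow> ('k, 'g \<Rightarrow>\<^sub>0 'k) fdmod" where
  "kg_tensor G V W = kg_module G (mdim V * mdim W)
     (\<lambda>h. kron (act V (kg_elt h)) (act W (kg_elt h)))"

text \<open>The dual module is written in the dual basis.\<close>

definition kg_dual ::
  "('g, 'z) monoid_scheme \<Rightarrow> ('k::field, 'g \<Rightarrow>\<^sub>0 'k) fdmod \<Rightarrow> ('k, 'g \<Rightarrow>\<^sub>0 'k) fdmod" where
  "kg_dual G V = kg_module G (mdim V) (\<lambda>h. transpose_mat (act V (kg_elt (inv\<^bsub>G\<^esub> h))))"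

definition tau ::
  "('g, 'z) monoid_scheme \<Rightarrow> ('g \<Rightarrow> 'k::field) \<Rightarrow> nat \<Rightarrow> (nat \<Rightarrow> ('k, 'g \<Rightarrow>\<^sub>0 'k) fdmod)
     \<Rightarrow> nat \<Rightarrow> nat" where
  "tau G \<chi> m V i = (THE k. k \<in> {1..m} \<and>
     iso_mod (group_algebra G) (kg_tensor G (kg_char G (\<lambda>h. inverse (\<chi> h))) (V i)) (V k))"

definition dual_index ::
  "('g, 'z) monoid_scheme \<Rightarrow> nat \<Rightarrow> (nat \<Rightarrow> ('k::field, 'g \<Rightarrow>\<^sub>0 'k) fdmod) \<Rightarrow> nat \<Rightarrow> nat" where
  "dual_index G m V i = (THE k. k \<in> {1..m} \<and> iso_mod (group_algebra G) (kg_dual G (V i)) (V k))"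

section \<open>The Hopf algebra and its modules\<close>

datatype 'g hopf_gen = Y | Gr 'g

definition hopf_gens :: "('g, 'z) monoid_scheme \<Rightarrow> 'g hopf_gen set" where
  "hopf_gens G = insert Y (Gr ` carrier G)"

text \<open>The relations of \<open>G\<close> come first: they make \<open>H\<close> contain the group algebra.\<close>

definition hopf_rels ::
  "('g, 'z) monoid_scheme \<Rightarrow> ('g \<Rightarrow> 'k::field) \<Rightarrow> nat \<Rightarrow> ('g hopf_gen list \<Rightarrow>\<^sub>0 'k) set" where
  "hopf_rels G \<chi> n =
     {Poly_Mapping.single [Gr h, Gr h'] 1 - Poly_Mapping.single [Gr (h \<otimes>\<^bsub>G\<^esub> h')] 1
        | h h'. h \<in> carrier G \<and> h' \<in> carrier G}
     \<union> {Poly_Mapping.single [Gr \<one>\<^bsub>G\<^esub>] 1 - Poly_Mapping.single [] 1}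
     \<union> {Poly_Mapping.single (replicate n Y) 1}
     \<union> {Poly_Mapping.single [Y, Gr h] 1 - Poly_Mapping.single [Gr h, Y] (\<chi> h)
        | h. h \<in> carrier G}"

definition hopf_ideal ::
  "('g, 'z) monoid_scheme \<Rightarrow> ('g \<Rightarrow> 'k::field) \<Rightarrow> nat \<Rightarrow> ('g hopf_gen list \<Rightarrow>\<^sub>0 'k) set" where
  "hopf_ideal G \<chi> n = Idl\<^bsub>free_algebra (hopf_gens G)\<^esub> (hopf_rels G \<chi> n)"

type_synonym ('k, 'g) hopf_elt = "('g hopf_gen list \<Rightarrow>\<^sub>0 'k) set"

definition hopf_alg ::
  "('g, 'z) monoid_scheme \<Rightarrow> ('g \<Rightarrow> 'k::field) \<Rightarrow> nat \<Rightarrow> ('k, ('k, 'g) hopf_elt) module" where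
  "hopf_alg G \<chi> n = quot_algebra (free_algebra (hopf_gens G)) (hopf_ideal G \<chi> n)"

definition hopf_gen_elt ::
  "('g, 'z) monoid_scheme \<Rightarrow> ('g \<Rightarrow> 'k::field) \<Rightarrow> nat \<Rightarrow> 'g hopf_gen \<Rightarrow> ('k, 'g) hopf_elt" where
  "hopf_gen_elt G \<chi> n s =
     hopf_ideal G \<chi> n +>\<^bsub>free_algebra (hopf_gens G)\<^esub> Poly_Mapping.single [s] 1"

type_synonym ('k, 'g) hmod = "('k, ('k, 'g) hopf_elt) fdmod"

definition hopf_module ::
  "('g, 'z) monoid_scheme \<Rightarrow> ('g \<Rightarrow> 'k::field) \<Rightarrow> nat \<Rightarrow> nat \<Rightarrow> ('g hopf_gen \<Rightarrow> 'k mat)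
     \<Rightarrow> ('k, 'g) hmod" where
  "hopf_module G \<chi> n d f = gen_module (hopf_alg G \<chi> n) (hopf_gen_elt G \<chi> n) (hopf_gens G) d f"

text \<open>The module structure given by the counit \<open>\<epsilon>(h) = 1\<close>, \<open>\<epsilon>(y) = 0\<close>.\<close>

definition hopf_unit ::
  "('g, 'z) monoid_scheme \<Rightarrow> ('g \<Rightarrow> 'k::field) \<Rightarrow> nat \<Rightarrow> ('k, 'g) hmod" where
  "hopf_unit G \<chi> n = hopf_module G \<chi> n 1 (\<lambda>s. case s of Gr h \<Rightarrow> 1\<^sub>m 1 | Y \<Rightarrow> 0\<^sub>m 1 1)"

text \<open>Through \<open>\<Delta>(h) = h \<otimes> h\<close> and \<open>\<Delta>(y) = y \<otimes> g + 1 \<otimes> y\<close>.\<close>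

definition hopf_tensor ::
  "('g, 'z) monoid_scheme \<Rightarrow> ('g \<Rightarrow> 'k::field) \<Rightarrow> 'g \<Rightarrow> nat
     \<Rightarrow> ('k, 'g) hmod \<Rightarrow> ('k, 'g) hmod \<Rightarrow> ('k, 'g) hmod" where
  "hopf_tensor G \<chi> g n M N = hopf_module G \<chi> n (mdim M * mdim N)
     (\<lambda>s. case s of
        Gr h \<Rightarrow> kron (act M (hopf_gen_elt G \<chi> n (Gr h))) (act N (hopf_gen_elt G \<chi> n (Gr h)))
      | Y \<Rightarrow> kron (act M (hopf_gen_elt G \<chi> n Y)) (act N (hopf_gen_elt G \<chi> n (Gr g)))
           + kron (1\<^sub>m (mdim M)) (act N (hopf_gen_elt G \<chi> n Y)))"

definition inflate ::
  "('g, 'z) monoid_scheme \<Rightarrow> ('g \<Rightarrow> 'k::field) \<Rightarrow> nat \<Rightarrow> ('k, 'g \<Rightarrow>\<^sub>0 'k) fdmod \<Rightarrow> ('k, 'g) hmod" where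
  "inflate G \<chi> n V = hopf_module G \<chi> n (mdim V)
     (\<lambda>s. case s of Gr h \<Rightarrow> act V (kg_elt h) | Y \<Rightarrow> 0\<^sub>m (mdim V) (mdim V))"

text \<open>The module \<open>V \<oplus> xV \<oplus> \<dots> \<oplus> x\<^sup>j\<^sup>-\<^sup>1V\<close> (for \<open>V = V\<^sub>i\<close> this is \<open>M(i, j)\<close>); the vector \<open>x\<^sup>kv\<close> is
  the Kronecker product of the \<open>k\<close>-th unit vector with \<open>v\<close>.\<close>

definition string_module ::
  "('g, 'z) monoid_scheme \<Rightarrow> ('g \<Rightarrow> 'k::field) \<Rightarrow> nat \<Rightarrow> ('k, 'g \<Rightarrow>\<^sub>0 'k) fdmod \<Rightarrow> nat
     \<Rightarrow> ('k, 'g) hmod" where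
  "string_module G \<chi> n V j = hopf_module G \<chi> n (j * mdim V)
     (\<lambda>s. case s of
        Gr h \<Rightarrow> kron (mat j j (\<lambda>(r, c). if r = c then inverse (\<chi> h) ^ c else 0)) (act V (kg_elt h))
      | Y \<Rightarrow> kron (mat j j (\<lambda>(r, c). if r = Suc c then 1 else 0)) (1\<^sub>m (mdim V)))"

section \<open>Green rings\<close>

definition iso_monoid ::
  "('g, 'z) monoid_scheme \<Rightarrow> ('g \<Rightarrow> 'k::field) \<Rightarrow> 'g \<Rightarrow> nat \<Rightarrow> ('k, 'g) hmod set monoid" where
  "iso_monoid G \<chi> g n =
    \<lparr>carrier = iso_class (hopf_alg G \<chi> n) ` {M. alg_module (hopf_alg G \<chi> n) M},
     mult = (\<lambda>A B. \<Union>M\<in>A. \<Union>N\<in>B. iso_class (hopf_alg G \<chi> n) (hopf_tensor G \<chi> g n M N)),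
     one = iso_class (hopf_alg G \<chi> n) (hopf_unit G \<chi> n)\<rparr>"

text \<open>The additive group of the integral monoid algebra of \<open>iso_monoid\<close> is the free abelian group
  on the isomorphism classes; its product extends \<open>[M][N] = [M \<otimes> N]\<close> bilinearly.\<close>

definition free_green ::
  "('g, 'z) monoid_scheme \<Rightarrow> ('g \<Rightarrow> 'k::field) \<Rightarrow> 'g \<Rightarrow> nat
     \<Rightarrow> (int, ('k, 'g) hmod set \<Rightarrow>\<^sub>0 int) module" where
  "free_green G \<chi> g n = monoid_algebra (iso_monoid G \<chi> g n)"

definition green_rels ::
  "('g, 'z) monoid_scheme \<Rightarrow> ('g \<Rightarrow> 'k::field) \<Rightarrow> 'g \<Rightarrow> nat \<Rightarrow> (('k, 'g) hmod set \<Rightarrow>\<^sub>0 int) set" where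
  "green_rels G \<chi> g n = generate (add_monoid (free_green G \<chi> g n))
     {Poly_Mapping.single (iso_class (hopf_alg G \<chi> n) (dsum_mod M N)) 1
        - Poly_Mapping.single (iso_class (hopf_alg G \<chi> n) M) 1
        - Poly_Mapping.single (iso_class (hopf_alg G \<chi> n) N) 1
      | M N. alg_module (hopf_alg G \<chi> n) M \<and> alg_module (hopf_alg G \<chi> n) N}"

type_synonym ('k, 'g) green_elt = "(('k, 'g) hmod set \<Rightarrow>\<^sub>0 int) set"

definition green_ring ::
  "('g, 'z) monoid_scheme \<Rightarrow> ('g \<Rightarrow> 'k::field) \<Rightarrow> 'g \<Rightarrow> nat \<Rightarrow> ('k, 'g) green_elt ring" where
  "green_ring G \<chi> g n = free_green G \<chi> g n Quot green_rels G \<chi> g n"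

definition green_class ::
  "('g, 'z) monoid_scheme \<Rightarrow> ('g \<Rightarrow> 'k::field) \<Rightarrow> 'g \<Rightarrow> nat \<Rightarrow> ('k, 'g) hmod \<Rightarrow> ('k, 'g) green_elt" where
  "green_class G \<chi> g n M = green_rels G \<chi> g n +>\<^bsub>free_green G \<chi> g n\<^esub>
     Poly_Mapping.single (iso_class (hopf_alg G \<chi> n) M) 1"

definition projective_ideal ::
  "('g, 'z) monoid_scheme \<Rightarrow> ('g \<Rightarrow> 'k::field) \<Rightarrow> 'g \<Rightarrow> nat \<Rightarrow> ('k, 'g) green_elt set" where
  "projective_ideal G \<chi> g n = Idl\<^bsub>green_ring G \<chi> g n\<^esub>
     {green_class G \<chi> g n P | P.
        indecomposable_mod (hopf_alg G \<chi> n) P \<and> projective_mod (hopf_alg G \<chi> n) P}"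

definition stable_green_ring ::
  "('g, 'z) monoid_scheme \<Rightarrow> ('g \<Rightarrow> 'k::field) \<Rightarrow> 'g \<Rightarrow> nat \<Rightarrow> ('k, 'g) green_elt set ring" where
  "stable_green_ring G \<chi> g n = green_ring G \<chi> g n Quot projective_ideal G \<chi> g n"

definition stable_class ::
  "('g, 'z) monoid_scheme \<Rightarrow> ('g \<Rightarrow> 'k::field) \<Rightarrow> 'g \<Rightarrow> nat \<Rightarrow> ('k, 'g) hmod
     \<Rightarrow> ('k, 'g) green_elt set" where
  "stable_class G \<chi> g n M = projective_ideal G \<chi> g n +>\<^bsub>green_ring G \<chi> g n\<^esub> green_class G \<chi> g n M"

section \<open>Complexification\<close>

text \<open>\<open>\<complex> \<otimes> A\<close> over the integers, for a ring \<open>A\<close>: the free abelian group on pairs \<open>(c, a)\<close> modulo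
  biadditivity.  It is written as a quotient of the integral monoid algebra of the product of the
  multiplicative monoids, which provides \<open>(c \<otimes> a)(c' \<otimes> a') = cc' \<otimes> aa'\<close>.\<close>

definition tensor_free :: "'a ring \<Rightarrow> (int, (complex \<times> 'a) \<Rightarrow>\<^sub>0 int) module" where
  "tensor_free A = monoid_algebra ((class_ring :: complex ring) \<times>\<times> A)"

definition tensor_rels :: "'a ring \<Rightarrow> ((complex \<times> 'a) \<Rightarrow>\<^sub>0 int) set" where
  "tensor_rels A = generate (add_monoid (tensor_free A))
     ({Poly_Mapping.single (c + c', a) 1 - Poly_Mapping.single (c, a) 1
         - Poly_Mapping.single (c', a) 1 | c c' a. a \<in> carrier A}
      \<union> {Poly_Mapping.single (c, a \<oplus>\<^bsub>A\<^esub> a') 1 - Poly_Mapping.single (c, a) 1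
         - Poly_Mapping.single (c, a') 1 | c a a'. a \<in> carrier A \<and> a' \<in> carrier A})"

definition pure_tensor :: "'a ring \<Rightarrow> complex \<Rightarrow> 'a \<Rightarrow> ((complex \<times> 'a) \<Rightarrow>\<^sub>0 int) set" where
  "pure_tensor A c a = tensor_rels A +>\<^bsub>tensor_free A\<^esub> Poly_Mapping.single (c, a) 1"

definition complexification ::
  "'a ring \<Rightarrow> (complex, ((complex \<times> 'a) \<Rightarrow>\<^sub>0 int) set) module" where
  "complexification A =
    \<lparr>carrier = carrier (tensor_free A Quot tensor_rels A),
     mult = mult (tensor_free A Quot tensor_rels A),
     one = one (tensor_free A Quot tensor_rels A),
     zero = zero (tensor_free A Quot tensor_rels A),
     add = add (tensor_free A Quot tensor_rels A),
     smult = (\<lambda>c X. pure_tensor A c \<one>\<^bsub>A\<^esub> \<otimes>\<^bsub>tensor_free A Quot tensor_rels A\<^esub> X)\<rparr>"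

type_synonym ('k, 'g) stable_elt = "((complex \<times> ('k, 'g) green_elt set) \<Rightarrow>\<^sub>0 int) set"

definition R_st ::
  "('g, 'z) monoid_scheme \<Rightarrow> ('g \<Rightarrow> 'k::field) \<Rightarrow> 'g \<Rightarrow> nat
     \<Rightarrow> (complex, ('k, 'g) stable_elt) module" where
  "R_st G \<chi> g n = complexification (stable_green_ring G \<chi> g n)"

definition R_st_class ::
  "('g, 'z) monoid_scheme \<Rightarrow> ('g \<Rightarrow> 'k::field) \<Rightarrow> 'g \<Rightarrow> nat \<Rightarrow> ('k, 'g) hmod \<Rightarrow> ('k, 'g) stable_elt" where
  "R_st_class G \<chi> g n M = pure_tensor (stable_green_ring G \<chi> g n) 1 (stable_class G \<chi> g n M)"

section \<open>Group-like algebras\<close>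

definition algebra_hom_to_field ::
  "('f, 'r) ring_scheme \<Rightarrow> ('f, 'a) module \<Rightarrow> ('a \<Rightarrow> 'f) \<Rightarrow> bool" where
  "algebra_hom_to_field F A \<epsilon> \<longleftrightarrow> \<epsilon> \<in> Ring.ring_hom A F \<and>
     (\<forall>c\<in>carrier F. \<forall>x\<in>carrier A. \<epsilon> (c \<odot>\<^bsub>A\<^esub> x) = c \<otimes>\<^bsub>F\<^esub> \<epsilon> x)"

locale group_like_algebra = V: vectorspace F A + A: ring A
  for F :: "('f, 'r) ring_scheme" and A :: "('f, 'a) module" +
  fixes \<epsilon> :: "'a \<Rightarrow> 'f" and I :: "'i set" and b :: "'i \<Rightarrow> 'a" and star :: "'i \<Rightarrow> 'i" and i0 :: 'i
  assumes smult_mult: "c \<in> carrier F \<Longrightarrow> x \<in> carrier A \<Longrightarrow> y \<in> carrier A \<Longrightarrow>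
      (c \<odot>\<^bsub>A\<^esub> x) \<otimes>\<^bsub>A\<^esub> y = c \<odot>\<^bsub>A\<^esub> (x \<otimes>\<^bsub>A\<^esub> y) \<and> x \<otimes>\<^bsub>A\<^esub> (c \<odot>\<^bsub>A\<^esub> y) = c \<odot>\<^bsub>A\<^esub> (x \<otimes>\<^bsub>A\<^esub> y)"
    and finite_dim: "V.fin_dim"
    and eps_hom: "algebra_hom_to_field F A \<epsilon>"
    and finite_index: "finite I"
    and inj_basis: "inj_on b I"
    and basis: "V.basis (b ` I)"
    and base_index: "i0 \<in> I" "b i0 = \<one>\<^bsub>A\<^esub>"
    and involution: "i \<in> I \<Longrightarrow> star i \<in> I" "i \<in> I \<Longrightarrow> star (star i) = i"
    and G1: "i \<in> I \<Longrightarrow> \<epsilon> (b i) = \<epsilon> (b (star i)) \<and> \<epsilon> (b i) \<noteq> \<zero>\<^bsub>F\<^esub>"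
    and G2_G3: "\<exists>p :: 'i \<Rightarrow> 'i \<Rightarrow> 'i \<Rightarrow> 'f.
      (\<forall>i\<in>I. \<forall>j\<in>I. \<forall>k\<in>I. p i j k \<in> carrier F) \<and>
      (\<forall>i\<in>I. \<forall>j\<in>I. b i \<otimes>\<^bsub>A\<^esub> b j = (\<Oplus>\<^bsub>A\<^esub>k\<in>I. p i j k \<odot>\<^bsub>A\<^esub> b k)) \<and>
      (\<forall>i\<in>I. \<forall>j\<in>I. \<forall>k\<in>I. p i j k = p (star j) (star i) (star k)) \<and>
      (\<forall>i\<in>I. \<forall>j\<in>I. p i j i0 = (if i = star j then \<epsilon> (b i) else \<zero>\<^bsub>F\<^esub>))"

section \<open>The data on the stable Green ring\<close>

text \<open>The variable \<open>z\<close> of the polynomial description of the stable Green ring corresponds to the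
  class of \<open>M(1, 2)\<close>.  If \<open>n = 2\<close> this class is \<open>0\<close>, in accordance with \<open>2 cos (\<pi> / 2) = 0\<close>.\<close>

definition is_stable_eps ::
  "('g, 'z) monoid_scheme \<Rightarrow> ('g \<Rightarrow> 'k::field) \<Rightarrow> 'g \<Rightarrow> nat \<Rightarrow> nat
     \<Rightarrow> (nat \<Rightarrow> ('k, 'g \<Rightarrow>\<^sub>0 'k) fdmod) \<Rightarrow> (('k, 'g) stable_elt \<Rightarrow> complex) \<Rightarrow> bool" where
  "is_stable_eps G \<chi> g n m V \<epsilon> \<longleftrightarrow>
     algebra_hom_to_field class_ring (R_st G \<chi> g n) \<epsilon> \<and>
     (\<forall>i\<in>{1..m}. \<epsilon> (R_st_class G \<chi> g n (inflate G \<chi> n (V i))) = of_nat (mdim (V i))) \<and>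
     \<epsilon> (R_st_class G \<chi> g n (string_module G \<chi> n (V 1) 2)) = of_real (2 * cos (pi / real n))"

definition stable_basis ::
  "('g, 'z) monoid_scheme \<Rightarrow> ('g \<Rightarrow> 'k::field) \<Rightarrow> 'g \<Rightarrow> nat
     \<Rightarrow> (nat \<Rightarrow> ('k, 'g \<Rightarrow>\<^sub>0 'k) fdmod) \<Rightarrow> (('k, 'g) stable_elt \<Rightarrow> complex)
     \<Rightarrow> nat \<times> nat \<Rightarrow> ('k, 'g) stable_elt" where
  "stable_basis G \<chi> g n V \<epsilon> = (\<lambda>(i, j).
     \<epsilon> (R_st_class G \<chi> g n (string_module G \<chi> n (V i) j))
       \<odot>\<^bsub>R_st G \<chi> g n\<^esub> R_st_class G \<chi> g n (string_module G \<chi> n (V i) j))"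

text \<open>\<open>(i, j)\<^sup>* = (\<tau>\<^sup>1\<^sup>-\<^sup>j(i\<^sup>*), j)\<close>, for \<open>j \<ge> 1\<close>.\<close>

definition stable_star ::
  "('g, 'z) monoid_scheme \<Rightarrow> ('g \<Rightarrow> 'k::field) \<Rightarrow> nat \<Rightarrow> (nat \<Rightarrow> ('k, 'g \<Rightarrow>\<^sub>0 'k) fdmod)
     \<Rightarrow> nat \<times> nat \<Rightarrow> nat \<times> nat" where
  "stable_star G \<chi> m V = (\<lambda>(i, j).
     ((inv_into {1..m} (tau G \<chi> m V) ^^ (j - 1)) (dual_index G m V i), j))"

end

theory Submission
  imports Defs "Jordan_Normal_Form.Char_Poly"
begin

text \<open>Every module is a direct sum of strings \<open>M(i, j)\<close>, and the multiplicities of the strings can be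
  read off from the characters of \<open>G\<close> on the images of the powers of \<open>y\<close>.  They are therefore additive
  invariants; for \<open>j < n\<close> they vanish on projective modules, so they are coordinates on the stable
  Green ring.  The ring is generated by the \<open>[V\<^sub>i]\<close> and \<open>z = [M(1, 2)]\<close>, and the products
  \<open>z M(i, j) = M(i, j + 1) + M(\<tau>(i), j - 1)\<close> and \<open>[V\<^sub>i] M(k, j)\<close> suffice to check identities on these
  generators.  In this way one obtains commutativity, the morphism \<open>\<epsilon>\<close>, and the multiplicativity of the
  linear map \<open>\<sigma>\<close> that permutes the basis by \<open>*\<close>; the last fact and commutativity give (G2).  For (G3)
  the recursion for \<open>z\<close> shows by induction that \<open>M(1, 1)\<close> occurs in \<open>M(i, j) M(k, l)\<close> exactly if
  \<open>(k, l) = (i, j)\<^sup>*\<close>.\<close>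

section \<open>Linear algebra\<close>

text \<open>Modules are only matrices satisfying the relations of H, and multiplicities of strings
  must not depend on a chosen decomposition. Traces on \<open>y^j M\<close> settle this: they are
  additive isomorphism invariants, and since K has characteristic zero, natural numbers can be
  recovered from their values in K. Equality of multiplicities then takes the place of explicit
  isomorphisms between products, which matters because H is not cocommutative. The number 2
  cos(\<pi>/n) is such that the recursion for z turns the weights into sin(j \<pi>/n) /
  sin(\<pi>/n). This vanishes at j = n, as the stable class of M(i, n) does, and is positive for 0 <
  j < n; hence \<epsilon> is well defined and nonzero on the basis. The rescaling of the basis by
  its weights w is what (G3) asks for: an unscaled class pairs to 1 with its partner, whose weight
  is the same, so the coefficient at (1, 1) becomes the square of w, which is \<epsilon> of the
  rescaled basis element.\<close>

lemma mat_assoc: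
  fixes A :: "'a::semiring_0 mat"
  assumes "dim_col A = dim_row B" "dim_col B = dim_row C"
  shows "A * B * C = A * (B * C)"
  by (rule assoc_mult_mat[OF carrier_matI carrier_matI carrier_matI]; (rule refl | simp only: assms))

lemma mat_distrib_left:
  fixes A :: "'a::semiring_0 mat"
  assumes "dim_col A = dim_row B" "dim_row B = dim_row C" "dim_col B = dim_col C"
  shows "A * (B + C) = A * B + A * C"
  by (rule mult_add_distrib_mat[OF carrier_matI carrier_matI carrier_matI]; (rule refl | simp only: assms))

lemma mat_distrib_right:
  fixes A :: "'a::semiring_0 mat"
  assumes "dim_row A = dim_row B" "dim_col A = dim_col B" "dim_col B = dim_row C"
  shows "(A + B) * C = A * C + B * C"
  by (rule add_mult_distrib_mat[OF carrier_matI carrier_matI carrier_matI]; (rule refl | simp only: assms))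

lemma mat_diff_distrib_left:
  fixes A :: "'a::ring mat"
  assumes "dim_col A = dim_row B" "dim_row B = dim_row C" "dim_col B = dim_col C"
  shows "A * (B - C) = A * B - A * C"
  by (rule mult_minus_distrib_mat[OF carrier_matI carrier_matI carrier_matI]; (rule refl | simp only: assms))

lemma mat_diff_distrib_right:
  fixes A :: "'a::ring mat"
  assumes "dim_row A = dim_row B" "dim_col A = dim_col B" "dim_col B = dim_row C"
  shows "(A - B) * C = A * C - B * C"
  by (rule minus_mult_distrib_mat[OF carrier_matI carrier_matI carrier_matI]; (rule refl | simp only: assms))

lemma smult_mat_mult:
  fixes A :: "'a::comm_semiring_0 mat"
  assumes "dim_col A = dim_row B"
  shows "(c \<cdot>\<^sub>m A) * B = c \<cdot>\<^sub>m (A * B)" "A * (c \<cdot>\<^sub>m B) = c \<cdot>\<^sub>m (A * B)"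
  using assms by (auto simp: scalar_prod_def sum_distrib_left ac_simps intro!: eq_matI sum.cong)

lemma smult_smult_mat: "a \<cdot>\<^sub>m (b \<cdot>\<^sub>m A) = (a * b) \<cdot>\<^sub>m (A::'a::semigroup_mult mat)"
  by (auto simp: mult.assoc)

lemma one_smult_mat [simp]: "1 \<cdot>\<^sub>m A = (A::'a::monoid_mult mat)"
  by auto

lemma mat_mult_vec_assoc:
  fixes A :: "'a::semiring_0 mat"
  assumes "dim_col A = dim_row B" "dim_col B = dim_vec v"
  shows "A * B *\<^sub>v v = A *\<^sub>v (B *\<^sub>v v)"
  by (rule assoc_mult_mat_vec[OF carrier_matI carrier_matI carrier_vecI]) (rule refl, rule refl, simp_all only: assms)

subsection \<open>Sums of matrices\<close>

text \<open>Matrices of all sizes share one type, with no zero common to all sizes; the dimensions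
  are arguments so that the empty sum has a meaning.\<close>

definition msum :: "nat \<Rightarrow> nat \<Rightarrow> ('b \<Rightarrow> 'a::comm_monoid_add mat) \<Rightarrow> 'b set \<Rightarrow> 'a mat" where
  "msum nr nc f S = mat nr nc (\<lambda>ij. \<Sum>s\<in>S. f s $$ ij)"

lemma msum_dim [simp]: "dim_row (msum nr nc f S) = nr" "dim_col (msum nr nc f S) = nc"
  by (simp_all add: msum_def)

lemma msum_carrier [simp]: "msum nr nc f S \<in> carrier_mat nr nc"
  by (simp add: msum_def)

lemma msum_index [simp]: "i < nr \<Longrightarrow> j < nc \<Longrightarrow> msum nr nc f S $$ (i, j) = (\<Sum>s\<in>S. f s $$ (i, j))"
  by (simp add: msum_def)

lemma msum_cong: "S = T \<Longrightarrow> (\<And>s. s \<in> T \<Longrightarrow> f s = f' s) \<Longrightarrow> msum nr nc f S = msum nr nc f' T"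
  by (auto simp: msum_def)

lemma msum_empty [simp]: "msum nr nc f {} = 0\<^sub>m nr nc"
  by (auto simp: msum_def)

lemma msum_insert:
  assumes "finite S" "s \<notin> S" "f s \<in> carrier_mat nr nc"
  shows "msum nr nc f (insert s S) = f s + msum nr nc f S"
  using assms by (auto simp: msum_def)

lemma msum_singleton: "f s \<in> carrier_mat nr nc \<Longrightarrow> msum nr nc f {s} = f s"
  by (auto simp: msum_def)

lemma mult_msum:
  fixes A :: "'a::semiring_0 mat"
  assumes "A \<in> carrier_mat nr k" "\<And>s. s \<in> S \<Longrightarrow> f s \<in> carrier_mat k nc"
  shows "A * msum k nc f S = msum nr nc (\<lambda>s. A * f s) S"
proof (rule eq_matI)
  fix i j assume "i < dim_row (msum nr nc (\<lambda>s. A * f s) S)" "j < dim_col (msum nr nc (\<lambda>s. A * f s) S)"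
  hence ij: "i < nr" "j < nc" by auto
  have "(A * msum k nc f S) $$ (i, j) = (\<Sum>l = 0..<k. A $$ (i, l) * (\<Sum>s\<in>S. f s $$ (l, j)))"
    using ij assms by (auto simp: scalar_prod_def)
  also have "\<dots> = (\<Sum>s\<in>S. \<Sum>l = 0..<k. A $$ (i, l) * f s $$ (l, j))"
    unfolding sum_distrib_left by (rule sum.swap)
  also have "\<dots> = (\<Sum>s\<in>S. (A * f s) $$ (i, j))"
    using ij assms by (intro sum.cong refl) (auto simp: scalar_prod_def dest!: assms(2))
  finally show "(A * msum k nc f S) $$ (i, j) = msum nr nc (\<lambda>s. A * f s) S $$ (i, j)"
    using ij by simp
qed (use assms in auto)

lemma msum_mult:
  fixes A :: "'a::semiring_0 mat"
  assumes "A \<in> carrier_mat k nc" "\<And>s. s \<in> S \<Longrightarrow> f s \<in> carrier_mat nr k"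
  shows "msum nr k f S * A = msum nr nc (\<lambda>s. f s * A) S"
proof (rule eq_matI)
  fix i j assume "i < dim_row (msum nr nc (\<lambda>s. f s * A) S)" "j < dim_col (msum nr nc (\<lambda>s. f s * A) S)"
  hence ij: "i < nr" "j < nc" by auto
  have "(msum nr k f S * A) $$ (i, j) = (\<Sum>l = 0..<k. (\<Sum>s\<in>S. f s $$ (i, l)) * A $$ (l, j))"
    using ij assms by (auto simp: scalar_prod_def)
  also have "\<dots> = (\<Sum>s\<in>S. \<Sum>l = 0..<k. f s $$ (i, l) * A $$ (l, j))"
    unfolding sum_distrib_right by (rule sum.swap)
  also have "\<dots> = (\<Sum>s\<in>S. (f s * A) $$ (i, j))"
    using ij assms by (intro sum.cong refl) (auto simp: scalar_prod_def dest!: assms(2))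
  finally show "(msum nr k f S * A) $$ (i, j) = msum nr nc (\<lambda>s. f s * A) S $$ (i, j)"
    using ij by simp
qed (use assms in auto)

lemma msum_reindex:
  "inj_on h S \<Longrightarrow> msum nr nc f (h ` S) = msum nr nc (\<lambda>s. f (h s)) S"
  by (auto simp: msum_def sum.reindex)

subsection \<open>Trace\<close>

definition mtrace :: "'a::comm_monoid_add mat \<Rightarrow> 'a" where
  "mtrace A = (\<Sum>i<dim_row A. A $$ (i, i))"

lemma mtrace_comm:
  fixes A :: "'a::comm_semiring_0 mat"
  assumes "A \<in> carrier_mat n m" "B \<in> carrier_mat m n"
  shows "mtrace (A * B) = mtrace (B * A)"
proof -
  have "mtrace (A * B) = (\<Sum>i<n. \<Sum>j<m. A $$ (i, j) * B $$ (j, i))"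
    using assms by (auto simp: mtrace_def scalar_prod_def atLeast0LessThan)
  also have "\<dots> = (\<Sum>j<m. \<Sum>i<n. B $$ (j, i) * A $$ (i, j))"
    by (subst sum.swap) (simp add: mult.commute)
  also have "\<dots> = mtrace (B * A)"
    using assms by (auto simp: mtrace_def scalar_prod_def atLeast0LessThan)
  finally show ?thesis .
qed

lemma mtrace_smult: "A \<in> carrier_mat n n \<Longrightarrow> mtrace (c \<cdot>\<^sub>m A) = c * mtrace (A :: 'a::semiring_0 mat)"
  by (auto simp: mtrace_def sum_distrib_left)

lemma mtrace_zero [simp]: "mtrace (0\<^sub>m n n) = 0"
  by (auto simp: mtrace_def)

lemma mtrace_one [simp]: "mtrace (1\<^sub>m n :: 'a::semiring_1 mat) = of_nat n"
  by (auto simp: mtrace_def)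

lemma mtrace_transpose: "A \<in> carrier_mat n n \<Longrightarrow> mtrace (transpose_mat A) = mtrace A"
  by (auto simp: mtrace_def)

lemma mtrace_msum:
  assumes "\<And>s. s \<in> S \<Longrightarrow> f s \<in> carrier_mat n n"
  shows "mtrace (msum n n f S) = (\<Sum>s\<in>S. mtrace (f s))"
proof -
  have "mtrace (msum n n f S) = (\<Sum>i<n. \<Sum>s\<in>S. f s $$ (i, i))"
    by (simp add: mtrace_def)
  also have "\<dots> = (\<Sum>s\<in>S. \<Sum>i<n. f s $$ (i, i))" by (rule sum.swap)
  also have "\<dots> = (\<Sum>s\<in>S. mtrace (f s))"
    by (intro sum.cong refl) (auto simp: mtrace_def dest!: assms)
  finally show ?thesis .
qed

lemma sum_lessThan_add:
  fixes f :: "nat \<Rightarrow> 'a::comm_monoid_add"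
  shows "(\<Sum>i<n + m. f i) = (\<Sum>i<n. f i) + (\<Sum>i<m. f (n + i))"
  by (induction m) (auto simp: add.assoc)

lemma mtrace_four_block:
  assumes "A \<in> carrier_mat n n" "D \<in> carrier_mat m m"
  shows "mtrace (four_block_mat A B C D) = mtrace A + mtrace D"
  using assms by (auto simp: mtrace_def sum_lessThan_add intro!: arg_cong2[where f = "(+)"] sum.cong)

subsection \<open>Kronecker products\<close>

lemma kron_dim [simp]:
  "dim_row (kron A B) = dim_row A * dim_row B" "dim_col (kron A B) = dim_col A * dim_col B"
  by (simp_all add: kron_def)

lemma kron_carrier [simp]:
  "A \<in> carrier_mat a b \<Longrightarrow> B \<in> carrier_mat c d \<Longrightarrow> kron A B \<in> carrier_mat (a * c) (b * d)"
  by (auto simp: kron_def)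

lemma kron_index:
  "i < dim_row A * dim_row B \<Longrightarrow> j < dim_col A * dim_col B \<Longrightarrow>
   kron A B $$ (i, j) = A $$ (i div dim_row B, j div dim_col B) * B $$ (i mod dim_row B, j mod dim_col B)"
  by (simp add: kron_def)

lemma div_less_of_mult: "i < a * b \<Longrightarrow> i div b < (a::nat)"
  by (simp add: less_mult_imp_div_less)

lemma mod_less_of_mult: "i < a * b \<Longrightarrow> i mod b < (b::nat)"
  by (cases "b = 0") auto

text \<open>Indices of a Kronecker product encode a pair (i, j) as i * b + j; this decoding turns
  products of Kronecker products into double sums.\<close>

lemma sum_div_mod:
  fixes f :: "nat \<Rightarrow> nat \<Rightarrow> 'a::comm_monoid_add"
  shows "(\<Sum>k<a * b. f (k div b) (k mod b)) = (\<Sum>i<a. \<Sum>j<b. f i j)"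
proof -
  have "(\<Sum>k<a * b. f (k div b) (k mod b)) = (\<Sum>i<a. \<Sum>k = i * b..<i * b + b. f (k div b) (k mod b))"
    by (simp add: sum.nat_group)
  also have "\<dots> = (\<Sum>i<a. \<Sum>j<b. f i j)"
  proof (rule sum.cong[OF refl])
    fix i
    have "(\<Sum>k = i * b..<i * b + b. f (k div b) (k mod b)) = (\<Sum>k = 0 + i * b..<b + i * b. f (k div b) (k mod b))"
      by (simp add: add.commute)
    also have "\<dots> = (\<Sum>j = 0..<b. f ((j + i * b) div b) ((j + i * b) mod b))"
      by (rule sum.shift_bounds_nat_ivl)
    also have "\<dots> = (\<Sum>j<b. f i j)"
      by (auto simp: atLeast0LessThan intro!: sum.cong)
    finally show "(\<Sum>k = i * b..<i * b + b. f (k div b) (k mod b)) = (\<Sum>j<b. f i j)" .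
  qed
  finally show ?thesis .
qed

lemma kron_mult:
  fixes A :: "'a::comm_semiring_0 mat"
  assumes "dim_col A = dim_row B" "dim_col C = dim_row D"
  shows "kron A C * kron B D = kron (A * B) (C * D)"
proof (rule eq_matI)
  fix i j assume "i < dim_row (kron (A * B) (C * D))" "j < dim_col (kron (A * B) (C * D))"
  hence i: "i < dim_row A * dim_row C" and j: "j < dim_col B * dim_col D" by auto
  note ij = div_less_of_mult[OF i] mod_less_of_mult[OF i] div_less_of_mult[OF j] mod_less_of_mult[OF j]
  let ?a = "dim_row B" and ?b = "dim_row D"
  let ?F = "\<lambda>k l. A $$ (i div dim_row C, k) * C $$ (i mod dim_row C, l) *
        (B $$ (k, j div dim_col D) * D $$ (l, j mod dim_col D))"
  have "(kron A C * kron B D) $$ (i, j) = (\<Sum>k<?a * ?b. ?F (k div ?b) (k mod ?b))"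
    using i j assms by (auto simp: scalar_prod_def kron_index atLeast0LessThan intro!: sum.cong)
  also have "\<dots> = (\<Sum>k<?a. \<Sum>l<?b. ?F k l)" by (rule sum_div_mod)
  also have "\<dots> = (\<Sum>k<?a. A $$ (i div dim_row C, k) * B $$ (k, j div dim_col D)) *
      (\<Sum>l<?b. C $$ (i mod dim_row C, l) * D $$ (l, j mod dim_col D))"
    by (simp add: sum_product ac_simps)
  also have "\<dots> = kron (A * B) (C * D) $$ (i, j)"
    using i j ij assms by (simp add: kron_index scalar_prod_def atLeast0LessThan)
  finally show "(kron A C * kron B D) $$ (i, j) = kron (A * B) (C * D) $$ (i, j)" .
qed (use assms in auto)

lemma kron_one: "kron (1\<^sub>m a) (1\<^sub>m b) = (1\<^sub>m (a * b) :: 'a::semiring_1 mat)"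
proof (rule eq_matI)
  fix i j assume "i < dim_row (1\<^sub>m (a * b) :: 'a mat)" "j < dim_col (1\<^sub>m (a * b) :: 'a mat)"
  hence i: "i < a * b" and j: "j < a * b" by auto
  have "(i div b = j div b \<and> i mod b = j mod b) = (i = j)"
    by (metis div_mult_mod_eq)
  thus "kron (1\<^sub>m a) (1\<^sub>m b) $$ (i, j) = (1\<^sub>m (a * b) :: 'a mat) $$ (i, j)"
    using i j div_less_of_mult[OF i] mod_less_of_mult[OF i] div_less_of_mult[OF j] mod_less_of_mult[OF j]
    by (auto simp: kron_index)
qed auto

lemma div_mod_mod: "i mod (b * c) div c = i div c mod (b::nat)"
proof (cases "c = 0")
  case False
  have "i mod (c * b) = c * (i div c mod b) + i mod c" by (rule mod_mult2_eq)
  thus ?thesis using False by (simp add: mult.commute)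
qed simp

lemma mod_mod_mult: "i mod (b * c) mod c = i mod (c::nat)"
  by (simp add: mod_mod_cancel)

text \<open>Both sides read an index as the same three mixed-radix digits. The equality is strict,
  which later makes the identity matrix an isomorphism between the two bracketings of a triple
  tensor product.\<close>

lemma kron_assoc: "kron (kron A B) C = kron A (kron B (C :: 'a::semiring_0 mat))"
proof (rule eq_matI)
  fix i j assume "i < dim_row (kron A (kron B C))" "j < dim_col (kron A (kron B C))"
  hence i: "i < dim_row A * dim_row B * dim_row C" and j: "j < dim_col A * dim_col B * dim_col C"
    by (auto simp: mult.assoc)
  hence i': "i < dim_row A * (dim_row B * dim_row C)" and j': "j < dim_col A * (dim_col B * dim_col C)"
    by (auto simp: mult.assoc)
  have d: "i div dim_row C div dim_row B = i div (dim_row B * dim_row C)"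
    "j div dim_col C div dim_col B = j div (dim_col B * dim_col C)"
    by (simp_all only: div_mult2_eq[symmetric] mult.commute)
  show "kron (kron A B) C $$ (i, j) = kron A (kron B C) $$ (i, j)"
    using i j i' j' div_less_of_mult[OF i] div_less_of_mult[OF j] mod_less_of_mult[OF i'] mod_less_of_mult[OF j']
    by (simp add: kron_index d div_mod_mod mod_mod_mult mult.assoc)
qed (auto simp: mult.assoc)

lemma kron_add_left:
  fixes A :: "'a::semiring_0 mat"
  assumes "dim_row A = dim_row B" "dim_col A = dim_col B"
  shows "kron (A + B) C = kron A C + kron B C"
  using assms by (auto simp: kron_index div_less_of_mult distrib_right)

lemma kron_add_right:
  fixes A :: "'a::semiring_0 mat"
  assumes "dim_row B = dim_row C" "dim_col B = dim_col C"
  shows "kron A (B + C) = kron A B + kron A C"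
  using assms by (auto simp: kron_index mod_less_of_mult distrib_left)

lemma kron_smult:
  fixes A :: "'a::comm_semiring_0 mat"
  shows "kron (c \<cdot>\<^sub>m A) B = c \<cdot>\<^sub>m kron A B" "kron A (c \<cdot>\<^sub>m B) = c \<cdot>\<^sub>m kron A B"
  by (auto simp: kron_index div_less_of_mult mod_less_of_mult ac_simps)

lemma kron_zero [simp]:
  "kron (0\<^sub>m a b) (B :: 'a::semiring_0 mat) = 0\<^sub>m (a * dim_row B) (b * dim_col B)"
  "kron (A :: 'a::semiring_0 mat) (0\<^sub>m a b) = 0\<^sub>m (dim_row A * a) (dim_col A * b)"
  by (auto simp: kron_index div_less_of_mult mod_less_of_mult)

lemma kron_one_1 [simp]:
  "kron (1\<^sub>m 1) (B :: 'a::semiring_1 mat) = B" "kron B (1\<^sub>m 1) = B"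
  by (auto simp: kron_index)

lemma mtrace_kron:
  fixes A :: "'a::comm_semiring_0 mat"
  assumes "A \<in> carrier_mat a a" "B \<in> carrier_mat b b"
  shows "mtrace (kron A B) = mtrace A * mtrace B"
proof -
  have "mtrace (kron A B) = (\<Sum>k<a * b. A $$ (k div b, k div b) * B $$ (k mod b, k mod b))"
    using assms by (auto simp: mtrace_def kron_index)
  also have "\<dots> = (\<Sum>i<a. \<Sum>j<b. A $$ (i, i) * B $$ (j, j))"
    by (rule sum_div_mod)
  also have "\<dots> = mtrace A * mtrace B" using assms by (auto simp: mtrace_def sum_product)
  finally show ?thesis .
qed

lemma div_sub_mult: "a * r \<le> i \<Longrightarrow> (i - a * r) div r = i div r - (a::nat)"
  by (cases "r = 0") (auto dest!: le_Suc_ex)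

lemma mod_sub_mult: "a * r \<le> i \<Longrightarrow> (i - a * r) mod r = i mod (r::nat)"
  by (auto dest!: le_Suc_ex)

lemma kron_four_block:
  fixes A :: "'a::semiring_0 mat"
  assumes c: "A \<in> carrier_mat a b" "B \<in> carrier_mat a d" "C \<in> carrier_mat c b" "D \<in> carrier_mat c d"
  shows "kron (four_block_mat A B C D) X = four_block_mat (kron A X) (kron B X) (kron C X) (kron D X)"
proof (rule eq_matI)
  let ?r = "dim_row X" and ?s = "dim_col X"
  fix i j assume "i < dim_row (four_block_mat (kron A X) (kron B X) (kron C X) (kron D X))"
    "j < dim_col (four_block_mat (kron A X) (kron B X) (kron C X) (kron D X))"
  hence i: "i < (a + c) * ?r" and j: "j < (b + d) * ?s" using c by (auto simp: distrib_right)
  have iff: "i div ?r < a \<longleftrightarrow> i < a * ?r" "j div ?s < b \<longleftrightarrow> j < b * ?s"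
    using i j by (metis div_less_iff_less_mult gr0I mult_0_right not_less0)+
  have "i div ?r < a + c" "j div ?s < b + d" using div_less_of_mult[OF i] div_less_of_mult[OF j] .
  moreover have "i < a * ?r + c * ?r" "j < b * ?s + d * ?s" using i j by (auto simp: distrib_right)
  ultimately show "kron (four_block_mat A B C D) X $$ (i, j) =
     four_block_mat (kron A X) (kron B X) (kron C X) (kron D X) $$ (i, j)"
    using c i j iff by (auto simp: kron_index div_sub_mult mod_sub_mult not_less)
qed (use c in \<open>auto simp: distrib_right\<close>)

subsection \<open>Rank factorization\<close>

lemma mult_index_sum:
  "A \<in> carrier_mat n m \<Longrightarrow> B \<in> carrier_mat m k \<Longrightarrow> i < n \<Longrightarrow> j < k \<Longrightarrow>
   (A * B) $$ (i, j) = (\<Sum>l<m. A $$ (i, l) * B $$ (l, j))"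
  by (auto simp: scalar_prod_def atLeast0LessThan)

text \<open>Row \<open>a\<close> of the old columns is zero while the new column is nonzero there.
  The functional \<open>e_a / c a\<close> therefore detects the new column alone, and subtracting
  multiples of \<open>e_a\<close> from the rows of \<open>A'\<close> makes them blind to it.\<close>

lemma left_inverse_append:
  fixes A :: "'a::field mat"
  assumes A: "A \<in> carrier_mat nr r" "A' \<in> carrier_mat r nr" "A' * A = 1\<^sub>m r"
    and a: "a < nr" "\<And>k. k < r \<Longrightarrow> A $$ (a, k) = 0" "c a \<noteq> 0"
  shows "\<exists>B\<in>carrier_mat (Suc r) nr. B * mat nr (Suc r) (\<lambda>(i, k). if k < r then A $$ (i, k) else c i) = 1\<^sub>m (Suc r)"
proof -
  let ?M = "mat nr (Suc r) (\<lambda>(i, k). if k < r then A $$ (i, k) else c i)"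
  define w where "w k = (\<Sum>l<nr. A' $$ (k, l) * c l) / c a" for k
  define B where "B = mat (Suc r) nr (\<lambda>(k, i). if k < r then A' $$ (k, i) - (if i = a then w k else 0)
     else if i = a then 1 / c a else 0)"
  have AA: "(\<Sum>i<nr. A' $$ (k, i) * A $$ (i, k')) = (if k = k' then 1 else 0)" if "k < r" "k' < r" for k k'
  proof -
    have "(\<Sum>i<nr. A' $$ (k, i) * A $$ (i, k')) = (A' * A) $$ (k, k')"
      using A(1,2) that by (auto simp: scalar_prod_def atLeast0LessThan)
    thus ?thesis using A(3) that by simp
  qed
  have "B * ?M = 1\<^sub>m (Suc r)"
  proof (rule eq_matI)
    fix k k' assume "k < dim_row (1\<^sub>m (Suc r) :: 'a mat)" "k' < dim_col (1\<^sub>m (Suc r) :: 'a mat)"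
    hence k: "k < Suc r" "k' < Suc r" by auto
    define m where "m i = (if k' < r then A $$ (i, k') else c i)" for i
    have e: "(B * ?M) $$ (k, k') = (\<Sum>i<nr. B $$ (k, i) * m i)"
      using k by (auto simp: scalar_prod_def atLeast0LessThan B_def m_def)
    show "(B * ?M) $$ (k, k') = 1\<^sub>m (Suc r) $$ (k, k')"
    proof (cases "k < r")
      case True
      have "(\<Sum>i<nr. B $$ (k, i) * m i) = (\<Sum>i<nr. A' $$ (k, i) * m i - (if i = a then w k * m i else 0))"
        using True k by (intro sum.cong) (auto simp: B_def algebra_simps)
      also have "\<dots> = (\<Sum>i<nr. A' $$ (k, i) * m i) - w k * m a"
        using a(1) by (simp add: sum_subtractf)
      also have "\<dots> = (if k = k' then 1 else 0)"
      proof (cases "k' < r")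
        case k': True
        thus ?thesis using a True by (simp add: m_def AA)
      next
        case False
        thus ?thesis using a True k by (auto simp: m_def w_def)
      qed
      finally show ?thesis using e k by simp
    next
      case False
      hence kr: "k = r" using k by simp
      have "(\<Sum>i<nr. B $$ (k, i) * m i) = (\<Sum>i<nr. if i = a then m i / c a else 0)"
        using kr by (intro sum.cong) (auto simp: B_def)
      also have "\<dots> = m a / c a" using a(1) by simp
      finally show ?thesis using e k kr a by (auto simp: m_def)
    qed
  qed (auto simp: B_def)
  thus ?thesis by (intro bexI[of _ B]) (auto simp: B_def)
qed

text \<open>Gaussian elimination by induction on the number of nonzero rows: subtracting the rank
  one matrix \<open>c i * u j\<close> through a pivot clears its row and column and creates no new
  nonzero row. The one-sided inverses are carried along, since pseudo inverses and splittings of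
  idempotents are read off from them.\<close>

lemma rank_factorization:
  fixes M :: "'a::field mat"
  assumes "M \<in> carrier_mat nr nc"
  shows "\<exists>r A B A' B'. A \<in> carrier_mat nr r \<and> B \<in> carrier_mat r nc \<and> A' \<in> carrier_mat r nr \<and>
     B' \<in> carrier_mat nc r \<and> M = A * B \<and> A' * A = 1\<^sub>m r \<and> B * B' = 1\<^sub>m r"
  using assms
proof (induction "card {i. i < nr \<and> (\<exists>j<nc. M $$ (i, j) \<noteq> 0)}" arbitrary: M rule: less_induct)
  case (less M)
  note M = less.prems
  show ?case
  proof (cases "M = 0\<^sub>m nr nc")
    case True
    show ?thesis
      by (rule exI[of _ 0], rule exI[of _ "0\<^sub>m nr 0"], rule exI[of _ "0\<^sub>m 0 nc"], rule exI[of _ "0\<^sub>m 0 nr"],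
          rule exI[of _ "0\<^sub>m nc 0"]) (use True in auto)
  next
    case False
    then obtain a b where ab: "a < nr" "b < nc" and p0: "M $$ (a, b) \<noteq> 0"
      using M by (metis carrier_matD(1) carrier_matD(2) eq_matI index_zero_mat(1) index_zero_mat(2) index_zero_mat(3))
    define p where "p = M $$ (a, b)"
    define c where "c i = M $$ (i, b) / p" for i
    define u where "u j = M $$ (a, j)" for j
    define N where "N = mat nr nc (\<lambda>(i, j). M $$ (i, j) - c i * u j)"
    have N: "N \<in> carrier_mat nr nc" by (simp add: N_def)
    have Na: "N $$ (a, j) = 0" if "j < nc" for j using that ab p0 by (simp add: N_def c_def u_def p_def)
    have Nb: "N $$ (i, b) = 0" if "i < nr" for i using that ab p0 by (simp add: N_def c_def u_def p_def)
    have sub: "{i. i < nr \<and> (\<exists>j<nc. N $$ (i, j) \<noteq> 0)} \<subset> {i. i < nr \<and> (\<exists>j<nc. M $$ (i, j) \<noteq> 0)}"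
    proof (rule psubsetI)
      show "{i. i < nr \<and> (\<exists>j<nc. N $$ (i, j) \<noteq> 0)} \<subseteq> {i. i < nr \<and> (\<exists>j<nc. M $$ (i, j) \<noteq> 0)}"
      proof safe
        fix i j assume "i < nr" "j < nc" "N $$ (i, j) \<noteq> 0"
        thus "\<exists>j<nc. M $$ (i, j) \<noteq> 0"
          using ab by (cases "M $$ (i, b) = 0") (auto simp: N_def c_def)
      qed
      show "{i. i < nr \<and> (\<exists>j<nc. N $$ (i, j) \<noteq> 0)} \<noteq> {i. i < nr \<and> (\<exists>j<nc. M $$ (i, j) \<noteq> 0)}"
        using ab p0 Na by blast
    qed
    have "card {i. i < nr \<and> (\<exists>j<nc. N $$ (i, j) \<noteq> 0)} < card {i. i < nr \<and> (\<exists>j<nc. M $$ (i, j) \<noteq> 0)}"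
      by (rule psubset_card_mono[OF _ sub]) auto
    from less.hyps[OF this N] obtain r A B A' B' where AB: "A \<in> carrier_mat nr r" "B \<in> carrier_mat r nc"
      "A' \<in> carrier_mat r nr" "B' \<in> carrier_mat nc r" "N = A * B" "A' * A = 1\<^sub>m r" "B * B' = 1\<^sub>m r"
      by blast
    \<comment> \<open>Row \<open>a\<close> of N vanishes, hence so does row \<open>a\<close> of A;
      this is the hypothesis for appending a column. Column \<open>b\<close> of B is treated in the
      same way after transposition.\<close>
    have "A = N * B'" using AB by (simp add: mat_assoc)
    hence "A $$ (a, k) = 0" if "k < r" for k
      using that ab(1) Na mult_index_sum[OF N AB(4) ab(1) that] by simp
    from left_inverse_append[of A nr r A' a c, OF AB(1,3,6) ab(1) this] p0
    obtain A2' where A2': "A2' \<in> carrier_mat (Suc r) nr"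
      "A2' * mat nr (Suc r) (\<lambda>(i, k). if k < r then A $$ (i, k) else c i) = 1\<^sub>m (Suc r)"
      by (auto simp: c_def p_def)
    have "B = A' * N" using AB by (simp add: mat_assoc[symmetric])
    hence Bb: "B $$ (k, b) = 0" if "k < r" for k
      using that ab(2) Nb mult_index_sum[OF AB(3) N that ab(2)] by simp
    have BT: "transpose_mat B' * transpose_mat B = 1\<^sub>m r"
      using AB transpose_mult[of B r nc B' r] by simp
    obtain B2 where B2: "B2 \<in> carrier_mat (Suc r) nc"
      "B2 * mat nc (Suc r) (\<lambda>(i, k). if k < r then transpose_mat B $$ (i, k) else u i) = 1\<^sub>m (Suc r)"
      using left_inverse_append[of "transpose_mat B" nc r "transpose_mat B'" b u] AB BT ab Bb p0
      by (auto simp: u_def)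
    let ?A = "mat nr (Suc r) (\<lambda>(i, k). if k < r then A $$ (i, k) else c i)"
    let ?B = "mat (Suc r) nc (\<lambda>(k, j). if k < r then B $$ (k, j) else u j)"
    have "?B = transpose_mat (mat nc (Suc r) (\<lambda>(i, k). if k < r then transpose_mat B $$ (i, k) else u i))"
      using AB by auto
    hence "?B * transpose_mat B2 = 1\<^sub>m (Suc r)"
      using B2 transpose_mult[of B2 "Suc r" nc "mat nc (Suc r) (\<lambda>(i, k). if k < r then transpose_mat B $$ (i, k) else u i)" "Suc r"]
      by simp
    moreover have "M = ?A * ?B"
    proof (rule eq_matI)
      fix i j assume "i < dim_row (?A * ?B)" "j < dim_col (?A * ?B)"
      hence ij: "i < nr" "j < nc" by auto
      have "(?A * ?B) $$ (i, j) = (\<Sum>k<Suc r. ?A $$ (i, k) * ?B $$ (k, j))"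
        using ij by (auto simp: scalar_prod_def atLeast0LessThan)
      also have "\<dots> = (\<Sum>k<r. A $$ (i, k) * B $$ (k, j)) + c i * u j"
        using ij by simp
      also have "(\<Sum>k<r. A $$ (i, k) * B $$ (k, j)) = N $$ (i, j)"
        using ij AB by (auto simp: scalar_prod_def atLeast0LessThan)
      finally show "M $$ (i, j) = (?A * ?B) $$ (i, j)" using ij by (simp add: N_def)
    qed (use M in auto)
    moreover have "?A \<in> carrier_mat nr (Suc r)" "?B \<in> carrier_mat (Suc r) nc" "transpose_mat B2 \<in> carrier_mat nc (Suc r)"
      using B2(1) by simp_all
    ultimately show ?thesis using A2' by blast
  qed
qed

text \<open>For a factorization M = A B with left inverse A' of A and right inverse B' of B, the
  witness is \<open>B' * A'\<close>. Then M Z is a projection onto the image of M, which is how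
  images are handled later.\<close>

lemma pseudo_inverse:
  fixes M :: "'a::field mat"
  assumes "M \<in> carrier_mat nr nc"
  shows "\<exists>Z\<in>carrier_mat nc nr. M * Z * M = M"
proof -
  obtain r A B A' B' where AB: "A \<in> carrier_mat nr r" "B \<in> carrier_mat r nc"
      "A' \<in> carrier_mat r nr" "B' \<in> carrier_mat nc r" "M = A * B" "A' * A = 1\<^sub>m r" "B * B' = 1\<^sub>m r"
    using rank_factorization[OF assms] by blast
  have "M * (B' * A') * M = A * ((B * B') * ((A' * A) * B))"
    using AB(1-4) unfolding AB(5) by (simp add: mat_assoc)
  also have "\<dots> = M" using AB by simp
  finally show ?thesis using AB by (intro bexI[of _ "B' * A'"]) auto
qed

text \<open>In A B A B = A B the outer factors cancel by the one-sided inverses, leaving B A = 1.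
  Here A is the inclusion of the image of e and B the projection onto it.\<close>

lemma idempotent_split:
  fixes e :: "'a::field mat"
  assumes "e \<in> carrier_mat d d" "e * e = e"
  shows "\<exists>r A B. A \<in> carrier_mat d r \<and> B \<in> carrier_mat r d \<and> e = A * B \<and> B * A = 1\<^sub>m r"
proof -
  obtain r A B A' B' where AB: "A \<in> carrier_mat d r" "B \<in> carrier_mat r d"
      "A' \<in> carrier_mat r d" "B' \<in> carrier_mat d r" "e = A * B" "A' * A = 1\<^sub>m r" "B * B' = 1\<^sub>m r"
    using rank_factorization[OF assms(1)] by blast
  have "B * A = (A' * A) * ((B * A) * (B * B'))" using AB by (simp add: AB(6,7))
  also have "\<dots> = A' * (e * e) * B'" using AB(1-4) unfolding AB(5) by (simp add: mat_assoc)
  also have "\<dots> = (A' * A) * (B * B')" unfolding assms(2) using AB(1-4) unfolding AB(5) by (simp add: mat_assoc)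
  also have "\<dots> = 1\<^sub>m r" by (simp add: AB(6,7))
  finally show ?thesis using AB by blast
qed

lemma left_inverse_dim_le:
  fixes A :: "'a::field mat"
  assumes A: "A \<in> carrier_mat d r" "B \<in> carrier_mat r d" "B * A = 1\<^sub>m r"
  shows "r \<le> d"
proof (rule ccontr)
  assume "\<not> r \<le> d"
  hence dr: "d < r" by simp
  \<comment> \<open>Padding to square size makes the left inverse two-sided, but row
    \<open>d\<close> of the padded A is zero.\<close>
  let ?A = "mat r r (\<lambda>(i, j). if i < d then A $$ (i, j) else 0)"
  let ?B = "mat r r (\<lambda>(i, j). if j < d then B $$ (i, j) else 0)"
  have "?B * ?A = 1\<^sub>m r"
  proof (rule eq_matI)
    fix i j assume "i < dim_row (1\<^sub>m r :: 'a mat)" "j < dim_col (1\<^sub>m r :: 'a mat)"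
    hence ij: "i < r" "j < r" by auto
    have "(?B * ?A) $$ (i, j) = (\<Sum>k<r. if k < d then B $$ (i, k) * A $$ (k, j) else 0)"
      using ij by (auto simp: scalar_prod_def atLeast0LessThan intro!: sum.cong)
    also have "\<dots> = (\<Sum>k<d. B $$ (i, k) * A $$ (k, j))"
      using dr by (intro sum.mono_neutral_cong_right) auto
    also have "\<dots> = (B * A) $$ (i, j)"
      using ij A(1,2) by (auto simp: scalar_prod_def atLeast0LessThan)
    finally show "(?B * ?A) $$ (i, j) = 1\<^sub>m r $$ (i, j)" using A(3) by simp
  qed auto
  hence "?A * ?B = 1\<^sub>m r" by (rule mat_mult_left_right_inverse[rotated 2]) auto
  moreover have "(?A * ?B) $$ (d, d) = 0"
    using dr by (auto simp: scalar_prod_def)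
  ultimately show False using dr by simp
qed

lemma exists_eigenvector:
  fixes P :: "'a::alg_closed_field mat"
  assumes "P \<in> carrier_mat d d" "d > 0"
  shows "\<exists>c. \<exists>v\<in>carrier_vec d. v \<noteq> 0\<^sub>v d \<and> P *\<^sub>v v = c \<cdot>\<^sub>v v"
proof -
  have "degree (char_poly P) > 0" using degree_monic_char_poly[OF assms(1)] assms(2) by simp
  then obtain c where "poly (char_poly P) c = 0" using alg_closed_imp_poly_has_root by blast
  hence "eigenvalue P c" using eigenvalue_root_char_poly[OF assms(1)] by simp
  thus ?thesis using assms(1) by (auto simp: eigenvalue_def eigenvector_def)
qed

text \<open>A projection onto a subspace is built by eliminating one coordinate at a time.\<close>

lemma subspace_projection:
  fixes W :: "'a::field vec set"
  assumes "W \<subseteq> carrier_vec d" "0\<^sub>v d \<in> W"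
    "\<And>v w. v \<in> W \<Longrightarrow> w \<in> W \<Longrightarrow> v + w \<in> W" "\<And>c v. v \<in> W \<Longrightarrow> c \<cdot>\<^sub>v v \<in> W"
  shows "\<exists>E\<in>carrier_mat d d. (\<forall>v\<in>carrier_vec d. E *\<^sub>v v \<in> W) \<and> (\<forall>w\<in>W. E *\<^sub>v w = w)"
proof -
  have "\<exists>E\<in>carrier_mat d d. (\<forall>v\<in>carrier_vec d. E *\<^sub>v v \<in> W) \<and> (\<forall>w\<in>W. E *\<^sub>v w = w)"
    if "m \<le> d" "W \<subseteq> carrier_vec d" "0\<^sub>v d \<in> W"
      "\<And>v w. v \<in> W \<Longrightarrow> w \<in> W \<Longrightarrow> v + w \<in> W" "\<And>c v. v \<in> W \<Longrightarrow> c \<cdot>\<^sub>v v \<in> W"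
      "\<And>w i. w \<in> W \<Longrightarrow> i < d - m \<Longrightarrow> w $ i = 0" for m and W :: "'a vec set"
    using that
  proof (induction m arbitrary: W)
    case 0
    have w0: "w = 0\<^sub>v d" if "w \<in> W" for w
      using 0(6)[OF that] that 0(2) by (intro eq_vecI) auto
    have z: "0\<^sub>m d d *\<^sub>v v = 0\<^sub>v d" if "v \<in> carrier_vec d" for v :: "'a vec"
      using that by (intro eq_vecI) simp_all
    show ?case
    proof (intro bexI[of _ "0\<^sub>m d d"] conjI ballI)
      fix w assume "w \<in> W"
      show "0\<^sub>m d d *\<^sub>v w = w" using z[of "0\<^sub>v d"] by (simp only: w0[OF \<open>w \<in> W\<close>] zero_carrier_vec)
    qed (simp_all add: z 0(3))
  next
    case (Suc m)
    define k where "k = d - Suc m"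
    have k: "k < d" "d - m = Suc k" using Suc.prems(1) by (auto simp: k_def)
    define W' where "W' = {w \<in> W. w $ k = 0}"
    have "\<exists>E\<in>carrier_mat d d. (\<forall>v\<in>carrier_vec d. E *\<^sub>v v \<in> W') \<and> (\<forall>w\<in>W'. E *\<^sub>v w = w)"
    proof (rule Suc.IH)
      fix w i assume "w \<in> W'" "i < d - m"
      thus "w $ i = 0" using Suc.prems(6)[of w i] k by (cases "i = k") (auto simp: W'_def k_def)
    next
      fix v w assume "v \<in> W'" "w \<in> W'"
      moreover from this have "v \<in> carrier_vec d" "w \<in> carrier_vec d" using Suc.prems(2) by (auto simp: W'_def)
      ultimately show "v + w \<in> W'" using Suc.prems(4) k by (auto simp: W'_def)
    next
      fix c v assume "v \<in> W'"
      moreover from this have "v \<in> carrier_vec d" using Suc.prems(2) by (auto simp: W'_def)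
      ultimately show "c \<cdot>\<^sub>v v \<in> W'" using Suc.prems(5) k by (auto simp: W'_def)
    qed (use Suc.prems k in \<open>auto simp: W'_def\<close>)
    then obtain E where E: "E \<in> carrier_mat d d" "\<And>v. v \<in> carrier_vec d \<Longrightarrow> E *\<^sub>v v \<in> W'"
      "\<And>w. w \<in> W' \<Longrightarrow> E *\<^sub>v w = w" by blast
    show ?case
    proof (cases "W' = W")
      case True
      thus ?thesis using E by blast
    next
      case False
      then obtain c0 where c0: "c0 \<in> W" "c0 $ k \<noteq> 0" by (auto simp: W'_def)
      define c where "c = (1 / c0 $ k) \<cdot>\<^sub>v c0"
      have c: "c \<in> W" "c \<in> carrier_vec d" "c $ k = 1"
        using c0 Suc.prems(2,5) k by (auto simp: c_def)
      define C where "C = mat d d (\<lambda>(i, j). if j = k then c $ i else 0)"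
      have C: "C \<in> carrier_mat d d" by (simp add: C_def)
      have Cv: "C *\<^sub>v v = (v $ k) \<cdot>\<^sub>v c" if "v \<in> carrier_vec d" for v
      proof (rule eq_vecI)
        fix i assume "i < dim_vec ((v $ k) \<cdot>\<^sub>v c)"
        hence i: "i < d" using c by simp
        have "(C *\<^sub>v v) $ i = (\<Sum>j = 0..<d. (if j = k then c $ i else 0) * v $ j)"
          using i that by (auto simp: C_def scalar_prod_def)
        also have "\<dots> = (\<Sum>j = 0..<d. if j = k then c $ i * v $ j else 0)"
          by (intro sum.cong) auto
        also have "\<dots> = c $ i * v $ k" using k by simp
        finally show "(C *\<^sub>v v) $ i = ((v $ k) \<cdot>\<^sub>v c) $ i" using i c by simp
      qed (use c C in auto)
      \<comment> \<open>C sends v to v_k c, and is a projection because c has entry 1 at k. The rest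
        v - v_k c has k-th coordinate 0 and is handled by E, which projects onto the vectors of W
        with that property.\<close>
      define F where "F = E * (1\<^sub>m d - C) + C"
      have Fv: "F *\<^sub>v v = E *\<^sub>v (v - (v $ k) \<cdot>\<^sub>v c) + (v $ k) \<cdot>\<^sub>v c" if v: "v \<in> carrier_vec d" for v
      proof -
        have "F *\<^sub>v v = E * (1\<^sub>m d - C) *\<^sub>v v + C *\<^sub>v v"
          unfolding F_def by (rule add_mult_distrib_mat_vec) (use E(1) C v in auto)
        also have "E * (1\<^sub>m d - C) *\<^sub>v v = E *\<^sub>v ((1\<^sub>m d - C) *\<^sub>v v)"
          by (rule assoc_mult_mat_vec) (use E(1) C v in auto)
        also have "(1\<^sub>m d - C) *\<^sub>v v = 1\<^sub>m d *\<^sub>v v - C *\<^sub>v v"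
          by (rule minus_mult_distrib_mat_vec) (use C v in auto)
        finally show ?thesis using v by (simp add: Cv)
      qed
      show ?thesis
      proof (intro bexI[of _ F] conjI ballI)
        fix v :: "'a vec" assume v: "v \<in> carrier_vec d"
        have "E *\<^sub>v (v - (v $ k) \<cdot>\<^sub>v c) \<in> W"
          using E(2)[of "v - (v $ k) \<cdot>\<^sub>v c"] v c by (auto simp: W'_def)
        thus "F *\<^sub>v v \<in> W" using Fv[OF v] Suc.prems(4,5) c by simp
      next
        fix w assume w: "w \<in> W"
        hence wc: "w \<in> carrier_vec d" using Suc.prems(2) by auto
        have "w - (w $ k) \<cdot>\<^sub>v c = w + (- (w $ k)) \<cdot>\<^sub>v c" using wc c by auto
        also have "\<dots> \<in> W" using w c Suc.prems(4,5) by blast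
        finally have "w - (w $ k) \<cdot>\<^sub>v c \<in> W'" using wc c k by (auto simp: W'_def)
        from E(3)[OF this] have "F *\<^sub>v w = w - (w $ k) \<cdot>\<^sub>v c + (w $ k) \<cdot>\<^sub>v c" using Fv[OF wc] by simp
        also have "\<dots> = w" using wc c(2) by (intro eq_vecI) simp_all
        finally show "F *\<^sub>v w = w" .
      qed (use E(1) C in \<open>auto simp: F_def\<close>)
    qed
  qed
  from this[of d W] show ?thesis using assms by simp
qed

lemma mat_eq_iff_mult_vec:
  fixes A :: "'a::semiring_1 mat"
  assumes "A \<in> carrier_mat n m" "B \<in> carrier_mat n m" "\<And>v. v \<in> carrier_vec m \<Longrightarrow> A *\<^sub>v v = B *\<^sub>v v"
  shows "A = B"
proof (rule mat_col_eqI)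
  fix j assume j: "j < dim_col B"
  have "col A j = A *\<^sub>v unit_vec m j" "col B j = B *\<^sub>v unit_vec m j"
    using j assms(1,2) by (auto intro!: eq_vecI)
  thus "col A j = col B j" using assms(3) by simp
qed (use assms in auto)

section \<open>Representations of a finite group\<close>

locale fin_group = group G for G (structure) +
  assumes finite_carrier: "finite (carrier G)"
begin

definition rep :: "nat \<Rightarrow> ('a \<Rightarrow> 'k::field mat) \<Rightarrow> bool" where
  "rep d r \<longleftrightarrow> (\<forall>h\<in>carrier G. r h \<in> carrier_mat d d) \<and> r \<one> = 1\<^sub>m d \<and>
     (\<forall>h\<in>carrier G. \<forall>h'\<in>carrier G. r (h \<otimes> h') = r h * r h')"

definition homs :: "nat \<Rightarrow> ('a \<Rightarrow> 'k::field mat) \<Rightarrow> nat \<Rightarrow> ('a \<Rightarrow> 'k mat) \<Rightarrow> 'k mat set" where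
  "homs d r e s = {P \<in> carrier_mat e d. \<forall>h\<in>carrier G. P * r h = s h * P}"

text \<open>Irreducibility is encoded by Schur's condition on endomorphisms, the form that character
  theory consumes; \<open>simple_iff_irr\<close> proves its agreement with the absence of invariant
  subspaces.\<close>

definition irr :: "nat \<Rightarrow> ('a \<Rightarrow> 'k::field mat) \<Rightarrow> bool" where
  "irr d r \<longleftrightarrow> rep d r \<and> d > 0 \<and> (\<forall>P\<in>homs d r d r. \<exists>c. P = c \<cdot>\<^sub>m 1\<^sub>m d)"

text \<open>The Reynolds operator: the mean over G of the action on linear maps, which turns any
  linear map into an equivariant one.\<close>

definition avg :: "nat \<Rightarrow> nat \<Rightarrow> ('a \<Rightarrow> 'k::field mat) \<Rightarrow> ('a \<Rightarrow> 'k mat) \<Rightarrow> 'k mat \<Rightarrow> 'k mat" where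
  "avg e d s r X = inverse (of_nat (card (carrier G))) \<cdot>\<^sub>m msum e d (\<lambda>h. s h * X * r (inv h)) (carrier G)"

lemma order_pos: "card (carrier G) > 0"
  using finite_carrier by (auto simp: card_gt_0_iff)

lemma card_ne_0: "of_nat (card (carrier G)) \<noteq> (0 :: 'k::field_char_0)"
  using order_pos by simp

lemma translate: "k \<in> carrier G \<Longrightarrow> (\<lambda>h. k \<otimes> h) ` carrier G = carrier G"
  by (auto simp: image_iff) (metis inv_closed inv_solve_left m_closed)

lemma repD:
  assumes "rep d r"
  shows "h \<in> carrier G \<Longrightarrow> r h \<in> carrier_mat d d" "r \<one> = 1\<^sub>m d"
    "h \<in> carrier G \<Longrightarrow> h' \<in> carrier G \<Longrightarrow> r (h \<otimes> h') = r h * r h'"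
  using assms by (auto simp: rep_def)

lemma rep_dim [simp]:
  "rep d r \<Longrightarrow> h \<in> carrier G \<Longrightarrow> dim_row (r h) = d" "rep d r \<Longrightarrow> h \<in> carrier G \<Longrightarrow> dim_col (r h) = d"
  using repD(1) by blast+

lemma rep_inv:
  assumes "rep d r" "h \<in> carrier G"
  shows "r h * r (inv h) = 1\<^sub>m d" "r (inv h) * r h = 1\<^sub>m d"
  using repD[OF assms(1)] assms(2) by (metis r_inv inv_closed, metis l_inv inv_closed)

lemma homsD:
  assumes "P \<in> homs d r e s"
  shows "P \<in> carrier_mat e d" "h \<in> carrier G \<Longrightarrow> P * r h = s h * P"
  using assms by (auto simp: homs_def)

lemma homs_one: "rep d r \<Longrightarrow> 1\<^sub>m d \<in> homs d r d r"
  by (auto simp: homs_def)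

lemma homs_mult:
  assumes "P \<in> homs d r e s" "Q \<in> homs e s f t" "rep d r" "rep e s" "rep f t"
  shows "Q * P \<in> homs d r f t"
proof -
  have "Q * P * r h = t h * (Q * P)" if h: "h \<in> carrier G" for h
  proof -
    note c = homsD(1)[OF assms(1)] homsD(1)[OF assms(2)] repD(1)[OF assms(3) h] repD(1)[OF assms(4) h]
      repD(1)[OF assms(5) h]
    have "Q * P * r h = Q * (s h * P)"
      using c homsD(2)[OF assms(1) h] by (simp add: mat_assoc)
    also have "\<dots> = (Q * s h) * P" using c by (simp add: mat_assoc)
    also have "\<dots> = t h * (Q * P)" using c homsD(2)[OF assms(2) h] by (simp add: mat_assoc)
    finally show ?thesis .
  qed
  thus ?thesis using homsD(1)[OF assms(1)] homsD(1)[OF assms(2)] by (auto simp: homs_def)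
qed

lemma homs_smult: "P \<in> homs d r e s \<Longrightarrow> rep d r \<Longrightarrow> rep e s \<Longrightarrow> c \<cdot>\<^sub>m P \<in> homs d r e s"
  using homsD(1)[of P d r e s] by (auto simp: homs_def smult_mat_mult)

lemma homs_diff:
  assumes "P \<in> homs d r e s" "Q \<in> homs d r e s" "rep d r" "rep e s"
  shows "P - Q \<in> homs d r e s"
proof -
  have "(P - Q) * r h = s h * (P - Q)" if "h \<in> carrier G" for h
    using homsD[OF assms(1)] homsD[OF assms(2)] repD(1)[OF assms(3) that] repD(1)[OF assms(4) that] that
    by (simp add: mat_diff_distrib_left mat_diff_distrib_right)
  thus ?thesis using homsD(1)[OF assms(1)] homsD(1)[OF assms(2)] by (auto simp: homs_def)
qed

lemma avg_homs:
  assumes r: "rep d r" and s: "rep e s" and X: "X \<in> carrier_mat e d"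
  shows "avg e d s r X \<in> homs d r e s"
proof -
  let ?f = "\<lambda>h. s h * X * r (inv h)"
  have "msum e d ?f (carrier G) * r k = s k * msum e d ?f (carrier G)" if k: "k \<in> carrier G" for k
  proof -
    have fc: "?f h \<in> carrier_mat e d" if "h \<in> carrier G" for h
      using that by (intro carrier_matI) (simp_all add: rep_dim[OF r] rep_dim[OF s])
    have "msum e d ?f (carrier G) * r k = msum e d (\<lambda>h. ?f h * r k) (carrier G)"
      by (rule msum_mult) (use repD(1)[OF r k] fc in auto)
    also have "\<dots> = msum e d (\<lambda>h. ?f h * r k) ((\<lambda>h. k \<otimes> h) ` carrier G)"
      by (rule msum_cong[OF translate[OF k, symmetric] refl])
    also have "\<dots> = msum e d (\<lambda>h. ?f (k \<otimes> h) * r k) (carrier G)"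
      using k by (intro msum_reindex) (auto simp: inj_on_def)
    also have "\<dots> = msum e d (\<lambda>h. s k * ?f h) (carrier G)"
    proof (rule msum_cong[OF refl])
      fix h assume h: "h \<in> carrier G"
      have "r (inv (k \<otimes> h)) * r k = r (inv h)"
        using h k repD(3)[OF r, of "inv (k \<otimes> h)" k] by (simp add: inv_mult_group m_assoc)
      thus "?f (k \<otimes> h) * r k = s k * ?f h"
        using h k X repD(1)[OF r] repD(1)[OF s]
        by (simp add: repD(3)[OF s] mat_assoc rep_dim[OF r] rep_dim[OF s])
    qed
    also have "\<dots> = s k * msum e d ?f (carrier G)"
      by (rule mult_msum[symmetric]) (use repD(1)[OF s k] fc in auto)
    finally show ?thesis .
  qed
  hence "msum e d ?f (carrier G) \<in> homs d r e s" by (auto simp: homs_def)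
  thus ?thesis unfolding avg_def by (rule homs_smult) (use r s in auto)
qed

lemma msum_const:
  assumes "M \<in> carrier_mat e d"
  shows "inverse (of_nat (card (carrier G))) \<cdot>\<^sub>m msum e d (\<lambda>h. M) (carrier G) = (M :: 'k::field_char_0 mat)"
  using assms card_ne_0[where 'k = 'k] by (intro eq_matI) (simp_all add: mult.assoc[symmetric])

text \<open>Maschke's theorem in the form used here: a linear pseudo inverse is averaged over G.
  Equivariance of f gives \<open>f * (r h * Z * s (inv h)) * f = f\<close> for each h, so the mean
  is again a pseudo inverse.\<close>

lemma homs_pseudo_inverse:
  fixes r :: "'a \<Rightarrow> 'k::field_char_0 mat"
  assumes f: "f \<in> homs d r e s" and r: "rep d r" and s: "rep e s"
  shows "\<exists>Z\<in>homs e s d r. f * Z * f = f"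
proof -
  note fc = homsD(1)[OF f]
  obtain Z where Z: "Z \<in> carrier_mat d e" "f * Z * f = f" using pseudo_inverse[OF fc] by blast
  let ?f = "\<lambda>h. r h * Z * s (inv h)"
  have c: "?f h \<in> carrier_mat d e" if "h \<in> carrier G" for h
    using repD(1)[OF r that] repD(1)[OF s, of "inv h"] that Z by auto
  have "f * msum d e ?f (carrier G) * f = msum e e (\<lambda>h. f * ?f h) (carrier G) * f"
    by (subst mult_msum[OF fc]) (use c in auto)
  also have "\<dots> = msum e d (\<lambda>h. f * ?f h * f) (carrier G)"
    by (rule msum_mult) (use c fc in auto)
  also have "\<dots> = msum e d (\<lambda>h. f) (carrier G)"
  proof (rule msum_cong[OF refl])
    fix h assume h: "h \<in> carrier G"
    have 1: "s (inv h) * f = f * r (inv h)" using homsD(2)[OF f, of "inv h"] h by simp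
    have "f * ?f h * f = (f * r h) * Z * (s (inv h) * f)"
      using h Z fc by (simp add: mat_assoc rep_dim[OF r] rep_dim[OF s])
    also have "\<dots> = s h * (f * Z * f) * r (inv h)"
      unfolding 1 homsD(2)[OF f h] using h Z(1) fc by (simp add: mat_assoc rep_dim[OF r] rep_dim[OF s])
    also have "\<dots> = f * (r h * r (inv h))"
      unfolding Z(2) homsD(2)[OF f h, symmetric] using h fc by (simp add: mat_assoc rep_dim[OF r] rep_dim[OF s])
    also have "\<dots> = f" using fc by (simp add: rep_inv[OF r h])
    finally show "f * ?f h * f = f" .
  qed
  finally have "f * msum d e ?f (carrier G) * f = msum e d (\<lambda>h. f) (carrier G)" .
  hence "f * avg d e r s Z * f = inverse (of_nat (card (carrier G))) \<cdot>\<^sub>m msum e d (\<lambda>h. f) (carrier G)"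
    using fc by (simp add: avg_def smult_mat_mult)
  hence "f * avg d e r s Z * f = f" by (simp add: msum_const[OF fc])
  thus ?thesis using avg_homs[OF s r Z(1)] by blast
qed

text \<open>For an equivariant pseudo inverse Q of P, both P Q and Q P are scalars by
  irreducibility, and each scalar fixes the nonzero matrix P, so it is 1.\<close>

lemma schur:
  fixes r :: "'a \<Rightarrow> 'k::field_char_0 mat"
  assumes r: "irr d r" and s: "irr e s" and P: "P \<in> homs d r e s" "P \<noteq> 0\<^sub>m e d"
  shows "\<exists>Q\<in>homs e s d r. P * Q = 1\<^sub>m e \<and> Q * P = 1\<^sub>m d"
proof -
  have rr: "rep d r" and ss: "rep e s" using r s by (auto simp: irr_def)
  obtain Q where Q: "Q \<in> homs e s d r" "P * Q * P = P" using homs_pseudo_inverse[OF P(1) rr ss] by blast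
  note c = homsD(1)[OF P(1)] homsD(1)[OF Q(1)]
  obtain a where a: "P * Q = a \<cdot>\<^sub>m 1\<^sub>m e" using homs_mult[OF Q(1) P(1)] rr ss s by (auto simp: irr_def)
  obtain b where b: "Q * P = b \<cdot>\<^sub>m 1\<^sub>m d" using homs_mult[OF P(1) Q(1)] rr ss r by (auto simp: irr_def)
  have cancel: "x = 1" if "x \<cdot>\<^sub>m P = P" for x
  proof -
    obtain i j where ij: "i < e" "j < d" "P $$ (i, j) \<noteq> 0"
      using P(2) c by (metis carrier_matD(1) carrier_matD(2) eq_matI index_zero_mat(1) index_zero_mat(2) index_zero_mat(3))
    have "x * P $$ (i, j) = P $$ (i, j)" using arg_cong[OF that, of "\<lambda>M. M $$ (i, j)"] ij c by simp
    thus ?thesis using ij by simp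
  qed
  have "a \<cdot>\<^sub>m P = P" using Q(2) a c by (simp add: smult_mat_mult)
  moreover have "b \<cdot>\<^sub>m P = P"
  proof -
    have "P * (Q * P) = P" using Q(2) c by (simp add: mat_assoc)
    thus ?thesis unfolding b using c by (simp add: smult_mat_mult)
  qed
  ultimately have "a = 1" "b = 1" using cancel by blast+
  thus ?thesis using a b Q(1) by auto
qed

text \<open>A B is an equivariant idempotent; A and B identify its image with K^k, to which the
  representation is transported.\<close>

lemma sub_rep:
  assumes r: "rep d r" and A: "A \<in> carrier_mat d k" "B \<in> carrier_mat k d" "B * A = 1\<^sub>m k"
    and e: "A * B \<in> homs d r d r"
  shows "rep k (\<lambda>h. B * r h * A)" "A \<in> homs k (\<lambda>h. B * r h * A) d r" "B \<in> homs d r k (\<lambda>h. B * r h * A)"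
proof -
  have 1: "A * (B * r h * A) = r h * A" if h: "h \<in> carrier G" for h
  proof -
    have "A * (B * r h * A) = (A * B * r h) * A" using A h r by (simp add: mat_assoc)
    also have "\<dots> = r h * A * (B * A)" unfolding homsD(2)[OF e h] using A(1,2) h r by (simp add: mat_assoc)
    also have "\<dots> = r h * A" unfolding A(3) using A(1) h r by simp
    finally show ?thesis .
  qed
  have 2: "B * r h * A * B = B * r h" if h: "h \<in> carrier G" for h
  proof -
    have "B * r h * A * B = B * (r h * (A * B))" using A h r by (simp add: mat_assoc)
    also have "\<dots> = (B * A) * (B * r h)" unfolding homsD(2)[OF e h, symmetric] using A(1,2) h r by (simp add: mat_assoc)
    also have "\<dots> = B * r h" unfolding A(3) using A(2) h r by simp
    finally show ?thesis .
  qed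
  show "A \<in> homs k (\<lambda>h. B * r h * A) d r" using 1 A by (auto simp: homs_def)
  show "B \<in> homs d r k (\<lambda>h. B * r h * A)" using 2 A by (auto simp: homs_def)
  show "rep k (\<lambda>h. B * r h * A)"
    unfolding rep_def
  proof (intro conjI ballI)
    fix h assume h: "h \<in> carrier G"
    thus "B * r h * A \<in> carrier_mat k k" using A repD(1)[OF r h] by auto
    fix h' assume h': "h' \<in> carrier G"
    have "B * r h * A * (B * r h' * A) = (B * r h * A * B) * (r h' * A)"
      using A h h' r by (simp add: mat_assoc)
    also have "\<dots> = B * r (h \<otimes> h') * A"
      unfolding 2[OF h] using A h h' r by (simp add: mat_assoc repD(3)[OF r])
    finally show "B * r (h \<otimes> h') * A = B * r h * A * (B * r h' * A)" by simp
  qed (use A in \<open>simp add: repD(2)[OF r]\<close>)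
qed

lemma exists_irr_summand:
  fixes r :: "'a \<Rightarrow> 'k::{alg_closed_field, field_char_0} mat"
  assumes "rep d r" "d > 0"
  shows "\<exists>k t A B. irr k t \<and> A \<in> homs k t d r \<and> B \<in> homs d r k t \<and> B * A = 1\<^sub>m k"
  using assms
proof (induction d arbitrary: r rule: less_induct)
  case (less d r)
  note r = less.prems(1)
  show ?case
  proof (cases "irr d r")
    case True
    thus ?thesis using homs_one[OF r] by (intro exI[of _ d] exI[of _ r] exI[of _ "1\<^sub>m d"]) auto
  next
    case False
    then obtain P where P: "P \<in> homs d r d r" "\<And>c. P \<noteq> c \<cdot>\<^sub>m 1\<^sub>m d"
      using less.prems by (auto simp: irr_def)
    note Pc = homsD(1)[OF P(1)]
    obtain c v where v: "v \<in> carrier_vec d" "v \<noteq> 0\<^sub>v d" "P *\<^sub>v v = c \<cdot>\<^sub>v v"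
      using exists_eigenvector[OF Pc less.prems(2)] by blast
    \<comment> \<open>Subtracting an eigenvalue from a non-scalar endomorphism gives a nonzero
      singular one. With an equivariant pseudo inverse Z the product Z Q is an idempotent whose rank
      lies strictly between 0 and d, so induction applies to its image.\<close>
    define Q where "Q = P - c \<cdot>\<^sub>m 1\<^sub>m d"
    have Q: "Q \<in> homs d r d r" unfolding Q_def
      by (intro homs_diff homs_smult homs_one P(1) r)
    note Qc = homsD(1)[OF Q]
    have "Q *\<^sub>v v = P *\<^sub>v v - c \<cdot>\<^sub>m 1\<^sub>m d *\<^sub>v v" unfolding Q_def
      by (rule minus_mult_distrib_mat_vec) (use Pc v in auto)
    also have "c \<cdot>\<^sub>m 1\<^sub>m d *\<^sub>v v = c \<cdot>\<^sub>v v" using v(1) by (auto intro!: eq_vecI)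
    finally have Qv: "Q *\<^sub>v v = 0\<^sub>v d" using v by auto
    have Q0: "Q \<noteq> 0\<^sub>m d d"
    proof
      assume "Q = 0\<^sub>m d d"
      hence "P = c \<cdot>\<^sub>m 1\<^sub>m d" using Pc by (auto simp: Q_def mat_eq_iff)
      thus False using P(2) by blast
    qed
    obtain Z where Z: "Z \<in> homs d r d r" "Q * Z * Q = Q" using homs_pseudo_inverse[OF Q r r] by blast
    note Zc = homsD(1)[OF Z(1)]
    have e: "Z * Q \<in> homs d r d r" by (rule homs_mult[OF Q Z(1) r r r])
    have "Z * Q * (Z * Q) = Z * (Q * Z * Q)" using Qc Zc by (simp add: mat_assoc)
    hence "Z * Q * (Z * Q) = Z * Q" by (simp add: Z(2))
    from idempotent_split[OF homsD(1)[OF e] this] obtain k A B where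
      A: "A \<in> carrier_mat d k" "B \<in> carrier_mat k d" "Z * Q = A * B" "B * A = 1\<^sub>m k" by blast
    have kd: "k < d"
    proof (rule ccontr)
      assume "\<not> k < d"
      hence kd: "k = d" using left_inverse_dim_le[OF A(1,2,4)] by simp
      hence "A * B = 1\<^sub>m d" using mat_mult_left_right_inverse[of B d A] A by simp
      hence "v = A * B *\<^sub>v v" using v by simp
      also have "\<dots> = Z *\<^sub>v (Q *\<^sub>v v)" unfolding A(3)[symmetric] using Qc Zc v by (simp add: mat_mult_vec_assoc)
      also have "\<dots> = 0\<^sub>v d" using Qv Zc by (auto intro!: eq_vecI)
      finally show False using v by simp
    qed
    have k0: "k > 0"
    proof (rule ccontr)
      assume "\<not> k > 0"
      hence "A * B = 0\<^sub>m d d" using A(1,2) by (auto simp: scalar_prod_def)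
      hence "Q * (Z * Q) = 0\<^sub>m d d" using A(3) Qc by simp
      thus False using Z(2) Q0 Qc Zc by (simp add: mat_assoc)
    qed
    note sub = sub_rep[OF r A(1,2,4) e[unfolded A(3)]]
    obtain l t A' B' where L: "irr l t" "A' \<in> homs l t k (\<lambda>h. B * r h * A)" "B' \<in> homs k (\<lambda>h. B * r h * A) l t"
      "B' * A' = 1\<^sub>m l" using less.IH[OF kd sub(1) k0] by blast
    have t: "rep l t" using L(1) by (simp add: irr_def)
    note c = homsD(1)[OF L(2)] homsD(1)[OF L(3)]
    have "B' * B * (A * A') = B' * ((B * A) * A')" using c A(1,2) by (simp add: mat_assoc)
    also have "\<dots> = 1\<^sub>m l" using A(4) L(4) c by simp
    finally show ?thesis using L(1) homs_mult[OF L(2) sub(2) t sub(1) r] homs_mult[OF sub(3) L(3) r sub(1) t] by blast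
  qed
qed

text \<open>Used for the last nonvanishing power of y on a module: on the constituent found here f
  is split injective, so that constituent can start a string of maximal length.\<close>

lemma nonzero_hom_irr:
  fixes r :: "'a \<Rightarrow> 'k::{alg_closed_field, field_char_0} mat"
  assumes f: "f \<in> homs d r e s" "f \<noteq> 0\<^sub>m e d" and r: "rep d r" and s: "rep e s"
  shows "\<exists>k t A B. irr k t \<and> A \<in> homs k t d r \<and> B \<in> homs e s k t \<and> B * f * A = 1\<^sub>m k"
proof -
  note fc = homsD(1)[OF f(1)]
  obtain Z where Z: "Z \<in> homs e s d r" "f * Z * f = f" using homs_pseudo_inverse[OF f(1) r s] by blast
  note Zc = homsD(1)[OF Z(1)]
  have e: "Z * f \<in> homs d r d r" by (rule homs_mult[OF f(1) Z(1) r s r])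
  have "Z * f * (Z * f) = Z * (f * Z * f)" using fc Zc by (simp add: mat_assoc)
  hence "Z * f * (Z * f) = Z * f" by (simp add: Z(2))
  from idempotent_split[OF homsD(1)[OF e] this] obtain k A B where
    A: "A \<in> carrier_mat d k" "B \<in> carrier_mat k d" "Z * f = A * B" "B * A = 1\<^sub>m k" by blast
  have k0: "k > 0"
  proof (rule ccontr)
    assume "\<not> k > 0"
    hence "A * B = 0\<^sub>m d d" using A(1,2) by (auto simp: scalar_prod_def)
    hence "f * (Z * f) = 0\<^sub>m e d" using A(3) fc by simp
    thus False using Z(2) f(2) fc Zc by (simp add: mat_assoc)
  qed
  note sub = sub_rep[OF r A(1,2,4) e[unfolded A(3)]]
  obtain l t A' B' where L: "irr l t" "A' \<in> homs l t k (\<lambda>h. B * r h * A)" "B' \<in> homs k (\<lambda>h. B * r h * A) l t"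
    "B' * A' = 1\<^sub>m l" using exists_irr_summand[OF sub(1) k0] by blast
  have t: "rep l t" using L(1) by (simp add: irr_def)
  note c = homsD(1)[OF L(2)] homsD(1)[OF L(3)]
  have "B' * (B * Z) * f * (A * A') = B' * (B * ((Z * f) * (A * A')))" using c A(1,2) fc Zc by (simp add: mat_assoc)
  also have "\<dots> = B' * ((B * A) * ((B * A) * A'))" unfolding A(3) using c A(1,2) by (simp add: mat_assoc)
  also have "\<dots> = 1\<^sub>m l" using A(4) L(4) c by simp
  finally have "B' * (B * Z) * f * (A * A') = 1\<^sub>m l" .
  moreover have "A * A' \<in> homs l t d r" by (rule homs_mult[OF L(2) sub(2) t sub(1) r])
  moreover have "B' * (B * Z) \<in> homs e s l t"
    by (rule homs_mult[OF homs_mult[OF Z(1) sub(3)] L(3)]) (use r s t sub in auto)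
  ultimately show ?thesis using L(1) by blast
qed

subsection \<open>Characters\<close>

text \<open>The second function is evaluated at the inverse, which replaces complex conjugation over
  a general field; the pairing is bilinear.\<close>

definition cip :: "('a \<Rightarrow> 'k::field) \<Rightarrow> ('a \<Rightarrow> 'k) \<Rightarrow> 'k" where
  "cip \<phi> \<psi> = inverse (of_nat (card (carrier G))) * (\<Sum>h\<in>carrier G. \<phi> h * \<psi> (inv h))"

definition iso_rep :: "nat \<Rightarrow> ('a \<Rightarrow> 'k::field mat) \<Rightarrow> nat \<Rightarrow> ('a \<Rightarrow> 'k mat) \<Rightarrow> bool" where
  "iso_rep d r e s \<longleftrightarrow> (\<exists>P\<in>homs d r e s. \<exists>Q\<in>carrier_mat d e. P * Q = 1\<^sub>m e \<and> Q * P = 1\<^sub>m d)"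

lemma iso_rep_trace:
  assumes "iso_rep d r e s" "rep d r" "rep e s" "h \<in> carrier G"
  shows "mtrace (r h) = mtrace (s h)"
proof -
  obtain P Q where P: "P \<in> homs d r e s" "Q \<in> carrier_mat d e" "P * Q = 1\<^sub>m e" "Q * P = 1\<^sub>m d"
    using assms(1) by (auto simp: iso_rep_def)
  note c = homsD(1)[OF P(1)] repD(1)[OF assms(2,4)] repD(1)[OF assms(3,4)]
  have "mtrace (s h) = mtrace (s h * (P * Q))" using P(3) c by simp
  also have "\<dots> = mtrace (s h * P * Q)" using c P(2) by (simp add: mat_assoc)
  also have "\<dots> = mtrace (P * r h * Q)" using homsD(2)[OF P(1) assms(4)] by simp
  also have "\<dots> = mtrace (P * (r h * Q))" using c P(2) by (simp add: mat_assoc)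
  also have "\<dots> = mtrace (r h * Q * P)" by (rule mtrace_comm) (use c P(2) in auto)
  also have "\<dots> = mtrace (r h)" using c P(2,4) by (simp add: mat_assoc)
  finally show ?thesis by simp
qed

lemma sum_mtrace_mult:
  assumes "rep e s" "rep d r"
  shows "(\<Sum>h\<in>carrier G. mtrace (s h) * mtrace (r (inv h))) =
    (\<Sum>i<e. \<Sum>j<d. \<Sum>h\<in>carrier G. s h $$ (i, i) * r (inv h) $$ (j, j))"
proof -
  have "(\<Sum>h\<in>carrier G. mtrace (s h) * mtrace (r (inv h))) =
     (\<Sum>h\<in>carrier G. \<Sum>i<e. \<Sum>j<d. s h $$ (i, i) * r (inv h) $$ (j, j))"
    using assms by (intro sum.cong refl) (simp add: mtrace_def sum_product)
  also have "\<dots> = (\<Sum>i<e. \<Sum>h\<in>carrier G. \<Sum>j<d. s h $$ (i, i) * r (inv h) $$ (j, j))" by (rule sum.swap)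
  also have "\<dots> = (\<Sum>i<e. \<Sum>j<d. \<Sum>h\<in>carrier G. s h $$ (i, i) * r (inv h) $$ (j, j))"
    by (intro sum.cong refl sum.swap)
  finally show ?thesis .
qed

text \<open>Averages of matrix units have as entries the sums of products of matrix coefficients
  that make up the pairing of two characters; Schur's lemma evaluates them.\<close>

lemma avg_unit_index:
  assumes s: "rep e s" and r: "rep d r" and i: "i < e" and j: "j < d"
  shows "avg e d s r (mat e d (\<lambda>(a, b). if a = i \<and> b = j then 1 else 0)) $$ (i, j) =
    inverse (of_nat (card (carrier G))) * (\<Sum>h\<in>carrier G. s h $$ (i, i) * r (inv h) $$ (j, j))"
proof -
  let ?X = "mat e d (\<lambda>(a, b). if a = i \<and> b = j then 1 else 0)"
  have "(s h * ?X * r (inv h)) $$ (i, j) = s h $$ (i, i) * r (inv h) $$ (j, j)" if h: "h \<in> carrier G" for h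
  proof -
    have 1: "(s h * ?X) $$ (i, b) = (if b = j then s h $$ (i, i) else 0)" if "b < d" for b
    proof -
      have "(s h * ?X) $$ (i, b) = (\<Sum>a<e. s h $$ (i, a) * ?X $$ (a, b))"
        by (rule mult_index_sum) (use that i repD(1)[OF s h] in auto)
      also have "\<dots> = (\<Sum>a<e. if a = i then (if b = j then s h $$ (i, i) else 0) else 0)"
        using that by (intro sum.cong) auto
      finally show ?thesis using i by simp
    qed
    have "(s h * ?X * r (inv h)) $$ (i, j) = (\<Sum>b<d. (s h * ?X) $$ (i, b) * r (inv h) $$ (b, j))"
      using i j h s r by (auto simp: scalar_prod_def atLeast0LessThan intro!: sum.cong)
    also have "\<dots> = (\<Sum>b<d. if b = j then s h $$ (i, i) * r (inv h) $$ (j, j) else 0)"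
      by (intro sum.cong refl) (use 1 in auto)
    finally show ?thesis using j by simp
  qed
  thus ?thesis using i j by (simp add: avg_def)
qed

text \<open>Every averaged matrix unit is an equivariant map between non-isomorphic irreducibles,
  hence zero, and the pairing of the characters is a sum of entries of such maps.\<close>

lemma irr_orthogonal:
  fixes r :: "'a \<Rightarrow> 'k::{alg_closed_field, field_char_0} mat"
  assumes r: "irr d r" and s: "irr e s" and niso: "\<not> iso_rep d r e s"
  shows "cip (\<lambda>h. mtrace (s h)) (\<lambda>h. mtrace (r h)) = 0"
proof -
  have rr: "rep d r" and ss: "rep e s" using r s by (auto simp: irr_def)
  have "(\<Sum>h\<in>carrier G. s h $$ (i, i) * r (inv h) $$ (j, j)) = 0"
    if ij: "i < e" "j < d" for i j
  proof -
    let ?X = "mat e d (\<lambda>(a, b). if a = i \<and> b = j then 1 else 0) :: 'k mat"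
    have "avg e d s r ?X \<in> homs d r e s" by (rule avg_homs[OF rr ss]) simp
    hence "avg e d s r ?X = 0\<^sub>m e d"
      using schur[OF r s] niso by (auto simp: iso_rep_def) (metis homsD(1))
    hence "inverse (of_nat (card (carrier G))) * (\<Sum>h\<in>carrier G. s h $$ (i, i) * r (inv h) $$ (j, j)) = 0"
      using avg_unit_index[OF ss rr ij] ij by simp
    thus ?thesis using card_ne_0[where 'k = 'k] by (simp only: mult_eq_0_iff inverse_zero_imp_zero inverse_nonzero_iff_nonzero) simp
  qed
  thus ?thesis unfolding cip_def sum_mtrace_mult[OF ss rr] by simp
qed

text \<open>The average of the matrix unit at (i, j) is a scalar c, and comparing traces gives c d =
  1 for i = j and c d = 0 otherwise. Summing the resulting entries 1/d over the d diagonal positions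
  gives 1.\<close>

lemma irr_self:
  fixes r :: "'a \<Rightarrow> 'k::{alg_closed_field, field_char_0} mat"
  assumes r: "irr d r"
  shows "cip (\<lambda>h. mtrace (r h)) (\<lambda>h. mtrace (r h)) = 1"
proof -
  have rr: "rep d r" and d0: "d > 0" using r by (auto simp: irr_def)
  have "inverse (of_nat (card (carrier G))) * (\<Sum>h\<in>carrier G. r h $$ (i, i) * r (inv h) $$ (j, j)) =
     (if i = j then 1 / of_nat d else 0)" if ij: "i < d" "j < d" for i j
  proof -
    let ?X = "mat d d (\<lambda>(a, b). if a = i \<and> b = j then 1 else 0) :: 'k mat"
    have "avg d d r r ?X \<in> homs d r d r" by (rule avg_homs[OF rr rr]) simp
    then obtain c where c: "avg d d r r ?X = c \<cdot>\<^sub>m 1\<^sub>m d" using r by (auto simp: irr_def)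
    have "mtrace (avg d d r r ?X) = inverse (of_nat (card (carrier G))) * (\<Sum>h\<in>carrier G. mtrace (r h * ?X * r (inv h)))"
      unfolding avg_def
      by (subst mtrace_smult[of _ d]) (auto intro!: mtrace_msum carrier_matI simp: rep_dim[OF rr])
    also have "(\<Sum>h\<in>carrier G. mtrace (r h * ?X * r (inv h))) = (\<Sum>h\<in>carrier G. mtrace ?X)"
    proof (rule sum.cong[OF refl])
      fix h assume h: "h \<in> carrier G"
      have "mtrace (r h * ?X * r (inv h)) = mtrace (r (inv h) * (r h * ?X))"
        by (rule mtrace_comm) (use h repD(1)[OF rr] in \<open>auto intro!: carrier_matI simp: rep_dim[OF rr]\<close>)
      also have "r (inv h) * (r h * ?X) = (r (inv h) * r h) * ?X" using h rr by (simp add: mat_assoc)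
      finally show "mtrace (r h * ?X * r (inv h)) = mtrace ?X" using rep_inv[OF rr h] by simp
    qed
    also have "mtrace ?X = (if i = j then 1 else 0)"
    proof -
      have "mtrace ?X = (\<Sum>a<d. if a = i then (if i = j then 1 else 0) else 0)"
        by (auto simp: mtrace_def intro!: sum.cong)
      thus ?thesis using ij by simp
    qed
    finally have "mtrace (avg d d r r ?X) = (if i = j then 1 else 0)"
      using card_ne_0[where 'k = 'k] by auto
    moreover have "mtrace (avg d d r r ?X) = c * of_nat d" unfolding c by (subst mtrace_smult[of _ d]) auto
    ultimately have "c = (if i = j then 1 / of_nat d else 0)" using d0 by (auto simp: field_simps)
    thus ?thesis using avg_unit_index[OF rr rr ij] c ij by auto
  qed
  hence "cip (\<lambda>h. mtrace (r h)) (\<lambda>h. mtrace (r h)) = (\<Sum>i<d. \<Sum>j<d. if i = j then 1 / of_nat d else 0)"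
    unfolding cip_def sum_mtrace_mult[OF rr rr] unfolding sum_distrib_left[of "inverse _"] by (intro sum.cong refl) (auto simp: sum_distrib_left)
  also have "\<dots> = 1" using d0 by simp
  finally show ?thesis .
qed

end

section \<open>Monoid algebras and quotients\<close>

lemma pm_eq_sum_single: "p = (\<Sum>a\<in>Poly_Mapping.keys p. Poly_Mapping.single a (Poly_Mapping.lookup p a))"
proof (rule poly_mapping_eqI)
  fix k
  show "Poly_Mapping.lookup p k = Poly_Mapping.lookup (\<Sum>a\<in>Poly_Mapping.keys p. Poly_Mapping.single a (Poly_Mapping.lookup p a)) k"
    by (simp add: lookup_sum lookup_single when_def in_keys_iff)
qed

lemma pm_induct [consumes 1, case_names zero add]:
  fixes p :: "'a \<Rightarrow>\<^sub>0 'b::comm_monoid_add"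
  assumes "Poly_Mapping.keys p \<subseteq> S" "P 0"
    and step: "\<And>a x q. a \<in> S \<Longrightarrow> Poly_Mapping.keys q \<subseteq> S \<Longrightarrow> P q \<Longrightarrow> P (Poly_Mapping.single a x + q)"
  shows "P p"
proof -
  have "P (\<Sum>a\<in>A. Poly_Mapping.single a (f a)) \<and> Poly_Mapping.keys (\<Sum>a\<in>A. Poly_Mapping.single a (f a)) \<subseteq> S"
    if "finite A" "A \<subseteq> S" for A and f :: "'a \<Rightarrow> 'b"
    using that
  proof (induction A rule: finite_induct)
    case (insert a A)
    have "Poly_Mapping.keys (Poly_Mapping.single a (f a) + (\<Sum>a\<in>A. Poly_Mapping.single a (f a))) \<subseteq> S"
      using insert keys_add[of "Poly_Mapping.single a (f a)" "\<Sum>a\<in>A. Poly_Mapping.single a (f a)"]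
      by (force split: if_splits)
    thus ?case using insert by (auto intro: step)
  qed (use assms in auto)
  from this[of "Poly_Mapping.keys p" "Poly_Mapping.lookup p"] assms(1) show ?thesis
    using pm_eq_sum_single[of p] by simp
qed

lemma keys_uminus: "Poly_Mapping.keys (- p :: 'a \<Rightarrow>\<^sub>0 'b::ab_group_add) = Poly_Mapping.keys p"
  by (auto simp: in_keys_iff)

lemma keys_add_subset:
  "Poly_Mapping.keys p \<subseteq> S \<Longrightarrow> Poly_Mapping.keys q \<subseteq> S \<Longrightarrow> Poly_Mapping.keys (p + q) \<subseteq> S"
  using keys_add[of p q] by blast

lemma keys_diff_subset:
  fixes p q :: "'a \<Rightarrow>\<^sub>0 'b::ab_group_add"
  shows "Poly_Mapping.keys p \<subseteq> S \<Longrightarrow> Poly_Mapping.keys q \<subseteq> S \<Longrightarrow> Poly_Mapping.keys (p - q) \<subseteq> S"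
  using keys_add_subset[of p S "- q"] by (simp add: keys_uminus)

lemma keys_sum_subset:
  "(\<And>i. i \<in> I \<Longrightarrow> Poly_Mapping.keys (f i) \<subseteq> S) \<Longrightarrow> Poly_Mapping.keys (\<Sum>i\<in>I. f i) \<subseteq> S"
  by (induction I rule: infinite_finite_induct) (simp_all add: keys_add_subset)

lemma lookup_map_mult: "Poly_Mapping.lookup (Poly_Mapping.map ((*) c) p) k = (c :: 'a::mult_zero) * Poly_Mapping.lookup p k"
  by (simp add: Poly_Mapping.map.rep_eq when_def)

lemma monoid_algebra_simps:
  "carrier (monoid_algebra M) = {p. Poly_Mapping.keys p \<subseteq> carrier M}"
  "zero (monoid_algebra M) = 0" "add (monoid_algebra M) = (+)"
  "one (monoid_algebra M) = Poly_Mapping.single \<one>\<^bsub>M\<^esub> 1"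
  by (simp_all add: monoid_algebra_def)

text \<open>The extra type argument fixes the coefficient ring. The same locale serves for the group
  algebra, for the free algebra and, with integer coefficients, for the Green ring and the
  complexification.\<close>

locale monoid_alg = monoid M for M :: "('m, 'z) monoid_scheme" (structure) +
  fixes k_type :: "'k::comm_ring_1 itself"
begin

abbreviation MA :: "('k, 'm \<Rightarrow>\<^sub>0 'k) module" where "MA \<equiv> monoid_algebra M"
abbreviation sg :: "'m \<Rightarrow> 'k \<Rightarrow> 'm \<Rightarrow>\<^sub>0 'k" where "sg \<equiv> Poly_Mapping.single"

lemma mult_eq_sum:
  assumes "finite A" "finite B" "Poly_Mapping.keys p \<subseteq> A" "Poly_Mapping.keys q \<subseteq> B"
  shows "p \<otimes>\<^bsub>MA\<^esub> q = (\<Sum>a\<in>A. \<Sum>b\<in>B. sg (a \<otimes> b) (Poly_Mapping.lookup p a * Poly_Mapping.lookup q b))"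
proof -
  have "p \<otimes>\<^bsub>MA\<^esub> q = (\<Sum>a\<in>Poly_Mapping.keys p. \<Sum>b\<in>B. sg (a \<otimes> b) (Poly_Mapping.lookup p a * Poly_Mapping.lookup q b))"
    unfolding monoid_algebra_def using assms
    by simp (rule sum.cong[OF refl], rule sum.mono_neutral_left, auto simp: in_keys_iff)
  also have "\<dots> = (\<Sum>a\<in>A. \<Sum>b\<in>B. sg (a \<otimes> b) (Poly_Mapping.lookup p a * Poly_Mapping.lookup q b))"
    using assms by (auto intro!: sum.mono_neutral_left simp: in_keys_iff)
  finally show ?thesis .
qed

lemma mult_sg: "sg a x \<otimes>\<^bsub>MA\<^esub> sg b y = sg (a \<otimes> b) (x * y)"
  by (subst mult_eq_sum[of "{a}" "{b}"]) auto

lemma mult_add_left: "(p + q) \<otimes>\<^bsub>MA\<^esub> r = p \<otimes>\<^bsub>MA\<^esub> r + q \<otimes>\<^bsub>MA\<^esub> r"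
proof -
  let ?A = "Poly_Mapping.keys p \<union> Poly_Mapping.keys q" and ?B = "Poly_Mapping.keys r"
  have "Poly_Mapping.keys (p + q) \<subseteq> ?A" by (rule keys_add)
  thus ?thesis
    using mult_eq_sum[of ?A ?B "p + q" r] mult_eq_sum[of ?A ?B p r] mult_eq_sum[of ?A ?B q r]
    by (simp add: lookup_add distrib_right single_add sum.distrib)
qed

lemma mult_add_right: "r \<otimes>\<^bsub>MA\<^esub> (p + q) = r \<otimes>\<^bsub>MA\<^esub> p + r \<otimes>\<^bsub>MA\<^esub> q"
proof -
  let ?A = "Poly_Mapping.keys p \<union> Poly_Mapping.keys q" and ?B = "Poly_Mapping.keys r"
  have "Poly_Mapping.keys (p + q) \<subseteq> ?A" by (rule keys_add)
  thus ?thesis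
    using mult_eq_sum[of ?B ?A r "p + q"] mult_eq_sum[of ?B ?A r p] mult_eq_sum[of ?B ?A r q]
    by (simp add: lookup_add distrib_left single_add sum.distrib)
qed

lemma mult_zero: "0 \<otimes>\<^bsub>MA\<^esub> r = 0" "r \<otimes>\<^bsub>MA\<^esub> 0 = 0"
  by (simp_all add: monoid_algebra_def)

lemma mult_closed:
  assumes "Poly_Mapping.keys p \<subseteq> carrier M" "Poly_Mapping.keys q \<subseteq> carrier M"
  shows "Poly_Mapping.keys (p \<otimes>\<^bsub>MA\<^esub> q) \<subseteq> carrier M"
proof -
  have "Poly_Mapping.keys (sg (a \<otimes> b) x) \<subseteq> carrier M" if "a \<in> Poly_Mapping.keys p" "b \<in> Poly_Mapping.keys q" for a b x
    using that assms by auto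
  thus ?thesis unfolding monoid_algebra_def by (auto intro!: keys_sum_subset simp del: keys_single)
qed

lemma MA_assoc:
  assumes "Poly_Mapping.keys p \<subseteq> carrier M" "Poly_Mapping.keys q \<subseteq> carrier M" "Poly_Mapping.keys r \<subseteq> carrier M"
  shows "(p \<otimes>\<^bsub>MA\<^esub> q) \<otimes>\<^bsub>MA\<^esub> r = p \<otimes>\<^bsub>MA\<^esub> (q \<otimes>\<^bsub>MA\<^esub> r)"
  using assms(1)
proof (induction rule: pm_induct)
  case (add a x p)
  have "(sg a x \<otimes>\<^bsub>MA\<^esub> q) \<otimes>\<^bsub>MA\<^esub> r = sg a x \<otimes>\<^bsub>MA\<^esub> (q \<otimes>\<^bsub>MA\<^esub> r)" using assms(2)
  proof (induction rule: pm_induct)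
    case (add b y q)
    have "(sg a x \<otimes>\<^bsub>MA\<^esub> sg b y) \<otimes>\<^bsub>MA\<^esub> r = sg a x \<otimes>\<^bsub>MA\<^esub> (sg b y \<otimes>\<^bsub>MA\<^esub> r)" using assms(3)
      by (induction rule: pm_induct)
        (use add \<open>a \<in> carrier M\<close> in \<open>auto simp: mult_zero mult_add_right mult_sg m_assoc mult.assoc\<close>)
    thus ?case using add by (simp add: mult_add_left mult_add_right)
  qed (simp add: mult_zero)
  thus ?case using add by (simp add: mult_add_left)
qed (simp add: mult_zero)

lemma MA_one:
  assumes "Poly_Mapping.keys p \<subseteq> carrier M"
  shows "sg \<one> 1 \<otimes>\<^bsub>MA\<^esub> p = p" "p \<otimes>\<^bsub>MA\<^esub> sg \<one> 1 = p"
  using assms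
  by (induction rule: pm_induct) (auto simp: mult_zero mult_add_left mult_add_right mult_sg)

text \<open>Scalars act through multiples of the unit element, so compatibility with scalars reduces
  to multiplicativity.\<close>

lemma MA_smult: "c \<odot>\<^bsub>MA\<^esub> p = sg \<one> c \<otimes>\<^bsub>MA\<^esub> p" if "Poly_Mapping.keys p \<subseteq> carrier M"
proof -
  have "Poly_Mapping.map ((*) c) p = sg \<one> c \<otimes>\<^bsub>MA\<^esub> p" using that
  proof (induction rule: pm_induct)
    case (add a x q)
    have "Poly_Mapping.map ((*) c) (sg a x + q) = Poly_Mapping.map ((*) c) (sg a x) + Poly_Mapping.map ((*) c) q"
      by (rule poly_mapping_eqI) (simp add: lookup_map_mult lookup_add distrib_left lookup_single when_def)
    thus ?case using add by (simp add: mult_add_right mult_sg)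
  qed (auto simp: mult_zero lookup_map_mult intro: poly_mapping_eqI)
  thus ?thesis by (simp add: monoid_algebra_def)
qed

sublocale MA: ring MA
proof (rule ringI)
  show "abelian_group MA"
  proof (rule abelian_groupI)
    fix p :: "'m \<Rightarrow>\<^sub>0 'k" assume "p \<in> carrier MA"
    thus "\<exists>q\<in>carrier MA. q \<oplus>\<^bsub>MA\<^esub> p = \<zero>\<^bsub>MA\<^esub>"
      by (intro bexI[of _ "- p"]) (auto simp: monoid_algebra_simps keys_uminus)
  qed (auto simp: monoid_algebra_simps add.assoc add.commute dest: keys_add_subset)
  show "Group.monoid MA"
    by (rule monoidI) (use mult_closed MA_assoc MA_one in \<open>auto simp: monoid_algebra_simps\<close>)
qed (simp_all add: monoid_algebra_simps mult_add_left mult_add_right)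

lemma MA_minus:
  assumes "p \<in> carrier MA" "q \<in> carrier MA"
  shows "\<ominus>\<^bsub>MA\<^esub> p = - p" "q \<ominus>\<^bsub>MA\<^esub> p = q - p"
proof -
  show 1: "\<ominus>\<^bsub>MA\<^esub> p = - p"
    using assms by (intro MA.minus_equality) (auto simp: monoid_algebra_simps keys_uminus)
  show "q \<ominus>\<^bsub>MA\<^esub> p = q - p"
    unfolding a_minus_def 1 by (simp add: monoid_algebra_simps)
qed

lemma sg_closed [simp]: "a \<in> carrier M \<Longrightarrow> sg a x \<in> carrier MA"
  by (auto simp: monoid_algebra_simps)

end

subsection \<open>Modules over monoid algebras\<close>

definition lin_ext :: "nat \<Rightarrow> ('m \<Rightarrow> 'k::comm_ring_1 mat) \<Rightarrow> ('m \<Rightarrow>\<^sub>0 'k) \<Rightarrow> 'k mat" where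
  "lin_ext d \<phi> p = msum d d (\<lambda>a. Poly_Mapping.lookup p a \<cdot>\<^sub>m \<phi> a) (Poly_Mapping.keys p)"

lemma alg_moduleD:
  assumes "alg_module A M"
  shows "x \<in> carrier A \<Longrightarrow> act M x \<in> carrier_mat (mdim M) (mdim M)"
    "x \<in> carrier A \<Longrightarrow> y \<in> carrier A \<Longrightarrow> act M (x \<otimes>\<^bsub>A\<^esub> y) = act M x * act M y"
    "x \<in> carrier A \<Longrightarrow> y \<in> carrier A \<Longrightarrow> act M (x \<oplus>\<^bsub>A\<^esub> y) = act M x + act M y"
    "act M \<one>\<^bsub>A\<^esub> = 1\<^sub>m (mdim M)"
    "x \<in> carrier A \<Longrightarrow> act M (c \<odot>\<^bsub>A\<^esub> x) = c \<cdot>\<^sub>m act M x"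
  using assms by (auto simp: alg_module_def Ring.ring_hom_def ring_mat_simps)

lemma alg_moduleI:
  assumes "\<And>x. x \<in> carrier A \<Longrightarrow> act M x \<in> carrier_mat (mdim M) (mdim M)"
    "\<And>x y. x \<in> carrier A \<Longrightarrow> y \<in> carrier A \<Longrightarrow> act M (x \<otimes>\<^bsub>A\<^esub> y) = act M x * act M y"
    "\<And>x y. x \<in> carrier A \<Longrightarrow> y \<in> carrier A \<Longrightarrow> act M (x \<oplus>\<^bsub>A\<^esub> y) = act M x + act M y"
    "act M \<one>\<^bsub>A\<^esub> = 1\<^sub>m (mdim M)"
    "\<And>c x. x \<in> carrier A \<Longrightarrow> act M (c \<odot>\<^bsub>A\<^esub> x) = c \<cdot>\<^sub>m act M x"
  shows "alg_module A M"
  using assms by (auto simp: alg_module_def Ring.ring_hom_def ring_mat_simps)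

lemma lin_ext_superset:
  assumes "finite A" "Poly_Mapping.keys p \<subseteq> A" "\<And>a. a \<in> A \<Longrightarrow> \<phi> a \<in> carrier_mat d d"
  shows "lin_ext d \<phi> p = msum d d (\<lambda>a. Poly_Mapping.lookup p a \<cdot>\<^sub>m \<phi> a) A"
proof (rule eq_matI)
  fix i j assume "i < dim_row (msum d d (\<lambda>a. Poly_Mapping.lookup p a \<cdot>\<^sub>m \<phi> a) A)"
    "j < dim_col (msum d d (\<lambda>a. Poly_Mapping.lookup p a \<cdot>\<^sub>m \<phi> a) A)"
  hence ij: "i < d" "j < d" by simp_all
  have "(\<Sum>a\<in>Poly_Mapping.keys p. (Poly_Mapping.lookup p a \<cdot>\<^sub>m \<phi> a) $$ (i, j)) =
      (\<Sum>a\<in>A. (Poly_Mapping.lookup p a \<cdot>\<^sub>m \<phi> a) $$ (i, j))"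
  proof (rule sum.mono_neutral_left[OF assms(1,2)], safe)
    fix a assume "a \<in> A" "a \<notin> Poly_Mapping.keys p"
    thus "(Poly_Mapping.lookup p a \<cdot>\<^sub>m \<phi> a) $$ (i, j) = 0"
      using assms(3)[of a] ij by (simp add: in_keys_iff)
  qed
  thus "lin_ext d \<phi> p $$ (i, j) = msum d d (\<lambda>a. Poly_Mapping.lookup p a \<cdot>\<^sub>m \<phi> a) A $$ (i, j)"
    using ij by (simp add: lin_ext_def)
qed (simp_all add: lin_ext_def)

lemma lin_ext_carrier [simp]: "lin_ext d \<phi> p \<in> carrier_mat d d"
  by (simp add: lin_ext_def)

lemma lin_ext_dim [simp]: "dim_row (lin_ext d \<phi> p) = d" "dim_col (lin_ext d \<phi> p) = d"
  by (simp_all add: lin_ext_def)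

lemma lin_ext_single: "\<phi> a \<in> carrier_mat d d \<Longrightarrow> lin_ext d \<phi> (Poly_Mapping.single a x) = x \<cdot>\<^sub>m \<phi> a"
  by (subst lin_ext_superset[of "{a}"]) (auto simp: msum_singleton)

lemma lin_ext_zero: "lin_ext d \<phi> 0 = 0\<^sub>m d d"
  by (simp add: lin_ext_def)

lemma lin_ext_add:
  assumes "\<And>a. a \<in> Poly_Mapping.keys p \<union> Poly_Mapping.keys q \<Longrightarrow> \<phi> a \<in> carrier_mat d d"
  shows "lin_ext d \<phi> (p + q) = lin_ext d \<phi> p + lin_ext d \<phi> q"
proof -
  let ?A = "Poly_Mapping.keys p \<union> Poly_Mapping.keys q"
  note s = lin_ext_superset[of ?A _ \<phi> d, OF _ _ assms]
  have 1: "lin_ext d \<phi> (p + q) = msum d d (\<lambda>a. Poly_Mapping.lookup (p + q) a \<cdot>\<^sub>m \<phi> a) ?A"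
    by (rule s) (use keys_add[of p q] in auto)
  have 2: "lin_ext d \<phi> p = msum d d (\<lambda>a. Poly_Mapping.lookup p a \<cdot>\<^sub>m \<phi> a) ?A" by (rule s) auto
  have 3: "lin_ext d \<phi> q = msum d d (\<lambda>a. Poly_Mapping.lookup q a \<cdot>\<^sub>m \<phi> a) ?A" by (rule s) auto
  show ?thesis unfolding 1 2 3
  proof (rule eq_matI, goal_cases)
    case (1 i j)
    hence ij: "i < d" "j < d" by simp_all
    have "(\<Sum>a\<in>?A. (Poly_Mapping.lookup (p + q) a \<cdot>\<^sub>m \<phi> a) $$ (i, j)) = (\<Sum>a\<in>?A.
        (Poly_Mapping.lookup p a \<cdot>\<^sub>m \<phi> a) $$ (i, j) + (Poly_Mapping.lookup q a \<cdot>\<^sub>m \<phi> a) $$ (i, j))"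
    proof (rule sum.cong[OF refl])
      fix a assume "a \<in> ?A"
      from assms[OF this] show "(Poly_Mapping.lookup (p + q) a \<cdot>\<^sub>m \<phi> a) $$ (i, j) =
        (Poly_Mapping.lookup p a \<cdot>\<^sub>m \<phi> a) $$ (i, j) + (Poly_Mapping.lookup q a \<cdot>\<^sub>m \<phi> a) $$ (i, j)"
        using ij by (simp add: lookup_add distrib_right)
    qed
    thus ?case using ij by (simp add: sum.distrib)
  qed simp_all
qed

context monoid_alg
begin

lemma lin_ext_mult:
  assumes c: "\<And>a. a \<in> carrier M \<Longrightarrow> \<phi> a \<in> carrier_mat d d"
    and m: "\<And>a b. a \<in> carrier M \<Longrightarrow> b \<in> carrier M \<Longrightarrow> \<phi> (a \<otimes> b) = \<phi> a * \<phi> b"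
    and pq: "Poly_Mapping.keys p \<subseteq> carrier M" "Poly_Mapping.keys q \<subseteq> carrier M"
  shows "lin_ext d \<phi> (p \<otimes>\<^bsub>MA\<^esub> q) = lin_ext d \<phi> p * lin_ext d \<phi> q"
  using pq(1)
proof (induction rule: pm_induct)
  case zero
  show ?case by (simp add: mult_zero lin_ext_zero)
next
  case (add a x p)
  have 1: "lin_ext d \<phi> (sg a x \<otimes>\<^bsub>MA\<^esub> q) = lin_ext d \<phi> (sg a x) * lin_ext d \<phi> q" using pq(2)
  proof (induction rule: pm_induct)
    case zero
    show ?case by (simp add: mult_zero lin_ext_zero)
  next
    case (add b y q)
    have k: "Poly_Mapping.keys (sg (a \<otimes> b) (x * y)) \<subseteq> carrier M" "Poly_Mapping.keys (sg b y) \<subseteq> carrier M"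
      "Poly_Mapping.keys (sg a x \<otimes>\<^bsub>MA\<^esub> q) \<subseteq> carrier M"
      using add \<open>a \<in> carrier M\<close> by (simp_all add: mult_closed)
    have "lin_ext d \<phi> (sg a x \<otimes>\<^bsub>MA\<^esub> (sg b y + q)) = (x * y) \<cdot>\<^sub>m \<phi> (a \<otimes> b) + lin_ext d \<phi> (sg a x) * lin_ext d \<phi> q"
    proof -
      have "lin_ext d \<phi> (sg (a \<otimes> b) (x * y) + sg a x \<otimes>\<^bsub>MA\<^esub> q) = lin_ext d \<phi> (sg (a \<otimes> b) (x * y)) + lin_ext d \<phi> (sg a x \<otimes>\<^bsub>MA\<^esub> q)"
        by (rule lin_ext_add) (use k in \<open>blast intro: c\<close>)
      thus ?thesis unfolding mult_add_right mult_sg using add \<open>a \<in> carrier M\<close> c[of "a \<otimes> b"] by (simp add: lin_ext_single)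
    qed
    also have "(x * y) \<cdot>\<^sub>m \<phi> (a \<otimes> b) = lin_ext d \<phi> (sg a x) * lin_ext d \<phi> (sg b y)"
      using add \<open>a \<in> carrier M\<close> c[of a] c[of b] m[of a b]
      by (simp add: lin_ext_single smult_mat_mult smult_smult_mat mult.commute)
    also have "\<dots> + lin_ext d \<phi> (sg a x) * lin_ext d \<phi> q = lin_ext d \<phi> (sg a x) * (lin_ext d \<phi> (sg b y) + lin_ext d \<phi> q)"
      by (rule mat_distrib_left[symmetric]) (simp_all add: lin_ext_def)
    also have "lin_ext d \<phi> (sg b y) + lin_ext d \<phi> q = lin_ext d \<phi> (sg b y + q)"
      by (rule lin_ext_add[symmetric]) (use k(2) add in \<open>blast intro: c\<close>)
    finally show ?case .
  qed
  have k: "Poly_Mapping.keys (sg a x \<otimes>\<^bsub>MA\<^esub> q) \<subseteq> carrier M" "Poly_Mapping.keys (p \<otimes>\<^bsub>MA\<^esub> q) \<subseteq> carrier M"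
    using add pq(2) by (simp_all add: mult_closed)
  have k2: "Poly_Mapping.keys (sg a x) \<subseteq> carrier M" using add by simp
  have "lin_ext d \<phi> (sg a x \<otimes>\<^bsub>MA\<^esub> q + p \<otimes>\<^bsub>MA\<^esub> q) = lin_ext d \<phi> (sg a x \<otimes>\<^bsub>MA\<^esub> q) + lin_ext d \<phi> (p \<otimes>\<^bsub>MA\<^esub> q)"
    by (rule lin_ext_add) (use k in \<open>blast intro: c\<close>)
  hence "lin_ext d \<phi> ((sg a x + p) \<otimes>\<^bsub>MA\<^esub> q) = lin_ext d \<phi> (sg a x) * lin_ext d \<phi> q + lin_ext d \<phi> p * lin_ext d \<phi> q"
    unfolding mult_add_left using 1 add by simp
  also have "\<dots> = (lin_ext d \<phi> (sg a x) + lin_ext d \<phi> p) * lin_ext d \<phi> q"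
    by (rule mat_distrib_right[symmetric]) (simp_all add: lin_ext_def)
  also have "lin_ext d \<phi> (sg a x) + lin_ext d \<phi> p = lin_ext d \<phi> (sg a x + p)"
    by (rule lin_ext_add[symmetric]) (use k2 add in \<open>blast intro: c\<close>)
  finally show ?case .
qed

end

lemma alg_module_lin_ext:
  fixes \<phi> :: "'m \<Rightarrow> 'k::field mat"
  assumes mo: "Group.monoid Mo" and c: "\<And>a. a \<in> carrier Mo \<Longrightarrow> \<phi> a \<in> carrier_mat d d" and one: "\<phi> \<one>\<^bsub>Mo\<^esub> = 1\<^sub>m d"
    and m: "\<And>a b. a \<in> carrier Mo \<Longrightarrow> b \<in> carrier Mo \<Longrightarrow> \<phi> (a \<otimes>\<^bsub>Mo\<^esub> b) = \<phi> a * \<phi> b"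
  shows "alg_module (monoid_algebra Mo) (d, lin_ext d \<phi>)"
proof -
  interpret monoid_alg Mo "TYPE('k)" using mo by (simp add: monoid_alg_def)
  show ?thesis
  proof (rule alg_moduleI)
    fix p c assume "p \<in> carrier MA"
    hence p: "Poly_Mapping.keys p \<subseteq> carrier Mo" by (simp add: monoid_algebra_simps)
    have "lin_ext d \<phi> (c \<odot>\<^bsub>MA\<^esub> p) = lin_ext d \<phi> (sg \<one>\<^bsub>Mo\<^esub> c) * lin_ext d \<phi> p"
      unfolding MA_smult[OF p] by (rule lin_ext_mult[OF assms(2) m _ p]) auto
    also have "lin_ext d \<phi> (sg \<one>\<^bsub>Mo\<^esub> c) = c \<cdot>\<^sub>m 1\<^sub>m d" by (subst lin_ext_single) (simp_all add: one)
    also have "c \<cdot>\<^sub>m 1\<^sub>m d * lin_ext d \<phi> p = c \<cdot>\<^sub>m lin_ext d \<phi> p" by (simp add: smult_mat_mult)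
    finally show "act (d, lin_ext d \<phi>) (c \<odot>\<^bsub>MA\<^esub> p) = c \<cdot>\<^sub>m act (d, lin_ext d \<phi>) p" by simp
  next
    fix x y assume "x \<in> carrier MA" "y \<in> carrier MA"
    hence xy: "Poly_Mapping.keys x \<subseteq> carrier Mo" "Poly_Mapping.keys y \<subseteq> carrier Mo"
      by (simp_all add: monoid_algebra_simps)
    show "act (d, lin_ext d \<phi>) (x \<otimes>\<^bsub>MA\<^esub> y) = act (d, lin_ext d \<phi>) x * act (d, lin_ext d \<phi>) y"
      using lin_ext_mult[OF c m xy] by simp
    have "lin_ext d \<phi> (x + y) = lin_ext d \<phi> x + lin_ext d \<phi> y"
      by (rule lin_ext_add) (use xy in \<open>blast intro: c\<close>)
    thus "act (d, lin_ext d \<phi>) (x \<oplus>\<^bsub>MA\<^esub> y) = act (d, lin_ext d \<phi>) x + act (d, lin_ext d \<phi>) y"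
      by (simp add: monoid_algebra_simps)
  next
    show "act (d, lin_ext d \<phi>) \<one>\<^bsub>MA\<^esub> = 1\<^sub>m (mdim (d, lin_ext d \<phi>))"
      by (simp add: monoid_algebra_simps lin_ext_single one)
  qed simp
qed

text \<open>Both actions are linear, so it is enough to test on the monoid elements, which form a
  basis.\<close>

lemma act_pm_induct:
  assumes M: "alg_module (monoid_algebra Mo) M" and N: "alg_module (monoid_algebra Mo) N" and mo: "Group.monoid Mo"
    and P: "P \<in> carrier_mat (mdim N) (mdim M)"
    and g: "\<And>a. a \<in> carrier Mo \<Longrightarrow> P * act M (Poly_Mapping.single a 1) = act N (Poly_Mapping.single a 1) * P"
  shows "P \<in> intertwiners (monoid_algebra Mo :: ('k::field, 'm \<Rightarrow>\<^sub>0 'k) module) M N"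
proof -
  interpret monoid_alg Mo "TYPE('k)" using mo by (simp add: monoid_alg_def)
  have "P * act M x = act N x * P" if "x \<in> carrier MA" for x
  proof -
    from that have "Poly_Mapping.keys x \<subseteq> carrier Mo" by (simp add: monoid_algebra_simps)
    thus ?thesis
    proof (induction rule: pm_induct)
      case zero
      \<comment> \<open>The action of 0 is obtained from compatibility with scalars: writing
        \<open>0 = 0 \<odot> 0\<close> forces the zero matrix.\<close>
      have z: "0 \<in> carrier MA" "(0 :: 'm \<Rightarrow>\<^sub>0 'k) = 0 \<odot>\<^bsub>MA\<^esub> 0" by (auto simp: monoid_algebra_simps monoid_algebra_def lookup_map_mult intro!: poly_mapping_eqI)
      have "act M 0 = 0 \<cdot>\<^sub>m act M 0" "act N 0 = 0 \<cdot>\<^sub>m act N 0"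
        using alg_moduleD(5)[OF M z(1), of 0] alg_moduleD(5)[OF N z(1), of 0] z(2) by simp_all
      hence "act M 0 = 0\<^sub>m (mdim M) (mdim M)" "act N 0 = 0\<^sub>m (mdim N) (mdim N)"
        using alg_moduleD(1)[OF M z(1)] alg_moduleD(1)[OF N z(1)]
        by (metis (no_types, lifting) carrier_matD eq_matI index_smult_mat index_zero_mat mult_zero_left)+
      thus ?case using P by simp
    next
      case (add a c q)
      have s: "Poly_Mapping.single a c = c \<odot>\<^bsub>MA\<^esub> Poly_Mapping.single a 1"
        using add by (subst MA_smult) (auto simp: mult_sg)
      have a: "Poly_Mapping.single a 1 \<in> carrier MA" "Poly_Mapping.single a c \<in> carrier MA" and q: "q \<in> carrier MA"
        using add by (auto simp: monoid_algebra_simps)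
      have 1: "act M (Poly_Mapping.single a c + q) = c \<cdot>\<^sub>m act M (Poly_Mapping.single a 1) + act M q"
        "act N (Poly_Mapping.single a c + q) = c \<cdot>\<^sub>m act N (Poly_Mapping.single a 1) + act N q"
        using alg_moduleD(3)[OF M a(2) q] alg_moduleD(3)[OF N a(2) q]
          alg_moduleD(5)[OF M a(1), of c] alg_moduleD(5)[OF N a(1), of c]
        by (simp_all add: s[symmetric] monoid_algebra_simps)
      show ?case unfolding 1
        using P g[OF add(1)] add alg_moduleD(1)[OF M a(1)] alg_moduleD(1)[OF N a(1)]
          alg_moduleD(1)[OF M q] alg_moduleD(1)[OF N q]
        by (simp add: mat_distrib_left mat_distrib_right smult_mat_mult)
    qed
  qed
  thus ?thesis using P by (simp add: intertwiners_def)
qed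

subsection \<open>Quotients\<close>

context ideal
begin

lemma quot_carrier: "X \<in> carrier (R Quot I) \<longleftrightarrow> (\<exists>a\<in>carrier R. X = I +> a)"
  by (auto simp: FactRing_def A_RCOSETS_def')

lemma quot_mult: "a \<in> carrier R \<Longrightarrow> b \<in> carrier R \<Longrightarrow> (I +> a) \<otimes>\<^bsub>R Quot I\<^esub> (I +> b) = I +> (a \<otimes> b)"
  using rcos_ring_hom by (simp add: Ring.ring_hom_def)

lemma quot_add: "a \<in> carrier R \<Longrightarrow> b \<in> carrier R \<Longrightarrow> (I +> a) \<oplus>\<^bsub>R Quot I\<^esub> (I +> b) = I +> (a \<oplus> b)"
  using rcos_ring_hom by (simp add: Ring.ring_hom_def)

lemma quot_one: "\<one>\<^bsub>R Quot I\<^esub> = I +> \<one>"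
  by (simp add: FactRing_def)

lemma quot_zero: "\<zero>\<^bsub>R Quot I\<^esub> = I +> \<zero>"
  using ring_hom_zero[OF rcos_ring_hom ring_axioms quotient_is_ring] by simp

lemma quot_eq: "a \<in> carrier R \<Longrightarrow> b \<in> carrier R \<Longrightarrow> I +> a = I +> b \<longleftrightarrow> a \<ominus> b \<in> I"
proof -
  assume a: "a \<in> carrier R" and b: "b \<in> carrier R"
  have "I +> a = I +> b \<longleftrightarrow> a \<in> I +> b"
    using a b a_rcos_self[OF a] a_repr_independence'[OF _ b] by metis
  also have "\<dots> \<longleftrightarrow> a \<ominus> b \<in> I"
    using a_rcos_module[OF b a] by (simp add: a_minus_def)
  finally show ?thesis .
qed

text \<open>The map is evaluated at a chosen representative, and the hypothesis makes the choice
  irrelevant.\<close>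

lemma quot_lift:
  assumes "\<And>a b. a \<in> carrier R \<Longrightarrow> b \<in> carrier R \<Longrightarrow> a \<ominus> b \<in> I \<Longrightarrow> f a = f b"
  shows "\<exists>f'. \<forall>a\<in>carrier R. f' (I +> a) = f a"
proof (intro exI ballI)
  fix a assume a: "a \<in> carrier R"
  define x where "x = (SOME x. x \<in> carrier R \<and> I +> x = I +> a)"
  have "x \<in> carrier R \<and> I +> x = I +> a" unfolding x_def by (rule someI[of _ a]) (use a in auto)
  hence "f x = f a" using assms a quot_eq by blast
  thus "(\<lambda>X. f (SOME x. x \<in> carrier R \<and> I +> x = X)) (I +> a) = f a" by (simp add: x_def)
qed

end

section \<open>Group algebra modules as representations\<close>

lemma intertwinersD:
  assumes "P \<in> intertwiners A M N"
  shows "P \<in> carrier_mat (mdim N) (mdim M)" "x \<in> carrier A \<Longrightarrow> P * act M x = act N x * P"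
  using assms by (auto simp: intertwiners_def)

lemma inverse_mat_dim_eq:
  fixes P :: "'a::field mat"
  assumes "P \<in> carrier_mat e d" "Q \<in> carrier_mat d e" "P * Q = 1\<^sub>m e" "Q * P = 1\<^sub>m d"
  shows "d = e"
  using left_inverse_dim_le[OF assms(1,2,4)] left_inverse_dim_le[OF assms(2,1,3)] by simp

text \<open>\<open>invertible_mat\<close> speaks of a square matrix; here the inverse has its own
  format, and squareness becomes a consequence of \<open>inverse_mat_dim_eq\<close>.\<close>

lemma iso_mod_iff:
  "iso_mod A M N \<longleftrightarrow> (\<exists>P\<in>intertwiners A M N. \<exists>Q\<in>carrier_mat (mdim M) (mdim N).
     P * Q = 1\<^sub>m (mdim N) \<and> Q * P = 1\<^sub>m (mdim M))"
proof
  assume "iso_mod A M N"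
  then obtain P Q where P: "P \<in> intertwiners A M N" "square_mat P" "P * Q = 1\<^sub>m (dim_row P)" "Q * P = 1\<^sub>m (dim_row Q)"
    by (auto simp: iso_mod_def invertible_mat_def inverts_mat_def)
  note c = intertwinersD(1)[OF P(1)]
  have "dim_col Q = mdim N" using arg_cong[OF P(3), of dim_col] c by simp
  moreover have "dim_row Q = mdim M" using arg_cong[OF P(4), of dim_col] c by simp
  ultimately show "\<exists>P\<in>intertwiners A M N. \<exists>Q\<in>carrier_mat (mdim M) (mdim N).
     P * Q = 1\<^sub>m (mdim N) \<and> Q * P = 1\<^sub>m (mdim M)"
    using P c by (intro bexI[of _ P] bexI[of _ Q]) auto
next
  assume "\<exists>P\<in>intertwiners A M N. \<exists>Q\<in>carrier_mat (mdim M) (mdim N).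
     P * Q = 1\<^sub>m (mdim N) \<and> Q * P = 1\<^sub>m (mdim M)"
  then obtain P Q where P: "P \<in> intertwiners A M N" "Q \<in> carrier_mat (mdim M) (mdim N)"
    "P * Q = 1\<^sub>m (mdim N)" "Q * P = 1\<^sub>m (mdim M)" by blast
  note c = intertwinersD(1)[OF P(1)]
  have "mdim M = mdim N" by (rule inverse_mat_dim_eq[OF c P(2-4)])
  thus "iso_mod A M N" using P c unfolding iso_mod_def invertible_mat_def inverts_mat_def
    by (intro bexI[of _ P] conjI exI[of _ Q]) auto
qed

lemma iso_mod_dim: "iso_mod A M N \<Longrightarrow> mdim M = mdim N"
  using inverse_mat_dim_eq intertwinersD(1) unfolding iso_mod_iff by metis

lemma subspace_vecI:
  fixes W :: "'k::field vec set"
  assumes "W \<subseteq> carrier_vec d" "0\<^sub>v d \<in> W" "\<And>v w. v \<in> W \<Longrightarrow> w \<in> W \<Longrightarrow> v + w \<in> W"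
    "\<And>c v. v \<in> W \<Longrightarrow> c \<cdot>\<^sub>v v \<in> W"
  shows "VectorSpace.subspace class_ring W (module_vec TYPE('k) d)"
proof -
  interpret V: vectorspace class_ring "module_vec TYPE('k) d" by (rule vec_vs)
  show ?thesis
    by (intro VectorSpace.subspace.intro submodule.intro V.vectorspace_axioms V.module_axioms)
      (use assms in \<open>auto simp: module_vec_simps\<close>)
qed

lemma subspace_vecD:
  fixes W :: "'k::field vec set"
  assumes "VectorSpace.subspace class_ring W (module_vec TYPE('k) d)"
  shows "W \<subseteq> carrier_vec d" "0\<^sub>v d \<in> W" "v \<in> W \<Longrightarrow> w \<in> W \<Longrightarrow> v + w \<in> W" "v \<in> W \<Longrightarrow> c \<cdot>\<^sub>v v \<in> W"
proof -
  interpret submodule class_ring W "module_vec TYPE('k) d" using assms by (simp add: VectorSpace.subspace_def)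
  show "W \<subseteq> carrier_vec d" "0\<^sub>v d \<in> W" "v \<in> W \<Longrightarrow> w \<in> W \<Longrightarrow> v + w \<in> W" "v \<in> W \<Longrightarrow> c \<cdot>\<^sub>v v \<in> W"
    using subset zero_closed m_closed[of v w] smult_closed[of c v] by (auto simp: module_vec_simps)
qed

locale gd = group_datum G \<chi> g n
  for G :: "('g, 'z) monoid_scheme" (structure)
    and \<chi> :: "'g \<Rightarrow> 'k::{alg_closed_field, field_char_0}" and g :: 'g and n :: nat
begin

sublocale fin_group G
  by unfold_locales (rule finite_carrier)

abbreviation KG :: "('k, 'g \<Rightarrow>\<^sub>0 'k) module" where "KG \<equiv> group_algebra G"

definition kr :: "('k, 'g \<Rightarrow>\<^sub>0 'k) fdmod \<Rightarrow> 'g \<Rightarrow> 'k mat" where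
  "kr N h = act N (kg_elt h)"

sublocale ma: monoid_alg G "TYPE('k)"
  by unfold_locales

lemma kg_elt_closed: "h \<in> carrier G \<Longrightarrow> kg_elt h \<in> carrier KG"
  by (simp add: kg_elt_def)

lemma kg_rep:
  assumes "alg_module KG N"
  shows "rep (mdim N) (kr N)"
  unfolding rep_def kr_def
proof (intro conjI ballI)
  fix h h' assume h: "h \<in> carrier G" "h' \<in> carrier G"
  have "kg_elt (h \<otimes> h') = kg_elt h \<otimes>\<^bsub>KG\<^esub> kg_elt h'" by (simp add: kg_elt_def ma.mult_sg)
  thus "act N (kg_elt (h \<otimes> h')) = act N (kg_elt h) * act N (kg_elt h')"
    using alg_moduleD(2)[OF assms kg_elt_closed kg_elt_closed] h by simp
next
  show "act N (kg_elt \<one>) = 1\<^sub>m (mdim N)"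
    using alg_moduleD(4)[OF assms] by (simp add: monoid_algebra_simps kg_elt_def)
qed (use alg_moduleD(1)[OF assms kg_elt_closed] in auto)

text \<open>The linear extension of r is a witness for the choice in \<open>gen_module\<close>;
  afterwards only the values on group elements matter.\<close>

lemma kg_module:
  assumes "rep d r"
  shows "alg_module KG (kg_module G d r)" "mdim (kg_module G d r) = d"
    "h \<in> carrier G \<Longrightarrow> kr (kg_module G d r) h = r h"
proof -
  have "alg_module KG (d, lin_ext d r)"
    by (rule alg_module_lin_ext) (use repD[OF assms] in \<open>auto simp: is_monoid\<close>)
  moreover have "\<forall>h\<in>carrier G. lin_ext d r (kg_elt h) = r h"
    using repD(1)[OF assms] by (simp add: kg_elt_def lin_ext_single)
  ultimately have "\<exists>\<rho>. alg_module KG (d, \<rho>) \<and> (\<forall>h\<in>carrier G. \<rho> (kg_elt h) = r h)" by blast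
  from someI_ex[OF this]
  show "alg_module KG (kg_module G d r)" "mdim (kg_module G d r) = d"
    "h \<in> carrier G \<Longrightarrow> kr (kg_module G d r) h = r h"
    by (auto simp: kg_module_def gen_module_def kr_def)
qed

lemma kg_intertwiners:
  assumes "alg_module KG M" "alg_module KG N"
  shows "intertwiners KG M N = homs (mdim M) (kr M) (mdim N) (kr N)"
proof (intro equalityI subsetI)
  fix P assume "P \<in> intertwiners KG M N"
  thus "P \<in> homs (mdim M) (kr M) (mdim N) (kr N)"
    using kg_elt_closed by (auto simp: intertwiners_def homs_def kr_def)
next
  fix P assume P: "P \<in> homs (mdim M) (kr M) (mdim N) (kr N)"
  show "P \<in> intertwiners KG M N"
    by (rule act_pm_induct[OF assms is_monoid homsD(1)[OF P]]) (use homsD(2)[OF P] in \<open>simp add: kr_def kg_elt_def\<close>)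
qed

lemma kg_iso:
  assumes "alg_module KG M" "alg_module KG N"
  shows "iso_mod KG M N \<longleftrightarrow> iso_rep (mdim M) (kr M) (mdim N) (kr N)"
  unfolding iso_mod_iff iso_rep_def kg_intertwiners[OF assms] ..

lemma msum_mult_vec_mem:
  fixes W :: "'k vec set" and f :: "'g \<Rightarrow> 'k mat"
  assumes W: "0\<^sub>v d \<in> W" "\<And>v w. v \<in> W \<Longrightarrow> w \<in> W \<Longrightarrow> v + w \<in> W"
    and f: "\<And>h. h \<in> S \<Longrightarrow> f h \<in> carrier_mat d d" "\<And>h. h \<in> S \<Longrightarrow> f h *\<^sub>v v \<in> W"
    and v: "v \<in> carrier_vec d" and "finite S"
  shows "msum d d f S *\<^sub>v v \<in> W"
  using \<open>finite S\<close> f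
proof (induction S rule: finite_induct)
  case empty
  have "0\<^sub>m d d *\<^sub>v v = 0\<^sub>v d" using v by (intro eq_vecI) simp_all
  thus ?case using W by simp
next
  case (insert h S)
  have "msum d d f (insert h S) *\<^sub>v v = f h *\<^sub>v v + msum d d f S *\<^sub>v v"
    by (subst msum_insert) (use insert v in \<open>auto intro!: add_mult_distrib_mat_vec[of _ d d]\<close>)
  thus ?case using W insert by simp
qed

text \<open>Forward: an eigenspace of an endomorphism is a nonzero invariant subspace, hence
  everything. Backward: averaging a linear projection onto W gives an equivariant projection onto W,
  which irreducibility makes a scalar.\<close>

lemma simple_iff_irr:
  assumes N: "alg_module KG N"
  shows "simple_mod KG N \<longleftrightarrow> irr (mdim N) (kr N)"
proof
  let ?d = "mdim N"
  assume s: "simple_mod KG N"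
  have d: "?d > 0" using s by (simp add: simple_mod_def)
  have "\<exists>c. P = c \<cdot>\<^sub>m 1\<^sub>m ?d" if P: "P \<in> homs ?d (kr N) ?d (kr N)" for P
  proof -
    have Pi: "P \<in> intertwiners KG N N" using P kg_intertwiners[OF N N] by simp
    note Pc = homsD(1)[OF P]
    obtain c v where v: "v \<in> carrier_vec ?d" "v \<noteq> 0\<^sub>v ?d" "P *\<^sub>v v = c \<cdot>\<^sub>v v"
      using exists_eigenvector[OF Pc d] by blast
    define W where "W = {w \<in> carrier_vec ?d. P *\<^sub>v w = c \<cdot>\<^sub>v w}"
    have "VectorSpace.subspace class_ring W (module_vec TYPE('k) ?d)"
    proof (rule subspace_vecI)
      show "0\<^sub>v ?d \<in> W" using Pc by (auto simp: W_def intro!: eq_vecI)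
      show "v + w \<in> W" if "v \<in> W" "w \<in> W" for v w
        using that Pc by (auto simp: W_def mult_add_distrib_mat_vec[OF Pc] smult_add_distrib_vec)
      show "a \<cdot>\<^sub>v v \<in> W" if "v \<in> W" for a v
        using that Pc by (auto simp: W_def mult_mat_vec[OF Pc] smult_smult_assoc mult.commute)
    qed (auto simp: W_def)
    moreover have "act N x *\<^sub>v w \<in> W" if x: "x \<in> carrier KG" and w: "w \<in> W" for x w
    proof -
      note c = alg_moduleD(1)[OF N x]
      have "P *\<^sub>v (act N x *\<^sub>v w) = (P * act N x) *\<^sub>v w"
        using Pc c w by (simp add: W_def mat_mult_vec_assoc)
      also have "\<dots> = act N x *\<^sub>v (P *\<^sub>v w)" unfolding intertwinersD(2)[OF Pi x]
        using Pc c w by (simp add: W_def mat_mult_vec_assoc)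
      also have "\<dots> = c \<cdot>\<^sub>v (act N x *\<^sub>v w)" using w c by (simp add: W_def mult_mat_vec[OF c])
      finally show ?thesis using c w by (simp add: W_def)
    qed
    ultimately have "W = {0\<^sub>v ?d} \<or> W = carrier_vec ?d" using s by (auto simp: simple_mod_def)
    moreover have "v \<in> W" using v by (simp add: W_def)
    ultimately have W: "W = carrier_vec ?d" using v by auto
    have "P = c \<cdot>\<^sub>m 1\<^sub>m ?d"
    proof (rule mat_eq_iff_mult_vec[OF Pc])
      fix w :: "'k vec" assume w: "w \<in> carrier_vec ?d"
      have "c \<cdot>\<^sub>m 1\<^sub>m ?d *\<^sub>v w = c \<cdot>\<^sub>v w" using w by (auto intro!: eq_vecI)
      moreover have "w \<in> W" using w W by simp
      ultimately show "P *\<^sub>v w = c \<cdot>\<^sub>m 1\<^sub>m ?d *\<^sub>v w" by (simp add: W_def)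
    qed simp
    thus ?thesis by blast
  qed
  thus "irr ?d (kr N)" using kg_rep[OF N] d by (auto simp: irr_def)
next
  let ?d = "mdim N" and ?r = "kr N"
  assume irr: "irr ?d ?r"
  hence r: "rep ?d ?r" and d: "?d > 0" by (auto simp: irr_def)
  show "simple_mod KG N"
    unfolding simple_mod_def
  proof (intro conjI allI impI N)
    fix W :: "'k vec set"
    assume "VectorSpace.subspace class_ring W (module_vec TYPE('k) ?d)" and inv: "\<forall>x\<in>carrier KG. \<forall>w\<in>W. act N x *\<^sub>v w \<in> W"
    note W = subspace_vecD[OF this(1)]
    have inv': "?r h *\<^sub>v w \<in> W" if "h \<in> carrier G" "w \<in> W" for h w
      using inv that kg_elt_closed by (auto simp: kr_def)
    obtain E where E: "E \<in> carrier_mat ?d ?d" "\<And>v. v \<in> carrier_vec ?d \<Longrightarrow> E *\<^sub>v v \<in> W" "\<And>w. w \<in> W \<Longrightarrow> E *\<^sub>v w = w"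
      using subspace_projection[OF W(1,2)] W(3,4) by blast
    let ?f = "\<lambda>h. ?r h * E * ?r (inv h)"
    let ?S = "msum ?d ?d ?f (carrier G)"
    \<comment> \<open>The average of a projection onto W still maps into W and fixes W pointwise,
      because W is invariant under G.\<close>
    let ?F = "avg ?d ?d ?r ?r E"
    have fc: "?f h \<in> carrier_mat ?d ?d" if "h \<in> carrier G" for h
      using that E by (intro carrier_matI) (simp_all add: rep_dim[OF r])
    have fv: "?f h *\<^sub>v v = ?r h *\<^sub>v (E *\<^sub>v (?r (inv h) *\<^sub>v v))" if "h \<in> carrier G" "v \<in> carrier_vec ?d" for h v
      using that E(1) by (simp add: mat_mult_vec_assoc rep_dim[OF r])
    have Fv: "?F *\<^sub>v v = inverse (of_nat (card (carrier G))) \<cdot>\<^sub>v (?S *\<^sub>v v)" if "v \<in> carrier_vec ?d" for v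
      unfolding avg_def using that by (auto intro!: eq_vecI)
    have in_W: "?F *\<^sub>v v \<in> W" if v: "v \<in> carrier_vec ?d" for v
    proof -
      have "?f h *\<^sub>v v \<in> W" if h: "h \<in> carrier G" for h
        unfolding fv[OF h v] using h repD(1)[OF r, of "inv h"] v by (intro inv' E(2)) auto
      hence "?S *\<^sub>v v \<in> W" by (intro msum_mult_vec_mem W(2,3) fc v finite_carrier) auto
      thus ?thesis unfolding Fv[OF v] by (rule W(4))
    qed
    have fix_W: "?F *\<^sub>v w = w" if w: "w \<in> W" for w
    proof -
      have wc: "w \<in> carrier_vec ?d" using w W by auto
      have 1: "?f h *\<^sub>v w = w" if h: "h \<in> carrier G" for h
      proof -
        have "?f h *\<^sub>v w = ?r h *\<^sub>v (?r (inv h) *\<^sub>v w)"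
          unfolding fv[OF h wc] using E(3)[OF inv'[of "inv h" w]] h w by simp
        also have "\<dots> = (?r h * ?r (inv h)) *\<^sub>v w" using h wc by (simp add: mat_mult_vec_assoc rep_dim[OF r])
        finally show ?thesis using rep_inv[OF r h] wc by simp
      qed
      have "msum ?d ?d ?f S *\<^sub>v w = of_nat (card S) \<cdot>\<^sub>v w" if "finite S" "S \<subseteq> carrier G" for S
        using that
      proof (induction S rule: finite_induct)
        case empty
        show ?case using wc by (intro eq_vecI) simp_all
      next
        case (insert h S)
        have "msum ?d ?d ?f (insert h S) = ?f h + msum ?d ?d ?f S"
          by (rule msum_insert) (use insert fc in auto)
        moreover have hc: "h \<in> carrier G" using insert by simp
        ultimately have "msum ?d ?d ?f (insert h S) *\<^sub>v w = ?f h *\<^sub>v w + msum ?d ?d ?f S *\<^sub>v w"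
          using add_mult_distrib_mat_vec[OF fc[OF hc] msum_carrier[of ?d ?d ?f S] wc] by (simp only:)
        also have "\<dots> = w + of_nat (card S) \<cdot>\<^sub>v w" using insert 1 by simp
        also have "\<dots> = of_nat (card (insert h S)) \<cdot>\<^sub>v w"
          using insert wc by (auto simp: algebra_simps intro!: eq_vecI)
        finally show ?case .
      qed
      from this[of "carrier G"] show ?thesis unfolding Fv[OF wc] using finite_carrier card_ne_0[where 'k = 'k] wc
        by (simp add: smult_smult_assoc)
    qed
    obtain c where c: "?F = c \<cdot>\<^sub>m 1\<^sub>m ?d" using avg_homs[OF r r E(1)] irr by (auto simp: irr_def)
    have Fc: "?F *\<^sub>v v = c \<cdot>\<^sub>v v" if "v \<in> carrier_vec ?d" for v
      unfolding c using that by (auto intro!: eq_vecI)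
    show "W = {0\<^sub>v ?d} \<or> W = carrier_vec ?d"
    proof (cases "c = 0")
      case True
      have "w = 0\<^sub>v ?d" if "w \<in> W" for w
      proof -
        have wc: "w \<in> carrier_vec ?d" using that W(1) by auto
        have "w = 0 \<cdot>\<^sub>v w" using fix_W[OF that] Fc[OF wc] True by simp
        also have "\<dots> = 0\<^sub>v ?d" using wc by (intro eq_vecI) simp_all
        finally show ?thesis .
      qed
      thus ?thesis using W(2) by blast
    next
      case False
      have "v \<in> W" if v: "v \<in> carrier_vec ?d" for v
      proof -
        have "inverse c \<cdot>\<^sub>v (?F *\<^sub>v v) \<in> W" by (rule W(4)[OF in_W[OF v]])
        thus ?thesis using Fc[OF v] False v by (simp add: smult_smult_assoc)
      qed
      thus ?thesis using W(1) by blast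
    qed
  qed (use d in simp)
qed

end

section \<open>Modules over the Hopf algebra\<close>

text \<open>A named copy of the monoid inside \<open>free_algebra\<close>, so that the results on
  monoid algebras apply to it.\<close>

definition word_monoid :: "'s set \<Rightarrow> 's list monoid" where
  "word_monoid S = \<lparr>partial_object.carrier = lists S, monoid.mult = (@), monoid.one = []\<rparr>"

lemma word_monoid: "Group.monoid (word_monoid S)"
  by (rule monoidI) (auto simp: word_monoid_def)

definition word_act :: "nat \<Rightarrow> ('s \<Rightarrow> 'k::semiring_1 mat) \<Rightarrow> 's list \<Rightarrow> 'k mat" where
  "word_act d f w = foldr (\<lambda>s A. f s * A) w (1\<^sub>m d)"

lemma word_act_simps [simp]: "word_act d f [] = 1\<^sub>m d" "word_act d f (s # w) = f s * word_act d f w"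
  by (simp_all add: word_act_def)

lemma word_act_carrier:
  "(\<And>s. s \<in> set w \<Longrightarrow> f s \<in> carrier_mat d d) \<Longrightarrow> word_act d f w \<in> carrier_mat d d"
  by (induction w) (auto intro!: mult_carrier_mat[of _ d d])

lemma word_act_append:
  assumes "\<And>s. s \<in> set u \<union> set v \<Longrightarrow> f s \<in> carrier_mat d d"
  shows "word_act d f (u @ v) = word_act d f u * word_act d f v"
  using assms
proof (induction u)
  case Nil
  thus ?case using word_act_carrier[of v f d] by simp
next
  case (Cons s u)
  have c: "f s \<in> carrier_mat d d" "word_act d f u \<in> carrier_mat d d" "word_act d f v \<in> carrier_mat d d"
    using Cons.prems by (auto intro!: word_act_carrier)
  have "word_act d f (u @ v) = word_act d f u * word_act d f v" using Cons by simp
  thus ?case using c by (simp add: mat_assoc)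
qed

lemma word_act_replicate:
  "f s \<in> carrier_mat d d \<Longrightarrow> word_act d f (replicate k s) = f s ^\<^sub>m k"
proof (induction k)
  case (Suc k)
  have "f s * f s ^\<^sub>m k = f s ^\<^sub>m k * f s"
    using Suc.prems by (induction k) (auto simp: mat_assoc[symmetric])
  thus ?case using Suc by simp
qed simp

section \<open>The algebra H as a quotient of a free algebra, and its modules as matrices\<close>

context gd
begin

definition "S = hopf_gens G"

abbreviation FA :: "('k, 'g hopf_gen list \<Rightarrow>\<^sub>0 'k) module" where "FA \<equiv> monoid_algebra (word_monoid S)"

abbreviation J where "J \<equiv> hopf_ideal G \<chi> n"
abbreviation H where "H \<equiv> hopf_alg G \<chi> n"
abbreviation ge where "ge \<equiv> hopf_gen_elt G \<chi> n"

sublocale fa: monoid_alg "word_monoid S" "TYPE('k)"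
  by (simp add: monoid_alg_def word_monoid)

lemma free_algebra_eq: "free_algebra (hopf_gens G) = FA"
  by (simp add: free_algebra_def word_monoid_def S_def)

lemma word_carrier [simp]: "carrier (word_monoid S) = lists S" "u \<otimes>\<^bsub>word_monoid S\<^esub> v = u @ v" "\<one>\<^bsub>word_monoid S\<^esub> = []"
  by (simp_all add: word_monoid_def)

lemma S_mem [simp]: "Y \<in> S" "Gr h \<in> S \<longleftrightarrow> h \<in> carrier G"
  by (auto simp: S_def hopf_gens_def)

lemma hopf_rels_closed: "hopf_rels G \<chi> n \<subseteq> carrier FA"
proof
  have d: "x - y \<in> carrier FA" if "x \<in> carrier FA" "y \<in> carrier FA" for x y :: "'g hopf_gen list \<Rightarrow>\<^sub>0 'k"
    using that unfolding monoid_algebra_simps mem_Collect_eq by (rule keys_diff_subset)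
  have s: "Poly_Mapping.single w c \<in> carrier FA" if "set w \<subseteq> S" for w and c :: 'k
    using that by (intro fa.sg_closed) auto
  fix x assume "x \<in> hopf_rels G \<chi> n"
  then consider h h' where "h \<in> carrier G" "h' \<in> carrier G"
     "x = Poly_Mapping.single [Gr h, Gr h'] 1 - Poly_Mapping.single [Gr (h \<otimes>\<^bsub>G\<^esub> h')] 1"
   | "x = Poly_Mapping.single [Gr \<one>\<^bsub>G\<^esub>] 1 - Poly_Mapping.single [] 1"
   | "x = Poly_Mapping.single (replicate n Y) 1"
   | h where "h \<in> carrier G" "x = Poly_Mapping.single [Y, Gr h] 1 - Poly_Mapping.single [Gr h, Y] (\<chi> h)"
    unfolding hopf_rels_def by blast
  thus "x \<in> carrier FA"
    by cases (auto intro!: d s)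
qed

sublocale J: ideal J FA
  unfolding hopf_ideal_def free_algebra_eq by (rule fa.MA.genideal_ideal[OF hopf_rels_closed])

lemma rels_in_J: "x \<in> hopf_rels G \<chi> n \<Longrightarrow> x \<in> J"
  unfolding hopf_ideal_def free_algebra_eq using fa.MA.genideal_self[OF hopf_rels_closed] by blast

abbreviation cs where "cs x \<equiv> J +>\<^bsub>FA\<^esub> x"

lemma H_carrier: "X \<in> carrier H \<longleftrightarrow> (\<exists>x\<in>carrier FA. X = cs x)"
  by (simp add: hopf_alg_def quot_algebra_def free_algebra_eq J.quot_carrier)

lemma H_ops:
  "x \<in> carrier FA \<Longrightarrow> y \<in> carrier FA \<Longrightarrow> cs x \<otimes>\<^bsub>H\<^esub> cs y = cs (x \<otimes>\<^bsub>FA\<^esub> y)"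
  "x \<in> carrier FA \<Longrightarrow> y \<in> carrier FA \<Longrightarrow> cs x \<oplus>\<^bsub>H\<^esub> cs y = cs (x + y)"
  "\<one>\<^bsub>H\<^esub> = cs (Poly_Mapping.single [] 1)"
  using J.quot_mult J.quot_add J.quot_one
  by (simp_all add: hopf_alg_def quot_algebra_def free_algebra_eq monoid_algebra_simps)

lemma fa_smult_closed: "x \<in> carrier FA \<Longrightarrow> c \<odot>\<^bsub>FA\<^esub> x \<in> carrier FA"
  using fa.mult_closed[of "Poly_Mapping.single [] c" x]
  by (subst fa.MA_smult) (auto simp: monoid_algebra_simps)

text \<open>The scalar multiple of a coset is defined as a union over its elements. Multiplication
  by c is multiplication by c times the empty word, so all these elements give the same coset of the
  ideal.\<close>

lemma H_smult:
  assumes x: "x \<in> carrier FA"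
  shows "c \<odot>\<^bsub>H\<^esub> cs x = cs (c \<odot>\<^bsub>FA\<^esub> x)"
proof -
  have "cs (c \<odot>\<^bsub>FA\<^esub> y) = cs (c \<odot>\<^bsub>FA\<^esub> x)" if y: "y \<in> cs x" for y
  proof -
    have yc: "y \<in> carrier FA" using y x J.a_rcosets_carrier[of "cs x"] by (auto simp: A_RCOSETS_def')
    have k: "Poly_Mapping.keys x \<subseteq> lists S" "Poly_Mapping.keys y \<subseteq> lists S" using x yc by (simp_all add: monoid_algebra_simps)
    let ?c = "Poly_Mapping.single [] c :: 'g hopf_gen list \<Rightarrow>\<^sub>0 'k"
    have cc: "?c \<in> carrier FA" by (intro fa.sg_closed) simp
    have "cs y = cs x" using J.a_repr_independence'[OF y x] by simp
    hence "cs (?c \<otimes>\<^bsub>FA\<^esub> y) = cs (?c \<otimes>\<^bsub>FA\<^esub> x)"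
      using J.quot_mult[OF cc yc] J.quot_mult[OF cc x] by simp
    thus ?thesis using k by (simp add: fa.MA_smult)
  qed
  moreover have "x \<in> cs x" by (rule J.a_rcos_self[OF x])
  ultimately have "(\<Union>y\<in>cs x. cs (c \<odot>\<^bsub>FA\<^esub> y)) = cs (c \<odot>\<^bsub>FA\<^esub> x)" by blast
  thus ?thesis by (simp add: hopf_alg_def quot_algebra_def free_algebra_eq)
qed

lemma ge_eq: "ge s = cs (Poly_Mapping.single [s] 1)"
  by (simp add: hopf_gen_elt_def free_algebra_eq)

lemma ge_closed: "s \<in> S \<Longrightarrow> ge s \<in> carrier H"
  unfolding ge_eq H_carrier by (rule bexI[where x = "Poly_Mapping.single [s] 1"]) (auto intro!: fa.sg_closed)

lemma pull_module:
  assumes "alg_module H M"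
  shows "alg_module FA (mdim M, \<lambda>x. act M (cs x))"
proof (rule alg_moduleI)
  fix x y assume xy: "x \<in> carrier FA" "y \<in> carrier FA"
  hence c: "cs x \<in> carrier H" "cs y \<in> carrier H" by (auto simp: H_carrier)
  show "act (mdim M, \<lambda>x. act M (cs x)) (x \<otimes>\<^bsub>FA\<^esub> y) = act (mdim M, \<lambda>x. act M (cs x)) x * act (mdim M, \<lambda>x. act M (cs x)) y"
    using alg_moduleD(2)[OF assms c] H_ops(1)[OF xy] by simp
  show "act (mdim M, \<lambda>x. act M (cs x)) (x \<oplus>\<^bsub>FA\<^esub> y) = act (mdim M, \<lambda>x. act M (cs x)) x + act (mdim M, \<lambda>x. act M (cs x)) y"
    using alg_moduleD(3)[OF assms c] H_ops(2)[OF xy] by (simp add: monoid_algebra_simps)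
next
  fix x c assume x: "x \<in> carrier FA"
  hence c: "cs x \<in> carrier H" by (auto simp: H_carrier)
  show "act (mdim M, \<lambda>x. act M (cs x)) x \<in> carrier_mat (mdim (mdim M, \<lambda>x. act M (cs x))) (mdim (mdim M, \<lambda>x. act M (cs x)))"
    using alg_moduleD(1)[OF assms c] by simp
  show "act (mdim M, \<lambda>x. act M (cs x)) (c \<odot>\<^bsub>FA\<^esub> x) = c \<cdot>\<^sub>m act (mdim M, \<lambda>x. act M (cs x)) x"
    using alg_moduleD(5)[OF assms c] H_smult[OF x] by simp
next
  show "act (mdim M, \<lambda>x. act M (cs x)) \<one>\<^bsub>FA\<^esub> = 1\<^sub>m (mdim (mdim M, \<lambda>x. act M (cs x)))"
    using alg_moduleD(4)[OF assms] H_ops(3) by (simp add: monoid_algebra_simps)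
qed

definition hr :: "('k, 'g) hmod \<Rightarrow> 'g \<Rightarrow> 'k mat" where "hr M h = act M (ge (Gr h))"
definition hy :: "('k, 'g) hmod \<Rightarrow> 'k mat" where "hy M = act M (ge Y)"

text \<open>The presentation of H in matrices: a representation of G together with a matrix for y
  that satisfies the remaining relations.\<close>

definition hrep :: "nat \<Rightarrow> ('g \<Rightarrow> 'k mat) \<Rightarrow> 'k mat \<Rightarrow> bool" where
  "hrep d r y \<longleftrightarrow> rep d r \<and> y \<in> carrier_mat d d \<and> y ^\<^sub>m n = 0\<^sub>m d d \<and>
     (\<forall>h\<in>carrier G. y * r h = \<chi> h \<cdot>\<^sub>m (r h * y))"

lemma act_word:
  assumes M: "alg_module H M" and w: "set w \<subseteq> S"
  shows "act M (cs (Poly_Mapping.single w 1)) = word_act (mdim M) (\<lambda>s. act M (ge s)) w"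
  using w
proof (induction w)
  case Nil
  thus ?case using alg_moduleD(4)[OF M] H_ops(3) by simp
next
  case (Cons s w)
  have c: "Poly_Mapping.single [s] 1 \<in> carrier FA" "Poly_Mapping.single w 1 \<in> carrier FA"
    using Cons.prems by (auto intro!: fa.sg_closed)
  have e: "Poly_Mapping.single (s # w) 1 = Poly_Mapping.single [s] 1 \<otimes>\<^bsub>FA\<^esub> Poly_Mapping.single w 1"
    by (simp add: fa.mult_sg)
  have "act M (cs (Poly_Mapping.single (s # w) 1)) = act M (ge s) * act M (cs (Poly_Mapping.single w 1))"
    unfolding e using alg_moduleD(2)[OF pull_module[OF M] c] by (simp add: ge_eq)
  thus ?case using Cons by simp
qed

text \<open>The relations lie in the ideal, so the two sides of each relation have the same image in
  H and hence act by the same matrix.\<close>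

lemma hrep_of_module:
  assumes M: "alg_module H M"
  shows "hrep (mdim M) (hr M) (hy M)"
proof -
  let ?d = "mdim M" and ?f = "\<lambda>s. act M (ge s)"
  let ?s = "\<lambda>w. Poly_Mapping.single w (1 :: 'k)"
  have c: "?f s \<in> carrier_mat ?d ?d" if "s \<in> S" for s using alg_moduleD(1)[OF M ge_closed[OF that]] .
  have eq: "act M (cs x) = act M (cs y)" if "x - y \<in> hopf_rels G \<chi> n" "x \<in> carrier FA" "y \<in> carrier FA" for x y
    using J.quot_eq[OF that(2,3)] rels_in_J[OF that(1)] fa.MA_minus(2)[OF that(3,2)] by simp
  have sc: "Poly_Mapping.single w x \<in> carrier FA" if "set w \<subseteq> S" for w and x :: 'k
    using that by (auto intro!: fa.sg_closed)
  have m: "hr M (h \<otimes> h') = hr M h * hr M h'" if "h \<in> carrier G" "h' \<in> carrier G" for h h'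
  proof -
    have "act M (cs (?s [Gr h, Gr h'])) = act M (cs (?s [Gr (h \<otimes> h')]))"
      by (rule eq) (use that in \<open>auto simp: hopf_rels_def intro!: sc\<close>)
    moreover have "?f (Gr h) \<in> carrier_mat ?d ?d" "?f (Gr h') \<in> carrier_mat ?d ?d" "?f (Gr (h \<otimes> h')) \<in> carrier_mat ?d ?d"
      using that by (auto intro!: c)
    ultimately show ?thesis using that by (simp add: act_word[OF M] hr_def)
  qed
  have one: "hr M \<one> = 1\<^sub>m ?d"
  proof -
    have "act M (cs (?s [Gr \<one>])) = act M (cs (?s []))"
      by (rule eq) (auto simp: hopf_rels_def intro!: sc)
    thus ?thesis using c[of "Gr \<one>"] by (simp add: act_word[OF M] hr_def)
  qed
  have nil: "hy M ^\<^sub>m n = 0\<^sub>m ?d ?d"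
  proof -
    have z: "0 \<in> carrier FA" by (simp add: monoid_algebra_simps)
    have "act M (cs (?s (replicate n Y))) = act M (cs 0)"
      by (rule eq) (auto simp: hopf_rels_def z intro!: sc)
    moreover have "(0 :: 'g hopf_gen list \<Rightarrow>\<^sub>0 'k) = 0 \<odot>\<^bsub>FA\<^esub> 0"
      by (auto simp: monoid_algebra_def lookup_map_mult intro!: poly_mapping_eqI)
    hence "act M (cs 0) = 0 \<cdot>\<^sub>m act M (cs 0)" using alg_moduleD(5)[OF pull_module[OF M] z, of 0] by simp
    hence "act M (cs 0) = 0\<^sub>m ?d ?d" using alg_moduleD(1)[OF pull_module[OF M] z]
      by (metis (no_types, lifting) carrier_matD eq_matI fst_conv index_smult_mat index_zero_mat mult_zero_left snd_conv)
    ultimately show ?thesis using c[of Y] by (simp add: act_word[OF M] word_act_replicate set_replicate_conv_if hy_def)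
  qed
  have "hy M * hr M h = \<chi> h \<cdot>\<^sub>m (hr M h * hy M)" if h: "h \<in> carrier G" for h
  proof -
    have "act M (cs (?s [Y, Gr h])) = act M (cs (Poly_Mapping.single [Gr h, Y] (\<chi> h)))"
      by (rule eq) (use h in \<open>auto simp: hopf_rels_def intro!: sc\<close>)
    also have "Poly_Mapping.single [Gr h, Y] (\<chi> h) = \<chi> h \<odot>\<^bsub>FA\<^esub> ?s [Gr h, Y]"
      using h by (subst fa.MA_smult) (auto simp: fa.mult_sg)
    also have "act M (cs \<dots>) = \<chi> h \<cdot>\<^sub>m act M (cs (?s [Gr h, Y]))"
      using alg_moduleD(5)[OF pull_module[OF M] sc[of "[Gr h, Y]" 1]] h by simp
    finally show ?thesis using h c[of Y] c[of "Gr h"] by (simp add: act_word[OF M] hr_def hy_def)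
  qed
  thus ?thesis using m one nil c[of Y] c[of "Gr _"] by (auto simp: hrep_def rep_def hr_def hy_def)
qed

text \<open>The universal property of the presentation. The action of words extends linearly to the
  free algebra, kills the relations and hence the ideal, and so descends to H; this supplies the
  witness for the choice in \<open>gen_module\<close>.\<close>

lemma hopf_module:
  assumes f: "hrep d (\<lambda>h. f (Gr h)) (f Y)"
  shows "alg_module H (hopf_module G \<chi> n d f)" "mdim (hopf_module G \<chi> n d f) = d"
    "h \<in> carrier G \<Longrightarrow> hr (hopf_module G \<chi> n d f) h = f (Gr h)" "hy (hopf_module G \<chi> n d f) = f Y"
proof -
  have r: "rep d (\<lambda>h. f (Gr h))" and y: "f Y \<in> carrier_mat d d" "f Y ^\<^sub>m n = 0\<^sub>m d d"
    and yh: "\<And>h. h \<in> carrier G \<Longrightarrow> f Y * f (Gr h) = \<chi> h \<cdot>\<^sub>m (f (Gr h) * f Y)" using f by (auto simp: hrep_def)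
  have fc: "f s \<in> carrier_mat d d" if "s \<in> S" for s
    using that y(1) repD(1)[OF r] by (cases s) auto
  let ?w = "word_act d f" and ?e = "lin_ext d (word_act d f)"
  have wc: "?w w \<in> carrier_mat d d" if "w \<in> lists S" for w
    using that by (intro word_act_carrier fc) auto
  have wc': "?w w \<in> carrier_mat d d" if "set w \<subseteq> S" for w
    using that by (intro wc) auto
  have e: "alg_module FA (d, ?e)"
    by (rule alg_module_lin_ext[OF word_monoid]) (auto simp del: in_lists_conv_set simp: in_listsD intro!: wc word_act_append fc)
  have es: "?e (Poly_Mapping.single w c) = c \<cdot>\<^sub>m ?w w" if "set w \<subseteq> S" for w c
    by (rule lin_ext_single[of "word_act d f", OF wc'[OF that]])
  have eadd: "?e (x + y) = ?e x + ?e y" if "x \<in> carrier FA" "y \<in> carrier FA" for x y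
    using alg_moduleD(3)[OF e that] by (simp add: monoid_algebra_simps)
  have hom: "ring_hom_ring FA (ring_mat TYPE('k) d ()) ?e"
    using e by (intro ring_hom_ringI2 fa.MA.ring_axioms ring_mat) (simp add: alg_module_def)
  interpret h: ring_hom_ring FA "ring_mat TYPE('k) d ()" ?e by (rule hom)
  have ediff: "?e (x - y) = ?e x - ?e y" if "x \<in> carrier FA" "y \<in> carrier FA" for x y
  proof -
    have "x - y \<in> carrier FA" using that unfolding monoid_algebra_simps mem_Collect_eq by (rule keys_diff_subset)
    hence "?e x = ?e (x - y) + ?e y" using eadd[of "x - y" y] that by simp
    thus ?thesis by (auto simp: mat_eq_iff)
  qed
  have sc: "Poly_Mapping.single w x \<in> carrier FA" if "set w \<subseteq> S" for w and x :: 'k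
    using that by (auto intro!: fa.sg_closed)
  have rel: "?e x = 0\<^sub>m d d" if "x \<in> hopf_rels G \<chi> n" for x
  proof -
    have dz: "A - A = 0\<^sub>m d d" if "A \<in> carrier_mat d d" for A :: "'k mat" using that by auto
    from that consider h h' where "h \<in> carrier G" "h' \<in> carrier G"
       "x = Poly_Mapping.single [Gr h, Gr h'] 1 - Poly_Mapping.single [Gr (h \<otimes>\<^bsub>G\<^esub> h')] 1"
     | "x = Poly_Mapping.single [Gr \<one>\<^bsub>G\<^esub>] 1 - Poly_Mapping.single [] 1"
     | "x = Poly_Mapping.single (replicate n Y) 1"
     | h where "h \<in> carrier G" "x = Poly_Mapping.single [Y, Gr h] 1 - Poly_Mapping.single [Gr h, Y] (\<chi> h)"
      unfolding hopf_rels_def by blast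
    thus ?thesis
    proof cases
      case 1
      hence "?e x = ?e (Poly_Mapping.single [Gr h, Gr h'] 1) - ?e (Poly_Mapping.single [Gr (h \<otimes>\<^bsub>G\<^esub> h')] 1)"
        by (simp add: ediff sc)
      thus ?thesis using 1 fc[of "Gr h"] fc[of "Gr h'"] by (simp add: es repD(3)[OF r] dz)
    next
      case 2
      hence "?e x = ?e (Poly_Mapping.single [Gr \<one>\<^bsub>G\<^esub>] 1) - ?e (Poly_Mapping.single [] 1)"
        by (simp add: ediff sc)
      thus ?thesis by (simp add: es repD(2)[OF r] dz)
    next
      case 3
      thus ?thesis using y by (simp add: es set_replicate_conv_if word_act_replicate)
    next
      case 4
      hence "?e x = ?e (Poly_Mapping.single [Y, Gr h] 1) - ?e (Poly_Mapping.single [Gr h, Y] (\<chi> h))"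
        by (simp add: ediff sc)
      thus ?thesis using 4 fc[of "Gr h"] y(1) by (simp add: es yh dz)
    qed
  qed
  have ak: "a_kernel FA (ring_mat TYPE('k) d ()) ?e = {x \<in> carrier FA. ?e x = 0\<^sub>m d d}"
    by (simp only: a_kernel_def' ring_mat_simps)
  have "hopf_rels G \<chi> n \<subseteq> a_kernel FA (ring_mat TYPE('k) d ()) ?e"
    unfolding ak using rel hopf_rels_closed by blast
  hence "J \<subseteq> a_kernel FA (ring_mat TYPE('k) d ()) ?e"
    unfolding hopf_ideal_def free_algebra_eq by (rule fa.MA.genideal_minimal[OF h.kernel_is_ideal])
  hence ker: "?e x = 0\<^sub>m d d" if "x \<in> J" for x using that unfolding ak by blast
  have "\<exists>f'. \<forall>a\<in>carrier FA. f' (cs a) = ?e a"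
  proof (rule J.quot_lift)
    fix a b assume ab: "a \<in> carrier FA" "b \<in> carrier FA" "a \<ominus>\<^bsub>FA\<^esub> b \<in> J"
    have "?e a - ?e b = 0\<^sub>m d d" using ker[OF ab(3)] fa.MA_minus(2)[OF ab(2,1)] ediff[OF ab(1,2)] by simp
    thus "?e a = ?e b" by (auto simp: mat_eq_iff)
  qed
  then obtain \<rho> where \<rho>: "\<And>a. a \<in> carrier FA \<Longrightarrow> \<rho> (cs a) = ?e a" by blast
  have "alg_module H (d, \<rho>)"
  proof (rule alg_moduleI)
    fix x z assume "x \<in> carrier H" "z \<in> carrier H"
    then obtain a b where ab: "a \<in> carrier FA" "b \<in> carrier FA" "x = cs a" "z = cs b" unfolding H_carrier by blast
    have "a \<otimes>\<^bsub>FA\<^esub> b \<in> carrier FA" "a + b \<in> carrier FA"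
      using ab fa.MA.m_closed fa.MA.a_closed[of a b] by (auto simp: monoid_algebra_simps(3))
    thus "act (d, \<rho>) (x \<otimes>\<^bsub>H\<^esub> z) = act (d, \<rho>) x * act (d, \<rho>) z" "act (d, \<rho>) (x \<oplus>\<^bsub>H\<^esub> z) = act (d, \<rho>) x + act (d, \<rho>) z"
      using ab alg_moduleD(2)[OF e ab(1,2)] eadd by (simp_all add: H_ops \<rho>)
  next
    fix x c assume "x \<in> carrier H"
    then obtain a where a: "a \<in> carrier FA" "x = cs a" unfolding H_carrier by blast
    show "act (d, \<rho>) x \<in> carrier_mat (mdim (d, \<rho>)) (mdim (d, \<rho>))" using a by (simp add: \<rho>)
    show "act (d, \<rho>) (c \<odot>\<^bsub>H\<^esub> x) = c \<cdot>\<^sub>m act (d, \<rho>) x"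
      using a alg_moduleD(5)[OF e a(1)] fa_smult_closed[OF a(1)] by (simp add: H_smult \<rho>)
  next
    show "act (d, \<rho>) \<one>\<^bsub>H\<^esub> = 1\<^sub>m (mdim (d, \<rho>))" by (simp add: H_ops \<rho> sc es)
  qed
  moreover have "\<forall>s\<in>S. \<rho> (ge s) = f s"
  proof
    fix s assume s: "s \<in> S"
    show "\<rho> (ge s) = f s" using s fc[OF s] by (simp add: ge_eq \<rho> sc es)
  qed
  ultimately have "\<exists>\<rho>. alg_module H (d, \<rho>) \<and> (\<forall>s\<in>S. \<rho> (ge s) = f s)" by blast
  from someI_ex[OF this]
  show "alg_module H (hopf_module G \<chi> n d f)" "mdim (hopf_module G \<chi> n d f) = d"
    "h \<in> carrier G \<Longrightarrow> hr (hopf_module G \<chi> n d f) h = f (Gr h)" "hy (hopf_module G \<chi> n d f) = f Y"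
    by (simp_all add: hopf_module_def gen_module_def hr_def hy_def S_def[symmetric])
qed

text \<open>Compatibility with the generators passes to words by induction and then to the free
  algebra by linearity.\<close>

lemma H_intertwiners:
  assumes M: "alg_module H M" and N: "alg_module H N"
  shows "P \<in> intertwiners H M N \<longleftrightarrow> P \<in> homs (mdim M) (hr M) (mdim N) (hr N) \<and> P * hy M = hy N * P"
proof
  assume "P \<in> intertwiners H M N"
  thus "P \<in> homs (mdim M) (hr M) (mdim N) (hr N) \<and> P * hy M = hy N * P"
    using ge_closed by (auto simp: intertwiners_def homs_def hr_def hy_def)
next
  assume P: "P \<in> homs (mdim M) (hr M) (mdim N) (hr N) \<and> P * hy M = hy N * P"
  hence Pc: "P \<in> carrier_mat (mdim N) (mdim M)" by (auto simp: homs_def)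
  have Ps: "P * act M (ge s) = act N (ge s) * P" if "s \<in> S" for s
    using P that by (cases s) (auto simp: homs_def hr_def hy_def)
  have "P * act M (cs (Poly_Mapping.single w 1)) = act N (cs (Poly_Mapping.single w 1)) * P" if "set w \<subseteq> S" for w
    unfolding act_word[OF M that] act_word[OF N that] using that
  proof (induction w)
    case Nil
    thus ?case using Pc by simp
  next
    case (Cons s w)
    have s: "s \<in> S" using Cons.prems by simp
    note c = Pc alg_moduleD(1)[OF M ge_closed[OF s]] alg_moduleD(1)[OF N ge_closed[OF s]]
    have wc: "word_act (mdim M) (\<lambda>s. act M (ge s)) w \<in> carrier_mat (mdim M) (mdim M)"
      "word_act (mdim N) (\<lambda>s. act N (ge s)) w \<in> carrier_mat (mdim N) (mdim N)"
      using Cons.prems alg_moduleD(1)[OF M ge_closed] alg_moduleD(1)[OF N ge_closed] by (auto intro!: word_act_carrier)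
    have "P * (act M (ge s) * word_act (mdim M) (\<lambda>s. act M (ge s)) w) =
       P * act M (ge s) * word_act (mdim M) (\<lambda>s. act M (ge s)) w"
      by (rule mat_assoc[symmetric]) (use c wc in simp_all)
    also have "\<dots> = act N (ge s) * (P * word_act (mdim M) (\<lambda>s. act M (ge s)) w)"
      unfolding Ps[OF s] by (rule mat_assoc) (use c wc in simp_all)
    also have "\<dots> = act N (ge s) * word_act (mdim N) (\<lambda>s. act N (ge s)) w * P"
      using c wc Cons by (simp add: mat_assoc)
    finally show ?case by simp
  qed
  hence "P \<in> intertwiners FA (mdim M, \<lambda>x. act M (cs x)) (mdim N, \<lambda>x. act N (cs x))"
    by (intro act_pm_induct pull_module M N word_monoid) (use Pc in auto)
  thus "P \<in> intertwiners H M N" by (auto simp: intertwiners_def H_carrier)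
qed

end

section \<open>Matrices attached to strings\<close>

lemma pow_mat_carrier: "A \<in> carrier_mat d d \<Longrightarrow> A ^\<^sub>m k \<in> carrier_mat d d"
  by (rule pow_carrier_mat)

lemma pow_mat_add:
  assumes "A \<in> carrier_mat d d"
  shows "A ^\<^sub>m (i + j) = A ^\<^sub>m i * A ^\<^sub>m j"
  using assms pow_mat_carrier[OF assms] by (induction j) (simp_all add: mat_assoc)

lemma pow_mat_zero_mono:
  assumes "A \<in> carrier_mat d d" "A ^\<^sub>m i = 0\<^sub>m d d" "i \<le> j"
  shows "A ^\<^sub>m j = 0\<^sub>m d d"
  using pow_mat_add[OF assms(1), of i "j - i"] assms pow_mat_carrier[OF assms(1), of "j - i"] by simp

lemma kron_pow:
  fixes A :: "'a::comm_semiring_1 mat"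
  assumes "A \<in> carrier_mat a a" "B \<in> carrier_mat b b"
  shows "kron A B ^\<^sub>m k = kron (A ^\<^sub>m k) (B ^\<^sub>m k)"
  using assms pow_mat_carrier[OF assms(1)] pow_mat_carrier[OF assms(2)]
  by (induction k) (simp_all add: kron_one kron_mult)

text \<open>The k-th power of the nilpotent Jordan block, which is how \<open>y^k\<close> acts on a
  string of length l. The transposed matrix \<open>uh\<close> is a pseudo inverse of it.\<close>

definition sh :: "nat \<Rightarrow> nat \<Rightarrow> 'a::{zero,one} mat" where
  "sh l k = mat l l (\<lambda>(r, c). if r = c + k then 1 else 0)"

definition uh :: "nat \<Rightarrow> nat \<Rightarrow> 'a::{zero,one} mat" where
  "uh l k = mat l l (\<lambda>(r, c). if r + k = c then 1 else 0)"

lemma sh_carrier [simp]: "sh l k \<in> carrier_mat l l" "dim_row (sh l k) = l" "dim_col (sh l k) = l"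
  and uh_carrier [simp]: "uh l k \<in> carrier_mat l l" "dim_row (uh l k) = l" "dim_col (uh l k) = l"
  by (simp_all add: sh_def uh_def)

lemma mat_diag_dims [simp]: "dim_row (mat_diag l f) = l" "dim_col (mat_diag l f) = l"
  using mat_diag_dim[of l f] by (auto simp del: mat_diag_dim)

lemma mat_diag_index: "i < l \<Longrightarrow> j < l \<Longrightarrow> mat_diag l f $$ (i, j) = (if i = j then f j else 0)"
  by (simp add: mat_diag_def)

lemma sh_mult_left:
  fixes X :: "'a::semiring_1 mat"
  assumes "X \<in> carrier_mat l m"
  shows "sh l a * X = mat l m (\<lambda>(r, c). if a \<le> r then X $$ (r - a, c) else 0)"
proof (rule eq_matI, goal_cases)
  case (1 i j)
  hence ij: "i < l" "j < m" by simp_all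
  have "(sh l a * X) $$ (i, j) = (\<Sum>k<l. sh l a $$ (i, k) * X $$ (k, j))"
    by (rule mult_index_sum) (use ij assms in auto)
  also have "\<dots> = (\<Sum>k<l. if k = i - a then (if a \<le> i then X $$ (k, j) else 0) else 0)"
    using ij by (intro sum.cong) (auto simp: sh_def)
  also have "\<dots> = (if a \<le> i then X $$ (i - a, j) else 0)" using less_imp_diff_less[OF ij(1), of a] by simp
  finally show ?case using ij by simp
qed (use assms in auto)

lemma uh_mult_left:
  fixes X :: "'a::semiring_1 mat"
  assumes "X \<in> carrier_mat l m"
  shows "uh l a * X = mat l m (\<lambda>(r, c). if r + a < l then X $$ (r + a, c) else 0)"
proof (rule eq_matI, goal_cases)
  case (1 i j)
  hence ij: "i < l" "j < m" by simp_all
  have "(uh l a * X) $$ (i, j) = (\<Sum>k<l. uh l a $$ (i, k) * X $$ (k, j))"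
    by (rule mult_index_sum) (use ij assms in auto)
  also have "\<dots> = (\<Sum>k<l. if k = i + a then X $$ (k, j) else 0)"
    using ij by (intro sum.cong) (auto simp: uh_def)
  also have "\<dots> = (if i + a < l then X $$ (i + a, j) else 0)" using ij by simp
  finally show ?case using ij by simp
qed (use assms in auto)

lemma mat_diag_left: "A \<in> carrier_mat l m \<Longrightarrow> mat_diag l f * A = mat l m (\<lambda>(i, j). f i * (A :: 'a::semiring_0 mat) $$ (i, j))"
  by (rule mat_diag_mult_left)

lemma sh_sh: "sh l a * sh l b = (sh l (a + b) :: 'a::semiring_1 mat)"
  by (subst sh_mult_left[of _ l l], simp) (rule eq_matI, auto simp: sh_def)

lemma one_pow [simp]: "(1\<^sub>m d :: 'a::semiring_1 mat) ^\<^sub>m k = 1\<^sub>m d"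
  by (induction k) simp_all

lemma sh_pow [simp]: "(sh l (Suc 0) :: 'a::semiring_1 mat) ^\<^sub>m k = sh l k"
  by (induction k) (auto simp: sh_sh, auto simp: sh_def)

lemma sh_zero: "l \<le> k \<Longrightarrow> sh l k = 0\<^sub>m l l"
  by (auto simp: sh_def)

lemma sh_uh: "sh l k * uh l k = (mat_diag l (\<lambda>c. if k \<le> c then 1 else 0) :: 'a::semiring_1 mat)"
  by (subst sh_mult_left[of _ l l]) (auto simp: uh_def mat_diag_def)

lemma uh_sh: "uh l k * sh l k = (mat_diag l (\<lambda>c. if c + k < l then 1 else 0) :: 'a::semiring_1 mat)"
  by (subst uh_mult_left[of _ l l]) (auto simp: sh_def mat_diag_def)

lemma sh_uh_sh: "sh l k * uh l k * sh l k = (sh l k :: 'a::semiring_1 mat)"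
  unfolding sh_uh by (subst mat_diag_left[of _ l l]) (auto simp: sh_def)

lemma mtrace_mat_diag: "mtrace (mat_diag l f) = (\<Sum>i<l. f i)"
  by (simp add: mtrace_def mat_diag_index)

lemma kron_one_scalar: "kron (c \<cdot>\<^sub>m 1\<^sub>m 1) B = c \<cdot>\<^sub>m (B :: 'a::comm_semiring_1 mat)"
  by (simp only: kron_smult(1) kron_one_1)

lemma kron_zero_scalar: "kron (0\<^sub>m 1 1) B = 0\<^sub>m (dim_row B) (dim_col (B :: 'a::comm_semiring_1 mat))"
  by simp

lemma kron_diag_2:
  "kron (mat_diag 2 f) (B :: 'a::comm_semiring_1 mat) =
    four_block_mat (f 0 \<cdot>\<^sub>m B) (0\<^sub>m (dim_row B) (dim_col B)) (0\<^sub>m (dim_row B) (dim_col B)) (f 1 \<cdot>\<^sub>m B)"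
proof -
  have "mat_diag 2 f = four_block_mat (f 0 \<cdot>\<^sub>m 1\<^sub>m 1) (0\<^sub>m 1 1) (0\<^sub>m 1 1) (f 1 \<cdot>\<^sub>m 1\<^sub>m 1)"
    by (rule eq_matI) (auto simp: mat_diag_def less_Suc_eq numeral_2_eq_2)
  thus ?thesis by (simp only: kron_four_block[of _ 1 1 _ 1 _ 1] smult_carrier_mat one_carrier_mat
        zero_carrier_mat kron_one_scalar kron_zero_scalar)
qed

lemma kron_sh_2:
  "kron (sh 2 1) (B :: 'a::comm_semiring_1 mat) =
    four_block_mat (0\<^sub>m (dim_row B) (dim_col B)) (0\<^sub>m (dim_row B) (dim_col B)) B (0\<^sub>m (dim_row B) (dim_col B))"
proof -
  have "sh 2 1 = four_block_mat (0\<^sub>m 1 1) (0\<^sub>m 1 1) (1 \<cdot>\<^sub>m 1\<^sub>m 1 :: 'a mat) (0\<^sub>m 1 1)"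
    by (rule eq_matI) (auto simp: sh_def less_2_cases_iff)
  hence "kron (sh 2 1) B = four_block_mat (0\<^sub>m (dim_row B) (dim_col B)) (0\<^sub>m (dim_row B) (dim_col B)) (1 \<cdot>\<^sub>m B) (0\<^sub>m (dim_row B) (dim_col B))"
    by (simp only: kron_four_block[of _ 1 1 _ 1 _ 1] smult_carrier_mat one_carrier_mat
        zero_carrier_mat kron_one_scalar kron_zero_scalar)
  thus ?thesis by simp
qed

subsection \<open>The q-binomial theorem\<close>

text \<open>The Gaussian binomial coefficient, with the Pascal rule that belongs to B A = q A B and
  the normal order A^i B^(k-i): moving a new A to the left past B^(k-i) costs q^(k-i).\<close>

fun qbin :: "'a::comm_ring_1 \<Rightarrow> nat \<Rightarrow> nat \<Rightarrow> 'a" where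
  "qbin q k 0 = 1"
| "qbin q 0 (Suc i) = 0"
| "qbin q (Suc k) (Suc i) = qbin q k i * q ^ (k - i) + qbin q k (Suc i)"

lemma qbin_gt: "k < i \<Longrightarrow> qbin q k i = 0"
  by (induction q k i rule: qbin.induct) auto

text \<open>The quotient formula for Gaussian binomials with the denominator multiplied out, since 1
  - q^(i+1) may vanish at a root of unity.\<close>

lemma qbin_rec: "i \<le> k \<Longrightarrow> (1 - q ^ Suc i) * qbin q k (Suc i) = (1 - q ^ (k - i)) * qbin q k i"
proof (induction k arbitrary: i)
  case (Suc k)
  show ?case
  proof (cases "i = Suc k")
    case True
    thus ?thesis by (simp add: qbin_gt)
  next
    case False
    hence i: "i \<le> k" using Suc.prems by simp
    have qq: "q ^ Suc i * q ^ (k - i) = q ^ Suc k" using i by (simp add: mult.assoc power_add[symmetric])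
    have "(1 - q ^ Suc i) * qbin q (Suc k) (Suc i) =
       (1 - q ^ Suc i) * q ^ (k - i) * qbin q k i + (1 - q ^ Suc i) * qbin q k (Suc i)"
      by (simp add: algebra_simps)
    also have "\<dots> = (1 - q ^ Suc k) * qbin q k i"
      unfolding Suc.IH[OF i] qq[symmetric] by (simp add: algebra_simps)
    also have "\<dots> = (1 - q ^ (Suc k - i)) * qbin q (Suc k) i"
    proof (cases i)
      case (Suc i')
      have qi: "q ^ (Suc k - i) * q ^ i = q ^ Suc k" using i by (simp add: power_add[symmetric] del: power_Suc)
      have e: "Suc k - i = k - i'" using i Suc by simp
      have "(1 - q ^ (Suc k - i)) * qbin q (Suc k) i =
          q ^ (k - i') * ((1 - q ^ (k - i')) * qbin q k i') + (1 - q ^ (Suc k - i)) * qbin q k i"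
        unfolding Suc using e[unfolded Suc] by (simp add: algebra_simps)
      also have "(1 - q ^ (k - i')) * qbin q k i' = (1 - q ^ i) * qbin q k i"
        using Suc.IH[of i'] i Suc by simp
      also have "q ^ (k - i') * ((1 - q ^ i) * qbin q k i) + (1 - q ^ (Suc k - i)) * qbin q k i = (1 - q ^ Suc k) * qbin q k i"
        unfolding e[symmetric] qi[symmetric] by (simp add: algebra_simps)
      finally show ?thesis by simp
    qed simp
    finally show ?thesis .
  qed
qed (simp add: qbin_gt)

text \<open>In \<open>qbin_rec\<close> at i = 0 the factor 1 - q^k = 0 starts a chain of zeros, and
  1 - q^(i+1) can be cancelled as long as i + 1 < k.\<close>

lemma qbin_vanish:
  fixes q :: "'a::idom"
  assumes "q ^ k = 1" "\<And>i. 0 < i \<Longrightarrow> i < k \<Longrightarrow> q ^ i \<noteq> 1" "0 < i" "i < k"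
  shows "qbin q k i = 0"
  using assms(3,4)
proof (induction i)
  case (Suc i)
  have "(1 - q ^ Suc i) * qbin q k (Suc i) = (1 - q ^ (k - i)) * qbin q k i"
    by (rule qbin_rec) (use Suc in simp)
  also have "\<dots> = 0" using Suc assms(1) by (cases "i = 0") auto
  finally show ?case using assms(2)[of "Suc i"] Suc by auto
qed simp

lemma q_binomial:
  fixes A B :: "'a::comm_ring_1 mat"
  assumes A: "A \<in> carrier_mat d d" and B: "B \<in> carrier_mat d d" and BA: "B * A = q \<cdot>\<^sub>m (A * B)"
  shows "(A + B) ^\<^sub>m k = msum d d (\<lambda>i. qbin q k i \<cdot>\<^sub>m (A ^\<^sub>m i * B ^\<^sub>m (k - i))) {..k}"
proof (induction k)
  case 0
  show ?case using A B by (auto simp: msum_def)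
next
  case (Suc k)
  note Ac = pow_mat_carrier[OF A] and Bc = pow_mat_carrier[OF B]
  have BmA: "B ^\<^sub>m m * A = q ^ m \<cdot>\<^sub>m (A * B ^\<^sub>m m)" for m
  proof (induction m)
    case (Suc m)
    have "B ^\<^sub>m Suc m * A = B ^\<^sub>m m * (B * A)" using A B Bc[of m] by (simp add: mat_assoc)
    also have "\<dots> = q \<cdot>\<^sub>m (B ^\<^sub>m m * A * B)" unfolding BA using A B Bc[of m] by (simp add: smult_mat_mult mat_assoc)
    also have "\<dots> = q ^ Suc m \<cdot>\<^sub>m (A * B ^\<^sub>m Suc m)" unfolding Suc using A B Bc[of m]
      by (simp add: smult_mat_mult mat_assoc smult_smult_mat)
    finally show ?case .
  qed (use A B in simp)
  let ?T = "\<lambda>k i. A ^\<^sub>m i * B ^\<^sub>m (k - i)"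
  have Tc: "?T k i \<in> carrier_mat d d" for k i using Ac[of i] Bc[of "k - i"] by simp
  have step: "?T k i * (A + B) = q ^ (k - i) \<cdot>\<^sub>m ?T (Suc k) (Suc i) + ?T (Suc k) i" if "i \<le> k" for i
  proof -
    have "?T k i * (A + B) = A ^\<^sub>m i * (B ^\<^sub>m (k - i) * A) + A ^\<^sub>m i * (B ^\<^sub>m (k - i) * B)"
      using A B Ac[of i] Bc[of "k - i"] by (simp add: mat_distrib_left mat_assoc)
    also have "A ^\<^sub>m i * (B ^\<^sub>m (k - i) * A) = q ^ (k - i) \<cdot>\<^sub>m ?T (Suc k) (Suc i)"
      unfolding BmA using A B Ac[of i] Bc[of "k - i"] by (simp add: smult_mat_mult mat_assoc)
    also have "B ^\<^sub>m (k - i) * B = B ^\<^sub>m (Suc k - i)" using that by (simp add: Suc_diff_le)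
    finally show ?thesis .
  qed
  have "(A + B) ^\<^sub>m Suc k = msum d d (\<lambda>i. qbin q k i \<cdot>\<^sub>m ?T k i) {..k} * (A + B)"
    using Suc by simp
  also have "\<dots> = msum d d (\<lambda>i. qbin q k i \<cdot>\<^sub>m ?T k i * (A + B)) {..k}"
    by (rule msum_mult) (use A B Tc in auto)
  also have "\<dots> = msum d d (\<lambda>i. qbin q (Suc k) i \<cdot>\<^sub>m ?T (Suc k) i) {..Suc k}"
  proof (rule eq_matI, goal_cases)
    case (1 x y)
    hence xy: "x < d" "y < d" by simp_all
    define U where "U i = ?T (Suc k) i $$ (x, y)" for i
    have "msum d d (\<lambda>i. qbin q k i \<cdot>\<^sub>m ?T k i * (A + B)) {..k} $$ (x, y) =
       (\<Sum>i\<le>k. qbin q k i * (q ^ (k - i) * U (Suc i) + U i))"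
      unfolding msum_index[OF xy]
    proof (rule sum.cong[OF refl])
      fix i assume "i \<in> {..k}"
      hence i: "i \<le> k" by simp
      have "qbin q k i \<cdot>\<^sub>m ?T k i * (A + B) = qbin q k i \<cdot>\<^sub>m (?T k i * (A + B))"
        using A B Tc[of i k] by (simp add: smult_mat_mult)
      also have "\<dots> $$ (x, y) = qbin q k i * (q ^ (k - i) * U (Suc i) + U i)"
        unfolding step[OF i] using xy A B Tc[of "Suc i" "Suc k"] Tc[of i "Suc k"] by (simp add: U_def)
      finally show "(qbin q k i \<cdot>\<^sub>m ?T k i * (A + B)) $$ (x, y) = qbin q k i * (q ^ (k - i) * U (Suc i) + U i)" .
    qed
    also have "\<dots> = (\<Sum>i\<le>k. qbin q k i * q ^ (k - i) * U (Suc i)) + (\<Sum>i\<le>k. qbin q k i * U i)"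
      by (simp add: distrib_left sum.distrib mult.assoc)
    also have "(\<Sum>i\<le>k. qbin q k i * U i) = (\<Sum>i\<le>Suc k. qbin q k i * U i)"
      by (simp add: qbin_gt)
    also have "\<dots> = U 0 + (\<Sum>i\<le>k. qbin q k (Suc i) * U (Suc i))"
      by (subst sum.atMost_Suc_shift) simp
    also have "(\<Sum>i\<le>k. qbin q k i * q ^ (k - i) * U (Suc i)) + (U 0 + (\<Sum>i\<le>k. qbin q k (Suc i) * U (Suc i))) =
       U 0 + (\<Sum>i\<le>k. qbin q (Suc k) (Suc i) * U (Suc i))"
      by (simp add: distrib_right sum.distrib)
    also have "\<dots> = (\<Sum>i\<le>Suc k. qbin q (Suc k) i * U i)"
      by (subst sum.atMost_Suc_shift) simp
    also have "\<dots> = (\<Sum>i\<le>Suc k. (qbin q (Suc k) i \<cdot>\<^sub>m ?T (Suc k) i) $$ (x, y))"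
    proof (rule sum.cong[OF refl])
      fix i
      show "qbin q (Suc k) i * U i = (qbin q (Suc k) i \<cdot>\<^sub>m ?T (Suc k) i) $$ (x, y)"
        unfolding U_def using xy Tc[of i "Suc k"] by (subst index_smult_mat) auto
    qed
    finally show ?case using xy by simp
  qed simp_all
  finally show ?case .
qed

text \<open>Only the two pure powers survive the q-binomial expansion when q has order exactly k.
  This is the reason why y stays nilpotent of order n on tensor products.\<close>

lemma q_binomial_nilpotent:
  fixes A B :: "'a::idom mat"
  assumes A: "A \<in> carrier_mat d d" and B: "B \<in> carrier_mat d d" and BA: "B * A = q \<cdot>\<^sub>m (A * B)"
    and q: "q ^ k = 1" "\<And>i. 0 < i \<Longrightarrow> i < k \<Longrightarrow> q ^ i \<noteq> 1" and k: "0 < k"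
    and nil: "A ^\<^sub>m k = 0\<^sub>m d d" "B ^\<^sub>m k = 0\<^sub>m d d"
  shows "(A + B) ^\<^sub>m k = 0\<^sub>m d d"
proof -
  have "qbin q k i \<cdot>\<^sub>m (A ^\<^sub>m i * B ^\<^sub>m (k - i)) = 0\<^sub>m d d" if "i \<le> k" for i
  proof -
    note c = pow_mat_carrier[OF A, of i] pow_mat_carrier[OF B, of "k - i"]
    consider "i = 0" | "i = k" | "0 < i" "i < k" using \<open>i \<le> k\<close> by linarith
    thus ?thesis
    proof cases
      case 1
      thus ?thesis using c nil A by simp
    next
      case 2
      thus ?thesis using c nil B by simp
    next
      case 3
      have "qbin q k i = 0" by (rule qbin_vanish[OF q 3]) auto
      thus ?thesis using c A B by (intro eq_matI) auto
    qed
  qed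
  hence "msum d d (\<lambda>i. qbin q k i \<cdot>\<^sub>m (A ^\<^sub>m i * B ^\<^sub>m (k - i))) {..k} = msum d d (\<lambda>i. 0\<^sub>m d d) {..k}"
    by (intro msum_cong) auto
  also have "\<dots> = 0\<^sub>m d d" by (auto simp: msum_def)
  finally show ?thesis unfolding q_binomial[OF A B BA] .
qed

section \<open>Constructions of modules\<close>

lemma diag_block_mult:
  fixes A :: "'a::semiring_0 mat"
  assumes "A \<in> carrier_mat m m" "D \<in> carrier_mat k k" "A' \<in> carrier_mat m m" "D' \<in> carrier_mat k k"
  shows "four_block_mat A (0\<^sub>m m k) (0\<^sub>m k m) D * four_block_mat A' (0\<^sub>m m k) (0\<^sub>m k m) D' =
    four_block_mat (A * A') (0\<^sub>m m k) (0\<^sub>m k m) (D * D')"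
  using assms by (subst mult_four_block_mat[of _ m m _ k _ k _ _ m _ k]) auto

lemma dsum_module:
  assumes M: "alg_module A M" and N: "alg_module A N"
  shows "alg_module A (dsum_mod M N)"
proof (rule alg_moduleI)
  fix x y assume x: "x \<in> carrier A" and y: "y \<in> carrier A"
  note c = alg_moduleD(1)[OF M x] alg_moduleD(1)[OF N x] alg_moduleD(1)[OF M y] alg_moduleD(1)[OF N y]
  show "act (dsum_mod M N) (x \<otimes>\<^bsub>A\<^esub> y) = act (dsum_mod M N) x * act (dsum_mod M N) y"
    using c by (simp add: dsum_mod_def alg_moduleD(2)[OF M x y] alg_moduleD(2)[OF N x y]
        diag_block_mult)
  show "act (dsum_mod M N) (x \<oplus>\<^bsub>A\<^esub> y) = act (dsum_mod M N) x + act (dsum_mod M N) y"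
    using c by (simp add: dsum_mod_def alg_moduleD(3)[OF M x y] alg_moduleD(3)[OF N x y]
        add_four_block_mat[of _ "mdim M" "mdim M" _ "mdim N" _ "mdim N"])
next
  fix x c assume x: "x \<in> carrier A"
  note c = alg_moduleD(1)[OF M x] alg_moduleD(1)[OF N x]
  show "act (dsum_mod M N) x \<in> carrier_mat (mdim (dsum_mod M N)) (mdim (dsum_mod M N))"
    using c by (simp add: dsum_mod_def)
  show "act (dsum_mod M N) (c \<odot>\<^bsub>A\<^esub> x) = c \<cdot>\<^sub>m act (dsum_mod M N) x"
    using c by (simp add: dsum_mod_def alg_moduleD(5)[OF M x] alg_moduleD(5)[OF N x]
        smult_four_block_mat[of _ "mdim M" "mdim M" _ "mdim N" _ "mdim N"])
qed (simp add: dsum_mod_def alg_moduleD(4)[OF M] alg_moduleD(4)[OF N])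

lemma dsum_dim [simp]: "mdim (dsum_mod M N) = mdim M + mdim N"
  by (simp add: dsum_mod_def)

text \<open>Stacking p1 over p2 and placing i1 beside i2 gives mutually inverse matrices; blocks of
  width or height 0 let \<open>four_block_mat\<close> express this.\<close>

lemma iso_dsumI:
  fixes L :: "('k::field, 'a) fdmod"
  assumes L: "alg_module A L" and M: "alg_module A M" and N: "alg_module A N"
    and i: "i1 \<in> intertwiners A M L" "i2 \<in> intertwiners A N L"
    and p: "p1 \<in> intertwiners A L M" "p2 \<in> intertwiners A L N"
    and e: "p1 * i1 = 1\<^sub>m (mdim M)" "p2 * i2 = 1\<^sub>m (mdim N)" "p1 * i2 = 0\<^sub>m (mdim M) (mdim N)"
      "p2 * i1 = 0\<^sub>m (mdim N) (mdim M)" "i1 * p1 + i2 * p2 = 1\<^sub>m (mdim L)"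
  shows "iso_mod A L (dsum_mod M N)"
proof -
  let ?m = "mdim M" and ?n = "mdim N" and ?l = "mdim L"
  note c = intertwinersD(1)[OF i(1)] intertwinersD(1)[OF i(2)] intertwinersD(1)[OF p(1)] intertwinersD(1)[OF p(2)]
  define P where "P = four_block_mat p1 (0\<^sub>m ?m 0) p2 (0\<^sub>m ?n 0)"
  define Q where "Q = four_block_mat i1 i2 (0\<^sub>m 0 ?m) (0\<^sub>m 0 ?n)"
  have Pc: "P \<in> carrier_mat (?m + ?n) ?l" "Q \<in> carrier_mat ?l (?m + ?n)"
    using c by (auto simp: P_def Q_def)
  have PQ: "P * Q = 1\<^sub>m (?m + ?n)"
    unfolding P_def Q_def using c e
    by (subst mult_four_block_mat[of _ ?m ?l _ 0 _ ?n _ _ ?m _ ?n]) (auto simp: four_block_one_mat)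
  have "Q * P = four_block_mat (i1 * p1 + i2 * p2) (0\<^sub>m ?l 0) (0\<^sub>m 0 ?l) (0\<^sub>m 0 0)"
    unfolding P_def Q_def using c
    by (subst mult_four_block_mat[of _ ?l ?m _ ?n _ 0 _ _ ?l _ 0]) auto
  also have "\<dots> = 1\<^sub>m ?l" unfolding e by auto
  finally have QP: "Q * P = 1\<^sub>m ?l" .
  have "P \<in> intertwiners A L (dsum_mod M N)"
    unfolding intertwiners_def
  proof (intro CollectI conjI ballI)
    fix x assume x: "x \<in> carrier A"
    note cx = alg_moduleD(1)[OF L x] alg_moduleD(1)[OF M x] alg_moduleD(1)[OF N x]
    have Lx: "act L x = four_block_mat (act L x) (0\<^sub>m ?l 0) (0\<^sub>m 0 ?l) (0\<^sub>m 0 0)"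
      using cx by auto
    have "P * act L x = four_block_mat (p1 * act L x) (0\<^sub>m ?m 0) (p2 * act L x) (0\<^sub>m ?n 0)"
      unfolding P_def by (subst Lx, subst mult_four_block_mat[of _ ?m ?l _ 0 _ ?n _ _ ?l _ 0]) (use c cx in auto)
    also have "\<dots> = four_block_mat (act M x * p1) (0\<^sub>m ?m 0) (act N x * p2) (0\<^sub>m ?n 0)"
      using intertwinersD(2)[OF p(1) x] intertwinersD(2)[OF p(2) x] by simp
    also have "\<dots> = act (dsum_mod M N) x * P"
      unfolding P_def dsum_mod_def snd_conv
      by (subst mult_four_block_mat[of _ ?m ?m _ ?n _ ?n _ _ ?l _ 0]) (use c cx in auto)
    finally show "P * act L x = act (dsum_mod M N) x * P" .
  qed (use Pc in simp)
  thus ?thesis unfolding iso_mod_iff using Pc PQ QP by auto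
qed

context gd
begin

lemma n_pos [simp]: "0 < n" using n_ge_2 by simp

lemma chi_one: "\<chi> \<one> = 1"
  using chi_mult[of \<one> \<one>] chi_nonzero[of \<one>] by simp

lemma chi_inv: "h \<in> carrier G \<Longrightarrow> \<chi> (inv h) = inverse (\<chi> h)"
  using chi_mult[of h "inv h"] chi_one chi_nonzero[of h] by (simp add: field_simps)

lemma hrepD:
  assumes "hrep d r y"
  shows "rep d r" "y \<in> carrier_mat d d" "y ^\<^sub>m n = 0\<^sub>m d d" "h \<in> carrier G \<Longrightarrow> y * r h = \<chi> h \<cdot>\<^sub>m (r h * y)"
  using assms by (auto simp: hrep_def)

lemmas Hrep = hrepD[OF hrep_of_module]

lemma hr_carrier: "alg_module H M \<Longrightarrow> h \<in> carrier G \<Longrightarrow> hr M h \<in> carrier_mat (mdim M) (mdim M)"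
  using Hrep(1) repD(1) by blast

lemma hy_pow_carrier: "alg_module H M \<Longrightarrow> hy M ^\<^sub>m k \<in> carrier_mat (mdim M) (mdim M)"
  using Hrep(2) pow_mat_carrier by blast

lemma pow_commute:
  assumes "hrep d r y" "h \<in> carrier G"
  shows "y ^\<^sub>m k * r h = \<chi> h ^ k \<cdot>\<^sub>m (r h * y ^\<^sub>m k)"
proof (induction k)
  case 0
  show ?case using hrepD(2)[OF assms(1)] repD(1)[OF hrepD(1)[OF assms(1)] assms(2)] by simp
next
  case (Suc k)
  note c = hrepD(2)[OF assms(1)] repD(1)[OF hrepD(1)[OF assms(1)] assms(2)] pow_mat_carrier[OF hrepD(2)[OF assms(1)], of k]
  have "y ^\<^sub>m Suc k * r h = y ^\<^sub>m k * (y * r h)" using c by (simp add: mat_assoc)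
  also have "\<dots> = \<chi> h \<cdot>\<^sub>m (y ^\<^sub>m k * r h * y)"
    unfolding hrepD(4)[OF assms] using c by (simp add: smult_mat_mult mat_assoc)
  also have "\<dots> = \<chi> h ^ Suc k \<cdot>\<^sub>m (r h * y ^\<^sub>m Suc k)"
    unfolding Suc using c by (simp add: smult_mat_mult mat_assoc smult_smult_mat)
  finally show ?case .
qed

text \<open>The coproduct of y acts as A + B with A = y \<otimes> g and B = 1 \<otimes> y. The
  relation of y with g gives B A = \<chi>(g) A B, and \<chi>(g) has order n, so the n-th power of A
  + B vanishes. Centrality of g is what makes A commute with h \<otimes> h up to \<chi>(h).\<close>

lemma hrep_tensor:
  assumes M: "hrep d r y" and N: "hrep e s z"
  shows "hrep (d * e) (\<lambda>h. kron (r h) (s h)) (kron y (s g) + kron (1\<^sub>m d) z)"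
  unfolding hrep_def
proof (intro conjI ballI)
  note r = hrepD(1)[OF M] and s = hrepD(1)[OF N]
  note c = hrepD(2)[OF M] hrepD(2)[OF N] repD(1)[OF s g_closed]
  show "rep (d * e) (\<lambda>h. kron (r h) (s h))"
    unfolding rep_def
    by (auto simp: repD[OF r] repD[OF s] kron_one rep_dim[OF r] rep_dim[OF s] kron_mult)
  let ?A = "kron y (s g)" and ?B = "kron (1\<^sub>m d) z"
  have AB: "?A \<in> carrier_mat (d * e) (d * e)" "?B \<in> carrier_mat (d * e) (d * e)" using c by auto
  thus "?A + ?B \<in> carrier_mat (d * e) (d * e)" by simp
  show "(?A + ?B) ^\<^sub>m n = 0\<^sub>m (d * e) (d * e)"
  proof (rule q_binomial_nilpotent[OF AB])
    show "?B * ?A = \<chi> g \<cdot>\<^sub>m (?A * ?B)"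
      using c by (simp add: kron_mult hrepD(4)[OF N g_closed] kron_smult)
    have "(kron y (s g)) ^\<^sub>m n = kron (y ^\<^sub>m n) (s g ^\<^sub>m n)" by (rule kron_pow[OF c(1,3)])
    thus "?A ^\<^sub>m n = 0\<^sub>m (d * e) (d * e)"
      using hrepD(3)[OF M] pow_mat_carrier[OF c(3), of n] c by simp
    have "(kron (1\<^sub>m d) z) ^\<^sub>m n = kron (1\<^sub>m d ^\<^sub>m n) (z ^\<^sub>m n)" by (rule kron_pow) (use c in auto)
    thus "?B ^\<^sub>m n = 0\<^sub>m (d * e) (d * e)"
      using hrepD(3)[OF N] pow_mat_carrier[of "1\<^sub>m d :: 'k mat" d n] by simp
  qed (use q_power q_order in auto)
  fix h assume h: "h \<in> carrier G"
  note ch = repD(1)[OF r h] repD(1)[OF s h]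
  have gh: "s g * s h = s h * s g" using repD(3)[OF s] g_central[OF h] g_closed h by metis
  have "(?A + ?B) * kron (r h) (s h) = kron (y * r h) (s g * s h) + kron (r h) (z * s h)"
    using c ch by (simp add: mat_distrib_right kron_mult)
  also have "\<dots> = \<chi> h \<cdot>\<^sub>m (kron (r h * y) (s h * s g)) + \<chi> h \<cdot>\<^sub>m (kron (r h) (s h * z))"
    unfolding hrepD(4)[OF M h] hrepD(4)[OF N h] gh by (simp add: kron_smult)
  also have "\<dots> = \<chi> h \<cdot>\<^sub>m (kron (r h * y) (s h * s g) + kron (r h) (s h * z))"
    by (rule add_smult_distrib_left_mat[symmetric, of _ "d * e" "d * e"]) (use c ch in auto)
  also have "kron (r h * y) (s h * s g) + kron (r h) (s h * z) = kron (r h) (s h) * (?A + ?B)"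
    using c ch by (simp add: mat_distrib_left kron_mult)
  finally show "(?A + ?B) * kron (r h) (s h) = \<chi> h \<cdot>\<^sub>m (kron (r h) (s h) * (?A + ?B))" .
qed

lemma tensor_module:
  assumes M: "alg_module H M" and N: "alg_module H N"
  shows "alg_module H (hopf_tensor G \<chi> g n M N)" "mdim (hopf_tensor G \<chi> g n M N) = mdim M * mdim N"
    "h \<in> carrier G \<Longrightarrow> hr (hopf_tensor G \<chi> g n M N) h = kron (hr M h) (hr N h)"
    "hy (hopf_tensor G \<chi> g n M N) = kron (hy M) (hr N g) + kron (1\<^sub>m (mdim M)) (hy N)"
proof -
  have "hrep (mdim M * mdim N) (\<lambda>h. kron (hr M h) (hr N h)) (kron (hy M) (hr N g) + kron (1\<^sub>m (mdim M)) (hy N))"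
    by (intro hrep_tensor hrep_of_module M N)
  let ?f = "\<lambda>s. case s of
        Gr h \<Rightarrow> kron (act M (hopf_gen_elt G \<chi> n (Gr h))) (act N (hopf_gen_elt G \<chi> n (Gr h)))
      | Y \<Rightarrow> kron (act M (hopf_gen_elt G \<chi> n Y)) (act N (hopf_gen_elt G \<chi> n (Gr g)))
           + kron (1\<^sub>m (mdim M)) (act N (hopf_gen_elt G \<chi> n Y))"
  have "hrep (mdim M * mdim N) (\<lambda>h. ?f (Gr h)) (?f Y)"
    unfolding hopf_gen.case using \<open>hrep _ _ _\<close> by (simp only: hr_def hy_def)
  from hopf_module[of _ ?f, OF this]
  show "alg_module H (hopf_tensor G \<chi> g n M N)" "mdim (hopf_tensor G \<chi> g n M N) = mdim M * mdim N"
    "h \<in> carrier G \<Longrightarrow> hr (hopf_tensor G \<chi> g n M N) h = kron (hr M h) (hr N h)"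
    "hy (hopf_tensor G \<chi> g n M N) = kron (hy M) (hr N g) + kron (1\<^sub>m (mdim M)) (hy N)"
    by (simp_all only: hopf_tensor_def hr_def hy_def hopf_gen.case)
qed

lemma zero_pow: "0 < k \<Longrightarrow> (0\<^sub>m d d :: 'k mat) ^\<^sub>m k = 0\<^sub>m d d"
  by (cases k) simp_all

lemma hrep_trivial_y: "rep d r \<Longrightarrow> hrep d r (0\<^sub>m d d)"
  by (auto simp: hrep_def zero_pow rep_dim)

lemma unit_module:
  shows "alg_module H (hopf_unit G \<chi> n)" "mdim (hopf_unit G \<chi> n) = 1"
    "h \<in> carrier G \<Longrightarrow> hr (hopf_unit G \<chi> n) h = 1\<^sub>m 1" "hy (hopf_unit G \<chi> n) = 0\<^sub>m 1 1"
proof -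
  have "rep 1 (\<lambda>h. 1\<^sub>m 1)" by (auto simp: rep_def)
  from hrep_trivial_y[OF this]
  have "hrep 1 (\<lambda>h. 1\<^sub>m 1) (0\<^sub>m 1 1)" .
  hence "hrep 1 (\<lambda>h. (\<lambda>s. case s of Gr h \<Rightarrow> 1\<^sub>m 1 | Y \<Rightarrow> 0\<^sub>m 1 1) (Gr h)) ((\<lambda>s. case s of Gr h \<Rightarrow> 1\<^sub>m 1 | Y \<Rightarrow> 0\<^sub>m 1 1) Y)"
    unfolding hopf_gen.case .
  from hopf_module[of _ "\<lambda>s. case s of Gr h \<Rightarrow> 1\<^sub>m 1 | Y \<Rightarrow> 0\<^sub>m 1 1", OF this]
  show "alg_module H (hopf_unit G \<chi> n)" "mdim (hopf_unit G \<chi> n) = 1"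
    "h \<in> carrier G \<Longrightarrow> hr (hopf_unit G \<chi> n) h = 1\<^sub>m 1" "hy (hopf_unit G \<chi> n) = 0\<^sub>m 1 1"
    by (simp_all only: hopf_unit_def hopf_gen.case)
qed

lemma inflate_module:
  assumes V: "alg_module KG V"
  shows "alg_module H (inflate G \<chi> n V)" "mdim (inflate G \<chi> n V) = mdim V"
    "h \<in> carrier G \<Longrightarrow> hr (inflate G \<chi> n V) h = kr V h" "hy (inflate G \<chi> n V) = 0\<^sub>m (mdim V) (mdim V)"
proof -
  have "hrep (mdim V) (kr V) (0\<^sub>m (mdim V) (mdim V))" by (rule hrep_trivial_y[OF kg_rep[OF V]])
  let ?f = "\<lambda>s. case s of Gr h \<Rightarrow> act V (kg_elt h) | Y \<Rightarrow> 0\<^sub>m (mdim V) (mdim V)"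
  have "hrep (mdim V) (\<lambda>h. ?f (Gr h)) (?f Y)"
    unfolding hopf_gen.case using \<open>hrep _ _ _\<close> by (simp only: kr_def[abs_def])
  from hopf_module[of _ ?f, OF this]
  show "alg_module H (inflate G \<chi> n V)" "mdim (inflate G \<chi> n V) = mdim V"
    "h \<in> carrier G \<Longrightarrow> hr (inflate G \<chi> n V) h = kr V h" "hy (inflate G \<chi> n V) = 0\<^sub>m (mdim V) (mdim V)"
    by (simp_all only: inflate_def kr_def hopf_gen.case)
qed

text \<open>The scalar part of the action of h on a string: the copy \<open>x^c V\<close> carries
  the twist by \<chi>^(-c).\<close>

definition dg :: "nat \<Rightarrow> 'g \<Rightarrow> 'k mat" where "dg l h = mat_diag l (\<lambda>c. inverse (\<chi> h) ^ c)"

lemma dg_carrier [simp]: "dg l h \<in> carrier_mat l l" "dim_row (dg l h) = l" "dim_col (dg l h) = l"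
  by (simp_all add: dg_def)

lemma hrep_string:
  assumes V: "rep d r" and l: "l \<le> n"
  shows "hrep (l * d) (\<lambda>h. kron (dg l h) (r h)) (kron (sh l 1) (1\<^sub>m d))"
  unfolding hrep_def
proof (intro conjI ballI)
  show "rep (l * d) (\<lambda>h. kron (dg l h) (r h))"
    unfolding rep_def
    by (auto simp: repD[OF V] rep_dim[OF V] kron_mult dg_def chi_one kron_one chi_mult power_mult_distrib)
  show "kron (sh l 1) (1\<^sub>m d) \<in> carrier_mat (l * d) (l * d)" by simp
  have "(kron (sh l 1) (1\<^sub>m d) :: 'k mat) ^\<^sub>m n = kron (sh l n) (1\<^sub>m d ^\<^sub>m n :: 'k mat)"
    by (subst kron_pow) auto
  thus "kron (sh l 1) (1\<^sub>m d) ^\<^sub>m n = (0\<^sub>m (l * d) (l * d) :: 'k mat)"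
    by (simp add: sh_zero[OF l])
  fix h assume h: "h \<in> carrier G"
  have "sh l 1 * dg l h = \<chi> h \<cdot>\<^sub>m (dg l h * sh l 1)"
    unfolding dg_def by (subst sh_mult_left[of _ l l], simp, subst mat_diag_left[of _ l l])
      (use chi_nonzero[OF h] in \<open>auto simp: mat_diag_def sh_def field_simps intro!: eq_matI\<close>)
  thus "kron (sh l 1) (1\<^sub>m d) * kron (dg l h) (r h) = \<chi> h \<cdot>\<^sub>m (kron (dg l h) (r h) * kron (sh l 1) (1\<^sub>m d))"
    using h by (simp add: kron_mult rep_dim[OF V] kron_smult)
qed

lemma string_module:
  assumes V: "alg_module KG V" and l: "l \<le> n"
  shows "alg_module H (string_module G \<chi> n V l)" "mdim (string_module G \<chi> n V l) = l * mdim V"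
    "h \<in> carrier G \<Longrightarrow> hr (string_module G \<chi> n V l) h = kron (dg l h) (kr V h)"
    "hy (string_module G \<chi> n V l) = kron (sh l 1) (1\<^sub>m (mdim V))"
proof -
  have 1: "mat l l (\<lambda>(r, c). if r = c then inverse (\<chi> h) ^ c else 0) = dg l h" for h
    by (auto simp: dg_def mat_diag_def)
  have 2: "mat l l (\<lambda>(r, c). if r = Suc c then 1 else 0 :: 'k) = sh l 1"
    by (auto simp: sh_def)
  have "hrep (l * mdim V) (\<lambda>h. kron (dg l h) (kr V h)) (kron (sh l 1) (1\<^sub>m (mdim V)))"
    by (rule hrep_string[OF kg_rep[OF V] l])
  let ?f = "\<lambda>s. case s of
        Gr h \<Rightarrow> kron (mat l l (\<lambda>(r, c). if r = c then inverse (\<chi> h) ^ c else 0)) (act V (kg_elt h))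
      | Y \<Rightarrow> kron (mat l l (\<lambda>(r, c). if r = Suc c then 1 else 0)) (1\<^sub>m (mdim V))"
  have "hrep (l * mdim V) (\<lambda>h. ?f (Gr h)) (?f Y)"
    unfolding hopf_gen.case 1 2 using \<open>hrep _ _ _\<close> by (simp only: kr_def[abs_def])
  from hopf_module[of _ ?f, OF this]
  show "alg_module H (string_module G \<chi> n V l)" "mdim (string_module G \<chi> n V l) = l * mdim V"
    "h \<in> carrier G \<Longrightarrow> hr (string_module G \<chi> n V l) h = kron (dg l h) (kr V h)"
    "hy (string_module G \<chi> n V l) = kron (sh l 1) (1\<^sub>m (mdim V))"
    by (simp_all only: string_module_def 1 2 kr_def hopf_gen.case)
qed

lemma hr_dsum: "hr (dsum_mod M N) h = four_block_mat (hr M h) (0\<^sub>m (mdim M) (mdim N)) (0\<^sub>m (mdim N) (mdim M)) (hr N h)"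
  and hy_dsum: "hy (dsum_mod M N) = four_block_mat (hy M) (0\<^sub>m (mdim M) (mdim N)) (0\<^sub>m (mdim N) (mdim M)) (hy N)"
  by (simp_all add: hr_def hy_def dsum_mod_def)

subsection \<open>Traces on the images of powers of the nilpotent generator\<close>

text \<open>The trace of \<open>h\<close> on \<open>y\<^sup>jM\<close>.\<close>

definition tinv :: "('k, 'g) hmod \<Rightarrow> nat \<Rightarrow> 'g \<Rightarrow> 'k" where
  "tinv M j h = mtrace (hr M h * (hy M ^\<^sub>m j *
     (SOME Z. Z \<in> carrier_mat (mdim M) (mdim M) \<and> hy M ^\<^sub>m j * Z * hy M ^\<^sub>m j = hy M ^\<^sub>m j)))"

text \<open>The product of a matrix with a pseudo inverse is a projection onto its image, so
  the trace does not depend on the pseudo inverse.\<close>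

lemma tinv_eq:
  assumes M: "alg_module H M" and h: "h \<in> carrier G"
    and Z: "Z \<in> carrier_mat (mdim M) (mdim M)" "hy M ^\<^sub>m j * Z * hy M ^\<^sub>m j = hy M ^\<^sub>m j"
  shows "tinv M j h = mtrace (hr M h * (hy M ^\<^sub>m j * Z))"
proof -
  let ?d = "mdim M" and ?y = "hy M ^\<^sub>m j" and ?r = "hr M h"
  define Z' where "Z' = (SOME Z. Z \<in> carrier_mat ?d ?d \<and> ?y * Z * ?y = ?y)"
  have Z': "Z' \<in> carrier_mat ?d ?d" "?y * Z' * ?y = ?y"
    using someI[of "\<lambda>Z. Z \<in> carrier_mat ?d ?d \<and> ?y * Z * ?y = ?y" Z] Z unfolding Z'_def by auto
  note c = hr_carrier[OF M h] hy_pow_carrier[OF M, of j] Hrep(2)[OF M] Z(1) Z'(1)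
  define x where "x = \<chi> h ^ j"
  have x: "x \<noteq> 0" using chi_nonzero[OF h] by (simp add: x_def)
  \<comment> \<open>The element h preserves the image of \<open>y^j\<close>, commuting with
    \<open>y^j\<close> up to this scalar. After a cyclic shift under the trace,
    \<open>y^j * Z' * y^j\<close> can therefore be contracted and only Z remains.\<close>
  have ry: "?r * ?y = inverse x \<cdot>\<^sub>m (?y * ?r)"
    using pow_commute[OF hrep_of_module[OF M] h, of j] x c by (simp add: x_def[symmetric] smult_smult_mat)
  have "mtrace (?r * (?y * Z')) = mtrace (?r * (?y * Z * ?y * Z'))"
    using Z(2) by simp
  also have "?r * (?y * Z * ?y * Z') = (?r * (?y * Z)) * (?y * Z')" using c by (simp add: mat_assoc)
  also have "mtrace \<dots> = mtrace (?y * Z' * (?r * (?y * Z)))"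
    by (rule mtrace_comm) (use c in auto)
  also have "?y * Z' * (?r * (?y * Z)) = ?y * Z' * (?r * ?y) * Z" using c by (simp add: mat_assoc)
  also have "\<dots> = inverse x \<cdot>\<^sub>m (?y * Z' * ?y * (?r * Z))" unfolding ry using c by (simp add: smult_mat_mult mat_assoc)
  also have "\<dots> = (inverse x \<cdot>\<^sub>m (?y * ?r)) * Z" unfolding Z'(2) using c by (simp add: smult_mat_mult mat_assoc)
  also have "\<dots> = ?r * (?y * Z)" unfolding ry[symmetric] using c by (simp add: mat_assoc)
  finally show ?thesis by (simp add: tinv_def Z'_def)
qed

lemma tinv_pseudo:
  assumes "alg_module H M"
  shows "\<exists>Z\<in>carrier_mat (mdim M) (mdim M). hy M ^\<^sub>m j * Z * hy M ^\<^sub>m j = hy M ^\<^sub>m j \<and>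
    (\<forall>h\<in>carrier G. tinv M j h = mtrace (hr M h * (hy M ^\<^sub>m j * Z)))"
  using pseudo_inverse[OF hy_pow_carrier[OF assms, of j]] tinv_eq[OF assms] by blast

lemma tinv_zero:
  assumes "alg_module H M" "h \<in> carrier G" "hy M ^\<^sub>m j = 0\<^sub>m (mdim M) (mdim M)"
  shows "tinv M j h = 0"
  by (subst tinv_eq[OF assms(1,2), of "0\<^sub>m (mdim M) (mdim M)"]) (use hr_carrier[OF assms(1,2)] assms(3) in simp_all)

text \<open>Conjugating a pseudo inverse by the isomorphism gives a pseudo inverse on the other
  side, and the trace is invariant under conjugation.\<close>

lemma tinv_iso:
  assumes M: "alg_module H M" and N: "alg_module H N" and iso: "iso_mod H M N" and h: "h \<in> carrier G"
  shows "tinv M j h = tinv N j h"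
proof -
  obtain P Q where P: "P \<in> intertwiners H M N" "Q \<in> carrier_mat (mdim M) (mdim N)"
    "P * Q = 1\<^sub>m (mdim N)" "Q * P = 1\<^sub>m (mdim M)" using iso unfolding iso_mod_iff by blast
  obtain Z where Z: "Z \<in> carrier_mat (mdim M) (mdim M)" "hy M ^\<^sub>m j * Z * hy M ^\<^sub>m j = hy M ^\<^sub>m j"
    using tinv_pseudo[OF M] by blast
  note ph = P(1)[unfolded H_intertwiners[OF M N]]
  note Pc = intertwinersD(1)[OF P(1)]
  note c = Pc P(2) Z(1) Hrep(2)[OF M] Hrep(2)[OF N] hy_pow_carrier[OF M, of j] hy_pow_carrier[OF N, of j] hr_carrier[OF M h] hr_carrier[OF N h]
  have Py: "P * hy M ^\<^sub>m j = hy N ^\<^sub>m j * P"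
  proof (induction j)
    case 0
    show ?case using Pc Hrep(2)[OF M] Hrep(2)[OF N] by simp
  next
    case (Suc j)
    note cj = Pc Hrep(2)[OF M] Hrep(2)[OF N] hy_pow_carrier[OF M, of j] hy_pow_carrier[OF N, of j]
    have "P * hy M ^\<^sub>m Suc j = (P * hy M ^\<^sub>m j) * hy M" using cj by (simp add: mat_assoc)
    also have "\<dots> = hy N ^\<^sub>m j * (P * hy M)" unfolding Suc using cj by (simp add: mat_assoc)
    also have "\<dots> = hy N ^\<^sub>m Suc j * P" using ph cj by (simp add: mat_assoc)
    finally show ?case .
  qed
  have yN: "hy N ^\<^sub>m j = P * hy M ^\<^sub>m j * Q"
  proof -
    have "P * hy M ^\<^sub>m j * Q = hy N ^\<^sub>m j * (P * Q)" unfolding Py using c by (simp add: mat_assoc)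
    thus ?thesis using P(3) c by (simp add: mat_assoc)
  qed
  have rN: "hr N h = P * hr M h * Q"
  proof -
    have "P * hr M h * Q = hr N h * (P * Q)" using homsD(2)[OF conjunct1[OF ph] h] c by (simp add: mat_assoc)
    thus ?thesis using P(3) c by simp
  qed
  have W: "P * Z * Q \<in> carrier_mat (mdim N) (mdim N)" using c by auto
  have QP: "Q * (P * X) = X" if "dim_row X = mdim M" for X
  proof -
    have "Q * (P * X) = (Q * P) * X" by (rule mat_assoc[symmetric]) (use c that in simp_all)
    thus ?thesis unfolding P(4) using that by simp
  qed
  have "hy N ^\<^sub>m j * (P * Z * Q) * hy N ^\<^sub>m j = P * (hy M ^\<^sub>m j * Z * hy M ^\<^sub>m j) * Q"
    unfolding yN using c by (simp add: mat_assoc QP)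
  hence "tinv N j h = mtrace (hr N h * (hy N ^\<^sub>m j * (P * Z * Q)))"
    by (intro tinv_eq[OF N h W]) (simp add: Z(2) yN)
  also have "hr N h * (hy N ^\<^sub>m j * (P * Z * Q)) = P * (hr M h * (hy M ^\<^sub>m j * Z) * Q)"
    unfolding yN rN using c by (simp add: mat_assoc QP)
  also have "mtrace \<dots> = mtrace (hr M h * (hy M ^\<^sub>m j * Z) * Q * P)"
    by (rule mtrace_comm) (use c in auto)
  also have "hr M h * (hy M ^\<^sub>m j * Z) * Q * P = hr M h * (hy M ^\<^sub>m j * Z)"
    using c by (simp add: mat_assoc P(4))
  finally show ?thesis using tinv_eq[OF M h Z] by simp
qed

lemma tinv_dsum:
  assumes M: "alg_module H M" and N: "alg_module H N" and h: "h \<in> carrier G"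
  shows "tinv (dsum_mod M N) j h = tinv M j h + tinv N j h"
proof -
  let ?m = "mdim M" and ?n = "mdim N"
  let ?b = "\<lambda>A D. four_block_mat A (0\<^sub>m ?m ?n) (0\<^sub>m ?n ?m) D"
  note mb = diag_block_mult[of _ ?m _ ?n]
  obtain Z where Z: "Z \<in> carrier_mat ?m ?m" "hy M ^\<^sub>m j * Z * hy M ^\<^sub>m j = hy M ^\<^sub>m j"
    "tinv M j h = mtrace (hr M h * (hy M ^\<^sub>m j * Z))" using tinv_pseudo[OF M] h by blast
  obtain W where W: "W \<in> carrier_mat ?n ?n" "hy N ^\<^sub>m j * W * hy N ^\<^sub>m j = hy N ^\<^sub>m j"
    "tinv N j h = mtrace (hr N h * (hy N ^\<^sub>m j * W))" using tinv_pseudo[OF N] h by blast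
  note c = Z(1) W(1) hy_pow_carrier[OF M, of j] hy_pow_carrier[OF N, of j] hr_carrier[OF M h] hr_carrier[OF N h]
  have y: "hy (dsum_mod M N) ^\<^sub>m j = ?b (hy M ^\<^sub>m j) (hy N ^\<^sub>m j)"
  proof (induction j)
    case 0
    show ?case using Hrep(2)[OF M] Hrep(2)[OF N] by (simp add: hy_dsum)
  next
    case (Suc j)
    thus ?case using Hrep(2)[OF M] Hrep(2)[OF N] hy_pow_carrier[OF M, of j] hy_pow_carrier[OF N, of j]
      by (simp add: hy_dsum mb)
  qed
  have "tinv (dsum_mod M N) j h = mtrace (hr (dsum_mod M N) h * (hy (dsum_mod M N) ^\<^sub>m j * ?b Z W))"
    by (rule tinv_eq[OF dsum_module[OF M N] h]) (use c in \<open>simp_all add: y mb Z(2) W(2)\<close>)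
  also have "\<dots> = mtrace (?b (hr M h * (hy M ^\<^sub>m j * Z)) (hr N h * (hy N ^\<^sub>m j * W)))"
    using c by (simp add: y hr_dsum mb)
  also have "\<dots> = tinv M j h + tinv N j h"
    unfolding Z(3) W(3) by (rule mtrace_four_block) (use c in auto)
  finally show ?thesis .
qed

lemma string_pow:
  assumes "alg_module KG V" "l \<le> n"
  shows "hy (string_module G \<chi> n V l) ^\<^sub>m j = kron (sh l j) (1\<^sub>m (mdim V))"
proof -
  show ?thesis by (simp add: string_module[OF assms] kron_pow[of _ l _ "mdim V"])
qed

lemma string_pseudo:
  "kron (sh l j) (1\<^sub>m d) * kron (uh l j) (1\<^sub>m d) * kron (sh l j) (1\<^sub>m d) = (kron (sh l j) (1\<^sub>m d) :: 'k mat)"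
  by (simp add: kron_mult sh_uh_sh)

lemma mtrace_string:
  assumes V: "alg_module KG V" and h: "h \<in> carrier G"
  shows "mtrace (kron (dg l h) (kr V h) * kron (mat_diag l f) (1\<^sub>m (mdim V))) = (\<Sum>s<l. inverse (\<chi> h) ^ s * f s) * mtrace (kr V h)"
proof -
  note r = kg_rep[OF V]
  have "kron (dg l h) (kr V h) * kron (mat_diag l f) (1\<^sub>m (mdim V)) = kron (mat_diag l (\<lambda>s. inverse (\<chi> h) ^ s * f s)) (kr V h)"
    using h by (simp add: kron_mult rep_dim[OF r] dg_def)
  thus ?thesis using repD(1)[OF r h] by (simp add: mtrace_kron[of _ l _ "mdim V"] mtrace_mat_diag)
qed

text \<open>The image of \<open>y^j\<close> is spanned by the copies \<open>x^s V\<close> with j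
  \<le> s < l, and h acts on \<open>x^s V\<close> with trace \<chi>(h)^(-s) times the character of
  V.\<close>

lemma tinv_string:
  assumes V: "alg_module KG V" and l: "l \<le> n" and h: "h \<in> carrier G"
  shows "tinv (string_module G \<chi> n V l) j h = (\<Sum>s = j..<l. inverse (\<chi> h) ^ s) * mtrace (kr V h)"
proof -
  note sm = string_module[OF V l]
  have "tinv (string_module G \<chi> n V l) j h =
     mtrace (kron (dg l h) (kr V h) * (kron (sh l j) (1\<^sub>m (mdim V)) * kron (uh l j) (1\<^sub>m (mdim V))))"
    by (subst tinv_eq[OF sm(1) h, of "kron (uh l j) (1\<^sub>m (mdim V))"])
      (simp_all add: sm(2) string_pow[OF V l] string_pseudo sm(3)[OF h])
  also have "kron (sh l j) (1\<^sub>m (mdim V)) * kron (uh l j) (1\<^sub>m (mdim V)) =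
     kron (mat_diag l (\<lambda>c. if j \<le> c then 1 else 0)) (1\<^sub>m (mdim V) :: 'k mat)"
    by (simp add: kron_mult sh_uh)
  also have "mtrace (kron (dg l h) (kr V h) * \<dots>) = (\<Sum>s<l. inverse (\<chi> h) ^ s * (if j \<le> s then 1 else 0)) * mtrace (kr V h)"
    by (rule mtrace_string[OF V h])
  also have "(\<Sum>s<l. inverse (\<chi> h) ^ s * (if j \<le> s then 1 else 0)) = (\<Sum>s = j..<l. inverse (\<chi> h) ^ s)"
    by (rule sum.mono_neutral_cong_right) auto
  finally show ?thesis .
qed

text \<open>On an inflated module y acts by 0, so on the tensor product \<open>y^j\<close> acts as 1
  \<otimes> y^j and has the pseudo inverse 1 \<otimes> Z.\<close>

lemma tinv_inflate_tensor:
  assumes V: "alg_module KG V" and M: "alg_module H M" and h: "h \<in> carrier G"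
  shows "tinv (hopf_tensor G \<chi> g n (inflate G \<chi> n V) M) j h = mtrace (kr V h) * tinv M j h"
proof -
  note im = inflate_module[OF V]
  note tm = tensor_module[OF im(1) M]
  let ?d = "mdim V" and ?m = "mdim M"
  obtain Z where Z: "Z \<in> carrier_mat ?m ?m" "hy M ^\<^sub>m j * Z * hy M ^\<^sub>m j = hy M ^\<^sub>m j"
    "tinv M j h = mtrace (hr M h * (hy M ^\<^sub>m j * Z))" using tinv_pseudo[OF M] h by blast
  note c = Z(1) hy_pow_carrier[OF M, of j] hr_carrier[OF M h] repD(1)[OF kg_rep[OF V] h] Hrep(2)[OF M] hr_carrier[OF M g_closed]
  have "hy (hopf_tensor G \<chi> g n (inflate G \<chi> n V) M) = kron (1\<^sub>m ?d) (hy M)"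
    using c by (simp add: tm(4) im)
  hence y: "hy (hopf_tensor G \<chi> g n (inflate G \<chi> n V) M) ^\<^sub>m j = kron (1\<^sub>m ?d) (hy M ^\<^sub>m j)"
    using c by (simp add: kron_pow[of _ ?d _ ?m])
  have "tinv (hopf_tensor G \<chi> g n (inflate G \<chi> n V) M) j h =
     mtrace (kron (kr V h) (hr M h) * (kron (1\<^sub>m ?d) (hy M ^\<^sub>m j) * kron (1\<^sub>m ?d) Z))"
    by (subst tinv_eq[OF tm(1) h, of "kron (1\<^sub>m ?d) Z"])
      (use c in \<open>simp_all add: tm(2) tm(3)[OF h] im(2) im(3)[OF h] y kron_mult Z(2)\<close>)
  also have "\<dots> = mtrace (kron (kr V h) (hr M h * (hy M ^\<^sub>m j * Z)))"
    using c by (simp add: kron_mult)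
  also have "\<dots> = mtrace (kr V h) * mtrace (hr M h * (hy M ^\<^sub>m j * Z))"
    by (rule mtrace_kron[of _ ?d _ ?m]) (use c in auto)
  also have "\<dots> = mtrace (kr V h) * tinv M j h"
    using c by (simp add: kron_mult Z(3) mtrace_kron[of "kr V h" ?d _ ?m])
  finally show ?thesis .
qed

text \<open>The q-integer 1 + q + ... + q^(j-1) for q = \<chi>(g), the off-diagonal coefficient of
  y^j on M(1, 2) \<otimes> M. Its first zero at a positive index is j = n, which separates the
  strings of length below n from those of length n.\<close>

definition kap :: "nat \<Rightarrow> 'k" where "kap j = (\<Sum>a<j. \<chi> g ^ a)"

lemma kap_mult: "(1 - \<chi> g) * kap j = 1 - \<chi> g ^ j"
  by (simp add: kap_def one_diff_power_eq)

lemma kap_nonzero: "0 < j \<Longrightarrow> j < n \<Longrightarrow> kap j \<noteq> 0"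
  using kap_mult[of j] q_order[of j] by auto

lemma kap_n: "kap n = 0"
  using kap_mult[of n] q_power q_order[of 1] n_ge_2 by auto

end

text \<open>The pseudo inverse is sought in the same block triangular shape; the last equation in
  \<open>e\<close> is the condition that U corrects the off-diagonal block X.\<close>

lemma block_pseudo:
  fixes A :: "'a::ring_1 mat"
  assumes c: "A \<in> carrier_mat d d" "B \<in> carrier_mat d d" "X \<in> carrier_mat d d"
      "A' \<in> carrier_mat d d" "B' \<in> carrier_mat d d" "U \<in> carrier_mat d d"
    and e: "A * A' * A = A" "B * B' * B = B" "(X * A' + B * U) * A + B * B' * X = X"
  shows "four_block_mat A (0\<^sub>m d d) X B * four_block_mat A' (0\<^sub>m d d) U B' =
      four_block_mat (A * A') (0\<^sub>m d d) (X * A' + B * U) (B * B')"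
    "four_block_mat A (0\<^sub>m d d) X B * four_block_mat A' (0\<^sub>m d d) U B' * four_block_mat A (0\<^sub>m d d) X B =
      four_block_mat A (0\<^sub>m d d) X B"
proof -
  show 1: "four_block_mat A (0\<^sub>m d d) X B * four_block_mat A' (0\<^sub>m d d) U B' =
      four_block_mat (A * A') (0\<^sub>m d d) (X * A' + B * U) (B * B')"
    using c by (subst mult_four_block_mat[of _ d d _ d _ d _ _ d _ d]) auto
  show "four_block_mat A (0\<^sub>m d d) X B * four_block_mat A' (0\<^sub>m d d) U B' * four_block_mat A (0\<^sub>m d d) X B =
      four_block_mat A (0\<^sub>m d d) X B"
    unfolding 1 using c e by (subst mult_four_block_mat[of _ d d _ d _ d _ _ d _ d]) auto
qed

section \<open>Tensoring a string with M(1, 2)\<close>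

context gd
begin

context
  fixes W :: "('k, 'g \<Rightarrow>\<^sub>0 'k) fdmod"
  assumes W: "alg_module KG W" "mdim W = 1" "\<And>h. h \<in> carrier G \<Longrightarrow> kr W h = 1\<^sub>m 1"
begin

abbreviation zmod :: "('k, 'g) hmod" where "zmod \<equiv> string_module G \<chi> n W 2"

lemma zmod_props:
  "alg_module H zmod" "mdim zmod = 2" "h \<in> carrier G \<Longrightarrow> hr zmod h = dg 2 h" "hy zmod = sh 2 1"
  using string_module[OF W(1), of 2] n_ge_2 W(2,3) by (simp_all flip: One_nat_def)

lemma z_tensor:
  assumes M: "alg_module H M"
  shows "h \<in> carrier G \<Longrightarrow> hr (hopf_tensor G \<chi> g n zmod M) h =
      four_block_mat (hr M h) (0\<^sub>m (mdim M) (mdim M)) (0\<^sub>m (mdim M) (mdim M)) (inverse (\<chi> h) \<cdot>\<^sub>m hr M h)"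
    "hy (hopf_tensor G \<chi> g n zmod M) =
      four_block_mat (hy M) (0\<^sub>m (mdim M) (mdim M)) (hr M g) (hy M)"
proof -
  note tm = tensor_module[OF zmod_props(1) M]
  note c = Hrep(2)[OF M] hr_carrier[OF M g_closed]
  show "hr (hopf_tensor G \<chi> g n zmod M) h =
      four_block_mat (hr M h) (0\<^sub>m (mdim M) (mdim M)) (0\<^sub>m (mdim M) (mdim M)) (inverse (\<chi> h) \<cdot>\<^sub>m hr M h)"
    if h: "h \<in> carrier G"
    using hr_carrier[OF M h] by (simp add: tm(3)[OF h] zmod_props(3)[OF h] dg_def kron_diag_2)
  have one: "(1\<^sub>m 2 :: 'k mat) = mat_diag 2 (\<lambda>_. 1)" by simp
  have "hy (hopf_tensor G \<chi> g n zmod M) = kron (sh 2 1) (hr M g) + kron (1\<^sub>m 2) (hy M)"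
    by (simp add: tm(4) zmod_props)
  also have "\<dots> = four_block_mat (hy M) (0\<^sub>m (mdim M) (mdim M)) (hr M g) (hy M)"
    unfolding one kron_sh_2 kron_diag_2 using c
    by (subst add_four_block_mat[of _ "mdim M" "mdim M" _ "mdim M" _ "mdim M"]) auto
  finally show "hy (hopf_tensor G \<chi> g n zmod M) =
      four_block_mat (hy M) (0\<^sub>m (mdim M) (mdim M)) (hr M g) (hy M)" .
qed

text \<open>The off-diagonal block is the sum of y^i g y^(j-1-i) over i < j, and moving g to the
  front costs \<chi>(g)^i. For j = 0 the coefficient \<open>kap 0\<close> is 0, so the truncated
  exponent j - 1 is harmless.\<close>

lemma z_tensor_pow:
  assumes M: "alg_module H M"
  shows "hy (hopf_tensor G \<chi> g n zmod M) ^\<^sub>m j =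
    four_block_mat (hy M ^\<^sub>m j) (0\<^sub>m (mdim M) (mdim M)) (kap j \<cdot>\<^sub>m (hr M g * hy M ^\<^sub>m (j - 1))) (hy M ^\<^sub>m j)"
proof (induction j)
  case 0
  show ?case unfolding z_tensor(2)[OF M] using Hrep(2)[OF M] hr_carrier[OF M g_closed]
    by (intro eq_matI) (auto simp: kap_def)
next
  case (Suc j)
  let ?d = "mdim M" and ?y = "hy M" and ?r = "hr M g"
  note c = Hrep(2)[OF M] hr_carrier[OF M g_closed] hy_pow_carrier[OF M, of j] hy_pow_carrier[OF M, of "j - 1"]
  have 1: "kap j \<cdot>\<^sub>m (?r * ?y ^\<^sub>m (j - 1)) * ?y = kap j \<cdot>\<^sub>m (?r * ?y ^\<^sub>m j)"
  proof (cases j)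
    case 0
    thus ?thesis using c by (intro eq_matI) (auto simp: kap_def)
  next
    case (Suc i)
    thus ?thesis using c by (simp add: smult_mat_mult mat_assoc)
  qed
  have 2: "?y ^\<^sub>m j * ?r = \<chi> g ^ j \<cdot>\<^sub>m (?r * ?y ^\<^sub>m j)"
    by (rule pow_commute[OF hrep_of_module[OF M] g_closed])
  have "hy (hopf_tensor G \<chi> g n zmod M) ^\<^sub>m Suc j =
    four_block_mat (?y ^\<^sub>m j * ?y) (0\<^sub>m ?d ?d) (kap j \<cdot>\<^sub>m (?r * ?y ^\<^sub>m (j - 1)) * ?y + ?y ^\<^sub>m j * ?r) (?y ^\<^sub>m j * ?y)"
    unfolding pow_mat.simps(2) Suc unfolding z_tensor(2)[OF M] using c
    by (subst mult_four_block_mat[of _ ?d ?d _ ?d _ ?d _ _ ?d _ ?d]) auto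
  also have "kap j \<cdot>\<^sub>m (?r * ?y ^\<^sub>m (j - 1)) * ?y + ?y ^\<^sub>m j * ?r = kap (Suc j) \<cdot>\<^sub>m (?r * ?y ^\<^sub>m j)"
    unfolding 1 2 using c by (intro eq_matI) (simp_all add: kap_def distrib_right)
  finally show ?case by simp
qed

text \<open>On \<open>M(1, 2) \<otimes> M\<close> the \<open>j\<close>-th power of \<open>y\<close> is block triangular.  The off-diagonal block is
  absorbed by the diagonal ones unless \<open>j\<close> is the length of the string \<open>M\<close>.\<close>

lemma tinv_z_tensor:
  assumes V: "alg_module KG V" and l: "0 < l" "l \<le> n" and h: "h \<in> carrier G"
  shows "tinv (hopf_tensor G \<chi> g n zmod (string_module G \<chi> n V l)) j h =
    (1 + inverse (\<chi> h)) * tinv (string_module G \<chi> n V l) j h +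
    (if j = l \<and> l < n then inverse (\<chi> h) ^ l * mtrace (kr V h) else 0)"
proof -
  let ?M = "string_module G \<chi> n V l"
  let ?T = "hopf_tensor G \<chi> g n zmod ?M"
  let ?d = "l * mdim V" and ?r = "mdim V"
  define x where "x = inverse (\<chi> h)"
  note M = string_module[OF V l(2)]
  note T = tensor_module[OF zmod_props(1) M(1)]
  note V' = kg_rep[OF V]
  have dT: "mdim ?T = ?d + ?d" by (simp add: T(2) zmod_props(2) M(2))
  have hc: "hr ?M h \<in> carrier_mat ?d ?d" using hr_carrier[OF M(1) h] by (simp add: M(2))
  have gc: "kr V g \<in> carrier_mat ?r ?r" by (rule repD(1)[OF V' g_closed])
  define p where "p = j - 1"
  define N where "N = dg l g * sh l p"
  have Nc: "N \<in> carrier_mat l l" unfolding N_def by (intro carrier_matI) simp_all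
  have Ni: "N $$ (i, k) = (if i = k + p then inverse (\<chi> g) ^ i else 0)" if "i < l" "k < l" for i k
    using that unfolding N_def dg_def by (subst mat_diag_left[of _ l l]) (simp_all add: sh_def)
  define X where "X = kap j \<cdot>\<^sub>m kron N (kr V g)"
  have Xc: "X \<in> carrier_mat ?d ?d" using Nc gc by (simp add: X_def)
  let ?A = "kron (sh l j) (1\<^sub>m ?r) :: 'k mat" and ?A' = "kron (uh l j) (1\<^sub>m ?r) :: 'k mat"
  have Ac: "?A \<in> carrier_mat ?d ?d" "?A' \<in> carrier_mat ?d ?d" by simp_all
  have pow: "hy ?T ^\<^sub>m j = four_block_mat ?A (0\<^sub>m ?d ?d) X ?A"
    unfolding z_tensor_pow[OF M(1)] string_pow[OF V l(2)] M(2) M(3)[OF g_closed] X_def N_def p_def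
    using gc by (simp add: kron_mult)
  have hrT: "hr ?T h = four_block_mat (hr ?M h) (0\<^sub>m ?d ?d) (0\<^sub>m ?d ?d) (x \<cdot>\<^sub>m hr ?M h)"
    unfolding z_tensor(1)[OF M(1) h] M(2) x_def ..
  \<comment> \<open>Since h acts block diagonally, only the diagonal blocks of the projection onto
    the image enter the trace.\<close>
  have tr: "tinv ?T j h = mtrace (hr ?M h * P) + x * mtrace (hr ?M h * Q)"
    if Z: "Z \<in> carrier_mat (?d + ?d) (?d + ?d)"
      and FZ: "four_block_mat ?A (0\<^sub>m ?d ?d) X ?A * Z = four_block_mat P (0\<^sub>m ?d ?d) R Q"
      and F: "four_block_mat ?A (0\<^sub>m ?d ?d) X ?A * Z * four_block_mat ?A (0\<^sub>m ?d ?d) X ?A = four_block_mat ?A (0\<^sub>m ?d ?d) X ?A"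
      and c: "P \<in> carrier_mat ?d ?d" "R \<in> carrier_mat ?d ?d" "Q \<in> carrier_mat ?d ?d" for Z P R Q
  proof -
    have "tinv ?T j h = mtrace (hr ?T h * four_block_mat P (0\<^sub>m ?d ?d) R Q)"
      unfolding FZ[symmetric] by (subst tinv_eq[OF T(1) h, of Z]) (use Z F dT in \<open>simp_all add: pow\<close>)
    also have "hr ?T h * four_block_mat P (0\<^sub>m ?d ?d) R Q =
        four_block_mat (hr ?M h * P) (0\<^sub>m ?d ?d) (x \<cdot>\<^sub>m hr ?M h * R) (x \<cdot>\<^sub>m hr ?M h * Q)"
      unfolding hrT using hc c by (subst mult_four_block_mat[of _ ?d ?d _ ?d _ ?d _ _ ?d _ ?d]) auto
    also have "mtrace \<dots> = mtrace (hr ?M h * P) + mtrace (x \<cdot>\<^sub>m hr ?M h * Q)"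
      by (rule mtrace_four_block) (use hc c in auto)
    also have "x \<cdot>\<^sub>m hr ?M h * Q = x \<cdot>\<^sub>m (hr ?M h * Q)" using hc c by (simp add: smult_mat_mult)
    also have "mtrace \<dots> = x * mtrace (hr ?M h * Q)" by (rule mtrace_smult[of _ ?d]) (use hc c in auto)
    finally show ?thesis .
  qed
  have t: "tinv ?M j h = mtrace (hr ?M h * (?A * ?A'))"
    by (subst tinv_eq[OF M(1) h, of ?A']) (simp_all add: M(2) string_pow[OF V l(2)] string_pseudo)
  \<comment> \<open>Three regimes: below the length of the string, where the diagonal blocks absorb
    X; at the length l < n, where X alone survives; and the rest, where the whole power vanishes,
    because the string has no room for a shift by j - 1 when j > l, or because
    \<open>kap n = 0\<close>.\<close>
  consider "j < l" | "j = l" "l < n" | "j \<ge> l" "X = 0\<^sub>m ?d ?d" "\<not> (j = l \<and> l < n)"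
  proof -
    have "X = 0\<^sub>m ?d ?d" if "l < j \<or> j = l \<and> l = n"
    proof (cases "l < j")
      case True
      have "N = 0\<^sub>m l l" by (rule eq_matI) (use Nc Ni True in \<open>auto simp: p_def\<close>)
      thus ?thesis using gc by (simp add: X_def)
    next
      case False
      thus ?thesis using that Nc gc by (auto simp: X_def kap_n intro!: eq_matI)
    qed
    thus ?thesis using that l by linarith
  qed
  thus ?thesis
  proof cases
    case 1
    \<comment> \<open>The ansatz is U = - A' X A'. With e and f the diagonal projections belonging
      to A A' and A' A, it leaves exactly the part (1 - e) X (1 - f) of X uncovered.\<close>
    define U where "U = - kap j \<cdot>\<^sub>m kron (uh l j * N * uh l j) (kr V g)"
    have "uh l j * N * uh l j \<in> carrier_mat l l" by (intro carrier_matI) simp_all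
    hence Uc: "U \<in> carrier_mat ?d ?d" using gc by (simp add: U_def)
    let ?e = "mat_diag l (\<lambda>c. if j \<le> c then 1 else 0) :: 'k mat" and ?f = "mat_diag l (\<lambda>c. if c + j < l then 1 else 0) :: 'k mat"
    have eN: "?e * N = mat l l (\<lambda>(i, k). (if j \<le> i then 1 else 0) * N $$ (i, k))" by (rule mat_diag_left[OF Nc])
    have Nf: "N * ?f = mat l l (\<lambda>(i, k). N $$ (i, k) * (if k + j < l then 1 else 0))" by (rule mat_diag_mult_right[OF Nc])
    have eNf: "?e * N * ?f = mat l l (\<lambda>(i, k). (?e * N) $$ (i, k) * (if k + j < l then 1 else 0))"
      by (rule mat_diag_mult_right, rule carrier_matI) (use Nc in simp_all)
    \<comment> \<open>The nonzero entries of N sit at (k + j - 1, k). A row index below j forces k =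
      0, and column 0 is kept by f because j < l; so no entry lies in the uncovered part.\<close>
    have small: "N * ?f - ?e * N * ?f + ?e * N = N" if "kap j \<noteq> 0"
    proof -
      have j0: "j > 0" using that by (cases j) (auto simp: kap_def)
      show ?thesis
      proof (rule eq_matI, goal_cases)
        case (1 i k)
        hence ik: "i < l" "k < l" using Nc by auto
        show ?case unfolding eNf unfolding eN Nf using ik \<open>j < l\<close> j0 Nc by (auto simp: Ni p_def)
      qed (use Nc in auto)
    qed
    have XA: "X * ?A' * ?A = kap j \<cdot>\<^sub>m kron (N * ?f) (kr V g)"
      unfolding X_def using Nc gc by (simp add: smult_mat_mult kron_mult mat_assoc uh_sh)
    have AU: "?A * U * ?A = - kap j \<cdot>\<^sub>m kron (?e * N * ?f) (kr V g)"
    proof -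
      have "?A * U * ?A = - kap j \<cdot>\<^sub>m kron (sh l j * (uh l j * N * uh l j) * sh l j) (kr V g)"
        unfolding U_def using Nc gc by (simp add: smult_mat_mult kron_mult)
      also have "sh l j * (uh l j * N * uh l j) * sh l j = (sh l j * uh l j) * N * (uh l j * sh l j)"
        using Nc by (simp add: mat_assoc)
      finally show ?thesis unfolding sh_uh uh_sh .
    qed
    have AX: "?A * ?A' * X = kap j \<cdot>\<^sub>m kron (?e * N) (kr V g)"
      unfolding X_def using Nc gc by (simp add: smult_mat_mult kron_mult sh_uh)
    have "(X * ?A' + ?A * U) * ?A + ?A * ?A' * X = (X * ?A' * ?A + ?A * U * ?A) + ?A * ?A' * X"
      using Xc Uc Ac by (subst mat_distrib_right) auto
    also have "\<dots> = X"
    proof (cases "kap j = 0")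
      case True
      thus ?thesis unfolding XA AU AX unfolding X_def using Nc gc by (intro eq_matI) auto
    next
      case False
      have "X = kap j \<cdot>\<^sub>m kron (N * ?f - ?e * N * ?f + ?e * N) (kr V g)"
        unfolding small[OF False] X_def ..
      also have "\<dots> = (kap j \<cdot>\<^sub>m kron (N * ?f) (kr V g) + - kap j \<cdot>\<^sub>m kron (?e * N * ?f) (kr V g)) + kap j \<cdot>\<^sub>m kron (?e * N) (kr V g)"
        using Nc gc by (intro eq_matI) (auto simp: kron_index div_less_of_mult algebra_simps)
      finally show ?thesis unfolding XA AU AX by simp
    qed
    finally have key: "(X * ?A' + ?A * U) * ?A + ?A * ?A' * X = X" .
    note bp = block_pseudo[OF Ac(1) Ac(1) Xc Ac(2) Ac(2) Uc string_pseudo string_pseudo key]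
    have "tinv ?T j h = mtrace (hr ?M h * (?A * ?A')) + x * mtrace (hr ?M h * (?A * ?A'))"
      by (rule tr[OF _ bp]) (use Ac Uc Xc in auto)
    thus ?thesis using 1 unfolding t by (simp add: x_def distrib_right)
  next
    case 2
    \<comment> \<open>Now the diagonal blocks are zero and X is \<open>kap l\<close> times g
      y^(l-1); X' inverts X on its image, which is possible because \<open>kap l\<close> is nonzero
      for 0 < l < n.\<close>
    define X' where "X' = inverse (kap j) \<cdot>\<^sub>m kron (uh l p * mat_diag l (\<lambda>c. \<chi> g ^ c)) (kr V (inv g))"
    have ic: "kr V (inv g) \<in> carrier_mat ?r ?r" by (rule repD(1)[OF V']) (simp add: g_closed)
    have "uh l p * mat_diag l (\<lambda>c. \<chi> g ^ c) \<in> carrier_mat l l" by (intro carrier_matI) simp_all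
    hence X'c: "X' \<in> carrier_mat ?d ?d" using ic by (simp add: X'_def)
    have k0: "kap j \<noteq> 0" using kap_nonzero[of j] 2 l by simp
    have A0: "?A = 0\<^sub>m ?d ?d" using 2 by (simp add: sh_zero)
    let ?e = "mat_diag l (\<lambda>c. if p \<le> c then 1 else 0) :: 'k mat"
    have "N * (uh l p * mat_diag l (\<lambda>c. \<chi> g ^ c)) = dg l g * (sh l p * uh l p) * mat_diag l (\<lambda>c. \<chi> g ^ c)"
      unfolding N_def by (simp add: mat_assoc)
    also have "\<dots> = ?e" unfolding sh_uh dg_def mat_diag_diag using chi_nonzero[OF g_closed]
      by (auto simp: mat_diag_def power_inverse)
    finally have Ne: "N * (uh l p * mat_diag l (\<lambda>c. \<chi> g ^ c)) = ?e" .
    have XX: "X * X' = kron ?e (1\<^sub>m ?r)"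
      unfolding X_def X'_def using Nc gc ic k0 rep_inv(1)[OF V' g_closed]
      by (simp add: smult_mat_mult kron_mult Ne smult_smult_mat)
    have eN: "?e * N = N" unfolding mat_diag_left[OF Nc] using Nc by (intro eq_matI) (auto simp: Ni)
    have XXX: "X * X' * X = X" unfolding XX unfolding X_def using Nc gc by (simp add: smult_mat_mult kron_mult eN)
    let ?Z = "four_block_mat (0\<^sub>m ?d ?d) X' (0\<^sub>m ?d ?d) (0\<^sub>m ?d ?d)"
    have FZ: "four_block_mat ?A (0\<^sub>m ?d ?d) X ?A * ?Z = four_block_mat (0\<^sub>m ?d ?d) (0\<^sub>m ?d ?d) (0\<^sub>m ?d ?d) (X * X')"
      unfolding A0 using Xc X'c by (subst mult_four_block_mat[of _ ?d ?d _ ?d _ ?d _ _ ?d _ ?d]) auto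
    have F: "four_block_mat ?A (0\<^sub>m ?d ?d) X ?A * ?Z * four_block_mat ?A (0\<^sub>m ?d ?d) X ?A = four_block_mat ?A (0\<^sub>m ?d ?d) X ?A"
      unfolding FZ unfolding A0 using Xc X'c XXX by (subst mult_four_block_mat[of _ ?d ?d _ ?d _ ?d _ _ ?d _ ?d]) auto
    have "tinv ?T j h = mtrace (hr ?M h * 0\<^sub>m ?d ?d) + x * mtrace (hr ?M h * (X * X'))"
      by (rule tr[OF _ FZ F]) (use Xc X'c in auto)
    also have "mtrace (hr ?M h * (X * X')) = (\<Sum>s<l. x ^ s * (if p \<le> s then 1 else 0)) * mtrace (kr V h)"
      unfolding XX M(3)[OF h] x_def by (rule mtrace_string[OF V h])
    \<comment> \<open>Only the last copy s = l - 1 contributes; the factor x from the second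
      diagonal block of h raises its power to l.\<close>
    also have "(\<Sum>s<l. x ^ s * (if p \<le> s then 1 else 0)) = (\<Sum>s<l. if s = p then x ^ s else 0)"
      by (rule sum.cong[OF refl]) (use 2(1) in \<open>auto simp: p_def\<close>)
    also have "\<dots> = x ^ p" using 2(1) l(1) by (simp add: p_def)
    also have "mtrace (hr ?M h * 0\<^sub>m ?d ?d) = 0" using hc by simp
    finally have "tinv ?T j h = x ^ l * mtrace (kr V h)" using 2(1) l(1) by (simp add: power_eq_if p_def)
    moreover have "tinv ?M j h = 0" unfolding t A0 using hc by simp
    ultimately show ?thesis using 2 by (simp add: x_def)
  next
    case 3
    have A0: "?A = 0\<^sub>m ?d ?d" using 3 by (simp add: sh_zero)
    have "hy ?T ^\<^sub>m j = 0\<^sub>m (mdim ?T) (mdim ?T)" unfolding pow A0 3(2) dT by simp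
    from tinv_zero[OF T(1) h this] have "tinv ?T j h = 0" .
    moreover have "tinv ?M j h = 0" unfolding t A0 using hc by simp
    ultimately show ?thesis using 3(3) by auto
  qed
qed

end

end

section \<open>Decomposition into strings\<close>

text \<open>The complement is the image of the idempotent 1 - i p, split as C B; it is invariant
  because 1 - i p commutes with the action.\<close>

lemma summand:
  fixes L :: "('k::field, 'a) fdmod"
  assumes L: "alg_module A L" and M: "alg_module A M"
    and i: "i \<in> intertwiners A L M" and p: "p \<in> intertwiners A M L" and pi: "p * i = 1\<^sub>m (mdim L)"
  shows "\<exists>N. alg_module A N \<and> iso_mod A M (dsum_mod L N)"
proof -
  let ?d = "mdim M" and ?l = "mdim L"
  note c = intertwinersD(1)[OF i] intertwinersD(1)[OF p]
  define e where "e = 1\<^sub>m ?d - i * p"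
  have ec: "e \<in> carrier_mat ?d ?d" unfolding e_def using c by (intro minus_carrier_mat mult_carrier_mat[of _ ?d ?l])
  have ipip: "i * p * (i * p) = i * p"
  proof -
    have "i * p * (i * p) = i * (p * i) * p" using c by (simp add: mat_assoc)
    thus ?thesis using c by (simp add: pi)
  qed
  have "e * (i * p) = 0\<^sub>m ?d ?d"
    unfolding e_def using c ipip by (simp add: mat_diff_distrib_right)
  hence "e * e = e - 0\<^sub>m ?d ?d" using c ec by (subst (2) e_def) (simp add: mat_diff_distrib_left)
  hence "e * e = e" using ec by (simp add: mat_eq_iff)
  from idempotent_split[OF ec this] obtain k C B where C: "C \<in> carrier_mat ?d k" and B: "B \<in> carrier_mat k ?d"
    and e: "e = C * B" and BC: "B * C = 1\<^sub>m k" by blast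
  have eC: "e * C = C" unfolding e using C B by (simp add: mat_assoc BC)
  have Be: "B * e = B" unfolding e using C B by (simp add: mat_assoc[symmetric] BC)
  have com: "act M x * e = e * act M x" if x: "x \<in> carrier A" for x
  proof -
    note a = alg_moduleD(1)[OF M x] alg_moduleD(1)[OF L x]
    have "act M x * (i * p) = (act M x * i) * p" using a c by (simp add: mat_assoc)
    also have "\<dots> = i * (act L x * p)" unfolding intertwinersD(2)[OF i x, symmetric] using a c by (simp add: mat_assoc)
    also have "\<dots> = i * p * act M x" unfolding intertwinersD(2)[OF p x, symmetric] using a c by (simp add: mat_assoc)
    finally show ?thesis unfolding e_def using a c by (simp add: mat_diff_distrib_left mat_diff_distrib_right)
  qed
  have xC: "C * (B * act M x * C) = act M x * C" if x: "x \<in> carrier A" for x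
  proof -
    note a = alg_moduleD(1)[OF M x]
    have "C * (B * act M x * C) = (e * act M x) * C" unfolding e using a B C by (simp add: mat_assoc)
    also have "\<dots> = act M x * (e * C)" unfolding com[OF x, symmetric] using a C ec by (simp add: mat_assoc)
    finally show ?thesis unfolding eC .
  qed
  have Bx: "B * act M x * C * B = B * act M x" if x: "x \<in> carrier A" for x
  proof -
    note a = alg_moduleD(1)[OF M x]
    have "B * act M x * C * B = B * (act M x * e)" unfolding e using a B C by (simp add: mat_assoc)
    also have "\<dots> = (B * e) * act M x" unfolding com[OF x] using a B ec by (simp add: mat_assoc)
    finally show ?thesis unfolding Be .
  qed
  define N where "N = (k, \<lambda>x. B * act M x * C)"
  have N: "alg_module A N"
  proof (rule alg_moduleI)
    fix x y assume x: "x \<in> carrier A" and y: "y \<in> carrier A"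
    note a = alg_moduleD(1)[OF M x] alg_moduleD(1)[OF M y]
    have "B * act M x * C * (B * act M y * C) = (B * act M x * C * B) * (act M y * C)"
      using a B C by (simp add: mat_assoc)
    also have "\<dots> = B * (act M x * act M y) * C" unfolding Bx[OF x] using a B C by (simp add: mat_assoc)
    finally show "act N (x \<otimes>\<^bsub>A\<^esub> y) = act N x * act N y"
      by (simp add: N_def alg_moduleD(2)[OF M x y])
    show "act N (x \<oplus>\<^bsub>A\<^esub> y) = act N x + act N y"
      using a B C by (simp add: N_def alg_moduleD(3)[OF M x y] mat_distrib_left mat_distrib_right)
  next
    fix x c assume x: "x \<in> carrier A"
    note a = alg_moduleD(1)[OF M x]
    show "act N x \<in> carrier_mat (mdim N) (mdim N)" using a B C by (auto simp: N_def)
    show "act N (c \<odot>\<^bsub>A\<^esub> x) = c \<cdot>\<^sub>m act N x"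
      using a B C by (simp add: N_def alg_moduleD(5)[OF M x] smult_mat_mult)
  qed (use B BC in \<open>simp add: N_def alg_moduleD(4)[OF M]\<close>)
  have "iso_mod A M (dsum_mod L N)"
  proof (rule iso_dsumI[OF M L N i _ p _ pi])
    show "C \<in> intertwiners A N M" using xC C by (auto simp: intertwiners_def N_def)
    show "B \<in> intertwiners A M N" using Bx B by (auto simp: intertwiners_def N_def)
    show "B * C = 1\<^sub>m (mdim N)" by (simp add: N_def BC)
    have "p * (i * p) = (p * i) * p" using c by (simp add: mat_assoc)
    hence pe: "p * e = 0\<^sub>m ?l ?d" unfolding e_def using c by (simp add: mat_diff_distrib_left pi)
    have "p * C = p * e * C" using eC c C ec by (simp add: mat_assoc)
    thus "p * C = 0\<^sub>m (mdim L) (mdim N)" unfolding pe using C by (simp add: N_def)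
    have "i * p * i = i * (p * i)" using c by (simp add: mat_assoc)
    hence ei: "e * i = 0\<^sub>m ?d ?l" unfolding e_def using c by (simp add: mat_diff_distrib_right pi)
    have "B * i = B * (e * i)" using Be c B ec by (simp add: mat_assoc[symmetric])
    thus "B * i = 0\<^sub>m (mdim N) (mdim L)" unfolding ei using B by (simp add: N_def)
    show "i * p + C * B = 1\<^sub>m ?d" unfolding e[symmetric] e_def using c by (intro eq_matI) auto
  qed
  thus ?thesis using N by blast
qed

subsection \<open>Block rows and columns\<close>

text \<open>Linear maps out of the space of a string (into it for \<open>blk_col\<close>), given by
  one block per copy \<open>x^k V\<close>; the index convention is that of
  \<open>kron\<close>.\<close>

definition blk_row :: "nat \<Rightarrow> nat \<Rightarrow> nat \<Rightarrow> (nat \<Rightarrow> 'a mat) \<Rightarrow> 'a mat" where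
  "blk_row d l r F = mat d (l * r) (\<lambda>(a, c). F (c div r) $$ (a, c mod r))"

definition blk_col :: "nat \<Rightarrow> nat \<Rightarrow> nat \<Rightarrow> (nat \<Rightarrow> 'a mat) \<Rightarrow> 'a mat" where
  "blk_col d l r F = mat (l * r) d (\<lambda>(c, a). F (c div r) $$ (c mod r, a))"

lemma blk_carrier [simp]: "blk_row d l r F \<in> carrier_mat d (l * r)" "blk_col d l r F \<in> carrier_mat (l * r) d"
  by (simp_all add: blk_row_def blk_col_def)

lemma blk_dim [simp]:
  "dim_row (blk_row d l r F) = d" "dim_col (blk_row d l r F) = l * r"
  "dim_row (blk_col d l r F) = l * r" "dim_col (blk_col d l r F) = d"
  by (simp_all add: blk_row_def blk_col_def)

lemma blk_row_cong: "(\<And>k. k < l \<Longrightarrow> F k = F' k) \<Longrightarrow> blk_row d l r F = blk_row d l r F'"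
  by (auto simp: blk_row_def div_less_of_mult)

lemma blk_col_cong: "(\<And>k. k < l \<Longrightarrow> F k = F' k) \<Longrightarrow> blk_col d l r F = blk_col d l r F'"
  by (auto simp: blk_col_def div_less_of_mult)

lemma mult_blk_row:
  fixes X :: "'a::comm_semiring_0 mat"
  assumes X: "X \<in> carrier_mat e d" and F: "\<And>k. k < l \<Longrightarrow> F k \<in> carrier_mat d r"
  shows "X * blk_row d l r F = blk_row e l r (\<lambda>k. X * F k)"
proof (rule eq_matI, goal_cases)
  case (1 a c)
  hence ac: "a < e" "c < l * r" by (simp_all add: blk_row_def)
  have "(X * blk_row d l r F) $$ (a, c) = (\<Sum>b<d. X $$ (a, b) * blk_row d l r F $$ (b, c))"
    by (rule mult_index_sum[OF X blk_carrier(1) ac])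
  also have "\<dots> = (\<Sum>b<d. X $$ (a, b) * F (c div r) $$ (b, c mod r))"
    using ac by (simp add: blk_row_def)
  also have "\<dots> = (X * F (c div r)) $$ (a, c mod r)"
    by (rule mult_index_sum[symmetric, OF X F]) (use ac div_less_of_mult mod_less_of_mult in auto)
  finally show ?case using ac by (simp add: blk_row_def)
qed (use X in \<open>auto simp: blk_row_def\<close>)

lemma blk_col_mult:
  fixes X :: "'a::comm_semiring_0 mat"
  assumes X: "X \<in> carrier_mat d e" and F: "\<And>k. k < l \<Longrightarrow> F k \<in> carrier_mat r d"
  shows "blk_col d l r F * X = blk_col e l r (\<lambda>k. F k * X)"
proof (rule eq_matI, goal_cases)
  case (1 c a)
  hence ac: "a < e" "c < l * r" by (simp_all add: blk_col_def)
  have "(blk_col d l r F * X) $$ (c, a) = (\<Sum>b<d. blk_col d l r F $$ (c, b) * X $$ (b, a))"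
    by (rule mult_index_sum[OF blk_carrier(2) X ac(2,1)])
  also have "\<dots> = (\<Sum>b<d. F (c div r) $$ (c mod r, b) * X $$ (b, a))"
    using ac by (simp add: blk_col_def)
  also have "\<dots> = (F (c div r) * X) $$ (c mod r, a)"
    by (rule mult_index_sum[symmetric, OF F X]) (use ac div_less_of_mult mod_less_of_mult in auto)
  finally show ?case using ac by (simp add: blk_col_def)
qed (use X in \<open>auto simp: blk_col_def\<close>)

lemma blk_row_kron_index:
  fixes S :: "'a::comm_semiring_0 mat"
  assumes F: "\<And>k. k < l \<Longrightarrow> F k \<in> carrier_mat d r" and S: "S \<in> carrier_mat l l" and R: "R \<in> carrier_mat r r"
    and ac: "a < d" "c < l * r"
  shows "(blk_row d l r F * kron S R) $$ (a, c) = (\<Sum>k<l. S $$ (k, c div r) * (F k * R) $$ (a, c mod r))"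
proof -
  note c = div_less_of_mult[OF ac(2)] mod_less_of_mult[OF ac(2)]
  have "(blk_row d l r F * kron S R) $$ (a, c) = (\<Sum>k<l * r. blk_row d l r F $$ (a, k) * kron S R $$ (k, c))"
    by (rule mult_index_sum[OF blk_carrier(1) kron_carrier[OF S R] ac])
  also have "\<dots> = (\<Sum>k<l * r. F (k div r) $$ (a, k mod r) * (S $$ (k div r, c div r) * R $$ (k mod r, c mod r)))"
    using ac S R by (intro sum.cong) (auto simp: blk_row_def kron_index)
  also have "\<dots> = (\<Sum>k<l. \<Sum>b<r. F k $$ (a, b) * (S $$ (k, c div r) * R $$ (b, c mod r)))"
    by (rule sum_div_mod)
  also have "\<dots> = (\<Sum>k<l. S $$ (k, c div r) * (F k * R) $$ (a, c mod r))"
  proof (rule sum.cong[OF refl])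
    fix k assume "k \<in> {..<l}"
    hence "(F k * R) $$ (a, c mod r) = (\<Sum>b<r. F k $$ (a, b) * R $$ (b, c mod r))"
      by (intro mult_index_sum[OF F R] ac c) auto
    thus "(\<Sum>b<r. F k $$ (a, b) * (S $$ (k, c div r) * R $$ (b, c mod r))) = S $$ (k, c div r) * (F k * R) $$ (a, c mod r)"
      by (simp add: sum_distrib_left ac_simps)
  qed
  finally show ?thesis .
qed

lemma kron_blk_col_index:
  fixes S :: "'a::comm_semiring_0 mat"
  assumes F: "\<And>k. k < l \<Longrightarrow> F k \<in> carrier_mat r d" and S: "S \<in> carrier_mat l l" and R: "R \<in> carrier_mat r r"
    and ac: "a < d" "c < l * r"
  shows "(kron S R * blk_col d l r F) $$ (c, a) = (\<Sum>k<l. S $$ (c div r, k) * (R * F k) $$ (c mod r, a))"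
proof -
  note c = div_less_of_mult[OF ac(2)] mod_less_of_mult[OF ac(2)]
  have "(kron S R * blk_col d l r F) $$ (c, a) = (\<Sum>k<l * r. kron S R $$ (c, k) * blk_col d l r F $$ (k, a))"
    by (rule mult_index_sum[OF kron_carrier[OF S R] blk_carrier(2) ac(2,1)])
  also have "\<dots> = (\<Sum>k<l * r. (S $$ (c div r, k div r) * R $$ (c mod r, k mod r)) * F (k div r) $$ (k mod r, a))"
    using ac S R by (intro sum.cong) (auto simp: blk_col_def kron_index)
  also have "\<dots> = (\<Sum>k<l. \<Sum>b<r. (S $$ (c div r, k) * R $$ (c mod r, b)) * F k $$ (b, a))"
    by (rule sum_div_mod)
  also have "\<dots> = (\<Sum>k<l. S $$ (c div r, k) * (R * F k) $$ (c mod r, a))"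
  proof (rule sum.cong[OF refl])
    fix k assume "k \<in> {..<l}"
    hence "(R * F k) $$ (c mod r, a) = (\<Sum>b<r. R $$ (c mod r, b) * F k $$ (b, a))"
      by (intro mult_index_sum[OF R F] ac c) auto
    thus "(\<Sum>b<r. (S $$ (c div r, k) * R $$ (c mod r, b)) * F k $$ (b, a)) = S $$ (c div r, k) * (R * F k) $$ (c mod r, a)"
      by (simp add: sum_distrib_left ac_simps)
  qed
  finally show ?thesis .
qed

lemma blk_row_diag:
  fixes R :: "'a::comm_semiring_1 mat"
  assumes F: "\<And>k. k < l \<Longrightarrow> F k \<in> carrier_mat d r" and R: "R \<in> carrier_mat r r"
  shows "blk_row d l r F * kron (mat_diag l f) R = blk_row d l r (\<lambda>k. f k \<cdot>\<^sub>m (F k * R))"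
proof (rule eq_matI, goal_cases)
  case (1 a c)
  hence ac: "a < d" "c < l * r" by (simp_all add: blk_row_def)
  note c = div_less_of_mult[OF ac(2)] mod_less_of_mult[OF ac(2)]
  have "(blk_row d l r F * kron (mat_diag l f) R) $$ (a, c) = (\<Sum>k<l. mat_diag l f $$ (k, c div r) * (F k * R) $$ (a, c mod r))"
    by (rule blk_row_kron_index[OF F _ R ac]) auto
  also have "\<dots> = (\<Sum>k<l. if k = c div r then f k * (F k * R) $$ (a, c mod r) else 0)"
    using c by (intro sum.cong) (auto simp: mat_diag_index)
  also have "\<dots> = f (c div r) * (F (c div r) * R) $$ (a, c mod r)" using c by simp
  finally show ?case using ac c R F[OF c(1)] by (simp add: blk_row_def)
qed (use R in \<open>auto simp: blk_row_def\<close>)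

lemma blk_col_diag:
  fixes R :: "'a::comm_semiring_1 mat"
  assumes F: "\<And>k. k < l \<Longrightarrow> F k \<in> carrier_mat r d" and R: "R \<in> carrier_mat r r"
  shows "kron (mat_diag l f) R * blk_col d l r F = blk_col d l r (\<lambda>k. f k \<cdot>\<^sub>m (R * F k))"
proof (rule eq_matI, goal_cases)
  case (1 c a)
  hence ac: "a < d" "c < l * r" by (simp_all add: blk_col_def)
  note c = div_less_of_mult[OF ac(2)] mod_less_of_mult[OF ac(2)]
  have "(kron (mat_diag l f) R * blk_col d l r F) $$ (c, a) = (\<Sum>k<l. mat_diag l f $$ (c div r, k) * (R * F k) $$ (c mod r, a))"
    by (rule kron_blk_col_index[OF F _ R ac]) auto
  also have "\<dots> = (\<Sum>k<l. if k = c div r then f k * (R * F k) $$ (c mod r, a) else 0)"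
    using c by (intro sum.cong) (auto simp: mat_diag_index)
  also have "\<dots> = f (c div r) * (R * F (c div r)) $$ (c mod r, a)" using c by simp
  finally show ?case using ac c R F[OF c(1)] by (simp add: blk_col_def)
qed (use R in \<open>auto simp: blk_col_def\<close>)

lemma blk_row_shift:
  fixes F :: "nat \<Rightarrow> 'a::comm_semiring_1 mat"
  assumes F: "\<And>k. k < l \<Longrightarrow> F k \<in> carrier_mat d r"
  shows "blk_row d l r F * kron (sh l 1) (1\<^sub>m r) = blk_row d l r (\<lambda>k. if Suc k < l then F (Suc k) else 0\<^sub>m d r)"
proof (rule eq_matI, goal_cases)
  case (1 a c)
  hence ac: "a < d" "c < l * r" by (simp_all add: blk_row_def)
  note c = div_less_of_mult[OF ac(2)] mod_less_of_mult[OF ac(2)]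
  have "(blk_row d l r F * kron (sh l 1) (1\<^sub>m r)) $$ (a, c) = (\<Sum>k<l. sh l 1 $$ (k, c div r) * (F k * 1\<^sub>m r) $$ (a, c mod r))"
    by (rule blk_row_kron_index[OF F _ _ ac]) auto
  also have "\<dots> = (\<Sum>k<l. if k = Suc (c div r) then F k $$ (a, c mod r) else 0)"
    using c by (intro sum.cong refl) (auto simp: sh_def right_mult_one_mat[OF F])
  also have "\<dots> = (if Suc (c div r) < l then F (Suc (c div r)) $$ (a, c mod r) else 0)" by simp
  finally show ?case using ac c by (simp add: blk_row_def)
qed (auto simp: blk_row_def)

lemma blk_col_shift:
  fixes F :: "nat \<Rightarrow> 'a::comm_semiring_1 mat"
  assumes F: "\<And>k. k < l \<Longrightarrow> F k \<in> carrier_mat r d"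
  shows "kron (sh l 1) (1\<^sub>m r) * blk_col d l r F = blk_col d l r (\<lambda>k. if k = 0 then 0\<^sub>m r d else F (k - 1))"
proof (rule eq_matI, goal_cases)
  case (1 c a)
  hence ac: "a < d" "c < l * r" by (simp_all add: blk_col_def)
  note c = div_less_of_mult[OF ac(2)] mod_less_of_mult[OF ac(2)]
  have "(kron (sh l 1) (1\<^sub>m r) * blk_col d l r F) $$ (c, a) = (\<Sum>k<l. sh l 1 $$ (c div r, k) * (1\<^sub>m r * F k) $$ (c mod r, a))"
    by (rule kron_blk_col_index[OF F _ _ ac]) auto
  also have "\<dots> = (\<Sum>k<l. if k = c div r - 1 then (if c div r = 0 then 0 else F k $$ (c mod r, a)) else 0)"
    using c by (intro sum.cong refl) (auto simp: sh_def left_mult_one_mat[OF F])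
  also have "\<dots> = (if c div r = 0 then 0 else F (c div r - 1) $$ (c mod r, a))"
    using c by (auto simp: less_imp_diff_less)
  finally show ?case using ac c by (auto simp: blk_col_def)
qed (auto simp: blk_col_def)

lemma blk_col_row_index:
  fixes E F :: "nat \<Rightarrow> 'a::comm_semiring_0 mat"
  assumes E: "\<And>k. k < l \<Longrightarrow> E k \<in> carrier_mat r d" and F: "\<And>k. k < l \<Longrightarrow> F k \<in> carrier_mat d r"
    and c: "c < l * r" "c' < l * r"
  shows "(blk_col d l r E * blk_row d l r F) $$ (c, c') = (E (c div r) * F (c' div r)) $$ (c mod r, c' mod r)"
proof -
  have "(blk_col d l r E * blk_row d l r F) $$ (c, c') = (\<Sum>b<d. blk_col d l r E $$ (c, b) * blk_row d l r F $$ (b, c'))"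
    by (rule mult_index_sum[OF blk_carrier(2,1) c])
  also have "\<dots> = (\<Sum>b<d. E (c div r) $$ (c mod r, b) * F (c' div r) $$ (b, c' mod r))"
    using c by (simp add: blk_row_def blk_col_def)
  also have "\<dots> = (E (c div r) * F (c' div r)) $$ (c mod r, c' mod r)"
    by (rule mult_index_sum[symmetric, OF E F]) (use c div_less_of_mult mod_less_of_mult in auto)
  finally show ?thesis .
qed

context gd
begin

text \<open>The map sends \<open>x^k v\<close> to \<open>y^k i(v)\<close>: a G-map defined on V
  alone determines a map on the whole string as soon as y^l vanishes on the target. For l = n this
  condition always holds, which is the source of projectivity.\<close>

lemma phi_intertwiner:
  assumes V: "alg_module KG V" and l: "l \<le> n" and M: "alg_module H M" and nil: "hy M ^\<^sub>m l = 0\<^sub>m (mdim M) (mdim M)"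
    and i: "i \<in> homs (mdim V) (kr V) (mdim M) (hr M)"
  shows "blk_row (mdim M) l (mdim V) (\<lambda>k. hy M ^\<^sub>m k * i) \<in> intertwiners H (string_module G \<chi> n V l) M"
proof -
  let ?d = "mdim M" and ?r = "mdim V" and ?y = "hy M" and ?F = "\<lambda>k. hy M ^\<^sub>m k * i"
  note sm = string_module[OF V l]
  note ic = homsD(1)[OF i] and yc = Hrep(2)[OF M] and ypc = hy_pow_carrier[OF M]
  have Fc: "?F k \<in> carrier_mat ?d ?r" for k using ic ypc[of k] by auto
  have "blk_row ?d l ?r ?F * kron (dg l h) (kr V h) = hr M h * blk_row ?d l ?r ?F" if h: "h \<in> carrier G" for h
  proof -
    note rc = repD(1)[OF kg_rep[OF V] h] hr_carrier[OF M h]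
    have "inverse (\<chi> h) ^ k \<cdot>\<^sub>m (?F k * kr V h) = hr M h * ?F k" for k
    proof -
      have "?F k * kr V h = (?y ^\<^sub>m k * hr M h) * i"
        using ic ypc[of k] yc rc homsD(2)[OF i h] by (simp add: mat_assoc)
      also have "\<dots> = \<chi> h ^ k \<cdot>\<^sub>m (hr M h * ?F k)"
        unfolding pow_commute[OF hrep_of_module[OF M] h] using ic ypc[of k] yc rc by (simp add: smult_mat_mult mat_assoc)
      finally show ?thesis using chi_nonzero[OF h] by (simp add: smult_smult_mat power_inverse)
    qed
    thus ?thesis unfolding dg_def blk_row_diag[OF Fc rc(1)] mult_blk_row[OF rc(2) Fc] by simp
  qed
  moreover have "blk_row ?d l ?r ?F * kron (sh l 1) (1\<^sub>m ?r) = ?y * blk_row ?d l ?r ?F"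
    unfolding blk_row_shift[OF Fc] mult_blk_row[OF yc Fc]
  proof (rule blk_row_cong)
    fix k assume k: "k < l"
    have comm: "?y * ?y ^\<^sub>m k = ?y ^\<^sub>m Suc k"
      using pow_mat_add[OF yc, of 1 k] yc by simp
    have "?y * ?F k = ?y ^\<^sub>m Suc k * i" unfolding comm[symmetric] using yc ypc[of k] ic by (simp add: mat_assoc)
    thus "(if Suc k < l then ?F (Suc k) else 0\<^sub>m ?d ?r) = ?y * ?F k"
      using k nil ic by (cases "Suc k = l") auto
  qed
  ultimately show ?thesis unfolding H_intertwiners[OF sm(1) M] homs_def by (simp add: sm)
qed

text \<open>If \<open>y\<^sup>l\<^sup>-\<^sup>1\<close> is nonzero and \<open>y\<^sup>l = 0\<close>, a simple constituent on which \<open>y\<^sup>l\<^sup>-\<^sup>1\<close> is injective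
  generates a string, and a retraction is obtained from any linear retraction onto the end of this string.\<close>

lemma string_summand:
  assumes V: "alg_module KG V" and l: "0 < l" "l \<le> n" and M: "alg_module H M" and nil: "hy M ^\<^sub>m l = 0\<^sub>m (mdim M) (mdim M)"
    and i: "i \<in> homs (mdim V) (kr V) (mdim M) (hr M)"
    and p: "p \<in> homs (mdim M) (\<lambda>h. \<chi> h ^ (l - 1) \<cdot>\<^sub>m hr M h) (mdim V) (kr V)"
    and pi: "p * hy M ^\<^sub>m (l - 1) * i = 1\<^sub>m (mdim V)"
  shows "\<exists>N. alg_module H N \<and> iso_mod H M (dsum_mod (string_module G \<chi> n V l) N)"
proof -
  let ?d = "mdim M" and ?r = "mdim V" and ?y = "hy M"
  \<comment> \<open>The component of the second map at \<open>x^k\<close> is p y^(l-1-k): it moves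
    the image of the copy \<open>x^k V\<close> to the end of the string before p is applied.\<close>
  let ?F = "\<lambda>k. ?y ^\<^sub>m k * i" and ?E = "\<lambda>k. p * ?y ^\<^sub>m (l - 1 - k)"
  let ?L = "string_module G \<chi> n V l"
  note sm = string_module[OF V l(2)]
  note ic = homsD(1)[OF i] and pc = homsD(1)[OF p] and yc = Hrep(2)[OF M] and ypc = hy_pow_carrier[OF M]
  have Fc: "?F k \<in> carrier_mat ?d ?r" for k using ic ypc[of k] by auto
  have Ec: "?E k \<in> carrier_mat ?r ?d" for k using pc ypc by auto
  let ?Phi = "blk_row ?d l ?r ?F" and ?Psi = "blk_col ?d l ?r ?E"
  have Phi: "?Phi \<in> intertwiners H ?L M" by (rule phi_intertwiner[OF V l(2) M nil i])
  have Psi: "?Psi \<in> intertwiners H M ?L"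
  proof -
    have "?Psi * hr M h = kron (dg l h) (kr V h) * ?Psi" if h: "h \<in> carrier G" for h
    proof -
      note rc = repD(1)[OF kg_rep[OF V] h] hr_carrier[OF M h]
      have "?E k * hr M h = inverse (\<chi> h) ^ k \<cdot>\<^sub>m (kr V h * ?E k)" if k: "k < l" for k
      proof -
        have "\<chi> h ^ (l - 1) = \<chi> h ^ k * \<chi> h ^ (l - 1 - k)" using k by (simp add: power_add[symmetric])
        hence e: "\<chi> h ^ (l - 1 - k) = inverse (\<chi> h) ^ k * \<chi> h ^ (l - 1)"
          using chi_nonzero[OF h] by (simp add: power_inverse)
        have "p * (\<chi> h ^ (l - 1) \<cdot>\<^sub>m hr M h) = kr V h * p" by (rule homsD(2)[OF p h])
        hence ph: "\<chi> h ^ (l - 1) \<cdot>\<^sub>m (p * hr M h) = kr V h * p" using pc rc by (simp add: smult_mat_mult)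
        have "?E k * hr M h = p * (?y ^\<^sub>m (l - 1 - k) * hr M h)" using pc ypc yc rc by (simp add: mat_assoc)
        also have "\<dots> = \<chi> h ^ (l - 1 - k) \<cdot>\<^sub>m (p * hr M h * ?y ^\<^sub>m (l - 1 - k))"
          unfolding pow_commute[OF hrep_of_module[OF M] h] using pc ypc yc rc by (simp add: smult_mat_mult mat_assoc)
        also have "\<dots> = inverse (\<chi> h) ^ k \<cdot>\<^sub>m ((\<chi> h ^ (l - 1) \<cdot>\<^sub>m (p * hr M h)) * ?y ^\<^sub>m (l - 1 - k))"
          unfolding e using pc ypc yc rc by (simp add: smult_mat_mult smult_smult_mat)
        also have "\<dots> = inverse (\<chi> h) ^ k \<cdot>\<^sub>m (kr V h * ?E k)"
          unfolding ph using pc ypc yc rc by (simp add: mat_assoc)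
        finally show ?thesis .
      qed
      thus ?thesis unfolding dg_def blk_col_diag[OF Ec rc(1)] blk_col_mult[OF rc(2) Ec] by (intro blk_col_cong) simp
    qed
    moreover have "?Psi * ?y = kron (sh l 1) (1\<^sub>m ?r) * ?Psi"
      unfolding blk_col_shift[OF Ec] blk_col_mult[OF yc Ec]
    proof (rule blk_col_cong)
      fix k assume k: "k < l"
      have 1: "?E k * ?y = p * ?y ^\<^sub>m Suc (l - 1 - k)" using pc ypc[of "l - 1 - k"] yc by (simp add: mat_assoc)
      show "?E k * ?y = (if k = 0 then 0\<^sub>m ?r ?d else ?E (k - 1))"
      proof (cases "k = 0")
        case True
        have "Suc (l - 1 - k) = l" using True l by simp
        thus ?thesis unfolding 1 using nil True pc by simp
      next
        case False
        hence "Suc (l - 1 - k) = l - 1 - (k - 1)" using k by simp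
        thus ?thesis unfolding 1 using False by simp
      qed
    qed
    ultimately show ?thesis unfolding H_intertwiners[OF M sm(1)] homs_def by (simp add: sm)
  qed
  \<comment> \<open>The second map is not yet a retraction. The block of the composite at (a, b) is
    p y^(l-1-a+b) i, which is the identity for a = b and 0 for a < b; the composite is therefore
    unitriangular, and its inverse T provides the correction.\<close>
  define U where "U = ?Psi * ?Phi"
  have Uc: "U \<in> carrier_mat (l * ?r) (l * ?r)" unfolding U_def by (intro carrier_matI) simp_all
  have Ui: "U $$ (c, c') = (if c = c' then 1 else 0)" if c: "c \<le> c'" "c' < l * ?r" for c c'
  proof -
    have cl: "c < l * ?r" using c by simp
    note cd = div_less_of_mult[OF cl] mod_less_of_mult[OF cl] div_less_of_mult[OF c(2)] mod_less_of_mult[OF c(2)]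
    have "U $$ (c, c') = (?E (c div ?r) * ?F (c' div ?r)) $$ (c mod ?r, c' mod ?r)"
      unfolding U_def by (rule blk_col_row_index[OF Ec Fc cl c(2)])
    also have "?E (c div ?r) * ?F (c' div ?r) = p * (?y ^\<^sub>m (l - 1 - c div ?r) * ?y ^\<^sub>m (c' div ?r)) * i"
      using pc ic yc ypc by (simp add: mat_assoc)
    also have "\<dots> = p * ?y ^\<^sub>m (l - 1 - c div ?r + c' div ?r) * i" by (simp add: pow_mat_add[OF yc])
    finally have e: "U $$ (c, c') = (p * ?y ^\<^sub>m (l - 1 - c div ?r + c' div ?r) * i) $$ (c mod ?r, c' mod ?r)" .
    have le: "c div ?r \<le> c' div ?r" using c by (simp add: div_le_mono)
    show ?thesis
    proof (cases "c div ?r = c' div ?r")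
      case True
      have m: "(c = c') = (c mod ?r = c' mod ?r)" using True by (metis div_mult_mod_eq)
      have "l - 1 - c div ?r + c' div ?r = l - 1" using True cd by simp
      hence "p * ?y ^\<^sub>m (l - 1 - c div ?r + c' div ?r) * i = 1\<^sub>m ?r" using pi by (simp only:)
      thus ?thesis unfolding e m using cd by simp
    next
      case False
      hence "l \<le> l - 1 - c div ?r + c' div ?r" using le cd by linarith
      hence "?y ^\<^sub>m (l - 1 - c div ?r + c' div ?r) = 0\<^sub>m ?d ?d" by (rule pow_mat_zero_mono[OF yc nil])
      thus ?thesis unfolding e using False pc ic cd by auto
    qed
  qed
  have "det U = prod_list (diag_mat U)"
    by (rule det_lower_triangular[OF _ Uc]) (use Ui in auto)
  also have "diag_mat U = replicate (l * ?r) 1"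
    unfolding diag_mat_def using Uc Ui by (auto intro!: nth_equalityI)
  finally have "det U = 1" by simp
  then obtain T where T: "T \<in> carrier_mat (l * ?r) (l * ?r)" "T * U = 1\<^sub>m (l * ?r)" "U * T = 1\<^sub>m (l * ?r)"
    using det_non_zero_imp_unit[OF Uc] by (auto simp: Units_def ring_mat_simps)
  have UL: "U \<in> intertwiners H ?L ?L"
  proof -
    have "U * act ?L x = act ?L x * U" if x: "x \<in> carrier H" for x
    proof -
      note ax = alg_moduleD(1)[OF sm(1) x] alg_moduleD(1)[OF M x]
      note ph = intertwinersD(1)[OF Phi] intertwinersD(1)[OF Psi]
      have "U * act ?L x = ?Psi * (?Phi * act ?L x)" unfolding U_def using ax ph by (simp add: mat_assoc)
      also have "\<dots> = (?Psi * act M x) * ?Phi" unfolding intertwinersD(2)[OF Phi x] using ax ph by (simp add: mat_assoc)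
      also have "\<dots> = act ?L x * U" unfolding intertwinersD(2)[OF Psi x] U_def using ax ph by (simp add: mat_assoc)
      finally show ?thesis .
    qed
    thus ?thesis using Uc by (simp add: intertwiners_def sm(2))
  qed
  have TP: "T * ?Psi \<in> intertwiners H M ?L"
  proof -
    have "T * ?Psi * act M x = act ?L x * (T * ?Psi)" if x: "x \<in> carrier H" for x
    proof -
      note ax = alg_moduleD(1)[OF sm(1) x] alg_moduleD(1)[OF M x]
      note ph = intertwinersD(1)[OF Psi]
      have Tx: "T * act ?L x = act ?L x * T"
      proof -
        have "T * act ?L x = T * (act ?L x * U) * T" using T Uc ax by (simp add: mat_assoc sm(2))
        also have "\<dots> = (T * U) * (act ?L x * T)" unfolding intertwinersD(2)[OF UL x, symmetric]
          using T(1) Uc ax by (simp add: mat_assoc sm(2))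
        finally show ?thesis using T ax by (simp add: sm(2))
      qed
      have "T * ?Psi * act M x = (T * act ?L x) * ?Psi" using ax ph T intertwinersD(2)[OF Psi x] by (simp add: mat_assoc sm(2))
      also have "\<dots> = act ?L x * (T * ?Psi)" unfolding Tx using ax ph T by (simp add: mat_assoc sm(2))
      finally show ?thesis .
    qed
    thus ?thesis using T(1) intertwinersD(1)[OF Psi] by (auto simp: intertwiners_def sm(2))
  qed
  have "T * ?Psi * ?Phi = 1\<^sub>m (mdim ?L)"
  proof -
    have "T * ?Psi * ?Phi = T * U" unfolding U_def by (rule mat_assoc) (use T in \<open>simp_all add: blk_row_def blk_col_def\<close>)
    thus ?thesis by (simp add: T(2) sm(2))
  qed
  from summand[OF sm(1) M Phi TP this] show ?thesis .
qed

end

section \<open>The simple modules\<close>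

locale gds = gd G \<chi> g n
  for G :: "('g, 'z) monoid_scheme" (structure)
    and \<chi> :: "'g \<Rightarrow> 'k::{alg_closed_field, field_char_0}" and g :: 'g and n :: nat +
  fixes m :: nat and V :: "nat \<Rightarrow> ('k, 'g \<Rightarrow>\<^sub>0 'k) fdmod"
  assumes simples: "complete_simples KG m V"
    and triv: "iso_mod KG (V 1) (kg_char G (\<lambda>_. 1))"
begin

definition chr :: "nat \<Rightarrow> 'g \<Rightarrow> 'k" where "chr i h = mtrace (kr (V i) h)"

lemma V_simple: "i \<in> {1..m} \<Longrightarrow> simple_mod KG (V i)"
  using simples unfolding complete_simples_def by blast

lemma V_module: "i \<in> {1..m} \<Longrightarrow> alg_module KG (V i)"
  using V_simple by (simp add: simple_mod_def)

lemma V_irr: "i \<in> {1..m} \<Longrightarrow> irr (mdim (V i)) (kr (V i))"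
  using V_simple V_module simple_iff_irr by blast

lemma V_dim_pos: "i \<in> {1..m} \<Longrightarrow> 0 < mdim (V i)"
  using V_irr by (simp add: irr_def)

lemma chr_orthonormal:
  assumes "i \<in> {1..m}" "k \<in> {1..m}"
  shows "cip (chr i) (chr k) = (if i = k then 1 else 0)"
proof (cases "i = k")
  case True
  thus ?thesis using irr_self[OF V_irr[OF assms(1)]] by (simp add: chr_def[abs_def])
next
  case False
  have "\<not> iso_mod KG (V k) (V i)" using False simples assms unfolding complete_simples_def by blast
  hence "\<not> iso_rep (mdim (V k)) (kr (V k)) (mdim (V i)) (kr (V i))"
    using kg_iso V_module assms by blast
  from irr_orthogonal[OF V_irr[OF assms(2)] V_irr[OF assms(1)] this] show ?thesis
    using False by (simp add: chr_def[abs_def])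
qed

lemma cip_cong: "(\<And>h. h \<in> carrier G \<Longrightarrow> \<phi> h = \<phi>' h) \<Longrightarrow> (\<And>h. h \<in> carrier G \<Longrightarrow> \<psi> h = \<psi>' h) \<Longrightarrow> cip \<phi> \<psi> = cip \<phi>' \<psi>'"
  unfolding cip_def by (auto intro!: sum.cong)

lemma cip_add: "cip (\<lambda>h. \<phi> h + \<phi>' h) \<psi> = cip \<phi> \<psi> + cip \<phi>' \<psi>"
  by (simp add: cip_def distrib_right sum.distrib distrib_left)

lemma cip_zero: "cip (\<lambda>h. 0) \<psi> = 0"
  by (simp add: cip_def)

lemma chr_inj:
  assumes "i \<in> {1..m}" "k \<in> {1..m}" "\<And>h. h \<in> carrier G \<Longrightarrow> chr i h = chr k h"
  shows "i = k"
proof -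
  have "cip (chr i) (chr k) = cip (chr k) (chr k)" by (rule cip_cong) (use assms in auto)
  thus ?thesis using chr_orthonormal[OF assms(1,2)] chr_orthonormal[OF assms(2,2)] by (auto split: if_splits)
qed

lemma irr_iso_simple:
  assumes "irr d r"
  shows "\<exists>i\<in>{1..m}. iso_rep d r (mdim (V i)) (kr (V i))"
proof -
  have r: "rep d r" using assms by (simp add: irr_def)
  note km = kg_module[OF r]
  have h: "homs d r e s = homs d (kr (kg_module G d r)) e s" "homs e s d r = homs e s d (kr (kg_module G d r))" for e s
    by (simp_all add: homs_def km(3))
  have "homs d r d r = homs d (kr (kg_module G d r)) d (kr (kg_module G d r))"
    by (simp add: homs_def km(3))
  hence "irr d (kr (kg_module G d r))"
    using assms kg_rep[OF km(1)] km(2) by (auto simp: irr_def)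
  hence "simple_mod KG (kg_module G d r)" using simple_iff_irr[OF km(1)] km(2) by simp
  then obtain i where i: "i \<in> {1..m}" "iso_mod KG (kg_module G d r) (V i)"
    using simples unfolding complete_simples_def by blast
  hence "iso_rep d (kr (kg_module G d r)) (mdim (V i)) (kr (V i))"
    using kg_iso[OF km(1) V_module[OF i(1)]] km(2) by simp
  thus ?thesis using i(1) h unfolding iso_rep_def by blast
qed

lemma iso_rep_chr:
  assumes "rep d r" "i \<in> {1..m}" "iso_rep d r (mdim (V i)) (kr (V i))"
  shows "h \<in> carrier G \<Longrightarrow> chr i h = mtrace (r h)" "mdim (V i) = d"
proof -
  show "h \<in> carrier G \<Longrightarrow> chr i h = mtrace (r h)"
    using iso_rep_trace[OF assms(3,1) kg_rep[OF V_module[OF assms(2)]]] by (simp add: chr_def)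
  obtain P Q where P: "P \<in> homs d r (mdim (V i)) (kr (V i))" "Q \<in> carrier_mat d (mdim (V i))"
    "P * Q = 1\<^sub>m (mdim (V i))" "Q * P = 1\<^sub>m d" using assms(3) by (auto simp: iso_rep_def)
  show "mdim (V i) = d" using inverse_mat_dim_eq[OF homsD(1)[OF P(1)] P(2-4)] by simp
qed

lemma rep_char:
  assumes "\<psi> \<one> = 1" "\<And>h h'. h \<in> carrier G \<Longrightarrow> h' \<in> carrier G \<Longrightarrow> \<psi> (h \<otimes> h') = \<psi> h * \<psi> h'"
  shows "rep 1 (\<lambda>h. \<psi> h \<cdot>\<^sub>m 1\<^sub>m 1)"
  unfolding rep_def by (simp add: assms smult_mat_mult smult_smult_mat mult.commute)

text \<open>The trivial representation is irreducible, so the complete list of simples is nonempty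
  and 1 is one of its indices.\<close>

lemma one_in_I: "1 \<in> {1..m}"
proof -
  have "rep 1 (\<lambda>h. 1 \<cdot>\<^sub>m 1\<^sub>m 1 :: 'k mat)" by (rule rep_char) auto
  moreover have "\<exists>c. P = c \<cdot>\<^sub>m 1\<^sub>m 1" if "P \<in> carrier_mat 1 1" for P :: "'k mat"
    using that by (intro exI[of _ "P $$ (0, 0)"] eq_matI) auto
  ultimately have "irr 1 (\<lambda>h. 1 \<cdot>\<^sub>m 1\<^sub>m 1 :: 'k mat)" by (auto simp: irr_def homs_def)
  thus ?thesis using irr_iso_simple by fastforce
qed

text \<open>In dimension one conjugation is trivial, so an isomorphism to the trivial module forces
  the matrices themselves to be identities.\<close>

lemma V1: "mdim (V 1) = 1" "h \<in> carrier G \<Longrightarrow> kr (V 1) h = 1\<^sub>m 1"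
proof -
  have r: "rep 1 (\<lambda>h. 1 \<cdot>\<^sub>m 1\<^sub>m 1 :: 'k mat)" by (rule rep_char) auto
  note km = kg_module[OF r, folded kg_char_def]
  obtain P Q where P: "P \<in> intertwiners KG (V 1) (kg_char G (\<lambda>_. 1))" "Q \<in> carrier_mat (mdim (V 1)) (mdim (kg_char G (\<lambda>_. 1 :: 'k)))"
    "P * Q = 1\<^sub>m (mdim (kg_char G (\<lambda>_. 1 :: 'k)))" "Q * P = 1\<^sub>m (mdim (V 1))" using triv unfolding iso_mod_iff by blast
  show d: "mdim (V 1) = 1" using iso_mod_dim[OF triv] km(2) by simp
  assume h: "h \<in> carrier G"
  note c = intertwinersD(1)[OF P(1)] repD(1)[OF kg_rep[OF V_module[OF one_in_I]] h]
  have "P * kr (V 1) h = kr (kg_char G (\<lambda>_. 1)) h * P"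
    using intertwinersD(2)[OF P(1) kg_elt_closed[OF h]] by (simp add: kr_def)
  hence e: "P * kr (V 1) h = P" using c by (simp add: km(2) km(3)[OF h])
  have "kr (V 1) h = Q * P * kr (V 1) h" using P(4) c by simp
  also have "\<dots> = Q * (P * kr (V 1) h)" using c P(2) by (simp add: mat_assoc)
  also have "\<dots> = 1\<^sub>m 1" unfolding e P(4) d ..
  finally show "kr (V 1) h = 1\<^sub>m 1" .
qed

lemma chr_1: "h \<in> carrier G \<Longrightarrow> chr 1 h = 1"
  using V1(2)[of h] by (simp add: chr_def flip: One_nat_def)

subsection \<open>Twists and duals\<close>

abbreviation \<tau> where "\<tau> \<equiv> tau G \<chi> m V"
abbreviation du where "du \<equiv> dual_index G m V"

text \<open>Makes the descriptions by \<open>THE\<close> in \<open>tau\<close> and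
  \<open>dual_index\<close> meaningful: existence by completeness of the list, uniqueness because
  the characters of the listed simples are orthonormal. From here on indices are compared through
  characters.\<close>

lemma the_simple:
  assumes r: "irr d r"
  shows "\<exists>!k. k \<in> {1..m} \<and> iso_mod KG (kg_module G d r) (V k)"
    "k = (THE k. k \<in> {1..m} \<and> iso_mod KG (kg_module G d r) (V k)) \<Longrightarrow>
      k \<in> {1..m} \<and> mdim (V k) = d \<and> (\<forall>h\<in>carrier G. chr k h = mtrace (r h))"
proof -
  have rr: "rep d r" using r by (simp add: irr_def)
  note km = kg_module[OF rr]
  have iso: "iso_mod KG (kg_module G d r) (V k) \<longleftrightarrow> iso_rep d r (mdim (V k)) (kr (V k))" if "k \<in> {1..m}" for k
    unfolding kg_iso[OF km(1) V_module[OF that]] unfolding iso_rep_def homs_def by (simp add: km)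
  obtain i where i: "i \<in> {1..m}" "iso_rep d r (mdim (V i)) (kr (V i))" using irr_iso_simple[OF r] by blast
  have uniq: "k = i" if "k \<in> {1..m}" "iso_rep d r (mdim (V k)) (kr (V k))" for k
    by (rule chr_inj[OF that(1) i(1)]) (simp add: iso_rep_chr[OF rr that] iso_rep_chr[OF rr i])
  show ex: "\<exists>!k. k \<in> {1..m} \<and> iso_mod KG (kg_module G d r) (V k)"
    using i uniq iso by blast
  assume "k = (THE k. k \<in> {1..m} \<and> iso_mod KG (kg_module G d r) (V k))"
  with theI'[OF ex] have k: "k \<in> {1..m}" "iso_mod KG (kg_module G d r) (V k)" by auto
  hence "iso_rep d r (mdim (V k)) (kr (V k))" using iso by blast
  from iso_rep_chr[OF rr k(1) this] k(1)
  show "k \<in> {1..m} \<and> mdim (V k) = d \<and> (\<forall>h\<in>carrier G. chr k h = mtrace (r h))" by auto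
qed

lemma rep_cong: "rep d r \<Longrightarrow> (\<And>h. h \<in> carrier G \<Longrightarrow> r h = r' h) \<Longrightarrow> rep d r'"
  by (auto simp: rep_def)

lemma tau_spec:
  assumes i: "i \<in> {1..m}"
  shows "\<tau> i \<in> {1..m}" "mdim (V (\<tau> i)) = mdim (V i)" "h \<in> carrier G \<Longrightarrow> chr (\<tau> i) h = inverse (\<chi> h) * chr i h"
proof -
  let ?d = "mdim (V i)" and ?r = "kr (V i)"
  have r: "rep ?d ?r" by (rule kg_rep[OF V_module[OF i]])
  have c1: "rep 1 (\<lambda>h. inverse (\<chi> h) \<cdot>\<^sub>m 1\<^sub>m 1)" by (rule rep_char) (simp_all add: chi_one chi_mult)
  note kc = kg_module[OF c1, folded kg_char_def]
  let ?s = "\<lambda>h. kron (kr (kg_char G (\<lambda>h. inverse (\<chi> h))) h) (?r h)"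
  have s: "?s h = inverse (\<chi> h) \<cdot>\<^sub>m ?r h" if "h \<in> carrier G" for h
    unfolding kc(3)[OF that] by (rule kron_one_scalar)
  have "rep ?d (\<lambda>h. inverse (\<chi> h) \<cdot>\<^sub>m ?r h)"
    unfolding rep_def
    by (simp add: repD[OF r] rep_dim[OF r] chi_mult chi_one smult_mat_mult smult_smult_mat mult.commute)
  hence srep: "rep ?d ?s" by (rule rep_cong) (simp add: s)
  \<comment> \<open>Twisting by a linear character multiplies both sides of the commutation relation
    by the same nonzero scalar, so endomorphisms, and with them irreducibility, are
    unchanged.\<close>
  have "homs ?d ?s ?d ?s = homs ?d ?r ?d ?r"
  proof -
    have "P * ?s h = ?s h * P \<longleftrightarrow> P * ?r h = ?r h * P" if "h \<in> carrier G" "P \<in> carrier_mat ?d ?d" for h P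
    proof -
      have "P * ?s h = inverse (\<chi> h) \<cdot>\<^sub>m (P * ?r h)" "?s h * P = inverse (\<chi> h) \<cdot>\<^sub>m (?r h * P)"
        using that repD(1)[OF r that(1)] by (simp_all add: s smult_mat_mult)
      moreover have "inverse (\<chi> h) \<noteq> 0" using chi_nonzero[OF that(1)] by simp
      moreover have "A = B" if "c \<cdot>\<^sub>m A = c \<cdot>\<^sub>m B" "c \<noteq> 0" for A B and c :: 'k
        using arg_cong[OF that(1), of "\<lambda>M. inverse c \<cdot>\<^sub>m M"] that(2) by (simp add: smult_smult_mat)
      ultimately show ?thesis by metis
    qed
    thus ?thesis by (auto simp: homs_def)
  qed
  hence "irr ?d ?s" using V_irr[OF i] srep by (auto simp: irr_def)
  from the_simple(2)[OF this, of "\<tau> i"]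
  have "\<tau> i \<in> {1..m} \<and> mdim (V (\<tau> i)) = ?d \<and> (\<forall>h\<in>carrier G. chr (\<tau> i) h = mtrace (?s h))"
    unfolding tau_def kg_tensor_def by (simp add: kc(2) kr_def flip: One_nat_def)
  thus "\<tau> i \<in> {1..m}" "mdim (V (\<tau> i)) = ?d" "h \<in> carrier G \<Longrightarrow> chr (\<tau> i) h = inverse (\<chi> h) * chr i h"
    by (auto simp: s chr_def intro!: mtrace_smult repD(1)[OF r])
qed

lemma dual_spec:
  assumes i: "i \<in> {1..m}"
  shows "du i \<in> {1..m}" "mdim (V (du i)) = mdim (V i)" "h \<in> carrier G \<Longrightarrow> chr (du i) h = chr i (inv h)"
proof -
  let ?d = "mdim (V i)" and ?r = "kr (V i)"
  have r: "rep ?d ?r" by (rule kg_rep[OF V_module[OF i]])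
  let ?s = "\<lambda>h. transpose_mat (?r (inv h))"
  have srep: "rep ?d ?s"
    unfolding rep_def
    by (simp add: inv_mult_group repD[OF r] transpose_mult[OF repD(1)[OF r] repD(1)[OF r]])
  \<comment> \<open>Transposition carries endomorphisms of the dual to endomorphisms of the original
    module, where they are scalars.\<close>
  have "\<exists>c. P = c \<cdot>\<^sub>m 1\<^sub>m ?d" if P: "P \<in> homs ?d ?s ?d ?s" for P
  proof -
    note Pc = homsD(1)[OF P]
    have "transpose_mat P \<in> homs ?d ?r ?d ?r"
      unfolding homs_def
    proof (intro CollectI conjI ballI)
      fix h assume h: "h \<in> carrier G"
      have "P * transpose_mat (?r h) = transpose_mat (?r h) * P" using homsD(2)[OF P, of "inv h"] h by simp
      hence "transpose_mat (P * transpose_mat (?r h)) = transpose_mat (transpose_mat (?r h) * P)" by simp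
      thus "transpose_mat P * ?r h = ?r h * transpose_mat P"
        using Pc repD(1)[OF r h] by (simp add: transpose_mult[of _ ?d ?d])
    qed (use Pc in simp)
    then obtain c where "transpose_mat P = c \<cdot>\<^sub>m 1\<^sub>m ?d" using V_irr[OF i] by (auto simp: irr_def)
    hence "P = transpose_mat (c \<cdot>\<^sub>m 1\<^sub>m ?d)" using Pc by (metis transpose_transpose)
    also have "\<dots> = c \<cdot>\<^sub>m 1\<^sub>m ?d" by auto
    finally show ?thesis by blast
  qed
  hence "irr ?d ?s" using srep V_dim_pos[OF i] by (auto simp: irr_def)
  from the_simple(2)[OF this, of "du i"]
  have "du i \<in> {1..m} \<and> mdim (V (du i)) = ?d \<and> (\<forall>h\<in>carrier G. chr (du i) h = mtrace (?s h))"
    unfolding dual_index_def kg_dual_def by (simp add: kr_def)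
  thus "du i \<in> {1..m}" "mdim (V (du i)) = ?d" "h \<in> carrier G \<Longrightarrow> chr (du i) h = chr i (inv h)"
    using repD(1)[OF r] by (auto simp: chr_def intro!: mtrace_transpose)
qed

lemma tau_bij: "bij_betw \<tau> {1..m} {1..m}"
proof -
  have "inj_on \<tau> {1..m}"
  proof (rule inj_onI)
    fix i k assume ik: "i \<in> {1..m}" "k \<in> {1..m}" "\<tau> i = \<tau> k"
    show "i = k"
    proof (rule chr_inj[OF ik(1,2)])
      fix h assume h: "h \<in> carrier G"
      show "chr i h = chr k h" using tau_spec(3)[OF ik(1) h] tau_spec(3)[OF ik(2) h] ik(3) chi_nonzero[OF h] by simp
    qed
  qed
  moreover have "\<tau> ` {1..m} \<subseteq> {1..m}" using tau_spec(1) by blast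
  ultimately show ?thesis by (simp add: bij_betw_def endo_inj_surj)
qed

abbreviation \<tau>i where "\<tau>i \<equiv> inv_into {1..m} \<tau>"

lemma taui_spec:
  assumes i: "i \<in> {1..m}"
  shows "\<tau>i i \<in> {1..m}" "\<tau> (\<tau>i i) = i" "\<tau>i (\<tau> i) = i" "mdim (V (\<tau>i i)) = mdim (V i)"
    "h \<in> carrier G \<Longrightarrow> chr (\<tau>i i) h = \<chi> h * chr i h"
proof -
  show 1: "\<tau>i i \<in> {1..m}" using tau_bij i by (metis bij_betw_imp_surj_on inv_into_into)
  show 2: "\<tau> (\<tau>i i) = i" using tau_bij i by (metis bij_betw_imp_surj_on f_inv_into_f)
  show "\<tau>i (\<tau> i) = i" using tau_bij i by (metis bij_betw_imp_inj_on inv_into_f_f)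
  show "mdim (V (\<tau>i i)) = mdim (V i)" using tau_spec(2)[OF 1] 2 by simp
  show "chr (\<tau>i i) h = \<chi> h * chr i h" if "h \<in> carrier G" using tau_spec(3)[OF 1 that] 2 chi_nonzero[OF that] by simp
qed

lemma taui_pow_spec:
  assumes i: "i \<in> {1..m}"
  shows "(\<tau>i ^^ k) i \<in> {1..m}" "mdim (V ((\<tau>i ^^ k) i)) = mdim (V i)"
    "h \<in> carrier G \<Longrightarrow> chr ((\<tau>i ^^ k) i) h = \<chi> h ^ k * chr i h"
proof -
  show 1: "(\<tau>i ^^ k) i \<in> {1..m}" for k by (induction k) (use i taui_spec(1) in auto)
  show "mdim (V ((\<tau>i ^^ k) i)) = mdim (V i)" by (induction k) (use taui_spec(4)[OF 1] in auto)
  show "chr ((\<tau>i ^^ k) i) h = \<chi> h ^ k * chr i h" if "h \<in> carrier G"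
    by (induction k) (use taui_spec(5)[OF 1 that] in auto)
qed

section \<open>Multiplicities\<close>

text \<open>All strings, including those of length n; \<open>Is\<close> later restricts to the
  lengths below n.\<close>

definition Ix :: "(nat \<times> nat) set" where "Ix = {1..m} \<times> {1..n}"

definition Mx :: "nat \<times> nat \<Rightarrow> ('k, 'g) hmod" where "Mx x = string_module G \<chi> n (V (fst x)) (snd x)"

lemma Ix_finite [simp]: "finite Ix" by (simp add: Ix_def)

lemma Mx_module: "x \<in> Ix \<Longrightarrow> alg_module H (Mx x)"
  unfolding Mx_def by (rule string_module(1)) (auto simp: Ix_def intro: V_module)

lemma Mx_dim: "x \<in> Ix \<Longrightarrow> mdim (Mx x) = snd x * mdim (V (fst x))"
  unfolding Mx_def by (rule string_module(2)) (auto simp: Ix_def intro: V_module)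

lemma Mx_dim_pos: "x \<in> Ix \<Longrightarrow> 0 < mdim (Mx x)"
  using Mx_dim[of x] V_dim_pos by (auto simp: Ix_def)

text \<open>The list records one way of splitting off strings successively; that the counts depend
  on M alone is shown afterwards.\<close>

inductive decomp :: "('k, 'g) hmod \<Rightarrow> (nat \<times> nat) list \<Rightarrow> bool" where
  Nil: "alg_module H M \<Longrightarrow> mdim M = 0 \<Longrightarrow> decomp M []"
| Cons: "alg_module H M \<Longrightarrow> alg_module H N \<Longrightarrow> x \<in> Ix \<Longrightarrow> iso_mod H M (dsum_mod (Mx x) N) \<Longrightarrow> decomp N xs \<Longrightarrow>
    decomp M (x # xs)"

text \<open>With l the nilpotency index of y on M, y^(l-1) is a nonzero G-map from M to its twist by
  \<chi>^(l-1). An irreducible constituent on which this map is split injective generates a string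
  of the maximal length l, and such a string splits off.\<close>

lemma exists_string_summand:
  assumes M: "alg_module H M" and d: "0 < mdim M"
  shows "\<exists>x\<in>Ix. \<exists>N. alg_module H N \<and> iso_mod H M (dsum_mod (Mx x) N)"
proof -
  let ?d = "mdim M" and ?y = "hy M"
  note yc = Hrep(2)[OF M] and ypc = hy_pow_carrier[OF M]
  define l where "l = (LEAST k. ?y ^\<^sub>m k = 0\<^sub>m ?d ?d)"
  have l: "?y ^\<^sub>m l = 0\<^sub>m ?d ?d" unfolding l_def by (rule LeastI[of _ n]) (rule Hrep(3)[OF M])
  have ln: "l \<le> n" unfolding l_def by (rule Least_le) (rule Hrep(3)[OF M])
  have l0: "0 < l"
  proof (rule ccontr)
    assume "\<not> 0 < l"
    hence "1\<^sub>m ?d = (0\<^sub>m ?d ?d :: 'k mat)" using l yc by simp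
    hence "(1\<^sub>m ?d :: 'k mat) $$ (0, 0) = 0" using d by simp
    thus False using d by simp
  qed
  define f where "f = ?y ^\<^sub>m (l - 1)"
  have f0: "f \<noteq> 0\<^sub>m ?d ?d" unfolding f_def using not_less_Least[of "l - 1" "\<lambda>k. ?y ^\<^sub>m k = 0\<^sub>m ?d ?d"] l0
    by (simp add: l_def[symmetric])
  have r: "rep ?d (hr M)" by (rule Hrep(1)[OF M])
  \<comment> \<open>The twist compensates the factor \<chi>(h)^(l-1) that arises when h is moved
    past y^(l-1), so that y^(l-1) becomes equivariant.\<close>
  let ?s = "\<lambda>h. \<chi> h ^ (l - 1) \<cdot>\<^sub>m hr M h"
  have s: "rep ?d ?s"
    unfolding rep_def using repD[OF r]
    by (simp add: rep_dim[OF r] chi_mult chi_one smult_mat_mult smult_smult_mat power_mult_distrib mult.commute)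
  have fh: "f \<in> homs ?d (hr M) ?d ?s"
    unfolding homs_def f_def
  proof (intro CollectI conjI ballI ypc)
    fix h assume h: "h \<in> carrier G"
    show "?y ^\<^sub>m (l - 1) * hr M h = ?s h * ?y ^\<^sub>m (l - 1)"
      unfolding pow_commute[OF hrep_of_module[OF M] h] using yc hr_carrier[OF M h] by (simp add: smult_mat_mult)
  qed
  obtain k t A B where t: "irr k t" and A: "A \<in> homs k t ?d (hr M)" and B: "B \<in> homs ?d ?s k t" and BA: "B * f * A = 1\<^sub>m k"
    using nonzero_hom_irr[OF fh f0 r s] by blast
  obtain i where i: "i \<in> {1..m}" "iso_rep k t (mdim (V i)) (kr (V i))" using irr_iso_simple[OF t] by blast
  let ?r = "mdim (V i)"
  have tr: "rep k t" using t by (simp add: irr_def)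
  have vr: "rep ?r (kr (V i))" by (rule kg_rep[OF V_module[OF i(1)]])
  obtain P Q where P: "P \<in> homs k t ?r (kr (V i))" "Q \<in> carrier_mat k ?r" "P * Q = 1\<^sub>m ?r" "Q * P = 1\<^sub>m k"
    using i(2) by (auto simp: iso_rep_def)
  have Q: "Q \<in> homs ?r (kr (V i)) k t"
    unfolding homs_def
  proof (intro CollectI conjI ballI P(2))
    fix h assume h: "h \<in> carrier G"
    note c = homsD(1)[OF P(1)] P(2) repD(1)[OF tr h] repD(1)[OF vr h]
    have "Q * kr (V i) h = Q * (kr (V i) h * P) * Q" using c P(3) by (simp add: mat_assoc)
    also have "\<dots> = (Q * P) * (t h * Q)" unfolding homsD(2)[OF P(1) h, symmetric] using c by (simp add: mat_assoc)
    also have "\<dots> = t h * Q" unfolding P(4) using c by simp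
    finally show "Q * kr (V i) h = t h * Q" .
  qed
  note c = homsD(1)[OF P(1)] P(2) homsD(1)[OF A] homsD(1)[OF B] homsD(1)[OF fh]
  have "P * B * f * (A * Q) = P * (B * f * A) * Q" using c by (simp add: mat_assoc)
  hence one: "P * B * f * (A * Q) = 1\<^sub>m ?r" unfolding BA using c P(3) by simp
  have "\<exists>N. alg_module H N \<and> iso_mod H M (dsum_mod (string_module G \<chi> n (V i) l) N)"
    by (rule string_summand[OF V_module[OF i(1)] l0 ln M l homs_mult[OF Q A vr tr r] homs_mult[OF B P(1) s tr vr]
        one[unfolded f_def]])
  thus ?thesis using i l0 ln by (intro bexI[of _ "(i, l)"]) (auto simp: Mx_def Ix_def)
qed

lemma exists_decomp:
  assumes "alg_module H M"
  shows "\<exists>xs. decomp M xs"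
  using assms
proof (induction "mdim M" arbitrary: M rule: less_induct)
  case (less M)
  show ?case
  proof (cases "mdim M = 0")
    case True
    thus ?thesis using decomp.Nil less by blast
  next
    case False
    then obtain x N where x: "x \<in> Ix" "alg_module H N" "iso_mod H M (dsum_mod (Mx x) N)"
      using exists_string_summand[OF less.prems] by auto
    have "mdim N < mdim M" using iso_mod_dim[OF x(3)] Mx_dim_pos[OF x(1)] by simp
    from less.hyps[OF this x(2)] obtain xs where "decomp N xs" by blast
    thus ?thesis using decomp.Cons[OF less.prems x(2,1,3)] by blast
  qed
qed

lemma decomp_module: "decomp M xs \<Longrightarrow> alg_module H M \<and> set xs \<subseteq> Ix"
  by (induction rule: decomp.induct) auto

text \<open>The vectors \<open>x\<^sup>j\<^sup>-\<^sup>1V\<^sub>i\<close> of the strings of length at least \<open>j\<close> form a basis of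
  \<open>y\<^sup>j\<^sup>-\<^sup>1M\<close> modulo \<open>y\<^sup>jM\<close>, so \<open>dinv M i j\<close> counts the strings \<open>M(i, l)\<close> with \<open>l \<ge> j\<close>.\<close>

definition dinv :: "('k, 'g) hmod \<Rightarrow> nat \<Rightarrow> nat \<Rightarrow> 'k" where
  "dinv M i j = cip (\<lambda>h. \<chi> h ^ (j - 1) * (tinv M (j - 1) h - tinv M j h)) (chr i)"

text \<open>Strings of length at least j minus strings of length at least j + 1. The value is taken
  in K, where the characters live.\<close>

definition nuK :: "('k, 'g) hmod \<Rightarrow> nat \<times> nat \<Rightarrow> 'k" where
  "nuK M x = dinv M (fst x) (snd x) - dinv M (fst x) (Suc (snd x))"

lemma nuK_cong:
  assumes "\<And>j h. h \<in> carrier G \<Longrightarrow> tinv M j h = tinv N j h"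
  shows "nuK M x = nuK N x"
proof -
  have "dinv M i j = dinv N i j" for i j unfolding dinv_def by (rule cip_cong) (use assms in auto)
  thus ?thesis by (simp add: nuK_def)
qed

lemma nuK_add:
  assumes "\<And>j h. h \<in> carrier G \<Longrightarrow> tinv L j h = tinv M j h + tinv N j h"
  shows "nuK L x = nuK M x + nuK N x"
proof -
  have "dinv L i j = dinv M i j + dinv N i j" for i j
  proof -
    have "dinv L i j = cip (\<lambda>h. \<chi> h ^ (j - 1) * (tinv M (j - 1) h - tinv M j h) + \<chi> h ^ (j - 1) * (tinv N (j - 1) h - tinv N j h)) (chr i)"
      unfolding dinv_def by (rule cip_cong) (use assms in \<open>auto simp: algebra_simps\<close>)
    thus ?thesis by (simp add: cip_add dinv_def)
  qed
  thus ?thesis by (simp add: nuK_def)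
qed

lemma nuK_iso: "alg_module H M \<Longrightarrow> alg_module H N \<Longrightarrow> iso_mod H M N \<Longrightarrow> nuK M x = nuK N x"
  by (rule nuK_cong) (rule tinv_iso)

lemma nuK_dsum: "alg_module H M \<Longrightarrow> alg_module H N \<Longrightarrow> nuK (dsum_mod M N) x = nuK M x + nuK N x"
  by (rule nuK_add) (rule tinv_dsum)

text \<open>The class function \<open>\<theta>\<close> is \<open>1\<close> for \<open>M(k, l)\<close> itself and the character of \<open>V\<^sub>i\<close> for \<open>V\<^sub>i \<otimes> M(k, l)\<close>.\<close>

lemma nuK_theta:
  assumes k: "k \<in> {1..m}" and l: "l \<le> n" and j: "0 < j"
    and t: "\<And>j h. h \<in> carrier G \<Longrightarrow> tinv M j h = \<theta> h * tinv (string_module G \<chi> n (V k) l) j h"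
  shows "nuK M (i, j) = (if j = l then cip (\<lambda>h. \<theta> h * chr k h) (chr i) else 0)"
proof -
  have d: "dinv M i j = (if j \<le> l then cip (\<lambda>h. \<theta> h * chr k h) (chr i) else 0)" if j: "0 < j" for j
  proof -
    have "dinv M i j = cip (\<lambda>h. if j \<le> l then \<theta> h * chr k h else 0) (chr i)"
      unfolding dinv_def
    proof (rule cip_cong)
      fix h assume h: "h \<in> carrier G"
      note ts = tinv_string[OF V_module[OF k] l h, folded chr_def]
      show "\<chi> h ^ (j - 1) * (tinv M (j - 1) h - tinv M j h) = (if j \<le> l then \<theta> h * chr k h else 0)"
      proof (cases "j \<le> l")
        case True
        \<comment> \<open>Consecutive traces differ by the contribution of the copy
          \<open>x^(j-1) V\<close>, whose twist is undone by the factor \<chi>^(j-1) in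
          \<open>dinv\<close>.\<close>
        have s: "sum ((^) (inverse (\<chi> h))) {j - 1..<l} = inverse (\<chi> h) ^ (j - 1) + sum ((^) (inverse (\<chi> h))) {j..<l}"
          using True j by (subst sum.atLeast_Suc_lessThan) auto
        have "tinv M (j - 1) h - tinv M j h = inverse (\<chi> h) ^ (j - 1) * (\<theta> h * chr k h)"
          unfolding t[OF h] ts s by (simp add: algebra_simps)
        moreover have "\<chi> h ^ (j - 1) * inverse (\<chi> h) ^ (j - 1) = 1"
          using chi_nonzero[OF h] by (simp add: power_inverse)
        ultimately show ?thesis using True by (simp add: mult.assoc[symmetric])
      next
        case False
        thus ?thesis by (simp add: t[OF h] ts)
      qed
    qed simp
    thus ?thesis by (simp add: cip_zero)
  qed
  show ?thesis using j by (auto simp: nuK_def d)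
qed

lemma nuK_string:
  assumes "k \<in> {1..m}" "l \<le> n" "x \<in> Ix"
  shows "nuK (string_module G \<chi> n (V k) l) x = (if x = (k, l) then 1 else 0)"
proof -
  obtain i j where x: "x = (i, j)" "i \<in> {1..m}" "0 < j" using assms(3) by (auto simp: Ix_def)
  have "nuK (string_module G \<chi> n (V k) l) (i, j) = (if j = l then cip (\<lambda>h. 1 * chr k h) (chr i) else 0)"
    by (rule nuK_theta[OF assms(1,2) x(3)]) simp
  thus ?thesis using chr_orthonormal[OF assms(1) x(2)] x(1) by auto
qed

text \<open>Additivity along the list; consequently a string occurs equally often in every
  decomposition.\<close>

lemma nuK_decomp:
  assumes "decomp M xs" "x \<in> Ix"
  shows "nuK M x = of_nat (count_list xs x)"
  using assms
proof (induction rule: decomp.induct)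
  case (Nil M)
  have t: "tinv M j h = 0" if h: "h \<in> carrier G" for j h
    by (rule tinv_zero[OF Nil(1) h]) (rule eq_matI, use hy_pow_carrier[OF Nil(1), of j] Nil(2) in auto)
  have "dinv M i j = cip (\<lambda>h. 0) (chr i)" for i j unfolding dinv_def by (rule cip_cong) (simp_all add: t)
  hence "dinv M i j = 0" for i j by (simp add: cip_zero)
  thus ?case by (simp add: nuK_def)
next
  case (Cons M N y xs)
  have "nuK M x = nuK (Mx y) x + nuK N x"
    using nuK_iso[OF Cons(1) dsum_module[OF Mx_module[OF Cons(3)] Cons(2)] Cons(4)]
      nuK_dsum[OF Mx_module[OF Cons(3)] Cons(2)] by simp
  also have "nuK (Mx y) x = (if x = y then 1 else 0)"
    unfolding Mx_def using nuK_string[of "fst y" "snd y" x] Cons.hyps(3) Cons.prems by (simp add: Ix_def mem_Times_iff)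
  finally show ?case using Cons by auto
qed

text \<open>A natural number read off from a chosen decomposition; \<open>mul_nuK\<close> ties it to
  the invariant \<open>nuK\<close>, and characteristic zero makes this identification
  faithful.\<close>

definition mul :: "('k, 'g) hmod \<Rightarrow> nat \<times> nat \<Rightarrow> nat" where
  "mul M x = count_list (SOME xs. decomp M xs) x"

lemma mul_nuK:
  assumes "alg_module H M" "x \<in> Ix"
  shows "of_nat (mul M x) = nuK M x"
  using nuK_decomp[OF someI_ex[OF exists_decomp[OF assms(1)]] assms(2)] by (simp add: mul_def)

lemma mul_decomp:
  assumes "decomp M xs" "x \<in> Ix"
  shows "mul M x = count_list xs x"
proof -
  have "(of_nat (mul M x) :: 'k) = of_nat (count_list xs x)"
    using mul_nuK[OF _ assms(2)] nuK_decomp[OF assms] decomp_module[OF assms(1)] by simp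
  thus ?thesis by simp
qed

lemma mul_iso: "alg_module H M \<Longrightarrow> alg_module H N \<Longrightarrow> iso_mod H M N \<Longrightarrow> x \<in> Ix \<Longrightarrow> mul M x = mul N x"
  using mul_nuK nuK_iso by (metis of_nat_eq_iff)

lemma mul_dsum:
  assumes "alg_module H M" "alg_module H N" "x \<in> Ix"
  shows "mul (dsum_mod M N) x = mul M x + mul N x"
proof -
  have "(of_nat (mul (dsum_mod M N) x) :: 'k) = of_nat (mul M x + mul N x)"
    using mul_nuK[OF dsum_module[OF assms(1,2)] assms(3)] mul_nuK[OF assms(1,3)] mul_nuK[OF assms(2,3)]
      nuK_dsum[OF assms(1,2)] by simp
  thus ?thesis by (simp only: of_nat_eq_iff)
qed

lemma mul_string:
  assumes "k \<in> {1..m}" "l \<le> n" "x \<in> Ix"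
  shows "mul (string_module G \<chi> n (V k) l) x = (if x = (k, l) then 1 else 0)"
proof -
  have "(of_nat (mul (string_module G \<chi> n (V k) l) x) :: 'k) = of_nat (if x = (k, l) then 1 else 0)"
    using mul_nuK[OF string_module(1)[OF V_module[OF assms(1)] assms(2)] assms(3)] nuK_string[OF assms] by simp
  thus ?thesis by (simp only: of_nat_eq_iff)
qed

text \<open>The multiplicity of \<open>V\<^sub>s\<close> in \<open>V\<^sub>i \<otimes> V\<^sub>k\<close>; note that \<open>M(k, 1)\<close> is \<open>V\<^sub>k\<close>.\<close>

definition NN :: "nat \<Rightarrow> nat \<Rightarrow> nat \<Rightarrow> nat" where
  "NN i k s = mul (hopf_tensor G \<chi> g n (inflate G \<chi> n (V i)) (string_module G \<chi> n (V k) 1)) (s, 1)"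

lemma nuK_V_tensor:
  assumes i: "i \<in> {1..m}" and k: "k \<in> {1..m}" and l: "l \<le> n" and j: "0 < j"
  shows "nuK (hopf_tensor G \<chi> g n (inflate G \<chi> n (V i)) (string_module G \<chi> n (V k) l)) (s, j) =
    (if j = l then cip (\<lambda>h. chr i h * chr k h) (chr s) else 0)"
proof (rule nuK_theta[OF k l j])
  fix j h assume h: "h \<in> carrier G"
  show "tinv (hopf_tensor G \<chi> g n (inflate G \<chi> n (V i)) (string_module G \<chi> n (V k) l)) j h =
     chr i h * tinv (string_module G \<chi> n (V k) l) j h"
    unfolding chr_def by (rule tinv_inflate_tensor[OF V_module[OF i] string_module(1)[OF V_module[OF k] l] h])
qed

lemma NN_cip:
  assumes "i \<in> {1..m}" "k \<in> {1..m}" "s \<in> {1..m}"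
  shows "of_nat (NN i k s) = cip (\<lambda>h. chr i h * chr k h) (chr s)"
proof -
  have n1: "1 \<le> n" using n_ge_2 by simp
  note sm = string_module(1)[OF V_module[OF assms(2)] n1]
  have x: "(s, 1) \<in> Ix" using assms n1 by (simp add: Ix_def)
  show ?thesis
    unfolding NN_def mul_nuK[OF tensor_module(1)[OF inflate_module(1)[OF V_module[OF assms(1)]] sm] x]
    using nuK_V_tensor[OF assms(1,2) n1, of 1 s] by simp
qed

lemma mul_V_tensor:
  assumes i: "i \<in> {1..m}" and k: "k \<in> {1..m}" and l: "l \<le> n" and x: "x \<in> Ix"
  shows "mul (hopf_tensor G \<chi> g n (inflate G \<chi> n (V i)) (string_module G \<chi> n (V k) l)) x =
    (if snd x = l then NN i k (fst x) else 0)"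
proof -
  obtain s j where xs: "x = (s, j)" "s \<in> {1..m}" "0 < j" using x by (auto simp: Ix_def)
  note sm = string_module(1)[OF V_module[OF k] l]
  have "(of_nat (mul (hopf_tensor G \<chi> g n (inflate G \<chi> n (V i)) (string_module G \<chi> n (V k) l)) x) :: 'k) =
      of_nat (if snd x = l then NN i k (fst x) else 0)"
    using mul_nuK[OF tensor_module(1)[OF inflate_module(1)[OF V_module[OF i]] sm] x]
      nuK_V_tensor[OF i k l xs(3), of s] NN_cip[OF i k xs(2)] xs(1) by simp
  thus ?thesis by (simp only: of_nat_eq_iff)
qed

text \<open>The traces on M(1, 2) \<otimes> M(k, l) are the sums of the traces on two strings, the
  second twisted by \<chi>^(-1), and traces determine multiplicities. At l = n the correction term
  of the trace formula is absent, and both strings have length n.\<close>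

lemma mul_z_tensor:
  assumes k: "k \<in> {1..m}" and l: "0 < l" "l \<le> n" and x: "x \<in> Ix"
  shows "mul (hopf_tensor G \<chi> g n (string_module G \<chi> n (V 1) 2) (string_module G \<chi> n (V k) l)) x =
    (if l < n then mul (string_module G \<chi> n (V k) (l + 1)) x + mul (string_module G \<chi> n (V (\<tau> k)) (l - 1)) x
     else mul (string_module G \<chi> n (V k) n) x + mul (string_module G \<chi> n (V (\<tau> k)) n) x)"
proof -
  let ?T = "hopf_tensor G \<chi> g n (string_module G \<chi> n (V 1) 2) (string_module G \<chi> n (V k) l)"
  note t1 = V_module[OF one_in_I] and kM = V_module[OF k] and tk = V_module[OF tau_spec(1)[OF k]]
  have T: "alg_module H ?T"
    using tensor_module(1)[OF string_module(1)[OF t1 n_ge_2] string_module(1)[OF kM l(2)]] .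
  define a where "a = (if l < n then l + 1 else n)"
  define b where "b = (if l < n then l - 1 else n)"
  have ab: "a \<le> n" "b \<le> n" using l by (auto simp: a_def b_def)
  have "nuK ?T x = nuK (string_module G \<chi> n (V k) a) x + nuK (string_module G \<chi> n (V (\<tau> k)) b) x"
  proof (rule nuK_add)
    fix j h assume h: "h \<in> carrier G"
    define x where "x = inverse (\<chi> h)"
    define S where "S j l = sum ((^) x) {j..<l}" for j l
    have SS: "x * S j b' = S (Suc j) (Suc b')" for j b'
      unfolding S_def sum.shift_bounds_Suc_ivl by (simp add: sum_distrib_left)
    have Sl: "S j (Suc l) = (if j \<le> l then S j l + x ^ l else 0)" for j l by (simp add: S_def)
    have S0: "S j l = (if j < l then x ^ j + S (Suc j) l else 0)" for j l by (auto simp: S_def sum.atLeast_Suc_lessThan)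
    have "tinv ?T j h = (1 + x) * (S j l * chr k h) + (if j = l \<and> l < n then x ^ l * chr k h else 0)"
      using tinv_z_tensor[OF t1 V1 kM l h, of j] tinv_string[OF kM l(2) h, of j] by (simp add: x_def S_def chr_def)
    also have "\<dots> = S j a * chr k h + S j b * (x * chr k h)"
    proof (cases "l < n")
      case True
      then obtain l' where l': "l = Suc l'" using l by (cases l) auto
      \<comment> \<open>For j < l the term x^l gained by the first string is the one lost by the
        second; at j = l only the gain remains, and it is the correction term.\<close>
      have "(1 + x) * S j l + (if j = l then x ^ l else 0) = S j (Suc l) + x * S j l'"
        unfolding l' distrib_right mult_1 SS unfolding Sl[of j "Suc l'"] Sl[of "Suc j" "Suc l'"] Sl[of j l'] Sl[of "Suc j" l']
        by (auto simp: S_def)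
      hence "((1 + x) * S j l + (if j = l then x ^ l else 0)) * chr k h = (S j (Suc l) + x * S j l') * chr k h" by simp
      thus ?thesis using True by (auto simp: a_def b_def l' algebra_simps split: if_splits)
    next
      case False
      hence "l = n" using l by simp
      thus ?thesis by (simp add: a_def b_def algebra_simps)
    qed
    also have "\<dots> = tinv (string_module G \<chi> n (V k) a) j h + tinv (string_module G \<chi> n (V (\<tau> k)) b) j h"
      using tinv_string[OF kM ab(1) h, of j] tinv_string[OF tk ab(2) h, of j] tau_spec(3)[OF k h]
      by (simp add: x_def S_def chr_def)
    finally show "tinv ?T j h = tinv (string_module G \<chi> n (V k) a) j h + tinv (string_module G \<chi> n (V (\<tau> k)) b) j h" .
  qed
  hence "(of_nat (mul ?T x) :: 'k) = of_nat (mul (string_module G \<chi> n (V k) a) x + mul (string_module G \<chi> n (V (\<tau> k)) b) x)"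
    using mul_nuK[OF T x] mul_nuK[OF string_module(1)[OF kM ab(1)] x] mul_nuK[OF string_module(1)[OF tk ab(2)] x] by simp
  hence "mul ?T x = mul (string_module G \<chi> n (V k) a) x + mul (string_module G \<chi> n (V (\<tau> k)) b) x"
    by (simp only: of_nat_eq_iff)
  thus ?thesis by (simp add: a_def b_def)
qed

text \<open>Dimension is additive along a decomposition; with \<open>mul_V_tensor\<close> this
  yields the dimension count for V_i \<otimes> V_k on which the multiplicativity of \<epsilon>
  rests.\<close>

lemma dim_mul:
  assumes "alg_module H M"
  shows "mdim M = (\<Sum>x\<in>Ix. mul M x * mdim (Mx x))"
proof -
  obtain xs where xs: "decomp M xs" using exists_decomp[OF assms] by blast
  hence "mdim M = (\<Sum>x\<leftarrow>xs. mdim (Mx x))"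
    by (induction rule: decomp.induct) (auto dest!: iso_mod_dim)
  also have "\<dots> = (\<Sum>x\<in>Ix. count_list xs x * mdim (Mx x))"
    by (rule sum_list_map_eq_sum_count2[OF conjunct2[OF decomp_module[OF xs]]]) simp
  also have "\<dots> = (\<Sum>x\<in>Ix. mul M x * mdim (Mx x))"
    by (intro sum.cong refl) (simp add: mul_decomp[OF xs])
  finally show ?thesis .
qed

section \<open>Indecomposable projective modules\<close>

text \<open>The multiplicities of a string add up to one in total, so of two summands one has an
  empty decomposition.\<close>

lemma string_indecomposable:
  assumes x: "x \<in> Ix"
  shows "indecomposable_mod H (Mx x)"
  unfolding indecomposable_mod_def
proof (intro conjI allI impI)
  show "alg_module H (Mx x)" by (rule Mx_module[OF x])
  show "mdim (Mx x) \<noteq> 0" using Mx_dim_pos[OF x] by simp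
  fix N L assume N: "alg_module H N" and L: "alg_module H L" and iso: "iso_mod H (Mx x) (dsum_mod N L)"
  obtain xs where xs: "decomp N xs" using exists_decomp[OF N] by blast
  obtain ys where ys: "decomp L ys" using exists_decomp[OF L] by blast
  have c: "count_list xs y + count_list ys y = (if y = x then 1 else 0)" if y: "y \<in> Ix" for y
  proof -
    have "mul (Mx x) y = mul N y + mul L y"
      using mul_iso[OF Mx_module[OF x] dsum_module[OF N L] iso y] mul_dsum[OF N L y] by simp
    moreover have "mul (Mx x) y = (if y = x then 1 else 0)"
      unfolding Mx_def using mul_string[of "fst x" "snd x" y] x y by (simp add: Ix_def mem_Times_iff)
    ultimately show ?thesis using mul_decomp[OF xs y] mul_decomp[OF ys y] by simp
  qed
  have "xs = [] \<or> ys = []"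
  proof (rule ccontr)
    assume "\<not> (xs = [] \<or> ys = [])"
    then obtain a xs' b ys' where e: "xs = a # xs'" "ys = b # ys'" by (meson list.exhaust)
    have "a \<in> Ix" "b \<in> Ix" using decomp_module[OF xs] decomp_module[OF ys] e by auto
    from c[OF this(1)] c[OF this(2)] show False using e by (auto split: if_splits)
  qed
  thus "mdim N = 0 \<or> mdim L = 0" using xs ys by (auto elim: decomp.cases)
qed

text \<open>A map h from M(k, n) is determined by its restriction to V_k, since its value on
  \<open>x^j V_k\<close> is y^j times that restriction. The surjection f has a G-equivariant section
  Z, so Z composed with the restriction is a lift of it, and \<open>phi_intertwiner\<close> extends
  this lift because y^n = 0 on every module.\<close>

lemma projective_string:
  assumes k: "k \<in> {1..m}"
  shows "projective_mod H (string_module G \<chi> n (V k) n)"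
  unfolding projective_mod_def
proof (intro conjI allI ballI impI)
  let ?P = "string_module G \<chi> n (V k) n" and ?r = "mdim (V k)"
  note VM = V_module[OF k]
  note sm = string_module[OF VM order_refl]
  show P: "alg_module H ?P" by (rule sm(1))
  fix M N f h assume f: "f \<in> intertwiners H M N" and h: "h \<in> intertwiners H ?P N"
    and M: "alg_module H M" and N: "alg_module H N"
    and surj: "(\<lambda>v. f *\<^sub>v v) ` carrier_vec (mdim M) = carrier_vec (mdim N)"
  have fh: "f \<in> homs (mdim M) (hr M) (mdim N) (hr N)" "f * hy M = hy N * f" using f H_intertwiners[OF M N] by auto
  have hh: "h \<in> homs (mdim ?P) (hr ?P) (mdim N) (hr N)" "h * hy ?P = hy N * h" using h H_intertwiners[OF P N] by auto
  note fc = homsD(1)[OF fh(1)]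
  have hc: "h \<in> carrier_mat (mdim N) (n * ?r)" using homsD(1)[OF hh(1)] by (simp add: sm(2))
  obtain Z where Z: "Z \<in> homs (mdim N) (hr N) (mdim M) (hr M)" "f * Z * f = f"
    using homs_pseudo_inverse[OF fh(1) Hrep(1)[OF M] Hrep(1)[OF N]] by blast
  note Zc = homsD(1)[OF Z(1)]
  \<comment> \<open>The equation f Z f = f together with surjectivity of f makes Z a
    section.\<close>
  have fZ: "f * Z = 1\<^sub>m (mdim N)"
  proof (rule mat_eq_iff_mult_vec)
    fix v :: "'k vec" assume "v \<in> carrier_vec (mdim N)"
    then obtain w where w: "w \<in> carrier_vec (mdim M)" "v = f *\<^sub>v w" using surj by blast
    have "f * Z *\<^sub>v v = f * Z * f *\<^sub>v w" unfolding w(2) using fc Zc w(1) by (simp add: mat_mult_vec_assoc)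
    thus "f * Z *\<^sub>v v = 1\<^sub>m (mdim N) *\<^sub>v v" using Z(2) w fc by (simp add: mult_mat_vec_carrier[OF fc])
  qed (use fc Zc in auto)
  \<comment> \<open>The n column blocks of h, that is, its restrictions to the copies
    \<open>x^j V_k\<close>.\<close>
  define F where "F j = mat (mdim N) ?r (\<lambda>(a, b). h $$ (a, j * ?r + b))" for j
  have Fc: "F j \<in> carrier_mat (mdim N) ?r" for j by (simp add: F_def)
  have hF: "h = blk_row (mdim N) n ?r F"
    by (rule eq_matI) (use hc in \<open>auto simp: blk_row_def F_def mod_less_of_mult\<close>)
  have F0: "F 0 \<in> homs ?r (kr (V k)) (mdim N) (hr N)"
    unfolding homs_def
  proof (intro CollectI conjI ballI Fc)
    fix x assume x: "x \<in> carrier G"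
    note rc = repD(1)[OF kg_rep[OF VM] x] hr_carrier[OF N x]
    have "blk_row (mdim N) n ?r (\<lambda>j. inverse (\<chi> x) ^ j \<cdot>\<^sub>m (F j * kr (V k) x)) = blk_row (mdim N) n ?r (\<lambda>j. hr N x * F j)"
      using homsD(2)[OF hh(1) x] unfolding sm(3)[OF x] hF dg_def blk_row_diag[OF Fc rc(1)] mult_blk_row[OF rc(2) Fc] .
    hence e: "blk_row (mdim N) n ?r (\<lambda>j. inverse (\<chi> x) ^ j \<cdot>\<^sub>m (F j * kr (V k) x)) $$ (a, b) = blk_row (mdim N) n ?r (\<lambda>j. hr N x * F j) $$ (a, b)" for a b by simp
    have rn: "b < n * ?r" if "b < ?r" for b using that n_pos by (metis less_le_trans mult_le_mono1 nat_mult_1 Suc_leI One_nat_def)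
    show "F 0 * kr (V k) x = hr N x * F 0"
    proof (rule eq_matI)
      fix a b assume "a < dim_row (hr N x * F 0)" "b < dim_col (hr N x * F 0)"
      hence ab: "a < mdim N" "b < ?r" using rc Fc[of 0] by auto
      show "(F 0 * kr (V k) x) $$ (a, b) = (hr N x * F 0) $$ (a, b)"
        using e[of a b] ab rn[OF ab(2)] by (simp add: blk_row_def)
    qed (use rc Fc[of 0] in auto)
  qed
  have Fs: "F (Suc j) = hy N * F j" if j: "Suc j < n" for j
  proof (rule eq_matI)
    note yc = Hrep(2)[OF N]
    have "blk_row (mdim N) n ?r (\<lambda>k. if Suc k < n then F (Suc k) else 0\<^sub>m (mdim N) ?r) = blk_row (mdim N) n ?r (\<lambda>j. hy N * F j)"
      using hh(2) unfolding sm(4) hF blk_row_shift[OF Fc] mult_blk_row[OF yc Fc] .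
    hence e: "blk_row (mdim N) n ?r (\<lambda>k. if Suc k < n then F (Suc k) else 0\<^sub>m (mdim N) ?r) $$ (a, b) = blk_row (mdim N) n ?r (\<lambda>j. hy N * F j) $$ (a, b)" for a b by simp
    fix a b assume "a < dim_row (hy N * F j)" "b < dim_col (hy N * F j)"
    hence ab: "a < mdim N" "b < ?r" using yc Fc[of j] by auto
    have jn: "j * ?r + b < n * ?r"
    proof -
      have "j * ?r + b < Suc j * ?r" using ab by simp
      also have "\<dots> \<le> n * ?r" using j by (intro mult_le_mono1) simp
      finally show ?thesis .
    qed
    have "(j * ?r + b) div ?r = j" "(j * ?r + b) mod ?r = b" using ab by auto
    thus "F (Suc j) $$ (a, b) = (hy N * F j) $$ (a, b)"
      using e[of a "j * ?r + b"] ab jn j by (simp add: blk_row_def)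
  qed (use Hrep(2)[OF N] Fc in \<open>auto simp: F_def\<close>)
  have Fp: "F j = hy N ^\<^sub>m j * F 0" if "j < n" for j
    using that
  proof (induction j)
    case 0
    show ?case using Hrep(2)[OF N] Fc[of 0] by simp
  next
    case (Suc j)
    note yc = Hrep(2)[OF N] and ypc = hy_pow_carrier[OF N, of j]
    have comm: "hy N * hy N ^\<^sub>m j = hy N ^\<^sub>m Suc j" using pow_mat_add[OF yc, of 1 j] yc by simp
    have "F (Suc j) = hy N * (hy N ^\<^sub>m j * F 0)" using Fs[OF Suc.prems] Suc by simp
    also have "\<dots> = hy N ^\<^sub>m Suc j * F 0" unfolding comm[symmetric] using yc ypc Fc[of 0] by (simp add: mat_assoc)
    finally show ?case .
  qed
  have hP: "h = blk_row (mdim N) n ?r (\<lambda>j. hy N ^\<^sub>m j * F 0)" unfolding hF by (rule blk_row_cong) (rule Fp)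
  define i where "i = Z * F 0"
  have i: "i \<in> homs ?r (kr (V k)) (mdim M) (hr M)"
    unfolding i_def by (rule homs_mult[OF F0 Z(1) kg_rep[OF VM] Hrep(1)[OF N] Hrep(1)[OF M]])
  note ic = homsD(1)[OF i]
  define K where "K = blk_row (mdim M) n ?r (\<lambda>j. hy M ^\<^sub>m j * i)"
  have K: "K \<in> intertwiners H ?P M" unfolding K_def by (rule phi_intertwiner[OF VM order_refl M Hrep(3)[OF M] i])
  have fy: "f * hy M ^\<^sub>m j = hy N ^\<^sub>m j * f" for j
  proof (induction j)
    case 0
    show ?case using fc Hrep(2)[OF M] Hrep(2)[OF N] by simp
  next
    case (Suc j)
    note c = fc Hrep(2)[OF M] Hrep(2)[OF N] hy_pow_carrier[OF M, of j] hy_pow_carrier[OF N, of j]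
    have "f * hy M ^\<^sub>m Suc j = (f * hy M ^\<^sub>m j) * hy M" using c by (simp add: mat_assoc)
    also have "\<dots> = hy N ^\<^sub>m j * (f * hy M)" unfolding Suc using c by (simp add: mat_assoc)
    also have "\<dots> = hy N ^\<^sub>m Suc j * f" unfolding fh(2) using c by (simp add: mat_assoc)
    finally show ?case .
  qed
  have Kc: "hy M ^\<^sub>m j * i \<in> carrier_mat (mdim M) ?r" for j using hy_pow_carrier[OF M, of j] ic by auto
  have "f * K = blk_row (mdim N) n ?r (\<lambda>j. f * (hy M ^\<^sub>m j * i))"
    unfolding K_def by (rule mult_blk_row[OF fc Kc])
  also have "\<dots> = h"
    unfolding hP
  proof (rule blk_row_cong)
    fix j
    note c = fc Zc Fc[of 0] Hrep(2)[OF M] Hrep(2)[OF N] hy_pow_carrier[OF M, of j] hy_pow_carrier[OF N, of j]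
    have "f * (hy M ^\<^sub>m j * i) = (f * hy M ^\<^sub>m j) * (Z * F 0)" unfolding i_def using c by (simp add: mat_assoc)
    also have "\<dots> = hy N ^\<^sub>m j * ((f * Z) * F 0)" unfolding fy using c by (simp add: mat_assoc)
    also have "\<dots> = hy N ^\<^sub>m j * F 0" unfolding fZ using c by simp
    finally show "f * (hy M ^\<^sub>m j * i) = hy N ^\<^sub>m j * F 0" .
  qed
  finally show "\<exists>K\<in>intertwiners H ?P M. f * K = h" using K by blast
qed

end

section \<open>Integral monoid algebras modulo additive relations\<close>

text \<open>Both the Green ring and the complexification divide by the additive subgroup that
  certain relations generate. The two stability conditions say that multiplication by monoid
  elements keeps the relations inside this subgroup, which makes it an ideal.\<close>

locale gen_ideal = monoid_alg M "TYPE(int)" for M :: "('m, 'z) monoid_scheme" (structure) +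
  fixes S :: "('m \<Rightarrow>\<^sub>0 int) set"
  assumes S_closed: "S \<subseteq> carrier MA"
    and S_left: "c \<in> carrier M \<Longrightarrow> s \<in> S \<Longrightarrow> sg c 1 \<otimes>\<^bsub>MA\<^esub> s \<in> generate (add_monoid MA) S"
    and S_right: "c \<in> carrier M \<Longrightarrow> s \<in> S \<Longrightarrow> s \<otimes>\<^bsub>MA\<^esub> sg c 1 \<in> generate (add_monoid MA) S"
begin

definition "GS = generate (add_monoid MA) S"

lemma GS_subgroup: "subgroup GS (add_monoid MA)"
  unfolding GS_def by (rule group.generate_is_subgroup[OF MA.add.is_group]) (use S_closed in simp)

lemma GS_carrier: "x \<in> GS \<Longrightarrow> x \<in> carrier MA"
  using subgroup.mem_carrier[OF GS_subgroup] by simp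

lemma GS_zero: "0 \<in> GS"
  using subgroup.one_closed[OF GS_subgroup] by (simp add: monoid_algebra_simps)

lemma GS_add: "x \<in> GS \<Longrightarrow> y \<in> GS \<Longrightarrow> x + y \<in> GS"
  using subgroup.m_closed[OF GS_subgroup, of x y] by (simp add: monoid_algebra_simps)

lemma GS_uminus: "x \<in> GS \<Longrightarrow> - x \<in> GS"
  using subgroup.m_inv_closed[OF GS_subgroup, of x] MA_minus(1)[OF GS_carrier GS_carrier, of x x]
  by (simp add: a_inv_def)

lemma GS_S: "s \<in> S \<Longrightarrow> s \<in> GS"
  unfolding GS_def by (rule generate.incl)

lemma GS_induct [consumes 1, case_names zero gen uminus add]:
  assumes "x \<in> GS" "P 0" "\<And>s. s \<in> S \<Longrightarrow> P s" "\<And>s. s \<in> S \<Longrightarrow> P (- s)"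
    "\<And>x y. x \<in> GS \<Longrightarrow> y \<in> GS \<Longrightarrow> P x \<Longrightarrow> P y \<Longrightarrow> P (x + y)"
  shows "P x"
  using assms(1) unfolding GS_def
proof (induction rule: generate.induct)
  case (inv h)
  hence h: "h \<in> carrier MA" using S_closed by blast
  hence "inv\<^bsub>add_monoid MA\<^esub> h = - h" using MA_minus(1)[OF h h] by (simp add: a_inv_def)
  thus ?case using assms(4) inv by simp
next
  case (eng h1 h2)
  thus ?case using assms(5) by (simp add: GS_def monoid_algebra_simps)
qed (use assms in \<open>auto simp: monoid_algebra_simps\<close>)

text \<open>An additive f satisfies f k = k f 1, so integer coefficients reduce to the coefficient
  1.\<close>

lemma int_additive_mem:
  fixes f :: "int \<Rightarrow> 'm \<Rightarrow>\<^sub>0 int"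
  assumes "\<And>a b. f (a + b) = f a + f b" "f 1 \<in> GS"
  shows "f k \<in> GS"
proof -
  have f0: "f 0 = 0" using assms(1)[of 0 0] by simp
  have fm: "f (- k) = - f k" for k using assms(1)[of "- k" k] f0 by (simp add: add_eq_0_iff2)
  have "f (int j) \<in> GS" for j
    by (induction j) (use f0 GS_zero GS_add assms in auto)
  thus ?thesis using GS_uminus fm by (cases k rule: int_cases2) auto
qed

lemma GS_ideal: "ideal GS MA"
proof (rule idealI[OF MA.ring_axioms GS_subgroup])
  have sgk: "sg a (k + l) = sg a k + sg a l" for a and k l :: int by (rule single_add)
  fix a x assume a: "a \<in> GS" and "x \<in> carrier MA"
  hence x: "Poly_Mapping.keys x \<subseteq> carrier M" by (simp add: monoid_algebra_simps)
  have um: "p \<otimes>\<^bsub>MA\<^esub> (- q) = - (p \<otimes>\<^bsub>MA\<^esub> q)" "(- q) \<otimes>\<^bsub>MA\<^esub> p = - (q \<otimes>\<^bsub>MA\<^esub> p)" for p q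
    using mult_add_right[of p q "- q"] mult_add_left[of q "- q" p] mult_zero
    by (simp_all add: eq_neg_iff_add_eq_0 add.commute)
  have L: "x \<otimes>\<^bsub>MA\<^esub> s \<in> GS" if s: "s \<in> S" for s using x
  proof (induction rule: pm_induct)
    case (add c k q)
    have "sg c k \<otimes>\<^bsub>MA\<^esub> s \<in> GS"
      by (rule int_additive_mem[of "\<lambda>k. sg c k \<otimes>\<^bsub>MA\<^esub> s"])
        (use S_left[OF add(1) s] in \<open>simp_all add: sgk mult_add_left GS_def\<close>)
    thus ?case using add GS_add by (simp add: mult_add_left)
  qed (simp add: mult_zero GS_zero)
  have R: "s \<otimes>\<^bsub>MA\<^esub> x \<in> GS" if s: "s \<in> S" for s using x
  proof (induction rule: pm_induct)
    case (add c k q)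
    have "s \<otimes>\<^bsub>MA\<^esub> sg c k \<in> GS"
      by (rule int_additive_mem[of "\<lambda>k. s \<otimes>\<^bsub>MA\<^esub> sg c k"])
        (use S_right[OF add(1) s] in \<open>simp_all add: sgk mult_add_right GS_def\<close>)
    thus ?case using add GS_add by (simp add: mult_add_right)
  qed (simp add: mult_zero GS_zero)
  show "x \<otimes>\<^bsub>MA\<^esub> a \<in> GS" using a
    by (induction rule: GS_induct) (auto simp: mult_zero GS_zero L um GS_uminus mult_add_right GS_add)
  show "a \<otimes>\<^bsub>MA\<^esub> x \<in> GS" using a
    by (induction rule: GS_induct) (auto simp: mult_zero GS_zero R um GS_uminus mult_add_left GS_add)
qed

sublocale I: ideal GS MA by (rule GS_ideal)

abbreviation QA where "QA \<equiv> MA Quot GS"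
abbreviation q where "q a \<equiv> GS +>\<^bsub>MA\<^esub> sg a 1"

sublocale QA: ring QA by (rule I.quotient_is_ring)

lemma q_closed: "a \<in> carrier M \<Longrightarrow> q a \<in> carrier QA"
  unfolding I.quot_carrier by (rule bexI[OF refl sg_closed])

lemma q_mult: "a \<in> carrier M \<Longrightarrow> b \<in> carrier M \<Longrightarrow> q a \<otimes>\<^bsub>QA\<^esub> q b = q (a \<otimes> b)"
  by (simp add: I.quot_mult mult_sg)

lemma q_one: "\<one>\<^bsub>QA\<^esub> = q \<one>"
  by (simp add: I.quot_one monoid_algebra_simps)

lemma q_rel:
  assumes "a \<in> carrier M" "b \<in> carrier M" "c \<in> carrier M" "sg a 1 - sg b 1 - sg c 1 \<in> S"
  shows "q a = q b \<oplus>\<^bsub>QA\<^esub> q c"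
proof -
  have bc: "sg b 1 + sg c 1 \<in> carrier MA" using assms MA.a_closed[of "sg b 1" "sg c 1"] by (simp add: monoid_algebra_simps(3))
  have "sg a 1 \<ominus>\<^bsub>MA\<^esub> (sg b 1 + sg c 1) = sg a 1 - (sg b 1 + sg c 1)"
    by (rule MA_minus(2)[OF bc sg_closed[OF assms(1)]])
  hence "q a = GS +>\<^bsub>MA\<^esub> (sg b 1 + sg c 1)"
    using I.quot_eq[OF sg_closed[OF assms(1)] bc, of 1] GS_S[OF assms(4)] by (simp add: diff_diff_eq)
  thus ?thesis using I.quot_add[OF sg_closed[OF assms(2)] sg_closed[OF assms(3)], of 1 1] by (simp add: monoid_algebra_simps)
qed

lemma Q_induct [consumes 1, case_names gen zero uminus add]:
  assumes "X \<in> carrier QA" "\<And>a. a \<in> carrier M \<Longrightarrow> P (q a)" "P \<zero>\<^bsub>QA\<^esub>"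
    "\<And>X. X \<in> carrier QA \<Longrightarrow> P X \<Longrightarrow> P (\<ominus>\<^bsub>QA\<^esub> X)"
    "\<And>X Y. X \<in> carrier QA \<Longrightarrow> Y \<in> carrier QA \<Longrightarrow> P X \<Longrightarrow> P Y \<Longrightarrow> P (X \<oplus>\<^bsub>QA\<^esub> Y)"
  shows "P X"
proof -
  let ?c = "\<lambda>p. GS +>\<^bsub>MA\<^esub> p"
  have cc: "?c p \<in> carrier QA" if "p \<in> carrier MA" for p unfolding I.quot_carrier using that by blast
  have ca: "?c (p + p') = ?c p \<oplus>\<^bsub>QA\<^esub> ?c p'" if "p \<in> carrier MA" "p' \<in> carrier MA" for p p'
    using I.quot_add[OF that] by (simp add: monoid_algebra_simps)
  have z: "?c 0 = \<zero>\<^bsub>QA\<^esub>" using I.quot_zero by (simp add: monoid_algebra_simps)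
  obtain p where p: "p \<in> carrier MA" "X = ?c p" using assms(1) unfolding I.quot_carrier by blast
  have sgp: "P (?c (sg a k))" if a: "a \<in> carrier M" for a k
  proof -
    have nat: "P (?c (sg a (int j)))" for j
    proof (induction j)
      case 0
      show ?case using z assms(3) by simp
    next
      case (Suc j)
      have "sg a (int (Suc j)) = sg a 1 + sg a (int j)" by (simp add: single_add)
      thus ?case using ca[OF sg_closed[OF a] sg_closed[OF a], of 1 "int j"] assms(2)[OF a]
          assms(5)[OF cc[OF sg_closed[OF a]] cc[OF sg_closed[OF a]] _ Suc] by simp
    qed
    have "?c (sg a (- int j)) = \<ominus>\<^bsub>QA\<^esub> ?c (sg a (int j))" for j
    proof (rule QA.minus_equality[symmetric])
      show "?c (sg a (- int j)) \<oplus>\<^bsub>QA\<^esub> ?c (sg a (int j)) = \<zero>\<^bsub>QA\<^esub>"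
        using ca[OF sg_closed[OF a] sg_closed[OF a], of "- int j" "int j"] z by (simp add: single_add[symmetric])
    qed (use cc sg_closed a in auto)
    thus ?thesis using nat assms(4)[OF cc[OF sg_closed[OF a]]] by (cases k rule: int_cases2) auto
  qed
  from p(1) have "Poly_Mapping.keys p \<subseteq> carrier M" by (simp add: monoid_algebra_simps)
  hence "P (?c p)"
  proof (induction rule: pm_induct)
    case (add a k p)
    have "p \<in> carrier MA" using add by (simp add: monoid_algebra_simps)
    thus ?case using ca[OF sg_closed[OF add(1)]] assms(5)[OF cc cc] sgp[OF add(1)] add(3) sg_closed[OF add(1)] by simp
  qed (simp add: z assms(3))
  thus ?thesis using p by simp
qed

definition fext :: "('m \<Rightarrow> complex) \<Rightarrow> ('m \<Rightarrow>\<^sub>0 int) \<Rightarrow> complex" where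
  "fext \<phi> p = (\<Sum>a\<in>Poly_Mapping.keys p. of_int (Poly_Mapping.lookup p a) * \<phi> a)"

lemma fext_superset: "finite A \<Longrightarrow> Poly_Mapping.keys p \<subseteq> A \<Longrightarrow> fext \<phi> p = (\<Sum>a\<in>A. of_int (Poly_Mapping.lookup p a) * \<phi> a)"
  unfolding fext_def by (rule sum.mono_neutral_left) (auto simp: in_keys_iff)

lemma fext_add: "fext \<phi> (p + p') = fext \<phi> p + fext \<phi> p'"
proof -
  let ?A = "Poly_Mapping.keys p \<union> Poly_Mapping.keys p'"
  have "Poly_Mapping.keys (p + p') \<subseteq> ?A" by (rule keys_add)
  thus ?thesis using fext_superset[of ?A "p + p'" \<phi>] fext_superset[of ?A p \<phi>] fext_superset[of ?A p' \<phi>]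
    by (simp add: lookup_add distrib_right sum.distrib)
qed

lemma fext_single: "fext \<phi> (sg a k) = of_int k * \<phi> a"
  by (subst fext_superset[of "{a}"]) auto

lemma fext_uminus: "fext \<phi> (- p) = - fext \<phi> p"
  using fext_add[of \<phi> p "- p"] by (simp add: fext_def eq_neg_iff_add_eq_0 add.commute)

lemma fext_diff: "fext \<phi> (p - p') = fext \<phi> p - fext \<phi> p'"
  using fext_add[of \<phi> p "- p'"] by (simp add: fext_uminus)

text \<open>Only additivity is established at this level; multiplicativity of functionals is checked
  later on generators of the ring.\<close>

lemma Q_functional:
  assumes "\<And>s. s \<in> S \<Longrightarrow> fext \<phi> s = 0"
  shows "\<exists>f. (\<forall>a\<in>carrier M. f (q a) = \<phi> a) \<and> (\<forall>X\<in>carrier QA. \<forall>Y\<in>carrier QA. f (X \<oplus>\<^bsub>QA\<^esub> Y) = f X + f Y)"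
proof -
  have z: "fext \<phi> x = 0" if "x \<in> GS" for x using that
    by (induction rule: GS_induct) (auto simp: assms fext_uminus fext_add, simp add: fext_def)
  have "\<exists>f. \<forall>a\<in>carrier MA. f (GS +>\<^bsub>MA\<^esub> a) = fext \<phi> a"
  proof (rule I.quot_lift)
    fix a b assume ab: "a \<in> carrier MA" "b \<in> carrier MA" "a \<ominus>\<^bsub>MA\<^esub> b \<in> GS"
    hence "fext \<phi> (a - b) = 0" using z MA_minus(2)[OF ab(2,1)] by simp
    thus "fext \<phi> a = fext \<phi> b" by (simp add: fext_diff)
  qed
  then obtain f where f: "\<And>a. a \<in> carrier MA \<Longrightarrow> f (GS +>\<^bsub>MA\<^esub> a) = fext \<phi> a" by blast
  have "f (X \<oplus>\<^bsub>QA\<^esub> Y) = f X + f Y" if XY: "X \<in> carrier QA" "Y \<in> carrier QA" for X Y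
  proof -
    obtain a b where ab: "a \<in> carrier MA" "b \<in> carrier MA" "X = GS +>\<^bsub>MA\<^esub> a" "Y = GS +>\<^bsub>MA\<^esub> b"
      using XY unfolding I.quot_carrier by blast
    have "a \<oplus>\<^bsub>MA\<^esub> b \<in> carrier MA" using ab by simp
    thus ?thesis using ab f by (simp add: I.quot_add fext_add monoid_algebra_simps(3))
  qed
  moreover have "f (q a) = \<phi> a" if "a \<in> carrier M" for a
    using f[OF sg_closed[OF that]] by (simp add: fext_single)
  ultimately show ?thesis by blast
qed

end

section \<open>The Green ring\<close>

text \<open>The converse of \<open>iso_dsumI\<close>; together they transport direct sums through
  additive constructions such as tensoring with a fixed module.\<close>

lemma dsum_maps:
  fixes M N :: "('k::field, 'a) fdmod"
  assumes M: "alg_module A M" and N: "alg_module A N"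
  shows "\<exists>i1 i2 p1 p2. i1 \<in> intertwiners A M (dsum_mod M N) \<and> i2 \<in> intertwiners A N (dsum_mod M N) \<and>
    p1 \<in> intertwiners A (dsum_mod M N) M \<and> p2 \<in> intertwiners A (dsum_mod M N) N \<and>
    p1 * i1 = 1\<^sub>m (mdim M) \<and> p2 * i2 = 1\<^sub>m (mdim N) \<and> p1 * i2 = 0\<^sub>m (mdim M) (mdim N) \<and>
    p2 * i1 = 0\<^sub>m (mdim N) (mdim M) \<and> i1 * p1 + i2 * p2 = 1\<^sub>m (mdim (dsum_mod M N))"
proof -
  let ?m = "mdim M" and ?n = "mdim N"
  define i1 :: "'k mat" where "i1 = mat (?m + ?n) ?m (\<lambda>(i, j). if i = j then 1 else 0)"
  define i2 :: "'k mat" where "i2 = mat (?m + ?n) ?n (\<lambda>(i, j). if i = ?m + j then 1 else 0)"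
  define p1 :: "'k mat" where "p1 = mat ?m (?m + ?n) (\<lambda>(i, j). if i = j then 1 else 0)"
  define p2 :: "'k mat" where "p2 = mat ?n (?m + ?n) (\<lambda>(i, j). if ?m + i = j then 1 else 0)"
  have c: "i1 \<in> carrier_mat (?m + ?n) ?m" "i2 \<in> carrier_mat (?m + ?n) ?n" "p1 \<in> carrier_mat ?m (?m + ?n)" "p2 \<in> carrier_mat ?n (?m + ?n)"
    by (simp_all add: i1_def i2_def p1_def p2_def)
  have R: "X * i1 = mat (dim_row X) ?m (\<lambda>(a, b). X $$ (a, b))" "X * i2 = mat (dim_row X) ?n (\<lambda>(a, b). X $$ (a, ?m + b))"
    if "X \<in> carrier_mat d (?m + ?n)" for X d
  proof -
    show "X * i1 = mat (dim_row X) ?m (\<lambda>(a, b). X $$ (a, b))"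
    proof (rule eq_matI, goal_cases)
      case (1 a b)
      hence ab: "a < d" "b < ?m" using that by auto
      have "(X * i1) $$ (a, b) = (\<Sum>l<?m + ?n. X $$ (a, l) * i1 $$ (l, b))" by (rule mult_index_sum[OF that c(1) ab])
      also have "\<dots> = (\<Sum>l<?m + ?n. if l = b then X $$ (a, l) else 0)" using ab by (intro sum.cong) (auto simp: i1_def)
      finally show ?case using ab that by simp
    qed (use that c in auto)
    show "X * i2 = mat (dim_row X) ?n (\<lambda>(a, b). X $$ (a, ?m + b))"
    proof (rule eq_matI, goal_cases)
      case (1 a b)
      hence ab: "a < d" "b < ?n" using that by auto
      have "(X * i2) $$ (a, b) = (\<Sum>l<?m + ?n. X $$ (a, l) * i2 $$ (l, b))" by (rule mult_index_sum[OF that c(2) ab])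
      also have "\<dots> = (\<Sum>l<?m + ?n. if l = ?m + b then X $$ (a, l) else 0)" using ab by (intro sum.cong) (auto simp: i2_def)
      finally show ?case using ab that by simp
    qed (use that c in auto)
  qed
  have L: "p1 * X = mat ?m (dim_col X) (\<lambda>(a, b). X $$ (a, b))" "p2 * X = mat ?n (dim_col X) (\<lambda>(a, b). X $$ (?m + a, b))"
    if "X \<in> carrier_mat (?m + ?n) d" for X d
  proof -
    show "p1 * X = mat ?m (dim_col X) (\<lambda>(a, b). X $$ (a, b))"
    proof (rule eq_matI, goal_cases)
      case (1 a b)
      hence ab: "a < ?m" "b < d" using that by auto
      have "(p1 * X) $$ (a, b) = (\<Sum>l<?m + ?n. p1 $$ (a, l) * X $$ (l, b))" by (rule mult_index_sum[OF c(3) that ab])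
      also have "\<dots> = (\<Sum>l<?m + ?n. if l = a then X $$ (l, b) else 0)" using ab by (intro sum.cong) (auto simp: p1_def)
      finally show ?case using ab that by simp
    qed (use that c in auto)
    show "p2 * X = mat ?n (dim_col X) (\<lambda>(a, b). X $$ (?m + a, b))"
    proof (rule eq_matI, goal_cases)
      case (1 a b)
      hence ab: "a < ?n" "b < d" using that by auto
      have "(p2 * X) $$ (a, b) = (\<Sum>l<?m + ?n. p2 $$ (a, l) * X $$ (l, b))" by (rule mult_index_sum[OF c(4) that ab])
      also have "\<dots> = (\<Sum>l<?m + ?n. if l = ?m + a then X $$ (l, b) else 0)" using ab by (intro sum.cong) (auto simp: p2_def)
      finally show ?case using ab that by simp
    qed (use that c in auto)
  qed
  have L1: "i1 * X = mat (?m + ?n) (dim_col X) (\<lambda>(a, b). if a < ?m then X $$ (a, b) else 0)" if "X \<in> carrier_mat ?m d" for X d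
  proof (rule eq_matI, goal_cases)
    case (1 a b)
    hence ab: "a < ?m + ?n" "b < d" using that by auto
    have "(i1 * X) $$ (a, b) = (\<Sum>l<?m. i1 $$ (a, l) * X $$ (l, b))" by (rule mult_index_sum[OF c(1) that ab])
    also have "\<dots> = (\<Sum>l<?m. if l = a then X $$ (l, b) else 0)" using ab by (intro sum.cong) (auto simp: i1_def)
    finally show ?case using ab that by simp
  qed (use that c in auto)
  have L2: "i2 * X = mat (?m + ?n) (dim_col X) (\<lambda>(a, b). if a < ?m then 0 else X $$ (a - ?m, b))" if "X \<in> carrier_mat ?n d" for X d
  proof (rule eq_matI, goal_cases)
    case (1 a b)
    hence ab: "a < ?m + ?n" "b < d" using that by auto
    have "(i2 * X) $$ (a, b) = (\<Sum>l<?n. i2 $$ (a, l) * X $$ (l, b))" by (rule mult_index_sum[OF c(2) that ab])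
    also have "\<dots> = (\<Sum>l<?n. if l = a - ?m then (if a < ?m then 0 else X $$ (l, b)) else 0)" using ab by (intro sum.cong) (auto simp: i2_def)
    finally show ?case using ab that by auto
  qed (use that c in auto)
  have R1: "X * p1 = mat (dim_row X) (?m + ?n) (\<lambda>(a, b). if b < ?m then X $$ (a, b) else 0)" if "X \<in> carrier_mat d ?m" for X d
  proof (rule eq_matI, goal_cases)
    case (1 a b)
    hence ab: "a < d" "b < ?m + ?n" using that by auto
    have "(X * p1) $$ (a, b) = (\<Sum>l<?m. X $$ (a, l) * p1 $$ (l, b))" by (rule mult_index_sum[OF that c(3) ab])
    also have "\<dots> = (\<Sum>l<?m. if l = b then X $$ (a, l) else 0)" using ab by (intro sum.cong) (auto simp: p1_def)
    finally show ?case using ab that by simp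
  qed (use that c in auto)
  have R2: "X * p2 = mat (dim_row X) (?m + ?n) (\<lambda>(a, b). if b < ?m then 0 else X $$ (a, b - ?m))" if "X \<in> carrier_mat d ?n" for X d
  proof (rule eq_matI, goal_cases)
    case (1 a b)
    hence ab: "a < d" "b < ?m + ?n" using that by auto
    have "(X * p2) $$ (a, b) = (\<Sum>l<?n. X $$ (a, l) * p2 $$ (l, b))" by (rule mult_index_sum[OF that c(4) ab])
    also have "\<dots> = (\<Sum>l<?n. if l = b - ?m then (if b < ?m then 0 else X $$ (a, l)) else 0)" using ab by (intro sum.cong) (auto simp: p2_def)
    finally show ?case using ab that by auto
  qed (use that c in auto)
  have int: "i1 * act M x = act (dsum_mod M N) x * i1" "i2 * act N x = act (dsum_mod M N) x * i2"
    "p1 * act (dsum_mod M N) x = act M x * p1" "p2 * act (dsum_mod M N) x = act N x * p2" if x: "x \<in> carrier A" for x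
  proof -
    note ac = alg_moduleD(1)[OF M x] alg_moduleD(1)[OF N x]
    have dc: "act (dsum_mod M N) x \<in> carrier_mat (?m + ?n) (?m + ?n)" using ac by (simp add: dsum_mod_def)
    show "i1 * act M x = act (dsum_mod M N) x * i1"
      unfolding L1[OF ac(1)] R(1)[OF dc] by (rule eq_matI) (use ac in \<open>auto simp: dsum_mod_def\<close>)
    show "i2 * act N x = act (dsum_mod M N) x * i2"
      unfolding L2[OF ac(2)] R(2)[OF dc] by (rule eq_matI) (use ac in \<open>auto simp: dsum_mod_def\<close>)
    show "p1 * act (dsum_mod M N) x = act M x * p1"
      unfolding R1[OF ac(1)] L(1)[OF dc] by (rule eq_matI) (use ac in \<open>auto simp: dsum_mod_def\<close>)
    show "p2 * act (dsum_mod M N) x = act N x * p2"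
      unfolding R2[OF ac(2)] L(2)[OF dc] by (rule eq_matI) (use ac in \<open>auto simp: dsum_mod_def\<close>)
  qed
  have "i1 * p1 + i2 * p2 = 1\<^sub>m (?m + ?n)"
    unfolding L1[OF c(3)] L2[OF c(4)] by (rule eq_matI) (use c in \<open>auto simp: p1_def p2_def\<close>)
  moreover have "p1 * i1 = 1\<^sub>m ?m" "p1 * i2 = 0\<^sub>m ?m ?n" "p2 * i1 = 0\<^sub>m ?n ?m" "p2 * i2 = 1\<^sub>m ?n"
    unfolding L(1)[OF c(1)] L(1)[OF c(2)] L(2)[OF c(1)] L(2)[OF c(2)]
    by (rule eq_matI; use c in \<open>auto simp: i1_def i2_def\<close>)+
  ultimately show ?thesis using int c
    by (intro exI[of _ i1] exI[of _ i2] exI[of _ p1] exI[of _ p2]) (simp add: intertwiners_def)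
qed

lemma iso_mod_refl: "alg_module A M \<Longrightarrow> iso_mod A M M"
  unfolding iso_mod_iff
  by (intro bexI[of _ "1\<^sub>m (mdim M)"]) (auto simp: intertwiners_def dest: alg_moduleD(1))

lemma iso_mod_sym:
  assumes M: "alg_module A M" and N: "alg_module A N" and iso: "iso_mod A M N"
  shows "iso_mod A N M"
proof -
  obtain P Q where P: "P \<in> intertwiners A M N" "Q \<in> carrier_mat (mdim M) (mdim N)"
    "P * Q = 1\<^sub>m (mdim N)" "Q * P = 1\<^sub>m (mdim M)" using iso unfolding iso_mod_iff by blast
  have "Q * act N x = act M x * Q" if x: "x \<in> carrier A" for x
  proof -
    note c = intertwinersD(1)[OF P(1)] P(2) alg_moduleD(1)[OF M x] alg_moduleD(1)[OF N x]
    have "Q * act N x = Q * (act N x * P) * Q" using c P(3) by (simp add: mat_assoc)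
    also have "\<dots> = (Q * P) * (act M x * Q)" unfolding intertwinersD(2)[OF P(1) x, symmetric] using c by (simp add: mat_assoc)
    finally show ?thesis using P(4) c by simp
  qed
  hence "Q \<in> intertwiners A N M" using P(2) by (simp add: intertwiners_def)
  thus ?thesis unfolding iso_mod_iff using P intertwinersD(1)[OF P(1)] by blast
qed

lemma iso_mod_trans:
  assumes L: "alg_module A L" and M: "alg_module A M" and N: "alg_module A N" and iso: "iso_mod A L M" "iso_mod A M N"
  shows "iso_mod A L N"
proof -
  obtain P Q where P: "P \<in> intertwiners A L M" "Q \<in> carrier_mat (mdim L) (mdim M)"
    "P * Q = 1\<^sub>m (mdim M)" "Q * P = 1\<^sub>m (mdim L)" using iso(1) unfolding iso_mod_iff by blast
  obtain P' Q' where P': "P' \<in> intertwiners A M N" "Q' \<in> carrier_mat (mdim M) (mdim N)"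
    "P' * Q' = 1\<^sub>m (mdim N)" "Q' * P' = 1\<^sub>m (mdim M)" using iso(2) unfolding iso_mod_iff by blast
  note c = intertwinersD(1)[OF P(1)] P(2) intertwinersD(1)[OF P'(1)] P'(2)
  have "P' * P * act L x = act N x * (P' * P)" if x: "x \<in> carrier A" for x
  proof -
    note a = alg_moduleD(1)[OF L x] alg_moduleD(1)[OF M x] alg_moduleD(1)[OF N x]
    have "P' * P * act L x = (P' * act M x) * P" using c a intertwinersD(2)[OF P(1) x] by (simp add: mat_assoc)
    thus ?thesis unfolding intertwinersD(2)[OF P'(1) x] using c a by (simp add: mat_assoc)
  qed
  hence "P' * P \<in> intertwiners A L N" using c by (auto simp: intertwiners_def)
  moreover have "P' * P * (Q * Q') = P' * (P * Q) * Q'" "Q * Q' * (P' * P) = Q * (Q' * P') * P"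
    using c by (simp_all add: mat_assoc)
  hence "P' * P * (Q * Q') = 1\<^sub>m (mdim N)" "Q * Q' * (P' * P) = 1\<^sub>m (mdim L)"
    using c P(3,4) P'(3,4) by simp_all
  moreover have "Q * Q' \<in> carrier_mat (mdim L) (mdim N)" using c by auto
  ultimately show ?thesis unfolding iso_mod_iff by blast
qed

section \<open>The monoid of isomorphism classes and the ring built on it\<close>

context gd
begin

lemma iso_of_eq:
  assumes M: "alg_module H M" and N: "alg_module H N" and e: "mdim M = mdim N" "\<And>h. h \<in> carrier G \<Longrightarrow> hr M h = hr N h" "hy M = hy N"
  shows "iso_mod H M N"
proof -
  have "1\<^sub>m (mdim M) \<in> intertwiners H M N"
    unfolding H_intertwiners[OF M N] homs_def using Hrep(2)[OF N] hr_carrier[OF N] e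
    by (auto dest!: hr_carrier[OF N])
  thus ?thesis unfolding iso_mod_iff using e(1) by (intro bexI[of _ "1\<^sub>m (mdim M)"]) auto
qed

lemma tensor_intertwiner:
  assumes M: "alg_module H M" and M': "alg_module H M'" and N: "alg_module H N" and N': "alg_module H N'"
    and P: "P \<in> intertwiners H M M'" and Q: "Q \<in> intertwiners H N N'"
  shows "kron P Q \<in> intertwiners H (hopf_tensor G \<chi> g n M N) (hopf_tensor G \<chi> g n M' N')"
proof -
  note t = tensor_module[OF M N] and t' = tensor_module[OF M' N']
  note c = intertwinersD(1)[OF P] intertwinersD(1)[OF Q]
  have Ph: "P * hr M h = hr M' h * P" "Q * hr N h = hr N' h * Q" if "h \<in> carrier G" for h
    using P Q that by (auto simp: H_intertwiners M M' N N' homs_def)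
  have Py: "P * hy M = hy M' * P" "Q * hy N = hy N' * Q" using P Q by (auto simp: H_intertwiners M M' N N')
  have "kron P Q * kron (hr M h) (hr N h) = kron (hr M' h) (hr N' h) * kron P Q" if h: "h \<in> carrier G" for h
    using c hr_carrier[OF M h] hr_carrier[OF M' h] hr_carrier[OF N h] hr_carrier[OF N' h] Ph[OF h] by (simp add: kron_mult)
  moreover have "kron P Q * (kron (hy M) (hr N g) + kron (1\<^sub>m (mdim M)) (hy N)) =
     (kron (hy M') (hr N' g) + kron (1\<^sub>m (mdim M')) (hy N')) * kron P Q"
    using c Hrep(2)[OF M] Hrep(2)[OF M'] Hrep(2)[OF N] Hrep(2)[OF N'] hr_carrier[OF N g_closed] hr_carrier[OF N' g_closed]
      Ph[OF g_closed] Py by (simp add: mat_distrib_left mat_distrib_right kron_mult)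
  ultimately show ?thesis unfolding H_intertwiners[OF t(1) t'(1)] homs_def
    using c by (simp add: t t')
qed

lemma tensor_iso:
  assumes M: "alg_module H M" and M': "alg_module H M'" and N: "alg_module H N" and N': "alg_module H N'"
    and iso: "iso_mod H M M'" "iso_mod H N N'"
  shows "iso_mod H (hopf_tensor G \<chi> g n M N) (hopf_tensor G \<chi> g n M' N')"
proof -
  obtain P Q where P: "P \<in> intertwiners H M M'" "Q \<in> carrier_mat (mdim M) (mdim M')"
    "P * Q = 1\<^sub>m (mdim M')" "Q * P = 1\<^sub>m (mdim M)" using iso(1) unfolding iso_mod_iff by blast
  obtain P' Q' where P': "P' \<in> intertwiners H N N'" "Q' \<in> carrier_mat (mdim N) (mdim N')"
    "P' * Q' = 1\<^sub>m (mdim N')" "Q' * P' = 1\<^sub>m (mdim N)" using iso(2) unfolding iso_mod_iff by blast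
  note c = intertwinersD(1)[OF P(1)] P(2) intertwinersD(1)[OF P'(1)] P'(2)
  show ?thesis unfolding iso_mod_iff
    by (rule bexI[OF _ tensor_intertwiner[OF M M' N N' P(1) P'(1)]], rule bexI[of _ "kron Q Q'"])
      (use c P(3,4) P'(3,4) in \<open>simp_all add: tensor_module M M' N N' kron_mult kron_one\<close>)
qed

lemma intertwiner_one: "alg_module H M \<Longrightarrow> 1\<^sub>m (mdim M) \<in> intertwiners H M M"
  by (auto simp: intertwiners_def dest: alg_moduleD(1))

lemma tensor_dsum_left:
  assumes L: "alg_module H L" and M: "alg_module H M" and N: "alg_module H N"
  shows "iso_mod H (hopf_tensor G \<chi> g n L (dsum_mod M N)) (dsum_mod (hopf_tensor G \<chi> g n L M) (hopf_tensor G \<chi> g n L N))"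
proof -
  obtain i1 i2 p1 p2 where d: "i1 \<in> intertwiners H M (dsum_mod M N)" "i2 \<in> intertwiners H N (dsum_mod M N)"
    "p1 \<in> intertwiners H (dsum_mod M N) M" "p2 \<in> intertwiners H (dsum_mod M N) N"
    and e: "p1 * i1 = 1\<^sub>m (mdim M)" "p2 * i2 = 1\<^sub>m (mdim N)" "p1 * i2 = 0\<^sub>m (mdim M) (mdim N)"
      "p2 * i1 = 0\<^sub>m (mdim N) (mdim M)" "i1 * p1 + i2 * p2 = 1\<^sub>m (mdim (dsum_mod M N))"
    using dsum_maps[OF M N] by blast
  note D = dsum_module[OF M N]
  note c = intertwinersD(1)[OF d(1)] intertwinersD(1)[OF d(2)] intertwinersD(1)[OF d(3)] intertwinersD(1)[OF d(4)]
  note one = intertwiner_one[OF L]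
  note t = tensor_module(1,2)[OF L D] tensor_module(1,2)[OF L M] tensor_module(1,2)[OF L N]
  show ?thesis
    by (rule iso_dsumI[OF t(1,3,5) tensor_intertwiner[OF L L M D one d(1)] tensor_intertwiner[OF L L N D one d(2)]
          tensor_intertwiner[OF L L D M one d(3)] tensor_intertwiner[OF L L D N one d(4)]])
      (use c e in \<open>simp_all add: t(2,4,6) kron_mult kron_one kron_add_right[symmetric]\<close>)
qed

lemma tensor_dsum_right:
  assumes L: "alg_module H L" and M: "alg_module H M" and N: "alg_module H N"
  shows "iso_mod H (hopf_tensor G \<chi> g n (dsum_mod M N) L) (dsum_mod (hopf_tensor G \<chi> g n M L) (hopf_tensor G \<chi> g n N L))"
proof -
  obtain i1 i2 p1 p2 where d: "i1 \<in> intertwiners H M (dsum_mod M N)" "i2 \<in> intertwiners H N (dsum_mod M N)"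
    "p1 \<in> intertwiners H (dsum_mod M N) M" "p2 \<in> intertwiners H (dsum_mod M N) N"
    and e: "p1 * i1 = 1\<^sub>m (mdim M)" "p2 * i2 = 1\<^sub>m (mdim N)" "p1 * i2 = 0\<^sub>m (mdim M) (mdim N)"
      "p2 * i1 = 0\<^sub>m (mdim N) (mdim M)" "i1 * p1 + i2 * p2 = 1\<^sub>m (mdim (dsum_mod M N))"
    using dsum_maps[OF M N] by blast
  note D = dsum_module[OF M N]
  note c = intertwinersD(1)[OF d(1)] intertwinersD(1)[OF d(2)] intertwinersD(1)[OF d(3)] intertwinersD(1)[OF d(4)]
  note one = intertwiner_one[OF L]
  note t = tensor_module(1,2)[OF D L] tensor_module(1,2)[OF M L] tensor_module(1,2)[OF N L]
  show ?thesis
    by (rule iso_dsumI[OF t(1,3,5) tensor_intertwiner[OF M D L L d(1) one] tensor_intertwiner[OF N D L L d(2) one]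
          tensor_intertwiner[OF D M L L d(3) one] tensor_intertwiner[OF D N L L d(4) one]])
      (use c e in \<open>simp_all add: t(2,4,6) kron_mult kron_one kron_add_left[symmetric]\<close>)
qed

text \<open>Coassociativity in matrix form: both bracketings give literally the same matrices,
  because \<open>kron\<close> is strictly associative and g acts on a tensor product by g \<otimes>
  g.\<close>

lemma tensor_assoc:
  assumes L: "alg_module H L" and M: "alg_module H M" and N: "alg_module H N"
  shows "iso_mod H (hopf_tensor G \<chi> g n (hopf_tensor G \<chi> g n L M) N) (hopf_tensor G \<chi> g n L (hopf_tensor G \<chi> g n M N))"
proof -
  note t1 = tensor_module[OF L M] and t2 = tensor_module[OF M N]
  note t3 = tensor_module[OF t1(1) N] and t4 = tensor_module[OF L t2(1)]
  note c = Hrep(2)[OF L] Hrep(2)[OF M] Hrep(2)[OF N] hr_carrier[OF L g_closed] hr_carrier[OF M g_closed] hr_carrier[OF N g_closed]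
  show ?thesis
    by (rule iso_of_eq[OF t3(1) t4(1)])
      (use c in \<open>simp_all add: t1 t2 t3 t4 mult.assoc kron_assoc g_closed kron_add_left kron_add_right kron_one[symmetric]
         assoc_add_mat[of _ "mdim L * (mdim M * mdim N)" "mdim L * (mdim M * mdim N)"]\<close>)
qed

lemma tensor_unit:
  assumes M: "alg_module H M"
  shows "iso_mod H (hopf_tensor G \<chi> g n (hopf_unit G \<chi> n) M) M" "iso_mod H (hopf_tensor G \<chi> g n M (hopf_unit G \<chi> n)) M"
proof -
  note t1 = tensor_module[OF unit_module(1) M] and t2 = tensor_module[OF M unit_module(1)]
  note c = Hrep(2)[OF M] hr_carrier[OF M g_closed]
  have k: "kron (1\<^sub>m 1) B = B" "kron B (1\<^sub>m 1) = B" for B :: "'k mat" by (rule kron_one_1)+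
  show "iso_mod H (hopf_tensor G \<chi> g n (hopf_unit G \<chi> n) M) M"
    by (rule iso_of_eq[OF t1(1) M]) (use c in \<open>simp_all only: t1 unit_module k, simp_all\<close>)
  show "iso_mod H (hopf_tensor G \<chi> g n M (hopf_unit G \<chi> n)) M"
    by (rule iso_of_eq[OF t2(1) M]) (use c in \<open>simp_all only: t2 unit_module k g_closed, simp_all\<close>)
qed

abbreviation ic where "ic \<equiv> iso_class H"
abbreviation IM where "IM \<equiv> iso_monoid G \<chi> g n"
abbreviation tens where "tens \<equiv> hopf_tensor G \<chi> g n"

lemma ic_eq: "alg_module H M \<Longrightarrow> alg_module H N \<Longrightarrow> ic M = ic N \<longleftrightarrow> iso_mod H M N"
  unfolding iso_class_def using iso_mod_refl iso_mod_sym iso_mod_trans by blast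

lemma ic_self: "alg_module H M \<Longrightarrow> M \<in> ic M"
  by (simp add: iso_class_def iso_mod_refl)

lemma IM_carrier: "A \<in> carrier IM \<longleftrightarrow> (\<exists>M. alg_module H M \<and> A = ic M)"
  by (auto simp: iso_monoid_def)

text \<open>The union over all representatives is a union of equal classes, since tensoring respects
  isomorphism.\<close>

lemma IM_mult:
  assumes M: "alg_module H M" and N: "alg_module H N"
  shows "ic M \<otimes>\<^bsub>IM\<^esub> ic N = ic (tens M N)"
proof -
  have "ic (tens M' N') = ic (tens M N)" if "M' \<in> ic M" "N' \<in> ic N" for M' N'
  proof -
    have M': "alg_module H M'" "iso_mod H M M'" and N': "alg_module H N'" "iso_mod H N N'"
      using that by (auto simp: iso_class_def)
    have "iso_mod H (tens M N) (tens M' N')" by (rule tensor_iso[OF M M'(1) N N'(1) M'(2) N'(2)])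
    thus ?thesis using ic_eq[OF tensor_module(1)[OF M N] tensor_module(1)[OF M'(1) N'(1)]] by simp
  qed
  hence "(\<Union>M'\<in>ic M. \<Union>N'\<in>ic N. ic (tens M' N')) = ic (tens M N)"
    using ic_self[OF M] ic_self[OF N] by blast
  thus ?thesis by (simp add: iso_monoid_def)
qed

lemma IM_one: "\<one>\<^bsub>IM\<^esub> = ic (hopf_unit G \<chi> n)"
  by (simp add: iso_monoid_def)

lemma IM_monoid: "Group.monoid IM"
proof (rule monoidI)
  fix A B C assume "A \<in> carrier IM" "B \<in> carrier IM" "C \<in> carrier IM"
  then obtain L M N where L: "alg_module H L" "A = ic L" and M: "alg_module H M" "B = ic M" and N: "alg_module H N" "C = ic N"
    unfolding IM_carrier by blast
  note t = tensor_module(1)[OF L(1) M(1)] tensor_module(1)[OF M(1) N(1)]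
  show "A \<otimes>\<^bsub>IM\<^esub> B \<in> carrier IM" using L M t(1) IM_mult IM_carrier by blast
  show "A \<otimes>\<^bsub>IM\<^esub> B \<otimes>\<^bsub>IM\<^esub> C = A \<otimes>\<^bsub>IM\<^esub> (B \<otimes>\<^bsub>IM\<^esub> C)"
    unfolding L(2) M(2) N(2) IM_mult[OF L(1) M(1)] IM_mult[OF M(1) N(1)] IM_mult[OF t(1) N(1)] IM_mult[OF L(1) t(2)]
    using tensor_assoc[OF L(1) M(1) N(1)] ic_eq[OF tensor_module(1)[OF t(1) N(1)] tensor_module(1)[OF L(1) t(2)]] by simp
  show "\<one>\<^bsub>IM\<^esub> \<otimes>\<^bsub>IM\<^esub> A = A" "A \<otimes>\<^bsub>IM\<^esub> \<one>\<^bsub>IM\<^esub> = A"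
    unfolding L(2) IM_one IM_mult[OF unit_module(1) L(1)] IM_mult[OF L(1) unit_module(1)]
    using tensor_unit[OF L(1)] ic_eq[OF tensor_module(1)[OF unit_module(1) L(1)] L(1)] ic_eq[OF tensor_module(1)[OF L(1) unit_module(1)] L(1)]
    by simp_all
qed (use unit_module(1) in \<open>unfold IM_one IM_carrier, blast\<close>)

definition Grels :: "(('k, 'g) hmod set \<Rightarrow>\<^sub>0 int) set" where
  "Grels = {Poly_Mapping.single (ic (dsum_mod M N)) 1 - Poly_Mapping.single (ic M) 1 - Poly_Mapping.single (ic N) 1
      | M N. alg_module H M \<and> alg_module H N}"

text \<open>Tensoring distributes over direct sums on either side, so the product of a class with a
  relation is again a relation.\<close>

lemma green_gen_ideal: "gen_ideal IM Grels"
proof -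
  interpret monoid_alg IM "TYPE(int)" using IM_monoid by (simp add: monoid_alg_def)
  have d: "p - q' \<in> carrier MA" if "p \<in> carrier MA" "q' \<in> carrier MA" for p q'
    using that unfolding monoid_algebra_simps mem_Collect_eq by (rule keys_diff_subset)
  have icc: "ic M \<in> carrier IM" if "alg_module H M" for M using that IM_carrier by blast
  have md: "p \<otimes>\<^bsub>MA\<^esub> (a - b - c) = p \<otimes>\<^bsub>MA\<^esub> a - p \<otimes>\<^bsub>MA\<^esub> b - p \<otimes>\<^bsub>MA\<^esub> c"
    "(a - b - c) \<otimes>\<^bsub>MA\<^esub> p = a \<otimes>\<^bsub>MA\<^esub> p - b \<otimes>\<^bsub>MA\<^esub> p - c \<otimes>\<^bsub>MA\<^esub> p" for p a b c
    using mult_add_right[of p "a - b - c" "b + c"] mult_add_right[of p b c]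
      mult_add_left[of "a - b - c" "b + c" p] mult_add_left[of b c p] by (simp_all add: algebra_simps)
  show ?thesis
  proof
    show "Grels \<subseteq> carrier MA" unfolding Grels_def by (auto intro!: d sg_closed icc dsum_module)
    fix C s assume "C \<in> carrier IM" "s \<in> Grels"
    then obtain L M N where L: "alg_module H L" "C = ic L" and M: "alg_module H M" and N: "alg_module H N"
      and s: "s = sg (ic (dsum_mod M N)) 1 - sg (ic M) 1 - sg (ic N) 1"
      unfolding IM_carrier Grels_def by blast
    note D = dsum_module[OF M N]
    note tl = tensor_module(1)[OF L(1) D] tensor_module(1)[OF L(1) M] tensor_module(1)[OF L(1) N]
    note tr = tensor_module(1)[OF D L(1)] tensor_module(1)[OF M L(1)] tensor_module(1)[OF N L(1)]
    have "ic (tens L (dsum_mod M N)) = ic (dsum_mod (tens L M) (tens L N))"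
      using tensor_dsum_left[OF L(1) M N] ic_eq[OF tl(1) dsum_module[OF tl(2,3)]] by simp
    hence "sg C 1 \<otimes>\<^bsub>MA\<^esub> s = sg (ic (dsum_mod (tens L M) (tens L N))) 1 - sg (ic (tens L M)) 1 - sg (ic (tens L N)) 1"
      unfolding s md L(2) mult_sg IM_mult[OF L(1) D] IM_mult[OF L(1) M] IM_mult[OF L(1) N] by simp
    hence "sg C 1 \<otimes>\<^bsub>MA\<^esub> s \<in> Grels" unfolding Grels_def using tl(2,3) by blast
    thus "sg C 1 \<otimes>\<^bsub>MA\<^esub> s \<in> generate (add_monoid MA) Grels" by (rule generate.incl)
    have "ic (tens (dsum_mod M N) L) = ic (dsum_mod (tens M L) (tens N L))"
      using tensor_dsum_right[OF L(1) M N] ic_eq[OF tr(1) dsum_module[OF tr(2,3)]] by simp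
    hence "s \<otimes>\<^bsub>MA\<^esub> sg C 1 = sg (ic (dsum_mod (tens M L) (tens N L))) 1 - sg (ic (tens M L)) 1 - sg (ic (tens N L)) 1"
      unfolding s md L(2) mult_sg IM_mult[OF D L(1)] IM_mult[OF M L(1)] IM_mult[OF N L(1)] by simp
    hence "s \<otimes>\<^bsub>MA\<^esub> sg C 1 \<in> Grels" unfolding Grels_def using tr(2,3) by blast
    thus "s \<otimes>\<^bsub>MA\<^esub> sg C 1 \<in> generate (add_monoid MA) Grels" by (rule generate.incl)
  qed
qed

sublocale gr: gen_ideal IM Grels by (rule green_gen_ideal)

abbreviation R0 where "R0 \<equiv> green_ring G \<chi> g n"
abbreviation cl where "cl \<equiv> green_class G \<chi> g n"

lemma green_rels_eq: "green_rels G \<chi> g n = gr.GS"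
  unfolding green_rels_def free_green_def gr.GS_def unfolding Grels_def ..

lemma green_ring_eq: "R0 = gr.QA"
  unfolding green_ring_def green_rels_eq free_green_def ..

lemma cl_eq_q: "cl M = gr.q (ic M)"
  unfolding green_class_def green_rels_eq free_green_def ..

lemma cl_iso: "alg_module H M \<Longrightarrow> alg_module H N \<Longrightarrow> iso_mod H M N \<Longrightarrow> cl M = cl N"
  unfolding cl_eq_q by (subst ic_eq[THEN iffD2]) auto

lemma ic_closed: "alg_module H M \<Longrightarrow> ic M \<in> carrier IM"
  using IM_carrier by blast

lemma cl_closed: "alg_module H M \<Longrightarrow> cl M \<in> carrier R0"
  unfolding cl_eq_q green_ring_eq by (rule gr.q_closed[OF ic_closed])

lemma cl_tensor: "alg_module H M \<Longrightarrow> alg_module H N \<Longrightarrow> cl (tens M N) = cl M \<otimes>\<^bsub>R0\<^esub> cl N"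
  unfolding cl_eq_q green_ring_eq by (simp add: gr.q_mult ic_closed IM_mult)

lemma cl_dsum:
  assumes "alg_module H M" "alg_module H N"
  shows "cl (dsum_mod M N) = cl M \<oplus>\<^bsub>R0\<^esub> cl N"
  unfolding cl_eq_q green_ring_eq
proof (rule gr.q_rel)
  show "Poly_Mapping.single (ic (dsum_mod M N)) 1 - Poly_Mapping.single (ic M) 1 - Poly_Mapping.single (ic N) 1 \<in> Grels"
    unfolding Grels_def using assms by blast
qed (intro ic_closed dsum_module assms)+

lemma cl_unit: "\<one>\<^bsub>R0\<^esub> = cl (hopf_unit G \<chi> n)"
  unfolding cl_eq_q green_ring_eq gr.q_one IM_one ..

sublocale R0: ring R0 unfolding green_ring_eq by (rule gr.QA.ring_axioms)

lemma green_induct [consumes 1, case_names cls zero uminus add]: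
  assumes "X \<in> carrier R0" "\<And>M. alg_module H M \<Longrightarrow> P (cl M)" "P \<zero>\<^bsub>R0\<^esub>"
    "\<And>X. X \<in> carrier R0 \<Longrightarrow> P X \<Longrightarrow> P (\<ominus>\<^bsub>R0\<^esub> X)"
    "\<And>X Y. X \<in> carrier R0 \<Longrightarrow> Y \<in> carrier R0 \<Longrightarrow> P X \<Longrightarrow> P Y \<Longrightarrow> P (X \<oplus>\<^bsub>R0\<^esub> Y)"
  shows "P X"
  using assms(1) unfolding green_ring_eq
proof (induction rule: gr.Q_induct)
  case (gen A)
  then obtain M where "alg_module H M" "A = ic M" unfolding IM_carrier by blast
  thus ?case using assms(2) by (simp add: cl_eq_q)
qed (use assms(3-5) in \<open>auto simp: green_ring_eq\<close>)

text \<open>Additive isomorphism invariants of modules are the source of the functionals on the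
  Green ring, in particular of the multiplicities.\<close>

lemma green_functional:
  assumes iso: "\<And>M N. alg_module H M \<Longrightarrow> alg_module H N \<Longrightarrow> iso_mod H M N \<Longrightarrow> w M = w N"
    and add: "\<And>M N. alg_module H M \<Longrightarrow> alg_module H N \<Longrightarrow> w (dsum_mod M N) = (w M + w N :: complex)"
  shows "\<exists>f. (\<forall>M. alg_module H M \<longrightarrow> f (cl M) = w M) \<and> (\<forall>X\<in>carrier R0. \<forall>Y\<in>carrier R0. f (X \<oplus>\<^bsub>R0\<^esub> Y) = f X + f Y)"
proof -
  define \<phi> where "\<phi> A = w (SOME M. M \<in> A)" for A
  have \<phi>: "\<phi> (ic M) = w M" if M: "alg_module H M" for M
  proof -
    have "(SOME M'. M' \<in> ic M) \<in> ic M" by (rule someI) (rule ic_self[OF M])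
    hence "alg_module H (SOME M'. M' \<in> ic M)" "iso_mod H M (SOME M'. M' \<in> ic M)"
      unfolding iso_class_def mem_Collect_eq by blast+
    from iso[OF M this] show ?thesis unfolding \<phi>_def ..
  qed
  have "gr.fext \<phi> s = 0" if s: "s \<in> Grels" for s
  proof -
    obtain M N where s: "s = gr.sg (ic (dsum_mod M N)) 1 - gr.sg (ic M) 1 - gr.sg (ic N) 1" and MN: "alg_module H M" "alg_module H N"
      using s unfolding Grels_def by blast
    show ?thesis unfolding s gr.fext_diff gr.fext_single \<phi>[OF MN(1)] \<phi>[OF MN(2)] \<phi>[OF dsum_module[OF MN]] add[OF MN]
      by simp
  qed
  from gr.Q_functional[OF this] show ?thesis
    unfolding green_ring_eq cl_eq_q using \<phi> ic_closed by metis
qed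

end

section \<open>Generators of the Green ring, their products, and commutativity\<close>

context gds
begin

abbreviation st where "st k l \<equiv> string_module G \<chi> n (V k) l"
abbreviation infl where "infl k \<equiv> inflate G \<chi> n (V k)"
definition Z where "Z = string_module G \<chi> n (V 1) 2"
abbreviation z where "z \<equiv> cl Z"

lemma st_module: "k \<in> {1..m} \<Longrightarrow> l \<le> n \<Longrightarrow> alg_module H (st k l)"
  by (rule string_module(1)[OF V_module])

lemma infl_module: "k \<in> {1..m} \<Longrightarrow> alg_module H (infl k)"
  by (rule inflate_module(1)[OF V_module])

lemma z_module: "alg_module H Z"
  unfolding Z_def by (rule st_module[OF one_in_I n_ge_2])

lemmas mul_Z_tensor = mul_z_tensor[folded Z_def]

lemma n_ge_1 [simp]: "Suc 0 \<le> n" "1 \<le> n"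
  using n_ge_2 by auto

lemma Mx_st: "Mx (k, l) = st k l"
  by (simp add: Mx_def)

text \<open>The zero module is isomorphic to its double, which forces its class to be 0 in any group
  where classes add.\<close>

lemma zero_dim_iso: "alg_module H M \<Longrightarrow> mdim M = 0 \<Longrightarrow> iso_mod H M (dsum_mod M M)"
  unfolding iso_mod_iff
  by (intro bexI[of _ "0\<^sub>m 0 0"]) (auto simp: intertwiners_def dsum_mod_def intro!: eq_matI dest!: alg_moduleD(1))

text \<open>Stated for an arbitrary abelian group, since it serves both the Green ring and its
  complexified stable quotient.\<close>

lemma expansion:
  fixes A (structure)
  assumes A: "abelian_group A"
    and F: "\<And>M. alg_module H M \<Longrightarrow> F M \<in> carrier A"
    and iso: "\<And>M N. alg_module H M \<Longrightarrow> alg_module H N \<Longrightarrow> iso_mod H M N \<Longrightarrow> F M = F N"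
    and add: "\<And>M N. alg_module H M \<Longrightarrow> alg_module H N \<Longrightarrow> F (dsum_mod M N) = F M \<oplus>\<^bsub>A\<^esub> F N"
  shows "alg_module H M \<Longrightarrow> mdim M = 0 \<Longrightarrow> F M = \<zero>\<^bsub>A\<^esub>"
    and "alg_module H M \<Longrightarrow> F M = (\<Oplus>\<^bsub>A\<^esub>x\<in>Ix. add_pow A (mul M x) (F (Mx x)))"
proof -
  interpret A: abelian_group A by (rule A)
  have zero: "F M = \<zero>\<^bsub>A\<^esub>" if M: "alg_module H M" "mdim M = 0" for M
    using iso[OF M(1) dsum_module[OF M(1) M(1)] zero_dim_iso[OF M]] add[OF M(1) M(1)] F[OF M(1)]
    by (metis A.add.r_cancel_one')
  thus "alg_module H M \<Longrightarrow> mdim M = 0 \<Longrightarrow> F M = \<zero>\<^bsub>A\<^esub>" .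
  assume M: "alg_module H M"
  have Fc: "F (Mx x) \<in> carrier A" if "x \<in> Ix" for x using F Mx_module that by blast
  obtain xs where xs: "decomp M xs" using exists_decomp[OF M] by blast
  have "F M = (\<Oplus>\<^bsub>A\<^esub>x\<in>Ix. add_pow A (count_list xs x) (F (Mx x)))" using xs
  proof (induction rule: decomp.induct)
    case (Nil M)
    have "(\<Oplus>\<^bsub>A\<^esub>x\<in>Ix. add_pow A (count_list [] x) (F (Mx x))) = (\<Oplus>\<^bsub>A\<^esub>x\<in>Ix. \<zero>\<^bsub>A\<^esub>)"
      by (rule A.finsum_cong') (auto simp: Fc)
    thus ?case using zero[OF Nil] by simp
  next
    case (Cons M N x xs)
    have "(\<Oplus>\<^bsub>A\<^esub>y\<in>Ix. add_pow A (count_list (x # xs) y) (F (Mx y))) =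
      (\<Oplus>\<^bsub>A\<^esub>y\<in>Ix. add_pow A (count_list xs y) (F (Mx y)) \<oplus>\<^bsub>A\<^esub> (if x = y then F (Mx y) else \<zero>\<^bsub>A\<^esub>))"
      by (rule A.finsum_cong') (auto simp: Fc)
    also have "\<dots> = F N \<oplus>\<^bsub>A\<^esub> F (Mx x)"
      using A.finsum_addf[of "\<lambda>y. add_pow A (count_list xs y) (F (Mx y))" Ix "\<lambda>y. if x = y then F (Mx y) else \<zero>\<^bsub>A\<^esub>"]
        A.finsum_singleton[of x Ix "\<lambda>y. F (Mx y)"] Cons by (simp add: Fc Pi_def)
    also have "\<dots> = F M"
      using iso[OF Cons.hyps(1) dsum_module[OF Mx_module Cons.hyps(2)] Cons.hyps(4)] add[OF Mx_module Cons.hyps(2)]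
        Cons.hyps(3) F[OF Cons.hyps(2)] Fc by (simp add: A.a_comm)
    finally show ?case ..
  qed
  also have "\<dots> = (\<Oplus>\<^bsub>A\<^esub>x\<in>Ix. add_pow A (mul M x) (F (Mx x)))"
    by (rule A.finsum_cong') (auto simp: Fc mul_decomp[OF xs])
  finally show "F M = (\<Oplus>\<^bsub>A\<^esub>x\<in>Ix. add_pow A (mul M x) (F (Mx x)))" .
qed

lemma cl_expansion: "alg_module H M \<Longrightarrow> cl M = (\<Oplus>\<^bsub>R0\<^esub>x\<in>Ix. add_pow R0 (mul M x) (cl (Mx x)))"
  by (rule expansion(2)[OF R0.abelian_group_axioms cl_closed cl_iso cl_dsum])

lemma cl_zero: "alg_module H M \<Longrightarrow> mdim M = 0 \<Longrightarrow> cl M = \<zero>\<^bsub>R0\<^esub>"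
  by (rule expansion(1)[OF R0.abelian_group_axioms cl_closed cl_iso cl_dsum])

text \<open>Classes are determined by multiplicities, so ring identities can be verified by counting
  instead of by exhibiting isomorphisms.\<close>

lemma cl_eq:
  assumes M: "alg_module H M" and N: "alg_module H N" and e: "\<And>x. x \<in> Ix \<Longrightarrow> mul M x = mul N x"
  shows "cl M = cl N"
  unfolding cl_expansion[OF M] cl_expansion[OF N]
  by (rule R0.finsum_cong') (auto simp: e Mx_module cl_closed)

lemma cl_st_0: "k \<in> {1..m} \<Longrightarrow> cl (st k 0) = \<zero>\<^bsub>R0\<^esub>"
  by (rule cl_zero[OF st_module]) (simp_all add: string_module(2)[OF V_module])

text \<open>This is the recursion of the polynomials F_j(a, z), with \<tau> in place of
  multiplication by a. For l = 1 the term of length l - 1 is the zero module.\<close>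

lemma z_mult:
  assumes k: "k \<in> {1..m}" and l: "0 < l" "l < n"
  shows "z \<otimes>\<^bsub>R0\<^esub> cl (st k l) = cl (st k (l + 1)) \<oplus>\<^bsub>R0\<^esub> cl (st (\<tau> k) (l - 1))"
proof -
  have ms: "alg_module H (st k l)" "alg_module H (st k (l + 1))" "alg_module H (st (\<tau> k) (l - 1))"
    using k l tau_spec(1)[OF k] by (simp_all add: st_module)
  have "cl (tens Z (st k l)) = cl (dsum_mod (st k (l + 1)) (st (\<tau> k) (l - 1)))"
    by (rule cl_eq) (use tensor_module(1)[OF z_module] ms l in \<open>simp_all add: dsum_module mul_Z_tensor[OF k] mul_dsum\<close>)
  thus ?thesis by (simp only: cl_tensor[OF z_module ms(1)] cl_dsum[OF ms(2,3)])
qed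

text \<open>Keeps the span of the strings of length n stable under z, which is half of the proof
  that this span is an ideal.\<close>

lemma z_mult_n:
  assumes k: "k \<in> {1..m}"
  shows "z \<otimes>\<^bsub>R0\<^esub> cl (st k n) = cl (st k n) \<oplus>\<^bsub>R0\<^esub> cl (st (\<tau> k) n)"
proof -
  have ms: "alg_module H (st k n)" "alg_module H (st (\<tau> k) n)"
    using k tau_spec(1)[OF k] by (simp_all add: st_module)
  have "cl (tens Z (st k n)) = cl (dsum_mod (st k n) (st (\<tau> k) n))"
    by (rule cl_eq) (use tensor_module(1)[OF z_module] ms n_pos in \<open>simp_all add: dsum_module mul_Z_tensor[OF k] mul_dsum\<close>)
  thus ?thesis by (simp only: cl_tensor[OF z_module ms(1)] cl_dsum[OF ms])
qed

lemma dg_1: "dg 1 h = 1\<^sub>m 1" and sh_1: "sh 1 1 = (0\<^sub>m 1 1 :: 'k mat)"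
  by (rule eq_matI; auto simp: dg_def mat_diag_def sh_def)+

lemma cl_infl: "k \<in> {1..m} \<Longrightarrow> cl (infl k) = cl (st k 1)"
proof -
  assume k: "k \<in> {1..m}"
  have l: "1 \<le> n" by simp
  note im = inflate_module[OF V_module[OF k]] and sm = string_module[OF V_module[OF k] l]
  have "iso_mod H (infl k) (st k 1)"
    by (rule iso_of_eq[OF im(1) sm(1)]) (simp_all only: im sm dg_1 sh_1 kron_one_1 kron_zero, simp_all)
  thus ?thesis by (rule cl_iso[OF im(1) sm(1)])
qed

lemma cl_one: "\<one>\<^bsub>R0\<^esub> = cl (infl 1)"
proof -
  note im = inflate_module[OF V_module[OF one_in_I]]
  have "iso_mod H (hopf_unit G \<chi> n) (infl 1)"
    by (rule iso_of_eq[OF unit_module(1) im(1)]) (simp_all only: im unit_module V1)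
  thus ?thesis using cl_iso[OF unit_module(1) im(1)] cl_unit by simp
qed

text \<open>The recursion for z, solved for its longest string, expresses M(k, l + 2) by z M(k, l +
  1) and M(\<tau>(k), l); a two-step induction on the length starts from the zero module and from
  V_k.\<close>

lemma green_gen_induct [consumes 1, case_names base zero uminus add z]:
  assumes X: "X \<in> carrier R0" and base: "\<And>k. k \<in> {1..m} \<Longrightarrow> P (cl (infl k))" and zero: "P \<zero>\<^bsub>R0\<^esub>"
    and um: "\<And>X. X \<in> carrier R0 \<Longrightarrow> P X \<Longrightarrow> P (\<ominus>\<^bsub>R0\<^esub> X)"
    and add: "\<And>X W. X \<in> carrier R0 \<Longrightarrow> W \<in> carrier R0 \<Longrightarrow> P X \<Longrightarrow> P W \<Longrightarrow> P (X \<oplus>\<^bsub>R0\<^esub> W)"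
    and z: "\<And>X. X \<in> carrier R0 \<Longrightarrow> P X \<Longrightarrow> P (z \<otimes>\<^bsub>R0\<^esub> X)"
  shows "P X"
proof -
  have st: "k \<in> {1..m} \<Longrightarrow> l \<le> n \<Longrightarrow> P (cl (st k l))" for k l
  proof (induction l arbitrary: k rule: induct_nat_012)
    case 0
    thus ?case using cl_st_0 zero by simp
  next
    case 1
    thus ?case using base[of k] cl_infl[of k] by simp
  next
    case (ge2 l)
    note tk = tau_spec(1)[OF ge2.prems(1)]
    have c: "cl (st k (Suc (Suc l))) \<in> carrier R0" "cl (st k (Suc l)) \<in> carrier R0" "cl (st (\<tau> k) l) \<in> carrier R0"
      using ge2.prems tk by (simp_all add: cl_closed st_module)
    have "z \<otimes>\<^bsub>R0\<^esub> cl (st k (Suc l)) = cl (st k (Suc (Suc l))) \<oplus>\<^bsub>R0\<^esub> cl (st (\<tau> k) l)"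
      using z_mult[of k "Suc l"] ge2.prems by simp
    hence "cl (st k (Suc (Suc l))) = z \<otimes>\<^bsub>R0\<^esub> cl (st k (Suc l)) \<oplus>\<^bsub>R0\<^esub> \<ominus>\<^bsub>R0\<^esub> cl (st (\<tau> k) l)"
      using c by (simp add: R0.a_assoc R0.r_neg)
    moreover have "P (cl (st k (Suc l)))" "P (cl (st (\<tau> k) l))" using ge2 tk by simp_all
    ultimately show ?case
      using add[OF _ _ z um, OF _ _ c(2) _ c(3)] c cl_closed[OF z_module] by simp
  qed
  show ?thesis using X
  proof (induction rule: green_induct)
    case (cls M)
    obtain xs where "decomp M xs" using exists_decomp[OF cls] by blast
    thus ?case
    proof (induction rule: decomp.induct)
      case (Nil M)
      thus ?case using cl_zero zero by simp
    next
      case (Cons M N x xs)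
      have "fst x \<in> {1..m}" "snd x \<le> n" using Cons.hyps(3) by (auto simp: Ix_def)
      hence "P (cl (Mx x))" unfolding Mx_def by (rule st)
      moreover note xm = Mx_module[OF Cons.hyps(3)]
      have "cl M = cl (Mx x) \<oplus>\<^bsub>R0\<^esub> cl N"
        using cl_iso[OF Cons.hyps(1) dsum_module[OF xm Cons.hyps(2)] Cons.hyps(4)] cl_dsum[OF xm Cons.hyps(2)] by simp
      ultimately show ?case
        by (simp only: add[OF cl_closed[OF xm] cl_closed[OF Cons.hyps(2)] _ Cons.IH])
    qed
  qed (use zero um add in auto)
qed

lemma NN_sym:
  assumes "i \<in> {1..m}" "k \<in> {1..m}" "s \<in> {1..m}"
  shows "NN i k s = NN k i s"
proof -
  have "of_nat (NN i k s) = (of_nat (NN k i s) :: 'k)"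
    unfolding NN_cip[OF assms] NN_cip[OF assms(2,1,3)] by (rule cip_cong) (rule mult.commute, rule refl)
  thus ?thesis by (simp only: of_nat_eq_iff)
qed

lemma NN_1:
  assumes "k \<in> {1..m}" "s \<in> {1..m}"
  shows "NN k (Suc 0) s = (if s = k then 1 else 0)"
proof -
  have "of_nat (NN k (Suc 0) s) = cip (chr k) (chr s)"
    unfolding NN_cip[OF assms(1) one_in_I assms(2), unfolded One_nat_def]
    by (rule cip_cong) (simp_all add: chr_1[unfolded One_nat_def])
  hence "of_nat (NN k (Suc 0) s) = (of_nat (if s = k then 1 else 0) :: 'k)"
    using chr_orthonormal[OF assms] by auto
  thus ?thesis by (simp only: of_nat_eq_iff)
qed

lemma cl_V_mult: "i \<in> {1..m} \<Longrightarrow> k \<in> {1..m} \<Longrightarrow> l \<le> n \<Longrightarrow> cl (infl i) \<otimes>\<^bsub>R0\<^esub> cl (st k l) = cl (tens (infl i) (st k l))"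
  using cl_tensor[OF infl_module st_module] by simp

lemma V_comm:
  assumes i: "i \<in> {1..m}" and k: "k \<in> {1..m}"
  shows "cl (infl i) \<otimes>\<^bsub>R0\<^esub> cl (infl k) = cl (infl k) \<otimes>\<^bsub>R0\<^esub> cl (infl i)"
proof -
  have 1: "1 \<le> n" by simp
  have "cl (tens (infl i) (st k 1)) = cl (tens (infl k) (st i 1))"
    by (rule cl_eq)
      (use i k 1 in \<open>auto simp: tensor_module(1) infl_module st_module mul_V_tensor Ix_def NN_sym[of i k]\<close>)
  thus ?thesis using cl_V_mult[OF i k 1] cl_V_mult[OF k i 1] cl_infl i k by simp
qed

lemma V_z:
  assumes k: "k \<in> {1..m}"
  shows "cl (infl k) \<otimes>\<^bsub>R0\<^esub> z = z \<otimes>\<^bsub>R0\<^esub> cl (infl k)"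
proof -
  have n1: "1 \<le> n" "1 < n" using n_ge_2 by auto
  have "cl (tens (infl k) Z) = cl (tens Z (st k 1))"
    by (rule cl_eq)
      (use k n1 n_ge_2 one_in_I[unfolded One_nat_def] tau_spec(1)[OF k] z_module in
        \<open>auto simp: Z_def mul_V_tensor mul_z_tensor[OF k, unfolded One_nat_def] mul_string Ix_def NN_1 intro!: tensor_module(1) infl_module st_module\<close>)
  thus ?thesis using cl_tensor[OF infl_module[OF k] z_module] cl_tensor[OF z_module st_module[OF k n1(1)]] cl_infl[OF k] by simp
qed

text \<open>Commutation is known between generators by comparing multiplicities. It spreads by
  induction, first to z against everything, then to V_i against everything, and finally to arbitrary
  pairs.\<close>

lemma R0_comm:
  assumes X: "X \<in> carrier R0" and W: "W \<in> carrier R0"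
  shows "X \<otimes>\<^bsub>R0\<^esub> W = W \<otimes>\<^bsub>R0\<^esub> X"
proof -
  note c = cl_closed[OF z_module] cl_closed[OF infl_module]
  have z: "z \<otimes>\<^bsub>R0\<^esub> X = X \<otimes>\<^bsub>R0\<^esub> z" if "X \<in> carrier R0" for X
    using that
  proof (induction rule: green_gen_induct)
    case (z X)
    have "z \<otimes>\<^bsub>R0\<^esub> (X \<otimes>\<^bsub>R0\<^esub> z) = z \<otimes>\<^bsub>R0\<^esub> X \<otimes>\<^bsub>R0\<^esub> z" by (rule R0.m_assoc[OF c(1) z(1) c(1), symmetric])
    thus ?case by (simp only: z(2))
  qed (simp_all add: c V_z R0.l_minus R0.r_minus R0.l_distr R0.r_distr)
  have V: "cl (infl i) \<otimes>\<^bsub>R0\<^esub> X = X \<otimes>\<^bsub>R0\<^esub> cl (infl i)" if i: "i \<in> {1..m}" and X: "X \<in> carrier R0" for i X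
    using X
  proof (induction rule: green_gen_induct)
    case (z X)
    have "cl (infl i) \<otimes>\<^bsub>R0\<^esub> (z \<otimes>\<^bsub>R0\<^esub> X) = z \<otimes>\<^bsub>R0\<^esub> (cl (infl i) \<otimes>\<^bsub>R0\<^esub> X)"
      using z(1) V_z[OF i] c(1) c(2)[OF i] by (simp flip: R0.m_assoc)
    thus ?case using z c(1) c(2)[OF i] by (simp add: R0.m_assoc)
  qed (simp_all add: c c(2)[OF i] V_comm[OF i] R0.l_minus R0.r_minus R0.l_distr R0.r_distr)
  show ?thesis using X
  proof (induction rule: green_gen_induct)
    case (z X)
    have "z \<otimes>\<^bsub>R0\<^esub> X \<otimes>\<^bsub>R0\<^esub> W = z \<otimes>\<^bsub>R0\<^esub> W \<otimes>\<^bsub>R0\<^esub> X" using z W c(1) by (simp add: R0.m_assoc)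
    also have "\<dots> = W \<otimes>\<^bsub>R0\<^esub> (z \<otimes>\<^bsub>R0\<^esub> X)" using z W c(1) \<open>\<And>X. X \<in> carrier R0 \<Longrightarrow> z \<otimes>\<^bsub>R0\<^esub> X = X \<otimes>\<^bsub>R0\<^esub> z\<close>[OF W] by (simp add: R0.m_assoc)
    finally show ?case .
  qed (simp_all add: W c V R0.l_minus R0.r_minus R0.l_distr R0.r_distr)
qed

subsection \<open>The ideal of projective modules\<close>

text \<open>An explicit additive candidate for the ideal of projectives: an additive functional that
  kills the strings of length n vanishes on it.\<close>

definition Sp where "Sp = generate (add_monoid R0) ((\<lambda>k. cl (st k n)) ` {1..m})"

lemma Sp_gens: "(\<lambda>k. cl (st k n)) ` {1..m} \<subseteq> carrier R0"
  by (auto intro!: cl_closed st_module)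

lemma Sp_subgroup: "subgroup Sp (add_monoid R0)"
  unfolding Sp_def by (rule group.generate_is_subgroup[OF R0.add.is_group]) (use Sp_gens in simp)

lemma Sp_carrier: "X \<in> Sp \<Longrightarrow> X \<in> carrier R0"
  using subgroup.mem_carrier[OF Sp_subgroup] by simp

lemma Sp_closed: "\<zero>\<^bsub>R0\<^esub> \<in> Sp" "X \<in> Sp \<Longrightarrow> W \<in> Sp \<Longrightarrow> X \<oplus>\<^bsub>R0\<^esub> W \<in> Sp" "X \<in> Sp \<Longrightarrow> \<ominus>\<^bsub>R0\<^esub> X \<in> Sp"
  using subgroup.one_closed[OF Sp_subgroup] subgroup.m_closed[OF Sp_subgroup, of X W] subgroup.m_inv_closed[OF Sp_subgroup, of X]
  by (simp_all add: a_inv_def)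

lemma Sp_st: "k \<in> {1..m} \<Longrightarrow> cl (st k n) \<in> Sp"
  unfolding Sp_def by (rule generate.incl) simp

lemma Sp_induct [consumes 1, case_names st zero uminus add]:
  assumes "X \<in> Sp" "\<And>k. k \<in> {1..m} \<Longrightarrow> P (cl (st k n))" "P \<zero>\<^bsub>R0\<^esub>"
    "\<And>X. X \<in> Sp \<Longrightarrow> P X \<Longrightarrow> P (\<ominus>\<^bsub>R0\<^esub> X)"
    "\<And>X W. X \<in> Sp \<Longrightarrow> W \<in> Sp \<Longrightarrow> P X \<Longrightarrow> P W \<Longrightarrow> P (X \<oplus>\<^bsub>R0\<^esub> W)"
  shows "P X"
  using assms(1) unfolding Sp_def
proof (induction rule: generate.induct)
  case (inv X)
  then obtain k where k: "k \<in> {1..m}" "X = cl (st k n)" by blast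
  show ?case using assms(4)[OF Sp_st assms(2), OF k(1) k(1)] unfolding k(2) a_inv_def .
next
  case (eng X W)
  thus ?case using assms(5) by (simp add: Sp_def)
qed (use assms(2,3) in auto)

lemma Sp_if_top:
  assumes M: "alg_module H M" and t: "\<And>x. x \<in> Ix \<Longrightarrow> snd x \<noteq> n \<Longrightarrow> mul M x = 0"
  shows "cl M \<in> Sp"
proof -
  have "(\<Oplus>\<^bsub>R0\<^esub>x\<in>A. add_pow R0 (mul M x) (cl (Mx x))) \<in> Sp" if "A \<subseteq> Ix" for A
    using finite_subset[OF that Ix_finite] that
  proof (induction rule: finite_induct)
    case (insert x A)
    have "add_pow R0 (mul M x) (cl (Mx x)) \<in> Sp"
    proof (cases "snd x = n")
      case True
      hence "cl (Mx x) \<in> Sp" using insert(4) Sp_st by (auto simp: Mx_def Ix_def)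
      hence "add_pow R0 (j::nat) (cl (Mx x)) \<in> Sp" for j by (induction j) (simp_all add: Sp_closed)
      thus ?thesis .
    next
      case False
      thus ?thesis using t[of x] insert(4) Sp_closed by simp
    qed
    moreover have "add_pow R0 (mul M y) (cl (Mx y)) \<in> carrier R0" if "y \<in> Ix" for y
      using cl_closed[OF Mx_module[OF that]] by simp
    ultimately show ?case using insert Sp_closed(2) by (subst R0.finsum_insert) auto
  qed (simp add: Sp_closed)
  thus ?thesis using cl_expansion[OF M] by simp
qed

text \<open>Both kinds of generators send strings of length n to sums of such strings, by
  \<open>mul_V_tensor\<close> and \<open>z_mult_n\<close>; commutativity supplies the other
  side.\<close>

lemma Sp_ideal: "ideal Sp R0"
proof -
  have l: "W \<otimes>\<^bsub>R0\<^esub> X \<in> Sp" if W: "W \<in> carrier R0" and X: "X \<in> Sp" for X W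
    using W X
  proof (induction arbitrary: X rule: green_gen_induct)
    case (base i)
    from base(2) show ?case
    proof (induction rule: Sp_induct)
      case (st k)
      have "cl (tens (infl i) (st k n)) \<in> Sp"
        by (rule Sp_if_top) (use base st in \<open>simp_all add: tensor_module infl_module st_module mul_V_tensor\<close>)
      thus ?case using cl_V_mult[OF base(1) st order_refl] by simp
    qed (use base in \<open>simp_all add: R0.r_minus R0.r_distr Sp_closed cl_closed infl_module Sp_carrier\<close>)
  next
    case (z W)
    have zS: "z \<otimes>\<^bsub>R0\<^esub> X \<in> Sp" if "X \<in> Sp" for X
      using that
    proof (induction rule: Sp_induct)
      case (st k)
      show ?case unfolding z_mult_n[OF st] by (intro Sp_closed Sp_st st tau_spec(1))
    qed (simp_all add: R0.r_minus R0.r_distr Sp_closed cl_closed z_module Sp_carrier)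
    show ?case using zS[OF z(2)[OF z(3)]] z(1,3) by (simp add: R0.m_assoc cl_closed z_module Sp_carrier)
  qed (simp_all add: R0.l_minus R0.l_distr Sp_closed Sp_carrier)
  show ?thesis
  proof (rule idealI[OF R0.ring_axioms Sp_subgroup])
    fix a x assume "a \<in> Sp" "x \<in> carrier R0"
    thus "x \<otimes>\<^bsub>R0\<^esub> a \<in> Sp" "a \<otimes>\<^bsub>R0\<^esub> x \<in> Sp" using l[of x a] R0_comm[OF Sp_carrier, of a x] by simp_all
  qed
qed

end

text \<open>A map h out of L is extended to P as h p, lifted there, and the lift is restricted along
  i.\<close>

lemma retract_projective:
  fixes P :: "('k::field, 'a) fdmod"
  assumes P: "projective_mod A P" and L: "alg_module A L"
    and i: "i \<in> intertwiners A L P" and p: "p \<in> intertwiners A P L" and e: "p * i = 1\<^sub>m (mdim L)"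
  shows "projective_mod A L"
  unfolding projective_mod_def
proof (intro conjI allI ballI impI)
  fix M N f h assume f: "f \<in> intertwiners A M N" and h: "h \<in> intertwiners A L N"
    and M: "alg_module A M" and N: "alg_module A N"
    and s: "(\<lambda>v. f *\<^sub>v v) ` carrier_vec (mdim M) = carrier_vec (mdim N)"
  have PM: "alg_module A P" using P by (simp add: projective_mod_def)
  have mult: "a * b \<in> intertwiners A K K''" if "b \<in> intertwiners A K K'" "a \<in> intertwiners A K' K''"
    "alg_module A K" "alg_module A K'" "alg_module A K''" for a b K K' K''
  proof -
    note c = intertwinersD(1)[OF that(1)] intertwinersD(1)[OF that(2)]
    have "a * b * act K x = act K'' x * (a * b)" if x: "x \<in> carrier A" for x
    proof -
      note ac = alg_moduleD(1)[OF \<open>alg_module A K\<close> x] alg_moduleD(1)[OF \<open>alg_module A K'\<close> x] alg_moduleD(1)[OF \<open>alg_module A K''\<close> x]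
      have "a * b * act K x = a * (b * act K x)" using c ac by (simp add: mat_assoc)
      also have "\<dots> = (a * act K' x) * b" unfolding intertwinersD(2)[OF \<open>b \<in> intertwiners A K K'\<close> x] using c ac by (simp add: mat_assoc)
      also have "\<dots> = act K'' x * (a * b)" unfolding intertwinersD(2)[OF \<open>a \<in> intertwiners A K' K''\<close> x] using c ac by (simp add: mat_assoc)
      finally show ?thesis .
    qed
    thus ?thesis using c by (auto simp: intertwiners_def)
  qed
  obtain k where k: "k \<in> intertwiners A P M" "f * k = h * p"
    using P f M N s mult[OF p h PM L N] unfolding projective_mod_def by blast
  note c = intertwinersD(1)[OF f] intertwinersD(1)[OF h] intertwinersD(1)[OF i] intertwinersD(1)[OF p] intertwinersD(1)[OF k(1)]
  have "f * (k * i) = (f * k) * i" using c by (simp add: mat_assoc)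
  also have "\<dots> = h * (p * i)" unfolding k(2) using c by (simp add: mat_assoc)
  also have "\<dots> = h" unfolding e using c by simp
  finally show "\<exists>k\<in>intertwiners A L M. f * k = h" using mult[OF i k(1) L PM M] by blast
qed (rule L)

lemma dsum_projective:
  fixes P :: "('k::field, 'a) fdmod"
  assumes P: "projective_mod A P" and M: "alg_module A M" and N: "alg_module A N" and iso: "iso_mod A P (dsum_mod M N)"
  shows "projective_mod A M" "projective_mod A N"
proof -
  have PM: "alg_module A P" using P by (simp add: projective_mod_def)
  note D = dsum_module[OF M N]
  obtain a b where a: "a \<in> intertwiners A (dsum_mod M N) P" "b \<in> carrier_mat (mdim (dsum_mod M N)) (mdim P)"
    "a * b = 1\<^sub>m (mdim P)" "b * a = 1\<^sub>m (mdim (dsum_mod M N))"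
    using iso_mod_sym[OF PM D iso] unfolding iso_mod_iff by blast
  have PD: "projective_mod A (dsum_mod M N)"
  proof (rule retract_projective[OF P D a(1) _ a(4)])
    have "b * act P x = act (dsum_mod M N) x * b" if x: "x \<in> carrier A" for x
    proof -
      note c = intertwinersD(1)[OF a(1)] a(2) alg_moduleD(1)[OF PM x] alg_moduleD(1)[OF D x]
      have "b * act P x = b * (act P x * a) * b" using c a(3) by (simp add: mat_assoc)
      also have "\<dots> = (b * a) * (act (dsum_mod M N) x * b)" unfolding intertwinersD(2)[OF a(1) x, symmetric] using c by (simp add: mat_assoc)
      finally show ?thesis using a(4) c by simp
    qed
    thus "b \<in> intertwiners A P (dsum_mod M N)" using a(2) by (simp add: intertwiners_def)
  qed
  obtain i1 i2 p1 p2 where d: "i1 \<in> intertwiners A M (dsum_mod M N)" "i2 \<in> intertwiners A N (dsum_mod M N)"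
    "p1 \<in> intertwiners A (dsum_mod M N) M" "p2 \<in> intertwiners A (dsum_mod M N) N"
    "p1 * i1 = 1\<^sub>m (mdim M)" "p2 * i2 = 1\<^sub>m (mdim N)" using dsum_maps[OF M N] by blast
  show "projective_mod A M" by (rule retract_projective[OF PD M d(1,3,5)])
  show "projective_mod A N" by (rule retract_projective[OF PD N d(2,4,6)])
qed

section \<open>Which strings are projective, and the ideal they generate\<close>

context gds
begin

text \<open>The truncation from M(k, n) to M(k, l) that discards the copies \<open>x^s V\<close>
  with s \<ge> l is surjective. If it split, M(k, l) would be a proper nonzero summand of the
  indecomposable M(k, n).\<close>

lemma string_not_projective:
  assumes k: "k \<in> {1..m}" and l: "0 < l" "l < n"
  shows "\<not> projective_mod H (st k l)"
proof
  assume pr: "projective_mod H (st k l)"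
  let ?r = "mdim (V k)"
  note VM = V_module[OF k]
  note sl = string_module[OF VM less_imp_le[OF l(2)]] and sn = string_module[OF VM order_refl]
  define D :: "'k mat" where "D = mat l n (\<lambda>(a, b). if a = b then 1 else 0)"
  define E :: "'k mat" where "E = mat n l (\<lambda>(a, b). if a = b then 1 else 0)"
  have c: "D \<in> carrier_mat l n" "E \<in> carrier_mat n l" by (simp_all add: D_def E_def)
  have DL: "D * X = mat l d (\<lambda>(a, b). X $$ (a, b))" if "X \<in> carrier_mat n d" for X d
  proof (rule eq_matI)
    fix a b assume "a < dim_row (mat l d (\<lambda>(a, b). X $$ (a, b)))" "b < dim_col (mat l d (\<lambda>(a, b). X $$ (a, b)))"
    hence ab: "a < l" "b < d" by auto
    have "(D * X) $$ (a, b) = (\<Sum>j<n. D $$ (a, j) * X $$ (j, b))" by (rule mult_index_sum[OF c(1) that ab])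
    also have "\<dots> = (\<Sum>j<n. if j = a then X $$ (j, b) else 0)" using ab by (intro sum.cong) (auto simp: D_def)
    finally show "(D * X) $$ (a, b) = mat l d (\<lambda>(a, b). X $$ (a, b)) $$ (a, b)" using ab l by simp
  qed (use that c in auto)
  have DR: "X * D = mat l n (\<lambda>(a, b). if b < l then X $$ (a, b) else 0)" if "X \<in> carrier_mat l l" for X
  proof (rule eq_matI)
    fix a b assume "a < dim_row (mat l n (\<lambda>(a, b). if b < l then X $$ (a, b) else 0))"
      "b < dim_col (mat l n (\<lambda>(a, b). if b < l then X $$ (a, b) else 0))"
    hence ab: "a < l" "b < n" by auto
    have "(X * D) $$ (a, b) = (\<Sum>j<l. X $$ (a, j) * D $$ (j, b))" by (rule mult_index_sum[OF that c(1) ab])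
    also have "\<dots> = (\<Sum>j<l. if j = b then X $$ (a, j) else 0)" using ab by (intro sum.cong) (auto simp: D_def)
    finally show "(X * D) $$ (a, b) = mat l n (\<lambda>(a, b). if b < l then X $$ (a, b) else 0) $$ (a, b)" using ab by simp
  qed (use that c in auto)
  have De: "D * dg n h = dg l h * D" for h
    unfolding DL[OF dg_carrier(1)] DR[OF dg_carrier(1)] by (rule eq_matI) (use l in \<open>auto simp: dg_def mat_diag_def\<close>)
  have shc: "sh j 1 \<in> carrier_mat j j" for j by (simp add: sh_def)
  have Ds: "D * sh n 1 = sh l 1 * D"
    unfolding DL[OF shc] DR[OF shc] by (rule eq_matI) (use l in \<open>auto simp: sh_def\<close>)
  have DE: "D * E = 1\<^sub>m l"
    unfolding DL[OF c(2)] by (rule eq_matI) (use l in \<open>auto simp: E_def\<close>)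
  define f where "f = kron D (1\<^sub>m ?r)"
  have fc: "f \<in> carrier_mat (l * ?r) (n * ?r)" using c by (auto simp: f_def)
  have f: "f \<in> intertwiners H (st k n) (st k l)"
    unfolding H_intertwiners[OF sn(1) sl(1)] homs_def
    using c De Ds fc rep_dim[OF kg_rep[OF VM]] repD(1)[OF kg_rep[OF VM]] shc
    by (simp add: sn sl f_def kron_mult carrier_matD[OF shc])
  have "(\<lambda>v. f *\<^sub>v v) ` carrier_vec (mdim (st k n)) = carrier_vec (mdim (st k l))"
  proof
    show "(\<lambda>v. f *\<^sub>v v) ` carrier_vec (mdim (st k n)) \<subseteq> carrier_vec (mdim (st k l))"
      using fc by (auto simp: sn sl)
    have Ec: "kron E (1\<^sub>m ?r) \<in> carrier_mat (n * ?r) (l * ?r)" using c by auto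
    have fE: "f * kron E (1\<^sub>m ?r) = 1\<^sub>m (l * ?r)" using c DE by (simp add: f_def kron_mult kron_one)
    show "carrier_vec (mdim (st k l)) \<subseteq> (\<lambda>v. f *\<^sub>v v) ` carrier_vec (mdim (st k n))"
    proof
      fix v :: "'k vec" assume "v \<in> carrier_vec (mdim (st k l))"
      hence v: "v \<in> carrier_vec (l * ?r)" by (simp add: sl)
      have "f *\<^sub>v (kron E (1\<^sub>m ?r) *\<^sub>v v) = v"
        using assoc_mult_mat_vec[OF fc Ec v] fE v by simp
      moreover have "kron E (1\<^sub>m ?r) *\<^sub>v v \<in> carrier_vec (mdim (st k n))" using Ec v by (auto simp: sn)
      ultimately show "v \<in> (\<lambda>v. f *\<^sub>v v) ` carrier_vec (mdim (st k n))" by (metis image_eqI)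
    qed
  qed
  \<comment> \<open>Projectivity lifts the identity of M(k, l) through the truncation, which
    produces the splitting.\<close>
  then obtain s where s: "s \<in> intertwiners H (st k l) (st k n)" "f * s = 1\<^sub>m (mdim (st k l))"
    using pr f intertwiner_one[OF sl(1)] sn(1) sl(1) unfolding projective_mod_def by metis
  obtain N where N: "alg_module H N" "iso_mod H (st k n) (dsum_mod (st k l) N)"
    using summand[OF sl(1) sn(1) s(1) f s(2)] by blast
  have "n * ?r = l * ?r + mdim N" using iso_mod_dim[OF N(2)] by (simp add: sn sl)
  moreover have "0 < ?r" using V_dim_pos[OF k] .
  moreover have "mdim (st k l) = 0 \<or> mdim N = 0"
  proof -
    have "(k, n) \<in> Ix" using k n_pos by (simp add: Ix_def)
    from string_indecomposable[OF this, unfolded indecomposable_mod_def Mx_st, THEN conjunct2, THEN conjunct2, rule_format, OF sl(1) N]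
    show ?thesis .
  qed
  ultimately show False using l by (auto simp: sl)
qed

lemma projective_Sp:
  assumes "projective_mod H P"
  shows "cl P \<in> Sp"
proof -
  have PM: "alg_module H P" using assms by (simp add: projective_mod_def)
  obtain xs where "decomp P xs" using exists_decomp[OF PM] by blast
  thus ?thesis using assms
  proof (induction rule: decomp.induct)
    case (Nil M)
    thus ?case using cl_zero Sp_closed by simp
  next
    case (Cons M N x xs)
    note xm = Mx_module[OF Cons.hyps(3)]
    note pr = dsum_projective[OF Cons.prems xm Cons.hyps(2,4)]
    have "snd x = n"
    proof (rule ccontr)
      assume "snd x \<noteq> n"
      hence "fst x \<in> {1..m}" "0 < snd x" "snd x < n" using Cons.hyps(3) by (auto simp: Ix_def)
      thus False using string_not_projective pr(1) unfolding Mx_def by blast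
    qed
    hence "cl (Mx x) \<in> Sp" using Cons.hyps(3) Sp_st by (auto simp: Ix_def Mx_def)
    thus ?case
      using cl_iso[OF Cons.hyps(1) dsum_module[OF xm Cons.hyps(2)] Cons.hyps(4)] cl_dsum[OF xm Cons.hyps(2)]
        Cons.IH[OF pr(2)] Sp_closed(2) by simp
  qed
qed

abbreviation PI where "PI \<equiv> projective_ideal G \<chi> g n"

lemma PI_gens: "{cl P | P. indecomposable_mod H P \<and> projective_mod H P} \<subseteq> carrier R0"
  using cl_closed unfolding indecomposable_mod_def by blast

sublocale PI: ideal PI R0
  unfolding projective_ideal_def by (rule R0.genideal_ideal[OF PI_gens])

text \<open>This inclusion is what lets functionals that vanish on the strings of length n pass to
  the stable quotient.\<close>

lemma PI_Sp: "PI \<subseteq> Sp"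
  unfolding projective_ideal_def by (rule R0.genideal_minimal[OF Sp_ideal]) (use projective_Sp in blast)

lemma st_PI:
  assumes k: "k \<in> {1..m}"
  shows "cl (st k n) \<in> PI"
proof -
  have "indecomposable_mod H (st k n)" using string_indecomposable[of "(k, n)"] k n_pos by (simp add: Ix_def Mx_st)
  hence "cl (st k n) \<in> {cl P | P. indecomposable_mod H P \<and> projective_mod H P}" using projective_string[OF k] by blast
  thus ?thesis unfolding projective_ideal_def using R0.genideal_self[OF PI_gens] by blast
qed

end

section \<open>Complexification\<close>

text \<open>\<open>complexification\<close> is a record with a scalar multiplication, hence of
  another type than the quotient ring with the same operations.\<close>

lemma ring_cong:
  assumes "ring R" and e: "carrier S = carrier R" "monoid.mult S = monoid.mult R" "one S = one R" "zero S = zero R" "add S = add R"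
  shows "ring S"
proof -
  interpret R: ring R by fact
  show ?thesis
  proof (rule ringI)
    show "abelian_group S"
      by (rule abelian_groupI) (auto simp: e R.a_ac intro: R.l_neg bexI[of _ "\<ominus>\<^bsub>R\<^esub> x" for x])
    show "Group.monoid S"
      by (rule monoidI) (auto simp: e R.m_assoc)
  qed (auto simp: e R.l_distr R.r_distr)
qed

locale complexified = ring A for A :: "'a ring" (structure)
begin

abbreviation CA where "CA \<equiv> (class_ring :: complex ring) \<times>\<times> A"

definition Trels :: "((complex \<times> 'a) \<Rightarrow>\<^sub>0 int) set" where
  "Trels = {Poly_Mapping.single (c + c', a) 1 - Poly_Mapping.single (c, a) 1
         - Poly_Mapping.single (c', a) 1 | c c' a. a \<in> carrier A}
      \<union> {Poly_Mapping.single (c, a \<oplus> a') 1 - Poly_Mapping.single (c, a) 1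
         - Poly_Mapping.single (c, a') 1 | c a a'. a \<in> carrier A \<and> a' \<in> carrier A}"

lemma CA_simps [simp]: "p \<in> carrier CA \<longleftrightarrow> snd p \<in> carrier A"
  "(c, a) \<otimes>\<^bsub>CA\<^esub> (c', a') = (c * c', a \<otimes> a')" "\<one>\<^bsub>CA\<^esub> = (1, \<one>)"
  by (cases p) (simp_all add: DirProd_def)

lemma CA_monoid: "Group.monoid CA"
  by (rule monoidI) (auto simp: m_assoc mult.assoc)

text \<open>Multiplying a biadditivity relation by a pure tensor gives a relation of the same kind,
  by distributivity in \<complex> or in A.\<close>

lemma tensor_gen_ideal: "gen_ideal CA Trels"
proof -
  note mc = m_closed
  interpret monoid_alg CA "TYPE(int)" using CA_monoid by (simp add: monoid_alg_def)
  have d: "p - q' \<in> carrier MA" if "p \<in> carrier MA" "q' \<in> carrier MA" for p q'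
    using that unfolding monoid_algebra_simps mem_Collect_eq by (rule keys_diff_subset)
  have md: "p \<otimes>\<^bsub>MA\<^esub> (a - b - c) = p \<otimes>\<^bsub>MA\<^esub> a - p \<otimes>\<^bsub>MA\<^esub> b - p \<otimes>\<^bsub>MA\<^esub> c"
    "(a - b - c) \<otimes>\<^bsub>MA\<^esub> p = a \<otimes>\<^bsub>MA\<^esub> p - b \<otimes>\<^bsub>MA\<^esub> p - c \<otimes>\<^bsub>MA\<^esub> p" for p a b c
    using mult_add_right[of p "a - b - c" "b + c"] mult_add_right[of p b c]
      mult_add_left[of "a - b - c" "b + c" p] mult_add_left[of b c p] by (simp_all add: algebra_simps)
  show ?thesis
  proof
    show "Trels \<subseteq> carrier MA" unfolding Trels_def by (auto intro!: d sg_closed)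
    fix p s assume p: "p \<in> carrier CA" and s: "s \<in> Trels"
    obtain c a where ca: "p = (c, a)" "a \<in> carrier A" using p by (cases p) simp
    consider (1) c1 c2 b where "b \<in> carrier A" "s = sg (c1 + c2, b) 1 - sg (c1, b) 1 - sg (c2, b) 1"
      | (2) c1 b b' where "b \<in> carrier A" "b' \<in> carrier A" "s = sg (c1, b \<oplus> b') 1 - sg (c1, b) 1 - sg (c1, b') 1"
      using s unfolding Trels_def by blast
    hence "sg p 1 \<otimes>\<^bsub>MA\<^esub> s \<in> Trels \<and> s \<otimes>\<^bsub>MA\<^esub> sg p 1 \<in> Trels"
    proof cases
      case 1
      have "sg p 1 \<otimes>\<^bsub>MA\<^esub> s = sg (c * c1 + c * c2, a \<otimes> b) 1 - sg (c * c1, a \<otimes> b) 1 - sg (c * c2, a \<otimes> b) 1"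
        "s \<otimes>\<^bsub>MA\<^esub> sg p 1 = sg (c1 * c + c2 * c, b \<otimes> a) 1 - sg (c1 * c, b \<otimes> a) 1 - sg (c2 * c, b \<otimes> a) 1"
        by (simp_all only: 1 ca md mult_sg CA_simps distrib_left distrib_right mult_1)
      thus ?thesis unfolding Trels_def using mc[OF ca(2) 1(1)] mc[OF 1(1) ca(2)] by blast
    next
      case 2
      have "sg p 1 \<otimes>\<^bsub>MA\<^esub> s = sg (c * c1, a \<otimes> b \<oplus> a \<otimes> b') 1 - sg (c * c1, a \<otimes> b) 1 - sg (c * c1, a \<otimes> b') 1"
        "s \<otimes>\<^bsub>MA\<^esub> sg p 1 = sg (c1 * c, b \<otimes> a \<oplus> b' \<otimes> a) 1 - sg (c1 * c, b \<otimes> a) 1 - sg (c1 * c, b' \<otimes> a) 1"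
        by (simp_all only: 2 ca md mult_sg CA_simps r_distr l_distr mult_1)
      thus ?thesis unfolding Trels_def
        using mc[OF ca(2) 2(1)] mc[OF 2(1) ca(2)] mc[OF ca(2) 2(2)] mc[OF 2(2) ca(2)] by blast
    qed
    thus "sg p 1 \<otimes>\<^bsub>MA\<^esub> s \<in> generate (add_monoid MA) Trels" "s \<otimes>\<^bsub>MA\<^esub> sg p 1 \<in> generate (add_monoid MA) Trels"
      by (auto intro: generate.incl)
  qed
qed

sublocale ct: gen_ideal CA Trels by (rule tensor_gen_ideal)

abbreviation CT where "CT \<equiv> complexification A"
abbreviation pt where "pt \<equiv> pure_tensor A"

lemma tensor_rels_eq: "tensor_rels A = ct.GS"
  unfolding tensor_rels_def tensor_free_def ct.GS_def unfolding Trels_def ..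

lemma pt_eq: "pt c a = ct.q (c, a)"
  unfolding pure_tensor_def tensor_rels_eq tensor_free_def ..

lemma CT_simps: "carrier CT = carrier ct.QA" "monoid.mult CT = monoid.mult ct.QA" "one CT = one ct.QA" "zero CT = zero ct.QA"
  "add CT = add ct.QA" "c \<odot>\<^bsub>CT\<^esub> X = pt c \<one> \<otimes>\<^bsub>ct.QA\<^esub> X"
  by (simp_all add: complexification_def tensor_rels_eq tensor_free_def)

sublocale CT: ring CT
  by (rule ring_cong[OF ct.QA.ring_axioms]) (simp_all add: CT_simps)

lemma pt_closed: "a \<in> carrier A \<Longrightarrow> pt c a \<in> carrier CT"
  unfolding pt_eq CT_simps by (rule ct.q_closed) simp

lemma pt_mult: "a \<in> carrier A \<Longrightarrow> b \<in> carrier A \<Longrightarrow> pt c a \<otimes>\<^bsub>CT\<^esub> pt d b = pt (c * d) (a \<otimes> b)"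
  unfolding pt_eq CT_simps by (subst ct.q_mult) simp_all

lemma pt_one: "\<one>\<^bsub>CT\<^esub> = pt 1 \<one>"
  unfolding pt_eq CT_simps ct.q_one by simp

lemma pt_add_left: "a \<in> carrier A \<Longrightarrow> pt (c + d) a = pt c a \<oplus>\<^bsub>CT\<^esub> pt d a"
  unfolding pt_eq CT_simps by (rule ct.q_rel) (simp_all, unfold Trels_def, blast)

lemma pt_add_right: "a \<in> carrier A \<Longrightarrow> b \<in> carrier A \<Longrightarrow> pt c (a \<oplus> b) = pt c a \<oplus>\<^bsub>CT\<^esub> pt c b"
  unfolding pt_eq CT_simps by (rule ct.q_rel) (simp_all, unfold Trels_def, blast)

lemma CT_smult: "c \<odot>\<^bsub>CT\<^esub> X = pt c \<one> \<otimes>\<^bsub>CT\<^esub> X"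
  unfolding CT_simps ..

lemma pt_smult: "a \<in> carrier A \<Longrightarrow> c \<odot>\<^bsub>CT\<^esub> pt d a = pt (c * d) a"
  by (simp add: CT_smult pt_mult)

lemma CT_induct' [consumes 1, case_names pt zero uminus add]:
  assumes "X \<in> carrier CT" "\<And>c a. a \<in> carrier A \<Longrightarrow> P (pt c a)" "P \<zero>\<^bsub>CT\<^esub>"
    "\<And>X. X \<in> carrier CT \<Longrightarrow> P X \<Longrightarrow> P (\<ominus>\<^bsub>CT\<^esub> X)"
    "\<And>X W. X \<in> carrier CT \<Longrightarrow> W \<in> carrier CT \<Longrightarrow> P X \<Longrightarrow> P W \<Longrightarrow> P (X \<oplus>\<^bsub>CT\<^esub> W)"
  shows "P X"
proof -
  have "a_inv CT = a_inv ct.QA" by (simp add: a_inv_def[abs_def] m_inv_def[abs_def] CT_simps)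
  note inv = this
  show ?thesis
    by (rule ct.Q_induct[of X P]) (use assms in \<open>auto simp: CT_simps pt_eq inv\<close>)
qed

text \<open>Scalars are embedded as c \<otimes> 1; their centrality, which rests on commutativity of
  \<complex>, makes the complexification an algebra.\<close>

lemma pt_one_central: "X \<in> carrier CT \<Longrightarrow> pt c \<one> \<otimes>\<^bsub>CT\<^esub> X = X \<otimes>\<^bsub>CT\<^esub> pt c \<one>"
  by (induction rule: CT_induct')
    (simp_all add: pt_mult mult.commute pt_closed CT.l_minus CT.r_minus CT.l_distr CT.r_distr)

lemma CT_module: "Module.module class_ring CT"
  by (rule moduleI[OF class_cring.cring_axioms CT.abelian_group_axioms])
    (simp_all add: CT_smult pt_closed pt_add_left CT.l_distr CT.r_distr pt_one[symmetric]
      pt_mult[of \<one> \<one>, symmetric, simplified] CT.m_assoc)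

lemma CT_vectorspace: "vectorspace class_ring CT"
  unfolding vectorspace_def using CT_module class_field by blast

sublocale CV: vectorspace class_ring CT by (rule CT_vectorspace)

lemma CT_smult_mult:
  assumes "X \<in> carrier CT" "W \<in> carrier CT"
  shows "(c \<odot>\<^bsub>CT\<^esub> X) \<otimes>\<^bsub>CT\<^esub> W = c \<odot>\<^bsub>CT\<^esub> (X \<otimes>\<^bsub>CT\<^esub> W)" "X \<otimes>\<^bsub>CT\<^esub> (c \<odot>\<^bsub>CT\<^esub> W) = c \<odot>\<^bsub>CT\<^esub> (X \<otimes>\<^bsub>CT\<^esub> W)"
proof -
  have "X \<otimes>\<^bsub>CT\<^esub> (pt c \<one> \<otimes>\<^bsub>CT\<^esub> W) = (X \<otimes>\<^bsub>CT\<^esub> pt c \<one>) \<otimes>\<^bsub>CT\<^esub> W" using assms by (simp add: CT.m_assoc pt_closed)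
  also have "\<dots> = pt c \<one> \<otimes>\<^bsub>CT\<^esub> (X \<otimes>\<^bsub>CT\<^esub> W)" unfolding pt_one_central[OF assms(1), symmetric]
    using assms by (simp add: CT.m_assoc pt_closed)
  finally show "X \<otimes>\<^bsub>CT\<^esub> (c \<odot>\<^bsub>CT\<^esub> W) = c \<odot>\<^bsub>CT\<^esub> (X \<otimes>\<^bsub>CT\<^esub> W)" by (simp only: CT_smult)
  show "(c \<odot>\<^bsub>CT\<^esub> X) \<otimes>\<^bsub>CT\<^esub> W = c \<odot>\<^bsub>CT\<^esub> (X \<otimes>\<^bsub>CT\<^esub> W)" using assms by (simp add: CT_smult CT.m_assoc pt_closed)
qed

lemma CT_uminus: "X \<in> carrier CT \<Longrightarrow> \<ominus>\<^bsub>CT\<^esub> X = (- 1) \<odot>\<^bsub>CT\<^esub> X"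
  using CV.smult_l_minus[of 1 X] CV.smult_one[of X] by (simp add: class_ring_simps)

lemma CT_induct [consumes 1, case_names pt zero add smult]:
  assumes "X \<in> carrier CT" "\<And>a. a \<in> carrier A \<Longrightarrow> P (pt 1 a)" "P \<zero>\<^bsub>CT\<^esub>"
    "\<And>X W. X \<in> carrier CT \<Longrightarrow> W \<in> carrier CT \<Longrightarrow> P X \<Longrightarrow> P W \<Longrightarrow> P (X \<oplus>\<^bsub>CT\<^esub> W)"
    "\<And>c X. X \<in> carrier CT \<Longrightarrow> P X \<Longrightarrow> P (c \<odot>\<^bsub>CT\<^esub> X)"
  shows "P X"
  using assms(1)
proof (induction rule: CT_induct')
  case (pt c a)
  show ?case using assms(5)[OF pt_closed[OF pt] assms(2)[OF pt], of c] pt_smult[OF pt, of c 1] by simp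
next
  case (uminus X)
  show ?case unfolding CT_uminus[OF uminus(1)] by (rule assms(5)[OF uminus])
qed (use assms in auto)

text \<open>Extension of scalars: c \<otimes> a is sent to c times f0(a), which respects both
  biadditivity relations.\<close>

lemma CT_functional:
  assumes add: "\<And>a b. a \<in> carrier A \<Longrightarrow> b \<in> carrier A \<Longrightarrow> f0 (a \<oplus> b) = (f0 a + f0 b :: complex)"
  shows "\<exists>f. (\<forall>a\<in>carrier A. f (pt 1 a) = f0 a) \<and>
    (\<forall>X\<in>carrier CT. \<forall>W\<in>carrier CT. f (X \<oplus>\<^bsub>CT\<^esub> W) = f X + f W) \<and>
    (\<forall>c. \<forall>X\<in>carrier CT. f (c \<odot>\<^bsub>CT\<^esub> X) = c * f X)"
proof -
  define \<phi> where "\<phi> p = fst p * f0 (snd p)" for p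
  have "ct.fext \<phi> s = 0" if s: "s \<in> Trels" for s
  proof -
    consider (1) c c' a where "a \<in> carrier A" "s = ct.sg (c + c', a) 1 - ct.sg (c, a) 1 - ct.sg (c', a) 1"
      | (2) c a a' where "a \<in> carrier A" "a' \<in> carrier A" "s = ct.sg (c, a \<oplus> a') 1 - ct.sg (c, a) 1 - ct.sg (c, a') 1"
      using s unfolding Trels_def by blast
    thus ?thesis
    proof cases
      case 1
      show ?thesis unfolding 1(2) ct.fext_diff ct.fext_single by (simp add: \<phi>_def algebra_simps)
    next
      case 2
      show ?thesis unfolding 2(3) ct.fext_diff ct.fext_single by (simp add: \<phi>_def algebra_simps add 2)
    qed
  qed
  from ct.Q_functional[OF this]
  obtain f where f: "\<And>p. p \<in> carrier CA \<Longrightarrow> f (ct.q p) = \<phi> p"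
    "\<And>X W. X \<in> carrier CT \<Longrightarrow> W \<in> carrier CT \<Longrightarrow> f (X \<oplus>\<^bsub>CT\<^esub> W) = f X + f W"
    unfolding CT_simps by blast
  have fpt: "f (pt c a) = c * f0 a" if "a \<in> carrier A" for c a
    using f(1)[of "(c, a)"] that by (simp add: pt_eq \<phi>_def)
  have f0: "f \<zero>\<^bsub>CT\<^esub> = 0" using f(2)[of "\<zero>\<^bsub>CT\<^esub>" "\<zero>\<^bsub>CT\<^esub>"] by simp
  have fm: "f (\<ominus>\<^bsub>CT\<^esub> X) = - f X" if "X \<in> carrier CT" for X
    using f(2)[of X "\<ominus>\<^bsub>CT\<^esub> X"] that f0 by (simp add: CT.r_neg eq_neg_iff_add_eq_0 add.commute)
  have "f (c \<odot>\<^bsub>CT\<^esub> X) = c * f X" if "X \<in> carrier CT" for c X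
    using that
  proof (induction rule: CT_induct')
    case (uminus X)
    thus ?case using CV.smult_closed[of c X] by (simp add: CV.smult_r_minus fm)
  next
    case (add X W)
    thus ?case using CV.smult_closed[of c X] CV.smult_closed[of c W] by (simp add: CV.smult_r_distr f(2) distrib_left)
  qed (simp_all add: pt_smult fpt f0 CV.smult_r_null)
  moreover have "f (pt 1 a) = f0 a" if "a \<in> carrier A" for a using fpt[OF that, of 1] by simp
  ultimately show ?thesis using f(2) by blast
qed

end

section \<open>The stable Green ring\<close>

context gds
begin

abbreviation SR where "SR \<equiv> stable_green_ring G \<chi> g n"

sublocale SR: ring SR
  unfolding stable_green_ring_def by (rule PI.quotient_is_ring)

sublocale cx: complexified SR ..

abbreviation T where "T \<equiv> R_st G \<chi> g n"
abbreviation t where "t \<equiv> R_st_class G \<chi> g n"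

lemma T_eq: "T = cx.CT"
  by (simp add: R_st_def)

sublocale T: ring T unfolding T_eq by (rule cx.CT.ring_axioms)
sublocale TV: vectorspace class_ring T unfolding T_eq by (rule cx.CT_vectorspace)

lemmas T_smult_mult = cx.CT_smult_mult[folded T_eq]

abbreviation sc where "sc X \<equiv> PI +>\<^bsub>R0\<^esub> X"

lemma sc_closed: "X \<in> carrier R0 \<Longrightarrow> sc X \<in> carrier SR"
  unfolding stable_green_ring_def PI.quot_carrier by blast

lemma t_eq: "t M = cx.pt 1 (sc (cl M))"
  by (simp add: R_st_class_def stable_class_def)

lemma t_closed: "alg_module H M \<Longrightarrow> t M \<in> carrier T"
  unfolding t_eq T_eq by (intro cx.pt_closed sc_closed cl_closed)

lemma t_cl: "cl M = cl N \<Longrightarrow> t M = t N"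
  by (simp add: t_eq)

lemma t_iso: "alg_module H M \<Longrightarrow> alg_module H N \<Longrightarrow> iso_mod H M N \<Longrightarrow> t M = t N"
  by (rule t_cl[OF cl_iso])

lemma sc_hom: "X \<in> carrier R0 \<Longrightarrow> W \<in> carrier R0 \<Longrightarrow> sc X \<otimes>\<^bsub>SR\<^esub> sc W = sc (X \<otimes>\<^bsub>R0\<^esub> W)"
  "X \<in> carrier R0 \<Longrightarrow> W \<in> carrier R0 \<Longrightarrow> sc X \<oplus>\<^bsub>SR\<^esub> sc W = sc (X \<oplus>\<^bsub>R0\<^esub> W)"
  "\<one>\<^bsub>SR\<^esub> = sc \<one>\<^bsub>R0\<^esub>" "\<zero>\<^bsub>SR\<^esub> = sc \<zero>\<^bsub>R0\<^esub>"
  unfolding stable_green_ring_def by (rule PI.quot_mult PI.quot_add PI.quot_one PI.quot_zero; assumption)+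

lemma t_dsum:
  assumes "alg_module H M" "alg_module H N"
  shows "t (dsum_mod M N) = t M \<oplus>\<^bsub>T\<^esub> t N"
  unfolding t_eq T_eq cl_dsum[OF assms] using assms
  by (subst cx.pt_add_right[symmetric]) (simp_all add: sc_closed cl_closed sc_hom)

lemma t_tensor:
  assumes "alg_module H M" "alg_module H N"
  shows "t M \<otimes>\<^bsub>T\<^esub> t N = t (tens M N)"
  unfolding t_eq T_eq cl_tensor[OF assms] using assms
  by (subst cx.pt_mult) (simp_all add: sc_closed cl_closed sc_hom)

lemma t_one: "\<one>\<^bsub>T\<^esub> = t (infl 1)"
  unfolding t_eq T_eq cx.pt_one sc_hom cl_one ..

lemma t_st_n:
  assumes k: "k \<in> {1..m}"
  shows "t (st k n) = \<zero>\<^bsub>T\<^esub>"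
proof -
  note z = SR.zero_closed
  have "sc (cl (st k n)) = \<zero>\<^bsub>SR\<^esub>"
    unfolding sc_hom using PI.quot_eq[OF cl_closed[OF st_module[OF k order_refl]] R0.zero_closed] st_PI[OF k]
      cl_closed[OF st_module[OF k order_refl]] by (simp add: a_minus_def)
  moreover have "cx.pt 1 \<zero>\<^bsub>SR\<^esub> = \<zero>\<^bsub>cx.CT\<^esub>"
    using cx.pt_add_right[OF z z, of 1] cx.pt_closed[OF z, of 1] by (simp add: cx.CT.add.r_cancel_one')
  ultimately show ?thesis by (simp add: t_eq T_eq)
qed

lemma T_uminus: "X \<in> carrier T \<Longrightarrow> \<ominus>\<^bsub>T\<^esub> X = (- 1) \<odot>\<^bsub>T\<^esub> X"
  unfolding T_eq by (rule cx.CT_uminus)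

lemma t_st_0: "k \<in> {1..m} \<Longrightarrow> t (st k 0) = \<zero>\<^bsub>T\<^esub>"
  by (rule expansion(1)[OF T.abelian_group_axioms t_closed t_iso t_dsum st_module]) (simp_all add: string_module(2)[OF V_module])

definition Is :: "(nat \<times> nat) set" where "Is = {1..m} \<times> {1..n - 1}"

abbreviation tt where "tt x \<equiv> t (Mx x)"

lemma Is_Ix: "x \<in> Is \<Longrightarrow> x \<in> Ix"
  by (auto simp: Is_def Ix_def)

lemma Is_finite [simp]: "finite Is" by (simp add: Is_def)

lemma tt_closed: "x \<in> Is \<Longrightarrow> tt x \<in> carrier T"
  by (rule t_closed[OF Mx_module[OF Is_Ix]])

text \<open>Strings of length n have class 0 here, so the classes indexed by \<open>Is\<close>
  already span.\<close>

lemma T_induct [consumes 1, case_names tt zero add smult]: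
  assumes X: "X \<in> carrier T" and tt: "\<And>x. x \<in> Is \<Longrightarrow> P (tt x)" and zero: "P \<zero>\<^bsub>T\<^esub>"
    and add: "\<And>X W. X \<in> carrier T \<Longrightarrow> W \<in> carrier T \<Longrightarrow> P X \<Longrightarrow> P W \<Longrightarrow> P (X \<oplus>\<^bsub>T\<^esub> W)"
    and smult: "\<And>c X. X \<in> carrier T \<Longrightarrow> P X \<Longrightarrow> P (c \<odot>\<^bsub>T\<^esub> X)"
  shows "P X"
proof -
  have cls: "P (t M)" if "decomp M xs" for M xs using that
  proof (induction rule: decomp.induct)
    case (Nil M)
    thus ?case using expansion(1)[OF T.abelian_group_axioms t_closed t_iso t_dsum] zero by simp
  next
    case (Cons M N x xs)
    note xm = Mx_module[OF Cons.hyps(3)]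
    have "P (tt x)"
    proof (cases "snd x = n")
      case True
      hence "tt x = \<zero>\<^bsub>T\<^esub>" using t_st_n[of "fst x"] Cons.hyps(3) by (auto simp: Ix_def Mx_def)
      thus ?thesis using zero by simp
    next
      case False
      hence "x \<in> Is" using Cons.hyps(3) by (auto simp: Is_def Ix_def)
      thus ?thesis by (rule tt)
    qed
    from add[OF t_closed[OF xm] t_closed[OF Cons.hyps(2)] this Cons.IH]
    show ?case
      unfolding t_dsum[OF xm Cons.hyps(2), symmetric]
        t_iso[OF Cons.hyps(1) dsum_module[OF xm Cons.hyps(2)] Cons.hyps(4), symmetric] .
  qed
  have uc: "cx.pt 1 (sc X) \<in> carrier T" if "X \<in> carrier R0" for X
    unfolding T_eq by (intro cx.pt_closed sc_closed that)
  have ua: "cx.pt 1 (sc (X \<oplus>\<^bsub>R0\<^esub> W)) = cx.pt 1 (sc X) \<oplus>\<^bsub>T\<^esub> cx.pt 1 (sc W)" if "X \<in> carrier R0" "W \<in> carrier R0" for X W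
    unfolding sc_hom(2)[OF that, symmetric] T_eq by (rule cx.pt_add_right[OF sc_closed[OF that(1)] sc_closed[OF that(2)]])
  have u0: "cx.pt 1 (sc \<zero>\<^bsub>R0\<^esub>) = \<zero>\<^bsub>T\<^esub>"
    using ua[OF R0.zero_closed R0.zero_closed] uc[OF R0.zero_closed] by (simp add: T.add.r_cancel_one')
  have "P (cx.pt 1 (sc X))" if "X \<in> carrier R0" for X
    using that
  proof (induction rule: green_induct)
    case (cls M)
    thus ?case using \<open>\<And>M xs. decomp M xs \<Longrightarrow> P (t M)\<close> exists_decomp unfolding t_eq by blast
  next
    case (uminus X)
    have "cx.pt 1 (sc (\<ominus>\<^bsub>R0\<^esub> X)) = \<ominus>\<^bsub>T\<^esub> cx.pt 1 (sc X)"
      by (rule T.minus_equality[symmetric])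
        (use ua[of "\<ominus>\<^bsub>R0\<^esub> X" X] uminus(1) in \<open>simp_all add: R0.l_neg u0 uc\<close>)
    thus ?case using smult[OF uc[OF uminus(1)] uminus(2)] T_uminus[OF uc[OF uminus(1)]] by simp
  next
    case (add X W)
    show ?case unfolding ua[OF add(1,2)] by (rule assms(4)[OF uc[OF add(1)] uc[OF add(2)] add(3,4)])
  qed (simp add: u0 zero)
  moreover have "\<exists>X\<in>carrier R0. a = sc X" if "a \<in> carrier SR" for a
    using that unfolding stable_green_ring_def PI.quot_carrier .
  ultimately have pt: "P (cx.pt 1 a)" if "a \<in> carrier SR" for a using that by blast
  from X show ?thesis unfolding T_eq
    by (rule cx.CT_induct) (use pt zero add smult in \<open>simp_all add: T_eq\<close>)
qed

definition lin :: "(('k, 'g) stable_elt \<Rightarrow> complex) \<Rightarrow> bool" where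
  "lin f \<longleftrightarrow> (\<forall>X\<in>carrier T. \<forall>W\<in>carrier T. f (X \<oplus>\<^bsub>T\<^esub> W) = f X + f W) \<and> (\<forall>c. \<forall>X\<in>carrier T. f (c \<odot>\<^bsub>T\<^esub> X) = c * f X)"

text \<open>The functional is built on the Green ring, vanishes on \<open>Sp\<close> and therefore
  on the ideal of projectives, and is then extended over \<complex>.\<close>

lemma T_functional:
  assumes iso: "\<And>M N. alg_module H M \<Longrightarrow> alg_module H N \<Longrightarrow> iso_mod H M N \<Longrightarrow> w M = w N"
    and add: "\<And>M N. alg_module H M \<Longrightarrow> alg_module H N \<Longrightarrow> w (dsum_mod M N) = (w M + w N :: complex)"
    and top: "\<And>k. k \<in> {1..m} \<Longrightarrow> w (st k n) = 0"
  shows "\<exists>f. lin f \<and> (\<forall>M. alg_module H M \<longrightarrow> f (t M) = w M)"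
proof -
  have "\<exists>f. (\<forall>M. alg_module H M \<longrightarrow> f (cl M) = w M) \<and>
    (\<forall>X\<in>carrier R0. \<forall>W\<in>carrier R0. f (X \<oplus>\<^bsub>R0\<^esub> W) = f X + f W)"
    by (rule green_functional) (fact iso, fact add)
  then obtain f0 where f0: "\<And>M. alg_module H M \<Longrightarrow> f0 (cl M) = w M"
    "\<And>X W. X \<in> carrier R0 \<Longrightarrow> W \<in> carrier R0 \<Longrightarrow> f0 (X \<oplus>\<^bsub>R0\<^esub> W) = f0 X + f0 W" by blast
  have z: "f0 \<zero>\<^bsub>R0\<^esub> = 0" using f0(2)[of "\<zero>\<^bsub>R0\<^esub>" "\<zero>\<^bsub>R0\<^esub>"] by simp
  have m: "f0 (\<ominus>\<^bsub>R0\<^esub> X) = - f0 X" if "X \<in> carrier R0" for X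
    using f0(2)[of X "\<ominus>\<^bsub>R0\<^esub> X"] that z by (simp add: R0.r_neg eq_neg_iff_add_eq_0 add.commute)
  have S: "f0 X = 0" if "X \<in> Sp" for X
    using that by (induction rule: Sp_induct)
      (simp_all add: f0 st_module top z m Sp_carrier)
  have "\<exists>f1. \<forall>X\<in>carrier R0. f1 (sc X) = f0 X"
  proof (rule PI.quot_lift)
    fix X W assume XW: "X \<in> carrier R0" "W \<in> carrier R0" "X \<ominus>\<^bsub>R0\<^esub> W \<in> PI"
    hence "f0 (X \<ominus>\<^bsub>R0\<^esub> W) = 0" using S PI_Sp by blast
    thus "f0 X = f0 W" using XW by (simp add: a_minus_def f0(2) m)
  qed
  then obtain f1 where f1: "\<And>X. X \<in> carrier R0 \<Longrightarrow> f1 (sc X) = f0 X" by blast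
  have "f1 (a \<oplus>\<^bsub>SR\<^esub> b) = f1 a + f1 b" if "a \<in> carrier SR" "b \<in> carrier SR" for a b
  proof -
    obtain X W where XW: "X \<in> carrier R0" "W \<in> carrier R0" "a = sc X" "b = sc W"
      using \<open>a \<in> carrier SR\<close> \<open>b \<in> carrier SR\<close> unfolding stable_green_ring_def PI.quot_carrier by blast
    show ?thesis unfolding XW(3,4) sc_hom(2)[OF XW(1,2)] using XW by (simp add: f1 f0(2))
  qed
  from cx.CT_functional[OF this] obtain f where f: "\<And>a. a \<in> carrier SR \<Longrightarrow> f (cx.pt 1 a) = f1 a" "lin f"
    unfolding lin_def T_eq by blast
  have "f (t M) = w M" if "alg_module H M" for M
    using f(1)[OF sc_closed[OF cl_closed[OF that]]] f1[OF cl_closed[OF that]] f0(1)[OF that] by (simp add: t_eq)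
  with f(2) show ?thesis by blast
qed


subsection \<open>Products in the stable Green ring\<close>

lemma t_comm: "alg_module H M \<Longrightarrow> alg_module H N \<Longrightarrow> t M \<otimes>\<^bsub>T\<^esub> t N = t N \<otimes>\<^bsub>T\<^esub> t M"
  unfolding t_tensor by (rule t_cl) (simp add: cl_tensor R0_comm cl_closed)

lemma T_comm:
  assumes X: "X \<in> carrier T" and W: "W \<in> carrier T"
  shows "X \<otimes>\<^bsub>T\<^esub> W = W \<otimes>\<^bsub>T\<^esub> X"
proof -
  have 1: "tt x \<otimes>\<^bsub>T\<^esub> W = W \<otimes>\<^bsub>T\<^esub> tt x" if x: "x \<in> Is" for x
    using W by (induction rule: T_induct)
      (simp_all add: t_comm[OF Mx_module[OF Is_Ix[OF x]] Mx_module[OF Is_Ix]] tt_closed[OF x] T.l_distr T.r_distr T_smult_mult)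
  show ?thesis using X
    by (induction rule: T_induct) (simp_all add: 1 W T.l_distr T.r_distr T_smult_mult)
qed

lemma t_eqI: "alg_module H M \<Longrightarrow> alg_module H N \<Longrightarrow> (\<And>x. x \<in> Ix \<Longrightarrow> mul M x = mul N x) \<Longrightarrow> t M = t N"
  by (rule t_cl[OF cl_eq])

abbreviation zt where "zt \<equiv> t Z"

lemma zt_mult:
  assumes k: "k \<in> {1..m}" and l: "0 < l" "l < n"
  shows "zt \<otimes>\<^bsub>T\<^esub> t (st k l) = t (st k (l + 1)) \<oplus>\<^bsub>T\<^esub> t (st (\<tau> k) (l - 1))"
proof -
  have ms: "alg_module H (st k l)" "alg_module H (st k (l + 1))" "alg_module H (st (\<tau> k) (l - 1))"
    using k l tau_spec(1)[OF k] by (simp_all add: st_module)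
  show ?thesis
    unfolding t_tensor[OF z_module ms(1)] t_dsum[OF ms(2,3), symmetric]
    by (rule t_eqI) (use tensor_module(1)[OF z_module] ms l in \<open>simp_all add: dsum_module mul_Z_tensor[OF k] mul_dsum\<close>)
qed

lemma t_infl: "k \<in> {1..m} \<Longrightarrow> t (infl k) = t (st k 1)"
  by (rule t_cl[OF cl_infl])

lemma infl_mult:
  assumes i: "i \<in> {1..m}" and k: "k \<in> {1..m}" and s: "s \<in> {1..m}" and l: "l \<le> n"
    and N: "\<And>r. r \<in> {1..m} \<Longrightarrow> NN i k r = (if r = s then 1 else 0)"
  shows "t (infl i) \<otimes>\<^bsub>T\<^esub> t (st k l) = t (st s l)"
  unfolding t_tensor[OF infl_module[OF i] st_module[OF k l]]
proof (rule t_eqI)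
  fix x assume x: "x \<in> Ix"
  hence "fst x \<in> {1..m}" by (auto simp: Ix_def)
  thus "mul (tens (infl i) (st k l)) x = mul (st s l) x"
    unfolding mul_V_tensor[OF i k l x] mul_string[OF s l x] by (cases x) (auto simp: N)
qed (intro tensor_module(1) infl_module[OF i] st_module k s l)+

lemma T_gen_induct [consumes 1, case_names base zero add smult z]:
  assumes X: "X \<in> carrier T" and base: "\<And>k. k \<in> {1..m} \<Longrightarrow> P (t (infl k))" and zero: "P \<zero>\<^bsub>T\<^esub>"
    and add: "\<And>X W. X \<in> carrier T \<Longrightarrow> W \<in> carrier T \<Longrightarrow> P X \<Longrightarrow> P W \<Longrightarrow> P (X \<oplus>\<^bsub>T\<^esub> W)"
    and smult: "\<And>c X. X \<in> carrier T \<Longrightarrow> P X \<Longrightarrow> P (c \<odot>\<^bsub>T\<^esub> X)"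
    and z: "\<And>X. X \<in> carrier T \<Longrightarrow> P X \<Longrightarrow> P (zt \<otimes>\<^bsub>T\<^esub> X)"
  shows "P X"
proof -
  have st: "k \<in> {1..m} \<Longrightarrow> l \<le> n \<Longrightarrow> P (t (st k l))" for k l
  proof (induction l arbitrary: k rule: induct_nat_012)
    case 0
    thus ?case using t_st_0 zero by simp
  next
    case 1
    thus ?case using base[of k] t_infl[of k] by simp
  next
    case (ge2 l)
    note tk = tau_spec(1)[OF ge2.prems(1)]
    have c: "t (st k (Suc (Suc l))) \<in> carrier T" "t (st k (Suc l)) \<in> carrier T" "t (st (\<tau> k) l) \<in> carrier T"
      using ge2.prems tk by (simp_all add: t_closed st_module)
    have "zt \<otimes>\<^bsub>T\<^esub> t (st k (Suc l)) = t (st k (Suc (Suc l))) \<oplus>\<^bsub>T\<^esub> t (st (\<tau> k) l)"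
      using zt_mult[of k "Suc l"] ge2.prems by simp
    hence e: "t (st k (Suc (Suc l))) = zt \<otimes>\<^bsub>T\<^esub> t (st k (Suc l)) \<oplus>\<^bsub>T\<^esub> (- 1) \<odot>\<^bsub>T\<^esub> t (st (\<tau> k) l)"
      unfolding T_uminus[OF c(3), symmetric] using c by (simp add: T.a_assoc T.r_neg)
    have "P (t (st k (Suc l)))" "P (t (st (\<tau> k) l))" using ge2 tk by simp_all
    thus ?case unfolding e
      by (intro add z smult c T.m_closed t_closed[OF z_module] TV.smult_closed) simp_all
  qed
  show ?thesis using X
  proof (induction rule: T_induct)
    case (tt x)
    hence "fst x \<in> {1..m}" "snd x \<le> n" by (auto simp: Is_def)
    thus ?case unfolding Mx_def by (rule st)
  qed (use zero add smult in auto)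
qed

subsection \<open>Coordinates\<close>

text \<open>For x in \<open>Is\<close> such a functional exists by \<open>T_functional\<close>, as a
  string of length n has multiplicity 0 at every shorter string.\<close>

definition co :: "nat \<times> nat \<Rightarrow> ('k, 'g) stable_elt \<Rightarrow> complex" where
  "co x = (SOME f. lin f \<and> (\<forall>M. alg_module H M \<longrightarrow> f (t M) = of_nat (mul M x)))"

lemma co:
  assumes x: "x \<in> Is"
  shows "lin (co x)" "alg_module H M \<Longrightarrow> co x (t M) = of_nat (mul M x)"
proof -
  note x' = Is_Ix[OF x]
  have "\<exists>f. lin f \<and> (\<forall>M. alg_module H M \<longrightarrow> f (t M) = of_nat (mul M x))"
  proof (rule T_functional)
    fix k assume "k \<in> {1..m}"
    moreover have "snd x < n" using x n_ge_2 by (auto simp: Is_def)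
    hence "x \<noteq> (k, n)" by auto
    ultimately show "of_nat (mul (st k n) x) = (0::complex)" using mul_string[of k n x] x' by simp
  qed (simp_all add: mul_iso mul_dsum x')
  from someI_ex[OF this, folded co_def]
  show "lin (co x)" "alg_module H M \<Longrightarrow> co x (t M) = of_nat (mul M x)" by blast+
qed

lemma linD: "lin f \<Longrightarrow> X \<in> carrier T \<Longrightarrow> W \<in> carrier T \<Longrightarrow> f (X \<oplus>\<^bsub>T\<^esub> W) = f X + f W"
  "lin f \<Longrightarrow> X \<in> carrier T \<Longrightarrow> f (c \<odot>\<^bsub>T\<^esub> X) = c * f X"
  unfolding lin_def by blast+

lemma lin_zero: "lin f \<Longrightarrow> f \<zero>\<^bsub>T\<^esub> = 0"
  using linD(1)[of f "\<zero>\<^bsub>T\<^esub>" "\<zero>\<^bsub>T\<^esub>"] by simp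

lemma lin_finsum:
  assumes f: "lin f" and v: "\<And>x. x \<in> A \<Longrightarrow> v x \<in> carrier T" and A: "finite A"
  shows "f (\<Oplus>\<^bsub>T\<^esub>x\<in>A. c x \<odot>\<^bsub>T\<^esub> v x) = (\<Sum>x\<in>A. c x * f (v x))"
  using A v
proof (induction A rule: finite_induct)
  case (insert x A)
  have cv: "c y \<odot>\<^bsub>T\<^esub> v y \<in> carrier T" if "y \<in> insert x A" for y
    using TV.smult_closed[of "c y" "v y"] insert.prems[OF that] by simp
  have s: "(\<Oplus>\<^bsub>T\<^esub>y\<in>A. c y \<odot>\<^bsub>T\<^esub> v y) \<in> carrier T" by (rule T.finsum_closed) (use cv in auto)
  have "(\<Oplus>\<^bsub>T\<^esub>y\<in>insert x A. c y \<odot>\<^bsub>T\<^esub> v y) = c x \<odot>\<^bsub>T\<^esub> v x \<oplus>\<^bsub>T\<^esub> (\<Oplus>\<^bsub>T\<^esub>y\<in>A. c y \<odot>\<^bsub>T\<^esub> v y)"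
    by (rule T.finsum_insert) (use insert cv in auto)
  thus ?case using linD(1)[OF f cv s] linD(2)[OF f insert.prems[of x]] insert by simp
qed (simp add: lin_zero[OF f])

lemma tt_sum_closed: "(\<And>x. x \<in> Is \<Longrightarrow> v x \<in> carrier T) \<Longrightarrow> (\<Oplus>\<^bsub>T\<^esub>x\<in>Is. c x \<odot>\<^bsub>T\<^esub> v x) \<in> carrier T"
  by (rule T.finsum_closed) (auto intro!: TV.smult_closed)

lemma co_tt:
  assumes x: "x \<in> Is" and y: "y \<in> Is"
  shows "co x (tt y) = (if x = y then 1 else 0)"
proof -
  have "fst y \<in> {1..m}" "snd y \<le> n" using y by (auto simp: Is_def)
  thus ?thesis using co(2)[OF x Mx_module[OF Is_Ix[OF y]]] mul_string[OF _ _ Is_Ix[OF x]] by (simp add: Mx_def)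
qed

lemma co_sum: "y \<in> Is \<Longrightarrow> co y (\<Oplus>\<^bsub>T\<^esub>x\<in>Is. c x \<odot>\<^bsub>T\<^esub> tt x) = c y"
  by (simp add: lin_finsum[OF co(1) tt_closed] co_tt if_distrib cong: if_cong)

text \<open>Every element is a combination of the classes \<open>tt x\<close>, and the coordinates
  of a combination are its coefficients; so coordinates separate elements.\<close>

lemma T_eqI:
  assumes X: "X \<in> carrier T" and W: "W \<in> carrier T" and e: "\<And>x. x \<in> Is \<Longrightarrow> co x X = co x W"
  shows "X = W"
proof -
  have exp: "\<exists>c. X = (\<Oplus>\<^bsub>T\<^esub>x\<in>Is. c x \<odot>\<^bsub>T\<^esub> tt x)" if "X \<in> carrier T" for X
    using that
  proof (induction rule: T_induct)
    case (tt y)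
    have "(\<Oplus>\<^bsub>T\<^esub>x\<in>Is. (if y = x then 1 else 0) \<odot>\<^bsub>T\<^esub> tt x) = (\<Oplus>\<^bsub>T\<^esub>x\<in>Is. if y = x then tt x else \<zero>\<^bsub>T\<^esub>)"
      by (rule T.finsum_cong')
        (use TV.smult_one TV.lmult_0 tt_closed in \<open>auto simp: class_ring_simps\<close>)
    thus ?case using T.finsum_singleton[OF tt Is_finite, of "\<lambda>x. tt x"] tt_closed by (intro exI) (auto simp: Pi_def)
  next
    case zero
    have "(\<Oplus>\<^bsub>T\<^esub>x\<in>Is. 0 \<odot>\<^bsub>T\<^esub> tt x) = (\<Oplus>\<^bsub>T\<^esub>x\<in>Is. \<zero>\<^bsub>T\<^esub>)"
      by (rule T.finsum_cong') (use TV.lmult_0 tt_closed in \<open>auto simp: class_ring_simps\<close>)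
    thus ?case by (intro exI[of _ "\<lambda>x. 0"]) simp
  next
    case (add X W)
    then obtain c d where "X = (\<Oplus>\<^bsub>T\<^esub>x\<in>Is. c x \<odot>\<^bsub>T\<^esub> tt x)" "W = (\<Oplus>\<^bsub>T\<^esub>x\<in>Is. d x \<odot>\<^bsub>T\<^esub> tt x)" by blast
    moreover have "(\<Oplus>\<^bsub>T\<^esub>x\<in>Is. (c x + d x) \<odot>\<^bsub>T\<^esub> tt x) = (\<Oplus>\<^bsub>T\<^esub>x\<in>Is. c x \<odot>\<^bsub>T\<^esub> tt x \<oplus>\<^bsub>T\<^esub> d x \<odot>\<^bsub>T\<^esub> tt x)"
      by (rule T.finsum_cong') (use TV.smult_l_distr TV.smult_closed tt_closed in auto)
    ultimately have "X \<oplus>\<^bsub>T\<^esub> W = (\<Oplus>\<^bsub>T\<^esub>x\<in>Is. (c x + d x) \<odot>\<^bsub>T\<^esub> tt x)"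
      using TV.smult_closed tt_closed by (simp add: T.finsum_addf Pi_def)
    thus ?case by (intro exI[of _ "\<lambda>x. c x + d x"])
  next
    case (smult a X)
    then obtain c where X: "X = (\<Oplus>\<^bsub>T\<^esub>x\<in>Is. c x \<odot>\<^bsub>T\<^esub> tt x)" by blast
    have "a \<odot>\<^bsub>T\<^esub> X = (\<Oplus>\<^bsub>T\<^esub>x\<in>Is. a \<odot>\<^bsub>T\<^esub> (c x \<odot>\<^bsub>T\<^esub> tt x))"
      unfolding X by (rule TV.finsum_smult) (use TV.smult_closed tt_closed in auto)
    also have "\<dots> = (\<Oplus>\<^bsub>T\<^esub>x\<in>Is. (a * c x) \<odot>\<^bsub>T\<^esub> tt x)"
      by (rule T.finsum_cong') (use TV.smult_assoc1 TV.smult_closed tt_closed in auto)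
    finally show ?case by (intro exI[of _ "\<lambda>x. a * c x"])
  qed
  obtain c d where cd: "X = (\<Oplus>\<^bsub>T\<^esub>x\<in>Is. c x \<odot>\<^bsub>T\<^esub> tt x)" "W = (\<Oplus>\<^bsub>T\<^esub>x\<in>Is. d x \<odot>\<^bsub>T\<^esub> tt x)"
    using exp X W by blast
  have "c x = d x" if "x \<in> Is" for x using e[OF that] co_sum[OF that] by (simp add: cd)
  thus ?thesis unfolding cd by (intro T.finsum_cong') (use TV.smult_closed tt_closed in auto)
qed

lemma co_V_mult:
  assumes i: "i \<in> {1..m}" and k: "k \<in> {1..m}" and l: "l \<le> n" and x: "x \<in> Is"
  shows "co x (t (infl i) \<otimes>\<^bsub>T\<^esub> t (st k l)) = (if snd x = l then of_nat (NN i k (fst x)) else 0)"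
  unfolding t_tensor[OF infl_module[OF i] st_module[OF k l]]
  by (subst co(2)[OF x]) (simp_all add: tensor_module(1)[OF infl_module[OF i] st_module[OF k l]] mul_V_tensor[OF i k l Is_Ix[OF x]])

subsection \<open>The involution\<close>

text \<open>The first component of the involution. Its character is \<chi>^(l-1) times that of the
  dual of V_k; this is the top of the module dual to M(k, l).\<close>

definition sp :: "nat \<Rightarrow> nat \<Rightarrow> nat" where "sp l k = (\<tau>i ^^ (l - 1)) (du k)"

abbreviation star where "star \<equiv> stable_star G \<chi> m V"

lemma star_eq: "star x = (sp (snd x) (fst x), snd x)"
  by (cases x) (simp add: stable_star_def sp_def)

lemma sp_spec:
  assumes k: "k \<in> {1..m}"
  shows "sp l k \<in> {1..m}" "mdim (V (sp l k)) = mdim (V k)" "h \<in> carrier G \<Longrightarrow> chr (sp l k) h = \<chi> h ^ (l - 1) * chr k (inv h)"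
  unfolding sp_def using taui_pow_spec[OF dual_spec(1)[OF k]] dual_spec[OF k] by simp_all

lemma sp_sp:
  assumes k: "k \<in> {1..m}"
  shows "sp l (sp l k) = k"
proof (rule chr_inj[OF sp_spec(1)[OF sp_spec(1)[OF k]] k])
  fix h assume h: "h \<in> carrier G"
  have "\<chi> h ^ (l - 1) * inverse (\<chi> h) ^ (l - 1) = 1" using chi_nonzero[OF h] by (simp flip: power_mult_distrib)
  thus "chr (sp l (sp l k)) h = chr k h"
    using h by (simp add: sp_spec[OF k] sp_spec(3)[OF sp_spec(1)[OF k]] chi_inv mult.assoc[symmetric])
qed

lemma star_Is: "x \<in> Is \<Longrightarrow> star x \<in> Is"
  using sp_spec(1)[of "fst x"] by (auto simp: star_eq Is_def)

lemma star_star: "x \<in> Is \<Longrightarrow> star (star x) = x"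
  using sp_sp[of "fst x"] by (auto simp: star_eq Is_def)

text \<open>Raising the length by one costs a factor \<chi> in the character. It can be supplied by
  the inverse of \<tau> outside or, since duality inverts the twist, by \<tau> inside.\<close>

lemma taui_sp:
  assumes k: "k \<in> {1..m}" and l: "0 < l"
  shows "\<tau>i (sp l k) = sp (l + 1) k" "sp l (\<tau> k) = sp (l + 1) k"
proof -
  have l': "\<chi> h ^ l = \<chi> h * \<chi> h ^ (l - 1)" for h using l by (simp flip: power_Suc)
  show "\<tau>i (sp l k) = sp (l + 1) k"
    by (rule chr_inj[OF taui_spec(1)[OF sp_spec(1)[OF k]] sp_spec(1)[OF k]])
      (simp add: taui_spec(5)[OF sp_spec(1)[OF k]] sp_spec(3)[OF k] l' del: One_nat_def)
  show "sp l (\<tau> k) = sp (l + 1) k"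
    by (rule chr_inj[OF sp_spec(1)[OF tau_spec(1)[OF k]] sp_spec(1)[OF k]])
      (simp add: sp_spec(3)[OF tau_spec(1)[OF k]] sp_spec(3)[OF k] tau_spec(3)[OF k] chi_inv l')
qed

lemma cip_inv: "cip (\<lambda>h. \<phi> (inv h)) (\<lambda>h. \<psi> (inv h)) = cip \<phi> \<psi>"
proof -
  have "(\<Sum>h\<in>carrier G. \<phi> (inv h) * \<psi> (inv (inv h))) = (\<Sum>h\<in>carrier G. \<phi> h * \<psi> (inv h))"
    by (rule sum.reindex_bij_witness[of _ "\<lambda>h. inv h" "\<lambda>h. inv h"]) auto
  thus ?thesis by (simp add: cip_def)
qed

text \<open>In the character formula the twists \<chi>^(l-1) and \<chi>^(1-l) cancel, and the
  remaining inverses disappear under the substitution of the inverse of h for h.\<close>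

lemma NN_sp:
  assumes i: "i \<in> {1..m}" and k: "k \<in> {1..m}" and s: "s \<in> {1..m}"
  shows "NN (du i) (sp l k) (sp l s) = NN i k s"
proof -
  have "of_nat (NN (du i) (sp l k) (sp l s)) = cip (\<lambda>h. chr i (inv h) * (\<chi> h ^ (l - 1) * chr k (inv h))) (\<lambda>h. \<chi> h ^ (l - 1) * chr s (inv h))"
    unfolding NN_cip[OF dual_spec(1)[OF i] sp_spec(1)[OF k] sp_spec(1)[OF s]]
    by (rule cip_cong) (simp_all add: dual_spec(3)[OF i] sp_spec(3)[OF k] sp_spec(3)[OF s])
  also have "\<dots> = cip (\<lambda>h. chr i (inv h) * chr k (inv h)) (\<lambda>h. chr s (inv h))"
  proof -
    have "\<chi> h ^ (l - 1) * inverse (\<chi> h) ^ (l - 1) = 1" if "h \<in> carrier G" for h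
      using chi_nonzero[OF that] by (simp flip: power_mult_distrib)
    moreover have "a * (c * b) * (d * x) = (c * d) * (a * b * x)" for a b c d x :: 'k by (simp add: mult_ac)
    ultimately have "chr i (inv h) * (\<chi> h ^ (l - 1) * chr k (inv h)) * (\<chi> (inv h) ^ (l - 1) * x) = chr i (inv h) * chr k (inv h) * x"
      if "h \<in> carrier G" for h x using that by (simp only: chi_inv mult_1)
    thus ?thesis unfolding cip_def by (intro arg_cong2[where f = "(*)", OF refl sum.cong[OF refl]])
  qed
  also have "\<dots> = of_nat (NN i k s)" unfolding NN_cip[OF assms] by (rule cip_inv)
  finally show ?thesis by (simp only: of_nat_eq_iff)
qed

definition \<sigma> :: "('k, 'g) stable_elt \<Rightarrow> ('k, 'g) stable_elt" where
  "\<sigma> X = (\<Oplus>\<^bsub>T\<^esub>x\<in>Is. co x X \<odot>\<^bsub>T\<^esub> tt (star x))"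

lemma sigma_closed: "\<sigma> X \<in> carrier T"
  unfolding \<sigma>_def by (rule tt_sum_closed) (intro tt_closed star_Is)

lemma co_sigma: "y \<in> Is \<Longrightarrow> co y (\<sigma> X) = co (star y) X"
proof -
  assume y: "y \<in> Is"
  have "(y = star x) = (x = star y)" if "x \<in> Is" for x using star_star[OF that] star_star[OF y] by auto
  thus ?thesis unfolding \<sigma>_def
    using y star_Is[OF y] by (simp add: lin_finsum[OF co(1) tt_closed[OF star_Is]] co_tt star_Is if_distrib cong: if_cong)
qed

lemma sigma_add: "X \<in> carrier T \<Longrightarrow> W \<in> carrier T \<Longrightarrow> \<sigma> (X \<oplus>\<^bsub>T\<^esub> W) = \<sigma> X \<oplus>\<^bsub>T\<^esub> \<sigma> W"
  by (rule T_eqI) (simp_all add: sigma_closed co_sigma star_Is linD(1)[OF co(1)])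

lemma sigma_smult: "X \<in> carrier T \<Longrightarrow> \<sigma> (c \<odot>\<^bsub>T\<^esub> X) = c \<odot>\<^bsub>T\<^esub> \<sigma> X"
  using TV.smult_closed[of c "\<sigma> X"] 
  by (intro T_eqI) (simp_all add: sigma_closed co_sigma star_Is linD(2)[OF co(1)])

lemma sigma_zero: "\<sigma> \<zero>\<^bsub>T\<^esub> = \<zero>\<^bsub>T\<^esub>"
  by (rule T_eqI) (simp_all add: sigma_closed co_sigma star_Is lin_zero[OF co(1)])

text \<open>Both sides vanish at l = 0 and l = n; these lengths are included because the recursion
  for z reaches them.\<close>

lemma sigma_st:
  assumes k: "k \<in> {1..m}" and l: "l \<le> n"
  shows "\<sigma> (t (st k l)) = t (st (sp l k) l)"
proof (rule T_eqI)
  note s = sp_spec(1)[OF k]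
  show "t (st (sp l k) l) \<in> carrier T" by (rule t_closed[OF st_module[OF s l]])
  fix y assume y: "y \<in> Is"
  have "star y = (k, l) \<longleftrightarrow> y = (sp l k, l)"
    using star_star[OF y] sp_sp[OF k] by (auto simp: star_eq)
  thus "co y (\<sigma> (t (st k l))) = co y (t (st (sp l k) l))"
    unfolding co_sigma[OF y]
    by (simp add: co(2)[OF y st_module[OF s l]] co(2)[OF star_Is[OF y] st_module[OF k l]]
        mul_string[OF s l Is_Ix[OF y]] mul_string[OF k l Is_Ix[OF star_Is[OF y]]])
qed (rule sigma_closed)

lemma sigma_V:
  assumes i: "i \<in> {1..m}" and X: "X \<in> carrier T"
  shows "\<sigma> (t (infl i) \<otimes>\<^bsub>T\<^esub> X) = t (infl (du i)) \<otimes>\<^bsub>T\<^esub> \<sigma> X"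
proof -
  note V = t_closed[OF infl_module[OF i]] t_closed[OF infl_module[OF dual_spec(1)[OF i]]]
  show ?thesis using X
  proof (induction rule: T_induct)
    case (tt x)
    then obtain k l where x: "x = (k, l)" and k: "k \<in> {1..m}" and l: "l \<le> n" by (cases x) (auto simp: Is_def)
    note s = sp_spec(1)[OF k]
    have tc: "t (st (sp l k) l) \<in> carrier T" by (rule t_closed[OF st_module[OF s l]])
    show ?case unfolding x Mx_st sigma_st[OF k l]
    proof (rule T_eqI[OF sigma_closed T.m_closed[OF V(2) tc]])
      fix y assume y: "y \<in> Is"
      have fy: "fst y \<in> {1..m}" using y by (auto simp: Is_def)
      have "NN (du i) (sp l k) (fst y) = NN i k (sp l (fst y))"
        using NN_sp[OF i k sp_spec(1)[OF fy], of l l] by (simp add: sp_sp[OF fy])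
      thus "co y (\<sigma> (t (infl i) \<otimes>\<^bsub>T\<^esub> t (st k l))) = co y (t (infl (du i)) \<otimes>\<^bsub>T\<^esub> t (st (sp l k) l))"
        unfolding co_sigma[OF y] co_V_mult[OF i k l star_Is[OF y]] co_V_mult[OF dual_spec(1)[OF i] s l y]
        by (auto simp: star_eq)
    qed
  qed (simp_all add: V sigma_zero sigma_add sigma_smult sigma_closed T.r_distr T_smult_mult TV.smult_closed)
qed

text \<open>The image of z is [V_\<chi>] z, with V_\<chi> the one-dimensional module of character
  \<chi>. Multiplying by it undoes one application of \<tau>, and so the image of the recursion at
  (k, l) matches, summand by summand, the recursion at the image of (k, l).\<close>

lemma sigma_z:
  assumes X: "X \<in> carrier T"
  shows "\<sigma> (zt \<otimes>\<^bsub>T\<^esub> X) = \<sigma> zt \<otimes>\<^bsub>T\<^esub> \<sigma> X"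
proof -
  note zc = t_closed[OF z_module]
  \<comment> \<open>The module V_i has character \<chi>, so tensoring with it inverts \<tau> on
    labels.\<close>
  define i where "i = \<tau>i 1"
  have i: "i \<in> {1..m}" unfolding i_def by (rule taui_spec(1)[OF one_in_I])
  note Vc = t_closed[OF infl_module[OF i]]
  have NNi: "NN i k r = (if r = \<tau>i k then 1 else 0)" if k: "k \<in> {1..m}" and r: "r \<in> {1..m}" for k r
  proof -
    have "of_nat (NN i k r) = cip (chr (\<tau>i k)) (chr r)"
      unfolding NN_cip[OF i k r]
      by (rule cip_cong) (simp_all add: i_def taui_spec(5)[OF one_in_I] taui_spec(5)[OF k] chr_1 del: One_nat_def)
    hence "of_nat (NN i k r) = (of_nat (if r = \<tau>i k then 1 else 0) :: 'k)"
      using chr_orthonormal[OF taui_spec(1)[OF k] r] by auto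
    thus ?thesis by (simp only: of_nat_eq_iff)
  qed
  have Vst: "t (infl i) \<otimes>\<^bsub>T\<^esub> t (st k l) = t (st (\<tau>i k) l)" if "k \<in> {1..m}" "l \<le> n" for k l
    by (rule infl_mult[OF i that(1) taui_spec(1)[OF that(1)] that(2) NNi[OF that(1)]])
  have sz: "\<sigma> zt = t (infl i) \<otimes>\<^bsub>T\<^esub> zt"
  proof -
    have "sp 2 1 = \<tau>i (sp 1 1)" using taui_sp(1)[OF one_in_I, of 1] by (simp add: numeral_2_eq_2)
    moreover have "sp 1 1 = 1"
      by (rule chr_inj[OF sp_spec(1)[OF one_in_I] one_in_I]) (simp only: sp_spec(3)[OF one_in_I] chr_1 inv_closed, simp)
    ultimately show ?thesis using sigma_st[OF one_in_I n_ge_2] Vst[OF one_in_I n_ge_2] by (simp add: Z_def)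
  qed
  show ?thesis using X
  proof (induction rule: T_induct)
    case (tt x)
    then obtain k l where x: "x = (k, l)" and k: "k \<in> {1..m}" and l: "0 < l" "l < n" by (cases x) (auto simp: Is_def)
    note s = sp_spec(1)[OF k] and tk = tau_spec(1)[OF k]
    note c = t_closed[OF st_module]
    have l1: "l \<le> n" "l + 1 \<le> n" "l - 1 \<le> n" using l by auto
    have ck: "t (st k (l + 1)) \<in> carrier T" "t (st (\<tau> k) (l - 1)) \<in> carrier T"
      by (rule c[OF k l1(2)], rule c[OF tk l1(3)])
    have cs: "t (st (sp l k) l) \<in> carrier T" "t (st (sp l k) (l + 1)) \<in> carrier T" "t (st (\<tau> (sp l k)) (l - 1)) \<in> carrier T"
      by (rule c[OF s l1(1)], rule c[OF s l1(2)], rule c[OF tau_spec(1)[OF s] l1(3)])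
    \<comment> \<open>For l = 1 both strings have length 0 and class 0; for larger l the labels
      agree by \<open>taui_sp\<close> at l - 1.\<close>
    have e: "t (st (sp (l - 1) (\<tau> k)) (l - 1)) = t (st (sp l k) (l - 1))"
    proof (cases "l = 1")
      case True
      thus ?thesis using t_st_0 sp_spec(1)[OF tk] s by simp
    next
      case False
      thus ?thesis using taui_sp(2)[OF k, of "l - 1"] l by simp
    qed
    have "\<sigma> (zt \<otimes>\<^bsub>T\<^esub> t (st k l)) = t (st (\<tau>i (sp l k)) (l + 1)) \<oplus>\<^bsub>T\<^esub> t (st (sp l k) (l - 1))"
      unfolding zt_mult[OF k l] sigma_add[OF ck] sigma_st[OF k l1(2)] sigma_st[OF tk l1(3)] taui_sp(1)[OF k l(1)] e ..
    also have "\<dots> = t (infl i) \<otimes>\<^bsub>T\<^esub> (t (st (sp l k) (l + 1)) \<oplus>\<^bsub>T\<^esub> t (st (\<tau> (sp l k)) (l - 1)))"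
      unfolding T.r_distr[OF cs(2,3) Vc] Vst[OF s l1(2)] Vst[OF tau_spec(1)[OF s] l1(3)] taui_spec(3)[OF s] ..
    also have "\<dots> = \<sigma> zt \<otimes>\<^bsub>T\<^esub> \<sigma> (t (st k l))"
      unfolding sz sigma_st[OF k l1(1)] zt_mult[OF s l, symmetric] by (rule T.m_assoc[OF Vc zc cs(1), symmetric])
    finally show ?case unfolding x Mx_st .
  qed (simp_all add: zc sigma_zero sigma_add sigma_smult sigma_closed T.r_distr T_smult_mult TV.smult_closed)
qed

lemma sigma_mult:
  assumes X: "X \<in> carrier T" and W: "W \<in> carrier T"
  shows "\<sigma> (X \<otimes>\<^bsub>T\<^esub> W) = \<sigma> X \<otimes>\<^bsub>T\<^esub> \<sigma> W"
  using X
proof (induction rule: T_gen_induct)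
  case (base k)
  have "sp 1 k = du k" by (simp add: sp_def)
  hence "\<sigma> (t (infl k)) = t (infl (du k))"
    using t_infl[OF base] t_infl[OF dual_spec(1)[OF base]] sigma_st[OF base, of 1] by simp
  thus ?case using sigma_V[OF base W] by simp
next
  case (z X)
  note zc = t_closed[OF z_module]
  show ?case using z W zc by (simp add: T.m_assoc sigma_z sigma_closed)
qed (simp_all add: W sigma_zero sigma_add sigma_smult sigma_closed T.l_distr T_smult_mult TV.smult_closed)

lemma co_star:
  assumes "x \<in> Is" "y \<in> Is" "k \<in> Is"
  shows "co (star k) (tt (star y) \<otimes>\<^bsub>T\<^esub> tt (star x)) = co k (tt x \<otimes>\<^bsub>T\<^esub> tt y)"
proof -
  have s: "\<sigma> (tt w) = tt (star w)" if "w \<in> Is" for w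
    using sigma_st[of "fst w" "snd w"] that by (auto simp: Is_def Mx_def star_eq)
  have "tt (star y) \<otimes>\<^bsub>T\<^esub> tt (star x) = \<sigma> (tt x \<otimes>\<^bsub>T\<^esub> tt y)"
    using sigma_mult[OF tt_closed tt_closed] s assms T_comm[OF tt_closed tt_closed] star_Is by simp
  thus ?thesis using co_sigma[OF star_Is[OF assms(3)]] star_star[OF assms(3)] by simp
qed

text \<open>The induction step uses
  \<open>M(i, j + 2) M(k, l) = M(i, j + 1) (z M(k, l)) - M(\<tau>(i), j) M(k, l)\<close>.\<close>

lemma co_pairing_aux:
  "i \<in> {1..m} \<Longrightarrow> k \<in> {1..m} \<Longrightarrow> j < n \<Longrightarrow> l \<le> n \<Longrightarrow>
    co (1, 1) (t (st i j) \<otimes>\<^bsub>T\<^esub> t (st k l)) = (if 0 < j \<and> j = l \<and> k = sp j i then 1 else 0)"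
proof (induction j arbitrary: i k l rule: induct_nat_012)
  case 0
  have "(1, 1) \<in> Is" using one_in_I n_ge_2 by (auto simp: Is_def)
  thus ?case using t_st_0[OF 0(1)] t_closed[OF st_module[OF 0(2,4)]] lin_zero[OF co(1)] by simp
next
  case 1
  have I: "(1, 1) \<in> Is" using one_in_I n_ge_2 by (auto simp: Is_def)
  have "NN i k 1 = (if k = du i then 1 else 0)"
  proof -
    have "of_nat (NN i k 1) = cip (chr k) (chr (du i))"
      unfolding NN_cip[OF 1(1,2) one_in_I] cip_def
      by (simp add: chr_1 dual_spec(3)[OF 1(1)] mult.commute del: One_nat_def cong: sum.cong)
    hence "of_nat (NN i k 1) = (of_nat (if k = du i then 1 else 0) :: 'k)"
      using chr_orthonormal[OF 1(2) dual_spec(1)[OF 1(1)]] by simp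
    thus ?thesis by (simp only: of_nat_eq_iff)
  qed
  thus ?case using co_V_mult[OF 1(1,2,4) I] t_infl[OF 1(1)] by (auto simp: sp_def)
next
  case (ge2 j)
  note i = ge2.prems(1) and k = ge2.prems(2) and l = ge2.prems(4)
  have I: "(1, 1) \<in> Is" using one_in_I n_ge_2 by (auto simp: Is_def)
  note zc = t_closed[OF z_module] and c = t_closed[OF st_module]
  note L = linD(1)[OF co(1)[OF I]]
  have j: "0 < Suc j" "Suc j < n" "Suc j \<le> n" "Suc (Suc j) \<le> n" "j \<le> n" "j < n" using ge2.prems(3) by auto
  note ci = c[OF i j(3)] c[OF i j(4)] c[OF tau_spec(1)[OF i] j(5)]
  have ckl: "t (st k l) \<in> carrier T" by (rule c[OF k l])
  have zi: "zt \<otimes>\<^bsub>T\<^esub> t (st i (Suc j)) = t (st i (Suc (Suc j))) \<oplus>\<^bsub>T\<^esub> t (st (\<tau> i) j)"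
    using zt_mult[OF i j(1,2)] by simp
  have A: "co (1, 1) (t (st i (Suc (Suc j))) \<otimes>\<^bsub>T\<^esub> t (st k l)) =
    co (1, 1) (t (st i (Suc j)) \<otimes>\<^bsub>T\<^esub> (zt \<otimes>\<^bsub>T\<^esub> t (st k l))) - co (1, 1) (t (st (\<tau> i) j) \<otimes>\<^bsub>T\<^esub> t (st k l))"
  proof -
    have "t (st i (Suc j)) \<otimes>\<^bsub>T\<^esub> (zt \<otimes>\<^bsub>T\<^esub> t (st k l)) = (zt \<otimes>\<^bsub>T\<^esub> t (st i (Suc j))) \<otimes>\<^bsub>T\<^esub> t (st k l)"
      using T_comm[OF zc ci(1)] zc ci ckl by (simp add: T.m_assoc)
    also have "\<dots> = t (st i (Suc (Suc j))) \<otimes>\<^bsub>T\<^esub> t (st k l) \<oplus>\<^bsub>T\<^esub> t (st (\<tau> i) j) \<otimes>\<^bsub>T\<^esub> t (st k l)"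
      unfolding zi using ci ckl by (simp add: T.l_distr)
    finally show ?thesis using L[of "t (st i (Suc (Suc j))) \<otimes>\<^bsub>T\<^esub> t (st k l)" "t (st (\<tau> i) j) \<otimes>\<^bsub>T\<^esub> t (st k l)"] ci ckl by simp
  qed
  have B: "co (1, 1) (t (st (\<tau> i) j) \<otimes>\<^bsub>T\<^esub> t (st k l)) = (if 0 < j \<and> j = l \<and> k = sp j (\<tau> i) then 1 else 0)"
    by (rule ge2.IH(1)[OF tau_spec(1)[OF i] k j(6) l])
  consider "l = 0" | "l = n" | "0 < l" "l < n" using l by linarith
  thus ?case
  proof cases
    case 1
    thus ?thesis using t_st_0[OF k] ci lin_zero[OF co(1)[OF I]] by simp
  next
    case 2
    thus ?thesis using t_st_n[OF k] ci lin_zero[OF co(1)[OF I]] ge2.prems(3) by simp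
  next
    case 3
    note ck = c[OF k, of "l + 1"] c[OF tau_spec(1)[OF k], of "l - 1"]
    have "co (1, 1) (t (st i (Suc j)) \<otimes>\<^bsub>T\<^esub> (zt \<otimes>\<^bsub>T\<^esub> t (st k l))) =
      co (1, 1) (t (st i (Suc j)) \<otimes>\<^bsub>T\<^esub> t (st k (l + 1))) + co (1, 1) (t (st i (Suc j)) \<otimes>\<^bsub>T\<^esub> t (st (\<tau> k) (l - 1)))"
      unfolding zt_mult[OF k 3] using ck ci 3 L by (simp add: T.r_distr)
    also have "\<dots> = (if Suc j = l + 1 \<and> k = sp (Suc j) i then 1 else 0) + (if Suc j = l - 1 \<and> \<tau> k = sp (Suc j) i then 1 else 0)"
      using ge2.IH(2)[OF i k j(2), of "l + 1"] ge2.IH(2)[OF i tau_spec(1)[OF k] j(2), of "l - 1"] 3 by simp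
    finally have C: "co (1, 1) (t (st i (Suc j)) \<otimes>\<^bsub>T\<^esub> (zt \<otimes>\<^bsub>T\<^esub> t (st k l))) = \<dots>" .
    have "\<tau>i (sp (Suc j) i) = sp (Suc (Suc j)) i" using taui_sp(1)[OF i j(1)] unfolding Suc_eq_plus1 .
    hence "\<tau> k = sp (Suc j) i \<longleftrightarrow> k = sp (Suc (Suc j)) i"
      using taui_spec(2)[OF sp_spec(1)[OF i], of "Suc j"] taui_spec(3)[OF k] by metis
    moreover have "0 < j \<Longrightarrow> sp j (\<tau> i) = sp (Suc j) i" using taui_sp(2)[OF i] by simp
    \<comment> \<open>The term of C with l = j cancels against B, since l > 0 makes the condition 0
      < j automatic there; the term with l = j + 2 remains.\<close>
    ultimately show ?thesis unfolding A B C using 3 by (cases "k = sp (Suc (Suc j)) i"; cases "k = sp (Suc j) i") auto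
  qed
qed

lemma co_pairing:
  assumes "x \<in> Is" "y \<in> Is"
  shows "co (1, 1) (tt x \<otimes>\<^bsub>T\<^esub> tt y) = (if x = star y then 1 else 0)"
proof -
  have "co (1, 1) (tt x \<otimes>\<^bsub>T\<^esub> tt y) = (if y = star x then 1 else 0)"
  proof -
    obtain i j k l where xy: "x = (i, j)" "y = (k, l)" by (cases x, cases y)
    have "i \<in> {1..m}" "k \<in> {1..m}" "j < n" "l \<le> n" "0 < j" using assms n_pos by (auto simp: xy Is_def)
    note ikjl = this
    show ?thesis
      unfolding xy Mx_st star_eq fst_conv snd_conv prod.inject co_pairing_aux[OF ikjl(1-4)] using ikjl(5) by auto
  qed
  moreover have "y = star x \<longleftrightarrow> x = star y" using star_star[OF assms(1)] star_star[OF assms(2)] by metis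
  ultimately show ?thesis by simp
qed


subsection \<open>The morphism to the complex numbers\<close>

text \<open>The closed form of F_l(1, 2 cos(\<pi>/n)), which is the Chebyshev polynomial of the
  second kind of degree l - 1 at cos(\<pi>/n) for l > 0. Its zero at l = n matches the vanishing of
  the stable class of a string of length n.\<close>

definition Fs :: "nat \<Rightarrow> complex" where
  "Fs l = of_real (sin (real l * (pi / real n)) / sin (pi / real n))"

lemma sin_pos: "0 < l \<Longrightarrow> l < n \<Longrightarrow> 0 < sin (real l * (pi / real n))"
  by (rule sin_gt_zero) (use n_pos in \<open>auto simp: field_simps\<close>)

lemma Fs_0: "Fs 0 = 0" and Fs_n: "Fs n = 0" and Fs_1: "Fs 1 = 1"
  using sin_pos[of 1] n_ge_2 by (simp_all add: Fs_def)

text \<open>The addition theorem sin((l+1) a) + sin((l-1) a) = 2 cos(a) sin(l a), divided by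
  sin(a).\<close>

lemma Fs_rec: "0 < l \<Longrightarrow> Fs (l + 1) = of_real (2 * cos (pi / real n)) * Fs l - Fs (l - 1)"
proof -
  assume l: "0 < l"
  let ?a = "pi / real n"
  have "sin (real (l + 1) * ?a) + sin (real (l - 1) * ?a) = 2 * cos ?a * sin (real l * ?a)"
  proof -
    have "real (l + 1) * ?a = real l * ?a + ?a" "real (l - 1) * ?a = real l * ?a - ?a"
      using l by (simp_all add: of_nat_diff algebra_simps diff_divide_distrib add_divide_distrib)
    thus ?thesis by (simp only: sin_add sin_diff) simp
  qed
  hence "sin (real (l + 1) * ?a) / sin ?a = 2 * cos ?a * (sin (real l * ?a) / sin ?a) - sin (real (l - 1) * ?a) / sin ?a"
    by (simp add: field_simps flip: add_divide_distrib)
  thus ?thesis unfolding Fs_def by (simp only: of_real_mult of_real_diff)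
qed

lemma Fs_nonzero: "0 < l \<Longrightarrow> l < n \<Longrightarrow> Fs l \<noteq> 0"
  using sin_pos[of l] sin_pos[of 1] n_ge_2 by (simp add: Fs_def)

definition wt :: "nat \<times> nat \<Rightarrow> complex" where "wt x = of_nat (mdim (V (fst x))) * Fs (snd x)"

lemma wt_nonzero: "x \<in> Is \<Longrightarrow> wt x \<noteq> 0"
proof -
  assume "x \<in> Is"
  hence "fst x \<in> {1..m}" "0 < snd x" "snd x < n" using n_ge_2 by (auto simp: Is_def)
  thus ?thesis using V_dim_pos[of "fst x"] Fs_nonzero by (simp add: wt_def)
qed

lemma wt_star: "x \<in> Is \<Longrightarrow> wt (star x) = wt x"
  using sp_spec(2)[of "fst x"] by (auto simp: wt_def star_eq Is_def)

definition eps0 :: "('k, 'g) stable_elt \<Rightarrow> complex" where "eps0 X = (\<Sum>x\<in>Is. co x X * wt x)"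

lemma eps0_lin: "lin eps0"
  unfolding lin_def eps0_def
  by (auto simp: linD(1)[OF co(1)] linD(2)[OF co(1)] distrib_right sum.distrib sum_distrib_left mult.assoc)

text \<open>Valid at the lengths 0 and n too, where both sides are 0; this lets the recursion be
  used at the ends of the range.\<close>

lemma eps0_st:
  assumes k: "k \<in> {1..m}" and l: "l \<le> n"
  shows "eps0 (t (st k l)) = wt (k, l)"
proof -
  have "eps0 (t (st k l)) = (\<Sum>x\<in>Is. if x = (k, l) then wt x else 0)"
    unfolding eps0_def
    by (rule sum.cong[OF refl]) (simp add: co(2)[OF _ st_module[OF k l]] mul_string[OF k l Is_Ix])
  also have "\<dots> = (if (k, l) \<in> Is then wt (k, l) else 0)" by simp
  also have "\<dots> = wt (k, l)"
  proof (cases "0 < l \<and> l < n")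
    case True
    hence "(k, l) \<in> Is" using k by (auto simp: Is_def)
    thus ?thesis by simp
  next
    case False
    hence "l = 0 \<or> l = n" using l by auto
    thus ?thesis by (auto simp: wt_def Fs_0 Fs_n)
  qed
  finally show ?thesis .
qed

text \<open>Tensoring with V_i keeps string lengths, so the weight \<open>Fs l\<close> factors out
  and what remains is the dimension count for V_i \<otimes> V_k.\<close>

lemma eps0_V:
  assumes i: "i \<in> {1..m}" and X: "X \<in> carrier T"
  shows "eps0 (t (infl i) \<otimes>\<^bsub>T\<^esub> X) = of_nat (mdim (V i)) * eps0 X"
proof -
  note Vc = t_closed[OF infl_module[OF i]]
  show ?thesis using X
  proof (induction rule: T_induct)
    case (tt x)
    then obtain k l where x: "x = (k, l)" and k: "k \<in> {1..m}" and l: "l \<in> {1..n-1}" by (cases x) (auto simp: Is_def)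
    hence ln: "l \<le> n" by auto
    have "mdim (V i) * mdim (V k) = (\<Sum>s\<in>{1..m}. NN i k s * mdim (V s))"
    proof -
      have n1: "1 \<le> n" by simp
      note im = infl_module[OF i] and sm = st_module[OF k n1]
      note tm = tensor_module(1,2)[OF im sm]
      have "mdim (V i) * mdim (V k) = mdim (tens (infl i) (st k 1))"
        unfolding tm(2) by (simp add: inflate_module(2)[OF V_module[OF i]] string_module(2)[OF V_module[OF k]])
      also have "\<dots> = (\<Sum>x\<in>Ix. mul (tens (infl i) (st k 1)) x * mdim (Mx x))" by (rule dim_mul[OF tm(1)])
      also have "\<dots> = (\<Sum>x\<in>Ix. if snd x = 1 then NN i k (fst x) * mdim (V (fst x)) else 0)"
        by (rule sum.cong[OF refl]) (simp add: mul_V_tensor[OF i k n1] Mx_dim del: One_nat_def)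
      also have "\<dots> = (\<Sum>s\<in>{1..m}. \<Sum>j\<in>{1..n}. if j = 1 then NN i k s * mdim (V s) else 0)"
        unfolding Ix_def sum.cartesian_product by (rule sum.cong[OF refl]) auto
      finally show ?thesis by simp
    qed
    hence d: "of_nat (mdim (V i)) * of_nat (mdim (V k)) = (\<Sum>s\<in>{1..m}. of_nat (NN i k s) * of_nat (mdim (V s)) :: complex)"
      by (metis (no_types, lifting) of_nat_mult of_nat_sum sum.cong)
    have "eps0 (t (infl i) \<otimes>\<^bsub>T\<^esub> t (st k l)) = (\<Sum>x\<in>Is. (if snd x = l then of_nat (NN i k (fst x)) else 0) * wt x)"
      unfolding eps0_def by (rule sum.cong[OF refl]) (simp add: co_V_mult[OF i k ln])
    also have "\<dots> = (\<Sum>s\<in>{1..m}. \<Sum>j\<in>{1..n-1}. if j = l then of_nat (NN i k s) * of_nat (mdim (V s)) * Fs l else 0)"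
      unfolding Is_def sum.cartesian_product by (rule sum.cong[OF refl]) (auto simp: wt_def)
    also have "\<dots> = (\<Sum>s\<in>{1..m}. of_nat (NN i k s) * of_nat (mdim (V s))) * Fs l"
      unfolding sum_distrib_right using l by (intro sum.cong refl) simp
    finally show ?case unfolding x Mx_st eps0_st[OF k ln] d[symmetric] by (simp add: wt_def)
  qed (simp_all add: Vc T.r_distr T_smult_mult TV.smult_closed lin_zero[OF eps0_lin] linD[OF eps0_lin] distrib_left)
qed

text \<open>The recursion for z becomes \<open>Fs_rec\<close>, as \<tau> preserves
  dimensions.\<close>

lemma eps0_z:
  assumes X: "X \<in> carrier T"
  shows "eps0 (zt \<otimes>\<^bsub>T\<^esub> X) = of_real (2 * cos (pi / real n)) * eps0 X"
proof -
  note zc = t_closed[OF z_module]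
  show ?thesis using X
  proof (induction rule: T_induct)
    case (tt x)
    then obtain k l where x: "x = (k, l)" and k: "k \<in> {1..m}" and l: "0 < l" "l < n" by (cases x) (auto simp: Is_def)
    note tk = tau_spec(1)[OF k]
    have l1: "l \<le> n" "l + 1 \<le> n" "l - 1 \<le> n" using l by auto
    have "eps0 (zt \<otimes>\<^bsub>T\<^esub> t (st k l)) = wt (k, l + 1) + wt (\<tau> k, l - 1)"
      unfolding zt_mult[OF k l] linD(1)[OF eps0_lin t_closed[OF st_module[OF k l1(2)]] t_closed[OF st_module[OF tk l1(3)]]]
        eps0_st[OF k l1(2)] eps0_st[OF tk l1(3)] ..
    also have "\<dots> = of_real (2 * cos (pi / real n)) * wt (k, l)"
      unfolding wt_def fst_conv snd_conv tau_spec(2)[OF k] Fs_rec[OF l(1)] by (simp add: algebra_simps)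
    finally show ?case unfolding x Mx_st eps0_st[OF k l1(1)] .
  qed (simp_all add: zc T.r_distr T_smult_mult TV.smult_closed lin_zero[OF eps0_lin] linD[OF eps0_lin] distrib_left)
qed

lemma eps0_infl: "k \<in> {1..m} \<Longrightarrow> eps0 (t (infl k)) = of_nat (mdim (V k))"
  using eps0_st[of k 1] Fs_1 by (simp add: t_infl wt_def)

lemma eps0_one: "eps0 \<one>\<^bsub>T\<^esub> = 1"
  unfolding t_one eps0_infl[OF one_in_I] V1(1) by simp

lemma eps0_zt: "eps0 zt = of_real (2 * cos (pi / real n))"
  using eps0_z[OF T.one_closed] t_closed[OF z_module] by (simp add: eps0_one)

lemma eps0_mult:
  assumes X: "X \<in> carrier T" and W: "W \<in> carrier T"
  shows "eps0 (X \<otimes>\<^bsub>T\<^esub> W) = eps0 X * eps0 W"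
  using X
proof (induction rule: T_gen_induct)
  case (z X)
  note zc = t_closed[OF z_module]
  have "eps0 (zt \<otimes>\<^bsub>T\<^esub> X \<otimes>\<^bsub>T\<^esub> W) = of_real (2 * cos (pi / real n)) * eps0 (X \<otimes>\<^bsub>T\<^esub> W)"
    using eps0_z[of "X \<otimes>\<^bsub>T\<^esub> W"] z W zc by (simp add: T.m_assoc)
  thus ?case using z eps0_z[OF z(1)] by simp
qed (simp_all add: W eps0_V[OF _ W] eps0_infl T.l_distr T_smult_mult lin_zero[OF eps0_lin] linD[OF eps0_lin] distrib_right)

lemma eps0_stable: "is_stable_eps G \<chi> g n m V eps0"
  unfolding is_stable_eps_def algebra_hom_to_field_def Ring.ring_hom_def
  using eps0_mult eps0_one linD[OF eps0_lin] eps0_infl eps0_zt[unfolded Z_def] by simp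

text \<open>The prescribed values on V_i and z determine \<epsilon> on every string through the
  recursion, so the result applies to any \<epsilon> with these values and not only to
  \<open>eps0\<close>.\<close>

lemma stable_eps_st:
  assumes e: "is_stable_eps G \<chi> g n m V \<epsilon>" and k: "k \<in> {1..m}" and l: "l \<le> n"
  shows "\<epsilon> (t (st k l)) = wt (k, l)"
proof -
  have hom: "\<epsilon> (X \<otimes>\<^bsub>T\<^esub> W) = \<epsilon> X * \<epsilon> W" "\<epsilon> (X \<oplus>\<^bsub>T\<^esub> W) = \<epsilon> X + \<epsilon> W"
    if "X \<in> carrier T" "W \<in> carrier T" for X W
    using e that unfolding is_stable_eps_def algebra_hom_to_field_def Ring.ring_hom_def by auto
  have V: "\<epsilon> (t (infl k)) = of_nat (mdim (V k))" if "k \<in> {1..m}" for k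
    using e that unfolding is_stable_eps_def by blast
  have z: "\<epsilon> zt = of_real (2 * cos (pi / real n))" using e unfolding is_stable_eps_def Z_def by blast
  note zc = t_closed[OF z_module]
  from k l show ?thesis
  proof (induction l arbitrary: k rule: induct_nat_012)
    case 0
    have "\<epsilon> \<zero>\<^bsub>T\<^esub> = 0" using hom(2)[OF T.zero_closed T.zero_closed] by simp
    thus ?case using t_st_0[OF 0(1)] by (simp add: wt_def Fs_0)
  next
    case 1
    thus ?case using V[OF 1(1)] t_infl[OF 1(1)] Fs_1 by (simp add: wt_def)
  next
    case (ge2 l)
    note k = ge2.prems(1) and tk = tau_spec(1)[OF ge2.prems(1)]
    have l: "0 < Suc l" "Suc l < n" "Suc l \<le> n" "l \<le> n" "Suc (Suc l) \<le> n" using ge2.prems(2) by auto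
    note c = t_closed[OF st_module[OF k l(5)]] t_closed[OF st_module[OF k l(3)]] t_closed[OF st_module[OF tk l(4)]]
    have "\<epsilon> zt * \<epsilon> (t (st k (Suc l))) = \<epsilon> (t (st k (Suc (Suc l)))) + \<epsilon> (t (st (\<tau> k) l))"
      using hom(1)[OF zc c(2)] hom(2)[OF c(1,3)] zt_mult[OF k l(1,2)] by simp
    moreover have "Fs (Suc (Suc l)) = of_real (2 * cos (pi / real n)) * Fs (Suc l) - Fs l"
      using Fs_rec[of "Suc l"] by simp
    ultimately show ?case
      unfolding ge2.IH(2)[OF k l(3)] ge2.IH(1)[OF tk l(4)] z
      by (simp only: wt_def tau_spec(2)[OF k] fst_conv snd_conv) (simp add: algebra_simps)
  qed
qed

lemma stable_group_like:
  assumes e: "is_stable_eps G \<chi> g n m V \<epsilon>"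
  shows "group_like_algebra class_ring T \<epsilon> Is (stable_basis G \<chi> g n V \<epsilon>) star (1, 1)"
proof -
  let ?b = "stable_basis G \<chi> g n V \<epsilon>"
  have etx: "\<epsilon> (tt x) = wt x" if "x \<in> Is" for x
    using stable_eps_st[OF e, of "fst x" "snd x"] that by (auto simp: Is_def Mx_def)
  have b: "?b x = wt x \<odot>\<^bsub>T\<^esub> tt x" if "x \<in> Is" for x
    using etx[OF that] by (cases x) (simp add: stable_basis_def Mx_def)
  have bc: "?b x \<in> carrier T" if "x \<in> Is" for x
    unfolding b[OF that] using TV.smult_closed tt_closed[OF that] by simp
  have hom: "algebra_hom_to_field class_ring T \<epsilon>" using e unfolding is_stable_eps_def by blast
  hence elin: "lin \<epsilon>" unfolding lin_def algebra_hom_to_field_def Ring.ring_hom_def by auto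
  have eb: "\<epsilon> (?b x) = wt x * wt x" if "x \<in> Is" for x
    unfolding b[OF that] linD(2)[OF elin tt_closed[OF that]] etx[OF that] ..
  have co_b: "co y (?b x) = (if y = x then wt x else 0)" if "x \<in> Is" "y \<in> Is" for x y
    unfolding b[OF that(1)] linD(2)[OF co(1)[OF that(2)] tt_closed[OF that(1)]] by (simp add: co_tt that)
  have inj: "inj_on ?b Is"
    by (rule inj_onI) (metis co_b wt_nonzero)
  have co_b_sum: "co y (\<Oplus>\<^bsub>T\<^esub>x\<in>Is. c x \<odot>\<^bsub>T\<^esub> ?b x) = c y * wt y" if "y \<in> Is" for c y
    using that by (simp add: lin_finsum[OF co(1) bc] co_b if_distrib cong: if_cong)
  have I0: "(1, 1) \<in> Is" using one_in_I n_ge_2 by (auto simp: Is_def)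
  have wt0: "wt (1, 1) = 1" using Fs_1 V1(1) by (simp add: wt_def)
  have exp: "X = (\<Oplus>\<^bsub>T\<^esub>x\<in>Is. (co x X / wt x) \<odot>\<^bsub>T\<^esub> ?b x)" if "X \<in> carrier T" for X
  proof (rule T_eqI[OF that])
    show "(\<Oplus>\<^bsub>T\<^esub>x\<in>Is. (co x X / wt x) \<odot>\<^bsub>T\<^esub> ?b x) \<in> carrier T" by (rule tt_sum_closed[OF bc])
    fix y assume y: "y \<in> Is"
    show "co y X = co y (\<Oplus>\<^bsub>T\<^esub>x\<in>Is. (co x X / wt x) \<odot>\<^bsub>T\<^esub> ?b x)"
      unfolding co_b_sum[OF y] using wt_nonzero[OF y] by simp
  qed
  have lc: "TV.lincomb a (?b ` Is) = (\<Oplus>\<^bsub>T\<^esub>x\<in>Is. a (?b x) \<odot>\<^bsub>T\<^esub> ?b x)" for a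
    unfolding TV.lincomb_def
    by (rule T.finsum_reindex[OF _ inj]) (use TV.smult_closed bc in auto)
  have bI: "finite (?b ` Is)" "?b ` Is \<subseteq> carrier T" using bc by auto
  have indep: "TV.lin_indpt (?b ` Is)"
  proof (rule TV.finite_lin_indpt2[OF bI])
    fix a assume "TV.lincomb a (?b ` Is) = \<zero>\<^bsub>T\<^esub>"
    hence "a (?b y) * wt y = 0" if "y \<in> Is" for y
      using co_b_sum[OF that, of "\<lambda>x. a (?b x)"] lin_zero[OF co(1)[OF that]] by (simp add: lc)
    thus "\<forall>v\<in>?b ` Is. a v = \<zero>\<^bsub>class_ring\<^esub>" using wt_nonzero by auto
  qed
  have gen: "TV.gen_set (?b ` Is)"
  proof
    show "TV.span (?b ` Is) \<subseteq> carrier T" by (rule TV.span_is_subset2[OF bI(2)])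
    show "carrier T \<subseteq> TV.span (?b ` Is)"
    proof
      fix X assume X: "X \<in> carrier T"
      \<comment> \<open>\<open>lincomb\<close> takes coefficients indexed by vectors; injectivity of
        the basis map lets the index be read back from the vector.\<close>
      define a where "a v = co (inv_into Is ?b v) X / wt (inv_into Is ?b v)" for v
      have "TV.lincomb a (?b ` Is) = (\<Oplus>\<^bsub>T\<^esub>x\<in>Is. (co x X / wt x) \<odot>\<^bsub>T\<^esub> ?b x)"
        unfolding lc by (rule T.finsum_cong') (use TV.smult_closed bc inj in \<open>auto simp: a_def\<close>)
      hence "X = TV.lincomb a (?b ` Is)" using exp[OF X] by simp
      thus "X \<in> TV.span (?b ` Is)" unfolding TV.span_def using bI(1) by (intro CollectI exI[of _ a] exI[of _ "?b ` Is"]) simp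
    qed
  qed
  \<comment> \<open>The structure constants of the classes \<open>tt x\<close>, times the weights of
    the factors and divided by the weight of the result. As \<open>wt\<close> is invariant under the
    involution, the symmetry of the unscaled constants carries over to (G2).\<close>
  define p where "p x y k = wt x * wt y * co k (tt x \<otimes>\<^bsub>T\<^esub> tt y) / wt k" for x y k
  have pp: "?b x \<otimes>\<^bsub>T\<^esub> ?b y = (\<Oplus>\<^bsub>T\<^esub>k\<in>Is. p x y k \<odot>\<^bsub>T\<^esub> ?b k)" if xy: "x \<in> Is" "y \<in> Is" for x y
  proof -
    note c = tt_closed[OF xy(1)] tt_closed[OF xy(2)]
    have xyc: "tt x \<otimes>\<^bsub>T\<^esub> tt y \<in> carrier T" using c by simp
    have "?b x \<otimes>\<^bsub>T\<^esub> ?b y = wt x \<odot>\<^bsub>T\<^esub> (wt y \<odot>\<^bsub>T\<^esub> (tt x \<otimes>\<^bsub>T\<^esub> tt y))"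
      unfolding b[OF xy(1)] b[OF xy(2)] using c TV.smult_closed by (simp add: T_smult_mult(1) T_smult_mult(2)[OF c])
    hence "co k (?b x \<otimes>\<^bsub>T\<^esub> ?b y) = wt x * wt y * co k (tt x \<otimes>\<^bsub>T\<^esub> tt y)" if "k \<in> Is" for k
      using linD(2)[OF co(1)[OF that]] xyc TV.smult_closed by simp
    thus ?thesis
      using exp[OF T.m_closed[OF bc[OF xy(1)] bc[OF xy(2)]]]
        T.finsum_cong'[OF refl, of "\<lambda>k. p x y k \<odot>\<^bsub>T\<^esub> ?b k" Is "\<lambda>k. (co k (?b x \<otimes>\<^bsub>T\<^esub> ?b y) / wt k) \<odot>\<^bsub>T\<^esub> ?b k"]
        TV.smult_closed bc by (simp add: p_def Pi_def)
  qed
  show ?thesis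
  proof (intro group_like_algebra.intro group_like_algebra_axioms.intro TV.vectorspace_axioms T.ring_axioms hom inj)
    show "TV.fin_dim" unfolding TV.fin_dim_def using bI gen by blast
    show "TV.basis (?b ` Is)" unfolding TV.basis_def using indep gen bI by blast
    show "?b (1, 1) = \<one>\<^bsub>T\<^esub>"
      unfolding b[OF I0] wt0 t_one t_infl[OF one_in_I] Mx_st
      using TV.smult_one t_closed[OF st_module[OF one_in_I, of 1]] by simp
    show "\<exists>p. (\<forall>i\<in>Is. \<forall>j\<in>Is. \<forall>k\<in>Is. p i j k \<in> carrier class_ring) \<and>
      (\<forall>i\<in>Is. \<forall>j\<in>Is. ?b i \<otimes>\<^bsub>T\<^esub> ?b j = (\<Oplus>\<^bsub>T\<^esub>k\<in>Is. p i j k \<odot>\<^bsub>T\<^esub> ?b k)) \<and>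
      (\<forall>i\<in>Is. \<forall>j\<in>Is. \<forall>k\<in>Is. p i j k = p (star j) (star i) (star k)) \<and>
      (\<forall>i\<in>Is. \<forall>j\<in>Is. p i j (1, 1) = (if i = star j then \<epsilon> (?b i) else \<zero>\<^bsub>class_ring\<^esub>))"
    proof (intro exI[of _ p] conjI ballI)
      fix i j k assume "i \<in> Is" "j \<in> Is" "k \<in> Is"
      thus "p i j k = p (star j) (star i) (star k)" by (simp add: p_def wt_star co_star)
    next
      fix i j assume "i \<in> Is" "j \<in> Is"
      thus "p i j (1, 1) = (if i = star j then \<epsilon> (?b i) else \<zero>\<^bsub>class_ring\<^esub>)"
        unfolding p_def co_pairing[OF \<open>i \<in> Is\<close> \<open>j \<in> Is\<close>] wt0 by (auto simp: eb wt_star star_Is)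
    qed (simp_all add: pp)
  qed (use T_smult_mult I0 star_Is star_star wt_star eb wt_nonzero in simp_all)
qed

end

text \<open>The morphism is described by its values on V_i and z; the existence clause ensures that
  the universal clause is not vacuous.\<close>

theorem proposition6p3:
  fixes G :: "('g, 'z) monoid_scheme"
    and \<chi> :: "'g \<Rightarrow> 'k :: {alg_closed_field, field_char_0}"
    and g :: 'g and n m :: nat
    and V :: "nat \<Rightarrow> ('k, 'g \<Rightarrow>\<^sub>0 'k) fdmod"
  assumes "group_datum G \<chi> g n"
    and "complete_simples (group_algebra G) m V"
    and "iso_mod (group_algebra G) (V 1) (kg_char G (\<lambda>_. 1))"
  shows "(\<exists>\<epsilon>. is_stable_eps G \<chi> g n m V \<epsilon>) \<and>
    (\<forall>\<epsilon>. is_stable_eps G \<chi> g n m V \<epsilon> \<longrightarrow>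
      group_like_algebra class_ring (R_st G \<chi> g n) \<epsilon> ({1..m} \<times> {1..n - 1})
        (stable_basis G \<chi> g n V \<epsilon>) (stable_star G \<chi> m V) (1, 1))"
proof -
  interpret gd G \<chi> g n using assms(1) by (simp add: gd_def)
  interpret gds G \<chi> g n m V by unfold_locales (use assms(2,3) in auto)
  show ?thesis using eps0_stable stable_group_like unfolding Is_def by blast
qed

end
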